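(* Let $\mathcal{A}=\{\ell_1,\dots,\ell_n\}$ be an arrangement of (affine) lines in $\mathbb{C}^2$, and let $G=\pi_1\big(\mathbb{C}^2\setminus\bigcup_{i=1}^n\ell_i\big)$. The following are equivalent: (i) The group $G$ is a free group. (ii) The characteristic variety $\mathcal{V}_1(\mathcal{A})$ coincides with $(\mathbb{C}^{\times})^n$. (iii) The resonance variety $\mathcal{R}_1(\mathcal{A})$ coincides with $\mathbb{C}^n$. (iv) The lines $\ell_1,\dots,\ell_n$ are all parallel.
   Context: Here $H_1(G,\mathbb{Z})\cong\mathbb{Z}^n$, with basis the classes of the oriented meridians of the lines, so $\operatorname{Hom}(G,\mathbb{C}^\times)=(\mathbb{C}^\times)^n$ and $H^1(G,\mathbb{C})=\mathbb{C}^n$. $\mathcal{V}_1(\mathcal{A})=\{\rho\in\operatorname{Hom}(G,\mathbb{C}^\times)\mid \dim_{\mathbb{C}}H_1(G,\mathbb{C}_\rho)\ge1\}$, where $\mathbb{C}_\rho$ is the vector space $\mathbb{C}$ on which $G$ acts through $\rho$. $\mathcal{R}_1(\mathcal{A})=\{a\in H^1(G,\mathbb{C})\mid \dim_{\mathbb{C}} H^1(H^*(G,\mathbb{C}),\cdot a)\ge 1\}$, where $(H^*(G,\mathbb{C}),\cdot a)$ is the cochain complex $H^0(G,\mathbb{C})\xrightarrow{\cdot a}H^1(G,\mathbb{C})\xrightarrow{\cdot a}H^2(G,\mathbb{C})\to\cdots$ given by right cup-multiplication by $a$.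
   Formalization: The arrangement is assumed to have n ≥ 2 lines; for n = 1 the group is Z, which is free, and (iv) holds, but V_1 = {1} and R_1 = {0}, and for n = 0 both varieties are empty, so the stated equivalence fails for n < 2. *)

theory Defs
  imports
    "HOL-Analysis.Analysis"
    "HOL-Library.Poly_Mapping"
    "HOL-Algebra.AbelCoset"
    "Jordan_Normal_Form.VS_Connect"
begin

section \<open>Complex vector spaces, quotients and dimension\<close>

text \<open>Vector spaces with a carrier are records of the type \<open>(complex, 'v) module\<close> over
  \<open>class_ring\<close>. Its fields \<open>mult\<close> and \<open>one\<close> (inherited from rings) play no role for modules
  and are left undefined.\<close>

definition quotient_space ::
    "(complex, 'v) module \<Rightarrow> 'v set \<Rightarrow> (complex, 'v set) module" where
  "quotient_space V W =
     \<lparr>carrier = a_rcosets\<^bsub>V\<^esub> W, mult = undefined, one = undefined,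
      zero = W, add = set_add V,
      smult = (\<lambda>c X. \<Union>x\<in>X. W +>\<^bsub>V\<^esub> (c \<odot>\<^bsub>V\<^esub> x))\<rparr>"

text \<open>\<open>vectorspace.dim\<close> is meaningful only in the finite-dimensional case; an
  infinite-dimensional space has dimension at least \<open>d\<close> for every natural number \<open>d\<close>.\<close>

definition dim_at_least :: "nat \<Rightarrow> (complex, 'v) module \<Rightarrow> bool" where
  "dim_at_least d V \<longleftrightarrow>
     (vectorspace.fin_dim class_ring V \<longrightarrow> d \<le> vectorspace.dim class_ring V)"


section \<open>Fundamental groups and free groups\<close>

definition loops :: "'a::topological_space set \<Rightarrow> 'a \<Rightarrow> (real \<Rightarrow> 'a) set" where
  "loops S x = {p. path p \<and> path_image p \<subseteq> S \<and> pathstart p = x \<and> pathfinish p = x}"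

definition path_class :: "'a::topological_space set \<Rightarrow> (real \<Rightarrow> 'a) \<Rightarrow> (real \<Rightarrow> 'a) set" where
  "path_class S p = {q. homotopic_paths S p q}"

definition fundamental_group ::
    "'a::topological_space set \<Rightarrow> 'a \<Rightarrow> (real \<Rightarrow> 'a) set monoid" where
  "fundamental_group S x =
     \<lparr>carrier = path_class S ` loops S x,
      mult = (\<lambda>X Y. \<Union>p\<in>X. \<Union>q\<in>Y. path_class S (p +++ q)),
      one = path_class S (\<lambda>_. x)\<rparr>"

text \<open>A word is a list of letters \<open>(x, b)\<close>, standing for \<open>x\<close> if \<open>b\<close> holds and for the inverse
  of \<open>x\<close> otherwise. It is reduced if no letter is adjacent to its formal inverse.\<close>

definition reduced_words :: "'g set \<Rightarrow> ('g \<times> bool) list set" where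
  "reduced_words X =
     {w. fst ` set w \<subseteq> X \<and> successively (\<lambda>(x, a) (y, b). x = y \<longrightarrow> a = b) w}"

definition word_value :: "('g, 'm) monoid_scheme \<Rightarrow> ('g \<times> bool) list \<Rightarrow> 'g" where
  "word_value G w = foldr (\<lambda>(x, b) y. (if b then x else inv\<^bsub>G\<^esub> x) \<otimes>\<^bsub>G\<^esub> y) w \<one>\<^bsub>G\<^esub>"

definition free_basis :: "('g, 'm) monoid_scheme \<Rightarrow> 'g set \<Rightarrow> bool" where
  "free_basis G X \<longleftrightarrow>
     X \<subseteq> carrier G \<and> bij_betw (word_value G) (reduced_words X) (carrier G)"

definition free_group :: "('g, 'm) monoid_scheme \<Rightarrow> bool" where
  "free_group G \<longleftrightarrow> group G \<and> (\<exists>X. free_basis G X)"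


section \<open>Homology and cohomology of groups via the bar complex\<close>

definition tuples :: "('g, 'm) monoid_scheme \<Rightarrow> nat \<Rightarrow> 'g list set" where
  "tuples G k = {xs. length xs = k \<and> set xs \<subseteq> carrier G}"

text \<open>The faces of \<open>[g\<^sub>1|\<dots>|g\<^sub>k]\<close>, for \<open>i = 0, \<dots>, k\<close>: drop \<open>g\<^sub>1\<close>, multiply \<open>g\<^sub>i\<close> with the next
  entry, drop \<open>g\<^sub>k\<close>. Lists are indexed from 0.\<close>

definition bar_face :: "('g, 'm) monoid_scheme \<Rightarrow> nat \<Rightarrow> 'g list \<Rightarrow> 'g list" where
  "bar_face G i xs =
     (if i = 0 then tl xs
      else if i = length xs then butlast xs
      else take (i - 1) xs @ (xs ! (i - 1) \<otimes>\<^bsub>G\<^esub> xs ! i) # drop (i + 1) xs)"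

definition Cstar :: "complex monoid" where
  "Cstar = \<lparr>carrier = UNIV - {0}, mult = (*), one = 1\<rparr>"

text \<open>The complex \<open>\<complex>\<^sub>\<rho> \<otimes> F\<close> over the group ring, where \<open>F\<close> is the bar resolution by free left
  modules and \<open>g\<close> acts on the right of \<open>\<complex>\<^sub>\<rho>\<close> as multiplication by \<open>\<rho> g\<close>. Its boundary sends
  \<open>[g\<^sub>1|\<dots>|g\<^sub>k]\<close> to the alternating sum of the faces, the face \<open>i = 0\<close> being weighted by \<open>\<rho> g\<^sub>1\<close>.\<close>

definition bar_chains ::
    "('g, 'm) monoid_scheme \<Rightarrow> nat \<Rightarrow> (complex, 'g list \<Rightarrow>\<^sub>0 complex) module" where
  "bar_chains G k =
     \<lparr>carrier = {c. Poly_Mapping.keys c \<subseteq> tuples G k}, mult = undefined, one = undefined,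
      zero = 0, add = (+), smult = (\<lambda>a. Poly_Mapping.map ((*) a))\<rparr>"

definition bar_boundary ::
    "('g, 'm) monoid_scheme \<Rightarrow> ('g \<Rightarrow> complex) \<Rightarrow> ('g list \<Rightarrow>\<^sub>0 complex) \<Rightarrow> ('g list \<Rightarrow>\<^sub>0 complex)" where
  "bar_boundary G \<rho> c =
     (\<Sum>xs \<in> Poly_Mapping.keys c - {[]}. \<Sum>i\<le>length xs.
        Poly_Mapping.single (bar_face G i xs)
          ((- 1) ^ i * (if i = 0 then \<rho> (hd xs) else 1) * Poly_Mapping.lookup c xs))"

definition twisted_homology ::
    "('g, 'm) monoid_scheme \<Rightarrow> ('g \<Rightarrow> complex) \<Rightarrow> nat \<Rightarrow>
     (complex, ('g list \<Rightarrow>\<^sub>0 complex) set) module" where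
  "twisted_homology G \<rho> k =
     quotient_space
       ((bar_chains G k)\<lparr>carrier := {c \<in> carrier (bar_chains G k). bar_boundary G \<rho> c = 0}\<rparr>)
       (bar_boundary G \<rho> ` carrier (bar_chains G (k + 1)))"

text \<open>Cochains with trivial coefficients are functions on all lists that vanish off the
  \<open>k\<close>-tuples of group elements.\<close>

definition cochains ::
    "('g, 'm) monoid_scheme \<Rightarrow> nat \<Rightarrow> (complex, 'g list \<Rightarrow> complex) module" where
  "cochains G k =
     \<lparr>carrier = {f. \<forall>xs. xs \<notin> tuples G k \<longrightarrow> f xs = 0}, mult = undefined, one = undefined,
      zero = (\<lambda>_. 0), add = (\<lambda>f g xs. f xs + g xs), smult = (\<lambda>a f xs. a * f xs)\<rparr>"

definition coboundary ::
    "('g, 'm) monoid_scheme \<Rightarrow> nat \<Rightarrow> ('g list \<Rightarrow> complex) \<Rightarrow> ('g list \<Rightarrow> complex)" where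
  "coboundary G k f =
     (\<lambda>xs. if xs \<in> tuples G (k + 1) then \<Sum>i\<le>k + 1. (- 1) ^ i * f (bar_face G i xs) else 0)"

definition cocycles :: "('g, 'm) monoid_scheme \<Rightarrow> nat \<Rightarrow> ('g list \<Rightarrow> complex) set" where
  "cocycles G k = {f \<in> carrier (cochains G k). coboundary G k f = (\<lambda>_. 0)}"

definition coboundaries :: "('g, 'm) monoid_scheme \<Rightarrow> nat \<Rightarrow> ('g list \<Rightarrow> complex) set" where
  "coboundaries G k =
     (if k = 0 then {\<lambda>_. 0} else coboundary G (k - 1) ` carrier (cochains G (k - 1)))"

definition cohomology ::
    "('g, 'm) monoid_scheme \<Rightarrow> nat \<Rightarrow> (complex, ('g list \<Rightarrow> complex) set) module" where
  "cohomology G k =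
     quotient_space ((cochains G k)\<lparr>carrier := cocycles G k\<rparr>) (coboundaries G k)"

text \<open>For a \<open>p\<close>-cochain \<open>f\<close> and a \<open>q\<close>-cochain \<open>g\<close>, \<open>cup_cochain p f g\<close> is their cup product; it
  vanishes off the \<open>(p + q)\<close>-tuples because \<open>f\<close> and \<open>g\<close> vanish off their tuples.\<close>

definition cup_cochain ::
    "nat \<Rightarrow> ('g list \<Rightarrow> complex) \<Rightarrow> ('g list \<Rightarrow> complex) \<Rightarrow> ('g list \<Rightarrow> complex)" where
  "cup_cochain p f g = (\<lambda>xs. f (take p xs) * g (drop p xs))"

definition cup ::
    "('g, 'm) monoid_scheme \<Rightarrow> nat \<Rightarrow> nat \<Rightarrow> ('g list \<Rightarrow> complex) set \<Rightarrow>
     ('g list \<Rightarrow> complex) set \<Rightarrow> ('g list \<Rightarrow> complex) set" where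
  "cup G p q X Y =
     (\<Union>f\<in>X. \<Union>g\<in>Y. coboundaries G (p + q) +>\<^bsub>cochains G (p + q)\<^esub> cup_cochain p f g)"

text \<open>The cohomology in degree \<open>k\<close> of the complex formed by the spaces \<open>cohomology G i\<close>, with right
  multiplication by the class \<open>a\<close> of degree 1 as differential.\<close>

definition cup_complex_cohomology ::
    "('g, 'm) monoid_scheme \<Rightarrow> ('g list \<Rightarrow> complex) set \<Rightarrow> nat \<Rightarrow>
     (complex, ('g list \<Rightarrow> complex) set set) module" where
  "cup_complex_cohomology G a k =
     quotient_space
       ((cohomology G k)\<lparr>carrier :=
          {X \<in> carrier (cohomology G k). cup G k 1 X a = \<zero>\<^bsub>cohomology G (k + 1)\<^esub>}\<rparr>)
       (if k = 0 then {\<zero>\<^bsub>cohomology G 0\<^esub>}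
        else (\<lambda>Y. cup G (k - 1) 1 Y a) ` carrier (cohomology G (k - 1)))"


section \<open>Line arrangements and their jump loci\<close>

definition affine_line :: "(complex \<times> complex) set \<Rightarrow> bool" where
  "affine_line l \<longleftrightarrow> (\<exists>a b c. (a, b) \<noteq> (0, 0) \<and> l = {(x, y). a * x + b * y = c})"

definition line_arrangement :: "(complex \<times> complex) set set \<Rightarrow> bool" where
  "line_arrangement \<A> \<longleftrightarrow> finite \<A> \<and> (\<forall>l\<in>\<A>. affine_line l)"

definition parallel :: "(complex \<times> complex) set \<Rightarrow> (complex \<times> complex) set \<Rightarrow> bool" where
  "parallel l m \<longleftrightarrow> (\<exists>v. m = (+) v ` l)"

definition arrangement_group ::
    "(complex \<times> complex) set set \<Rightarrow> complex \<times> complex \<Rightarrow>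
     (real \<Rightarrow> complex \<times> complex) set monoid" where
  "arrangement_group \<A> x = fundamental_group (- \<Union>\<A>) x"

text \<open>Evaluation on the meridians identifies \<open>hom G Cstar\<close> with \<open>(\<complex>\<^sup>\<times>)\<^sup>n\<close> and \<open>cohomology G 1\<close> with
  \<open>\<complex>\<^sup>n\<close> for the group \<open>G\<close> of an arrangement of \<open>n\<close> lines; the jump loci are kept as subsets of
  the former.\<close>

definition characteristic_variety_1 :: "('g, 'm) monoid_scheme \<Rightarrow> ('g \<Rightarrow> complex) set" where
  "characteristic_variety_1 G = {\<rho> \<in> hom G Cstar. dim_at_least 1 (twisted_homology G \<rho> 1)}"

definition resonance_variety_1 :: "('g, 'm) monoid_scheme \<Rightarrow> ('g list \<Rightarrow> complex) set set" where
  "resonance_variety_1 G =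
     {a \<in> carrier (cohomology G 1). dim_at_least 1 (cup_complex_cohomology G a 1)}"

end

(* If all lines are parallel, a linear form L constant on them maps the complement onto the plane
minus finitely many points, and every loop can be moved along the level lines of L into a complex
line transversal to the arrangement; so G is the fundamental group of a punctured plane, which is
free by repeatedly cutting the punctures apart with a vertical strip.

If G is free with a basis containing y and z, y \<noteq> z (two lines have independent meridians, so a
basis has at least two elements), crossed homomorphisms, respectively homomorphisms to a Heisenberg
group, can be prescribed on the basis. They detect an explicit twisted cycle supported on y and z,
and they produce a class outside the line of a whose cup product with a vanishes.

If two lines are not parallel, let d be the sum of the winding numbers around the lines of a
configuration in coordinates adapted to one of these lines. Rotating the complex
line through a point of the plane gives loops that commute with their neighbours and on which d is
nonzero. Hence any relation that contains all commuting pairs, is compatible with products, and is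
transitive through elements with nonzero d, relates all pairs of elements of G. Applied to the
relation (rho(h) - 1) [g] = (rho(g) - 1) [h] in twisted homology with rho = exp o d, this makes every
cycle a boundary; applied to f(g) d(h) = f(h) d(g), it makes every class f with f u d = 0 a multiple
of d. *)

theory Submission
  imports Defs "HOL-Complex_Analysis.Riemann_Mapping" "HOL-Algebra.Generated_Groups"
begin

section \<open>Path functors\<close>

text \<open>Fundamental groups are handled through functors on paths, open ones included, with
  values in a group. Such functors can be evaluated on pieces of a loop and glued along open covers;
  this yields the existence half of van Kampen's theorem without forming amalgams. Universal
  properties are stated for groups on one fixed type at a time, since types cannot be quantified
  inside a statement.

  In the nonparallel case no presentation of \<open>G\<close> is available, only local commutations.
  Its values on \<open>G\<close> are integers, so that \<open>exp\<close> of a nonzero value is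
  never 1. The group is generated by loops in one generic horizontal plane section and by loops on a
  section that lies beyond all the graphs \<open>x = a y + b\<close>. Each horizontal line controls
  only its own neighbourhood; the link between different ones is a circle in a fibre around all its
  punctures, which has nonzero \<open>d\<close> and can be transported to every other generic
  fibre.\<close>

abbreviation path_in :: "'a::topological_space set \<Rightarrow> (real \<Rightarrow> 'a) \<Rightarrow> bool" where
  "path_in S p \<equiv> path p \<and> path_image p \<subseteq> S"

lemma path_in_iff: "path_in S p \<longleftrightarrow> continuous_on {0..1} p \<and> (\<forall>t\<in>{0..1}. p t \<in> S)"
  by (auto simp: path_def path_image_def)

text \<open>Connectedness of the interval: \<open>step\<close> makes \<open>Q\<close> locally
  constant, in both directions, around every \<open>t\<close>. This replaces subdivisions whenever
  data are carried along a path.\<close>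

lemma unit_interval_induct:
  assumes "Q 0"
    and step: "\<And>t. t \<in> {0..1::real} \<Longrightarrow>
      \<exists>e>0. \<forall>s\<in>{0..1}. \<forall>s'\<in>{0..1}. \<bar>s - t\<bar> < e \<longrightarrow> \<bar>s' - t\<bar> < e \<longrightarrow> Q s \<longrightarrow> Q s'"
  shows "Q 1"
proof (rule connected_induction_simple[where S = "{0..1::real}" and P = Q and a = 0 and b = 1])
  fix t :: real assume t: "t \<in> {0..1}"
  from step[OF t] obtain e where e: "e > 0" "\<forall>s\<in>{0..1}. \<forall>s'\<in>{0..1}.
      \<bar>s - t\<bar> < e \<longrightarrow> \<bar>s' - t\<bar> < e \<longrightarrow> Q s \<longrightarrow> Q s'" by blast
  show "\<exists>T. openin (top_of_set {0..1}) T \<and> t \<in> T \<and> (\<forall>x\<in>T. \<forall>y\<in>T. Q x \<longrightarrow> Q y)"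
    using e t by (intro exI[of _ "{0..1} \<inter> ball t e"]) (auto simp: dist_real_def abs_minus_commute)
qed (use assms in auto)

lemma homotopic_paths_convex:
  fixes C :: "'a::real_normed_vector set"
  assumes "convex C" "path_in C p" "path_in C q" "pathstart p = pathstart q" "pathfinish p = pathfinish q"
  shows "homotopic_paths C p q"
  using convex_imp_simply_connected[OF assms(1)] assms unfolding simply_connected_eq_homotopic_paths
  by metis

lemma path_in_const: "x \<in> S \<Longrightarrow> path_in S (\<lambda>_. x)"
  by (simp add: path_def path_image_def)

lemma path_in_join: "path_in S (p +++ q)"
  if "path_in S p" "path_in S q" "pathfinish p = pathstart q"
  using that path_image_join_subset[of p q] by auto

lemma path_in_reverse: "path_in S (reversepath p) \<longleftrightarrow> path_in S p"
  by auto

lemma path_in_subpath: "path_in S (subpath u v p)" if "path_in S p" "u \<in> {0..1}" "v \<in> {0..1}"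
  using that path_image_subpath_subset[of u v p] by auto

lemma path_in_linepath: "path_in S (linepath a b)" if "convex S" "a \<in> S" "b \<in> S"
  using that by (simp add: closed_segment_subset)

lemma path_in_compose:
  assumes "path_in S p" "continuous_on S f" "f ` S \<subseteq> T"
  shows "path_in T (f \<circ> p)"
  using assms by (auto intro!: path_continuous_image continuous_on_subset[of S f] simp: path_image_compose)

text \<open>A functor from the fundamental groupoid of \<open>S\<close> to a group, regarded as a
  category with one object. Since it is defined on open paths, it can be computed piece by piece and
  compared on overlaps.\<close>

locale path_functor = group G for G (structure) +
  fixes S :: "'b::real_normed_vector set" and \<Phi> :: "(real \<Rightarrow> 'b) \<Rightarrow> 'a"
  assumes closed [intro]: "path p \<Longrightarrow> path_image p \<subseteq> S \<Longrightarrow> \<Phi> p \<in> carrier G"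
    and join: "path_in S p \<Longrightarrow> path_in S q \<Longrightarrow> pathfinish p = pathstart q \<Longrightarrow>
      \<Phi> (p +++ q) = \<Phi> p \<otimes> \<Phi> q"
    and homotopic: "homotopic_paths S p q \<Longrightarrow> \<Phi> p = \<Phi> q"
begin

lemma path_functor_axioms': "path_functor G S \<Phi>" ..

lemma const: "x \<in> S \<Longrightarrow> \<Phi> (\<lambda>_. x) = \<one>"
proof -
  assume x: "x \<in> S"
  have c: "path_in S (\<lambda>_. x)" by (rule path_in_const[OF x])
  have "(\<lambda>_. x) +++ (\<lambda>_. x) = (\<lambda>_::real. x)" by (auto simp: joinpaths_def)
  with join[OF c c] have "\<Phi> (\<lambda>_. x) = \<Phi> (\<lambda>_. x) \<otimes> \<Phi> (\<lambda>_. x)"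
    by (simp add: pathfinish_def pathstart_def)
  with c closed show ?thesis by (metis r_cancel_one)
qed

text \<open>Paths are functions on all reals; the values off the unit interval must not
  matter.\<close>

lemma eq_on: "\<Phi> p = \<Phi> q" if "path_in S p" "\<And>t. t \<in> {0..1} \<Longrightarrow> p t = q t"
  using that by (intro homotopic homotopic_paths_eq) auto

lemma convex: "\<Phi> p = \<Phi> q"
  if "convex C" "C \<subseteq> S" "path_in C p" "path_in C q"
    "pathstart p = pathstart q" "pathfinish p = pathfinish q"
  using homotopic_paths_convex[OF that(1,3-)] that(2) homotopic homotopic_paths_subset by blast

lemma null: "\<Phi> p = \<one>"
  if "convex C" "C \<subseteq> S" "path_in C p" "pathstart p = pathfinish p"
proof -
  have s: "pathstart p \<in> C" using that(3) by auto
  have "\<Phi> p = \<Phi> (\<lambda>_. pathstart p)"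
    by (rule convex[OF that(1-3) path_in_const[OF s]]) (use that in \<open>auto simp: pathstart_def pathfinish_def\<close>)
  then show ?thesis using const s that(2) by auto
qed

lemma reverse: "\<Phi> (reversepath p) = inv (\<Phi> p)" if p: "path_in S p"
proof -
  have s: "pathstart p \<in> S" using p by auto
  have "\<Phi> p \<otimes> \<Phi> (reversepath p) = \<Phi> (p +++ reversepath p)"
    using p by (subst join) auto
  also have "\<dots> = \<Phi> (linepath (pathstart p) (pathstart p))"
    by (intro homotopic homotopic_paths_rinv) (use p in auto)
  also have "\<dots> = \<one>" using const s by (simp add: linepath_refl)
  finally show ?thesis using p closed by (simp add: inv_equality[symmetric] inv_comm)
qed

lemma subpath: "\<Phi> (subpath u v p) \<otimes> \<Phi> (subpath v w p) = \<Phi> (subpath u w p)"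
  if p: "path_in S p" and "u \<in> {0..1}" "v \<in> {0..1}" "w \<in> {0..1}"
  using that path_in_subpath[OF p]
  by (subst join[symmetric]) (auto intro!: homotopic homotopic_join_subpaths)

lemma compose:
  fixes T :: "'d::real_normed_vector set"
  assumes "continuous_on T f" "f ` T \<subseteq> S"
  shows "path_functor G T (\<lambda>p. \<Phi> (f \<circ> p))"
proof
  fix p :: "real \<Rightarrow> 'd" assume "path p" "path_image p \<subseteq> T"
  then show "\<Phi> (f \<circ> p) \<in> carrier G" using path_in_compose[OF _ assms] closed by blast
next
  fix p q :: "real \<Rightarrow> 'd" assume *: "path_in T p" "path_in T q" "pathfinish p = pathstart q"
  show "\<Phi> (f \<circ> (p +++ q)) = \<Phi> (f \<circ> p) \<otimes> \<Phi> (f \<circ> q)"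
    using path_in_compose[OF *(1) assms] path_in_compose[OF *(2) assms] *(3)
    by (simp add: path_compose_join join pathfinish_compose pathstart_compose)
next
  fix p q :: "real \<Rightarrow> 'd" assume "homotopic_paths T p q"
  then show "\<Phi> (f \<circ> p) = \<Phi> (f \<circ> q)"
    using homotopic homotopic_paths_continuous_image assms by blast
qed

lemma subset: "T \<subseteq> S \<Longrightarrow> path_functor G T \<Phi>"
  using compose[of T id] by auto

text \<open>The functor is pulled back along \<open>K\<close> to the unit square. The square is
  convex, so two paths in it with the same ends have the same value.\<close>

lemma
  assumes K: "continuous_on ({0..1} \<times> {0..1}) (\<lambda>z. K (fst z) (snd z))"
    "\<And>s t. s \<in> {0..1} \<Longrightarrow> t \<in> {0..1} \<Longrightarrow> K s t \<in> S"
  shows square: "\<Phi> (\<lambda>t. K t 0) \<otimes> \<Phi> (\<lambda>t. K 1 t) = \<Phi> (\<lambda>t. K 0 t) \<otimes> \<Phi> (\<lambda>t. K t 1)" (is ?A)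
    and diagonal: "\<Phi> (\<lambda>t. K t t) = \<Phi> (\<lambda>t. K 0 t) \<otimes> \<Phi> (\<lambda>t. K t 1)" (is ?B)
proof -
  let ?Q = "{0..1} \<times> {0..1} :: (real \<times> real) set" and ?f = "\<lambda>z. K (fst z) (snd z)"
  interpret Q: path_functor G ?Q "\<lambda>p. \<Phi> (?f \<circ> p)"
    by (rule compose) (use K in auto)
  have cv: "convex ?Q" by (simp add: convex_Times)
  have eq: "?f \<circ> linepath (0, 0) (1, 0) = (\<lambda>t. K t 0)" "?f \<circ> linepath (1, 0) (1, 1) = (\<lambda>t. K 1 t)"
      "?f \<circ> linepath (0, 0) (0, 1) = (\<lambda>t. K 0 t)" "?f \<circ> linepath (0, 1) (1, 1) = (\<lambda>t. K t 1)"
      "?f \<circ> linepath (0, 0) (1, 1) = (\<lambda>t. K t t)"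
    by (auto simp: linepath_def fun_eq_iff)
  have l: "path_in ?Q (linepath (0, 0) (1, 0))" "path_in ?Q (linepath (1, 0) (1, 1))"
      "path_in ?Q (linepath (0, 0) (0, 1))" "path_in ?Q (linepath (0, 1) (1, 1))"
      "path_in ?Q (linepath (0, 0) (1, 1))"
    by (rule path_in_linepath[OF cv]; simp)+
  have j1: "\<Phi> (?f \<circ> (linepath (0, 0) (1, 0) +++ linepath (1, 0) (1, 1)))
      = \<Phi> (\<lambda>t. K t 0) \<otimes> \<Phi> (\<lambda>t. K 1 t)"
    using l by (subst Q.join) (simp_all add: eq)
  have j2: "\<Phi> (?f \<circ> (linepath (0, 0) (0, 1) +++ linepath (0, 1) (1, 1)))
      = \<Phi> (\<lambda>t. K 0 t) \<otimes> \<Phi> (\<lambda>t. K t 1)"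
    using l by (subst Q.join) (simp_all add: eq)
  show ?A unfolding j1[symmetric] j2[symmetric]
    by (rule Q.convex[OF cv order.refl]; (rule path_in_join)?; (rule l)?; simp)
  show ?B unfolding eq(5)[symmetric] j2[symmetric]
    by (rule Q.convex[OF cv order.refl]; (rule path_in_join)?; (rule l)?; simp)
qed

end

section \<open>Fundamental groups\<close>

lemma path_class_eqI: "path_class S p = path_class S q" if "homotopic_paths S p q"
proof -
  have "homotopic_paths S p r \<longleftrightarrow> homotopic_paths S q r" for r
    using that homotopic_paths_sym homotopic_paths_trans by metis
  then show ?thesis by (simp add: path_class_def)
qed

lemma carrier_fundamental_group: "carrier (fundamental_group S x) = path_class S ` loops S x"
  by (simp add: fundamental_group_def)

lemma loops_iff: "p \<in> loops S x \<longleftrightarrow> path_in S p \<and> pathstart p = x \<and> pathfinish p = x"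
  by (auto simp: loops_def)

text \<open>The product of two classes is defined as a union over representatives; all members of
  that union coincide, so it collapses.\<close>

lemma fundamental_group_mult:
  assumes "path_in S p" "path_in S q" "pathfinish p = pathstart q"
  shows "path_class S p \<otimes>\<^bsub>fundamental_group S x\<^esub> path_class S q = path_class S (p +++ q)"
proof -
  have "path_class S (p' +++ q') = path_class S (p +++ q)"
    if "p' \<in> path_class S p" "q' \<in> path_class S q" for p' q'
    using that assms
    by (intro path_class_eqI homotopic_paths_sym[OF homotopic_paths_join]) (auto simp: path_class_def)
  then have "(\<Union>p'\<in>path_class S p. \<Union>q'\<in>path_class S q. path_class S (p' +++ q'))
      = (\<Union>p'\<in>path_class S p. \<Union>q'\<in>path_class S q. path_class S (p +++ q))"
    by (intro SUP_cong refl) blast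
  moreover have "path_class S p \<noteq> {}" "path_class S q \<noteq> {}"
    using assms homotopic_paths_refl unfolding path_class_def by blast+
  ultimately show ?thesis by (simp add: fundamental_group_def)
qed

lemma group_fundamental_group:
  fixes x :: "'a::real_normed_vector"
  assumes "x \<in> S"
  shows "group (fundamental_group S x)" (is "group ?G")
proof -
  have mult: "path_class S p \<otimes>\<^bsub>?G\<^esub> path_class S q = path_class S (p +++ q)"
    if "p \<in> loops S x" "q \<in> loops S x" for p q
    using that by (intro fundamental_group_mult) (auto simp: loops_iff)
  have jl: "p +++ q \<in> loops S x" if "p \<in> loops S x" "q \<in> loops S x" for p q
    using that by (simp add: loops_iff path_in_join)
  have one: "\<one>\<^bsub>?G\<^esub> = path_class S (linepath x x)"
    by (simp add: fundamental_group_def linepath_refl)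
  have cl: "linepath x x \<in> loops S x"
    using assms by (simp add: loops_iff)
  show ?thesis
  proof (rule groupI)
    fix a b c assume "a \<in> carrier ?G" "b \<in> carrier ?G" "c \<in> carrier ?G"
    then show "a \<otimes>\<^bsub>?G\<^esub> b \<otimes>\<^bsub>?G\<^esub> c = a \<otimes>\<^bsub>?G\<^esub> (b \<otimes>\<^bsub>?G\<^esub> c)"
      unfolding carrier_fundamental_group
      apply (clarsimp simp: mult jl)
      apply (rule path_class_eqI[symmetric])
      by (rule homotopic_paths_assoc) (auto simp: loops_iff)
  next
    fix a assume "a \<in> carrier ?G"
    then obtain p where p: "p \<in> loops S x" "a = path_class S p"
      by (auto simp: carrier_fundamental_group)
    have r: "reversepath p \<in> loops S x" using p by (simp add: loops_iff)
    show "\<exists>b\<in>carrier ?G. b \<otimes>\<^bsub>?G\<^esub> a = \<one>\<^bsub>?G\<^esub>"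
    proof (rule bexI[of _ "path_class S (reversepath p)"])
      show "path_class S (reversepath p) \<otimes>\<^bsub>?G\<^esub> a = \<one>\<^bsub>?G\<^esub>"
        unfolding p(2) mult[OF r p(1)] one
        by (rule path_class_eqI) (use p homotopic_paths_linv[of p S] in \<open>simp add: loops_iff\<close>)
    qed (use r in \<open>auto simp: carrier_fundamental_group\<close>)
    show "\<one>\<^bsub>?G\<^esub> \<otimes>\<^bsub>?G\<^esub> a = a"
      unfolding p(2) one mult[OF cl p(1)]
      by (rule path_class_eqI) (use p homotopic_paths_lid[of p S] in \<open>simp add: loops_iff\<close>)
  qed (auto simp: carrier_fundamental_group mult jl one cl)
qed

text \<open>The chosen tethers \<open>tr\<close> close a path up to a loop at the base point. This
  extends the map from loops to their classes to a functor on all paths.\<close>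

definition path_value ::
    "'a::topological_space set \<Rightarrow> ('a \<Rightarrow> real \<Rightarrow> 'a) \<Rightarrow> (real \<Rightarrow> 'a) \<Rightarrow> (real \<Rightarrow> 'a) set" where
  "path_value S tr p =
     path_class S (tr (pathstart p) +++ (p +++ reversepath (tr (pathfinish p))))"

lemma path_functor_path_value:
  fixes S :: "'a::real_normed_vector set"
  assumes x: "x \<in> S"
    and tr: "\<And>u. u \<in> S \<Longrightarrow> path_in S (tr u) \<and> pathstart (tr u) = x \<and> pathfinish (tr u) = u"
  shows "path_functor (fundamental_group S x) S (path_value S tr)"
proof -
  let ?G = "fundamental_group S x"
  interpret group ?G by (rule group_fundamental_group[OF x])
  have ends: "pathstart p \<in> S" "pathfinish p \<in> S" if "path_in S p" for p
    using that by auto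
  have lp: "tr (pathstart p) +++ (p +++ reversepath (tr (pathfinish p))) \<in> loops S x"
    if "path_in S p" for p
    using that ends[OF that] tr by (simp add: loops_iff path_in_join)
  show ?thesis
  proof
    fix p assume "path p" "path_image p \<subseteq> S"
    then show "path_value S tr p \<in> carrier ?G"
      using lp by (auto simp: carrier_fundamental_group path_value_def)
  next
    fix p q assume *: "path_in S p" "path_in S q" "pathfinish p = pathstart q"
    define A B C where "A = tr (pathstart p)" and "B = tr (pathfinish p)" and "C = tr (pathfinish q)"
    have pA: "path_in S A" "pathstart A = x" "pathfinish A = pathstart p"
      and pB: "path_in S B" "pathstart B = x" "pathfinish B = pathfinish p"
      and pC: "path_in S C" "pathstart C = x" "pathfinish C = pathfinish q"
      using tr ends[OF *(1)] ends[OF *(2)] by (auto simp: A_def B_def C_def)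
    note [simp] = pA pB pC * path_image_join
    let ?C = "reversepath C" and ?B = "reversepath B"
    \<comment> \<open>Reassociating brings the inner tether next to its reverse, where it
      contracts.\<close>
    have "homotopic_paths S ((p +++ ?B) +++ (B +++ (q +++ ?C))) (p +++ (?B +++ (B +++ (q +++ ?C))))"
      by (rule homotopic_paths_sym, rule homotopic_paths_assoc) (simp_all)
    also have "homotopic_paths S \<dots> (p +++ ((?B +++ B) +++ (q +++ ?C)))"
      by (rule homotopic_paths_join, simp, rule homotopic_paths_assoc) (simp_all)
    also have "homotopic_paths S \<dots> (p +++ (linepath (pathfinish B) (pathfinish B) +++ (q +++ ?C)))"
      by (rule homotopic_paths_join, simp, rule homotopic_paths_join, rule homotopic_paths_linv) (simp_all)
    also have "homotopic_paths S \<dots> (p +++ (q +++ ?C))"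
      by (rule homotopic_paths_join, simp) (use homotopic_paths_lid[of "q +++ ?C" S] in simp_all)
    also have "homotopic_paths S \<dots> ((p +++ q) +++ ?C)"
      by (rule homotopic_paths_assoc) simp_all
    finally have 1: "homotopic_paths S (A +++ ((p +++ ?B) +++ (B +++ (q +++ ?C)))) (A +++ ((p +++ q) +++ ?C))"
      by (rule homotopic_paths_join[rotated]) simp_all
    have "homotopic_paths S ((A +++ (p +++ ?B)) +++ (B +++ (q +++ ?C))) (A +++ ((p +++ ?B) +++ (B +++ (q +++ ?C))))"
      by (rule homotopic_paths_sym, rule homotopic_paths_assoc) simp_all
    from path_class_eqI[OF homotopic_paths_trans[OF this 1]]
    show "path_value S tr (p +++ q) = path_value S tr p \<otimes>\<^bsub>?G\<^esub> path_value S tr q"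
      unfolding path_value_def using *(3)
      by (subst fundamental_group_mult) (auto simp: A_def B_def C_def tr ends)
  next
    fix p q assume h: "homotopic_paths S p q"
    have p: "path_in S p" "path_in S q" using h
      using homotopic_paths_imp_path homotopic_paths_imp_subset by blast+
    have e: "pathstart p = pathstart q" "pathfinish p = pathfinish q"
      using h homotopic_paths_imp_pathstart homotopic_paths_imp_pathfinish by blast+
    show "path_value S tr p = path_value S tr q"
      unfolding path_value_def e
      by (intro path_class_eqI homotopic_paths_join) (use p h e tr ends[OF p(2)] in auto)
  qed
qed

text \<open>The constant tether at the base point makes the extension agree with the class map on
  loops.\<close>

lemma path_value_loop:
  fixes x :: "'a::real_normed_vector"
  assumes "p \<in> loops S x" "tr x = (\<lambda>_. x)"
  shows "path_value S tr p = path_class S p"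
proof -
  have [simp]: "path p" "path_image p \<subseteq> S" "pathstart p = x" "pathfinish p = x" "x \<in> S"
    using assms by (auto simp: loops_iff)
  have l: "(\<lambda>_. x) = linepath x x" by (simp add: linepath_refl)
  have "homotopic_paths S (linepath x x +++ (p +++ linepath x x)) (p +++ linepath x x)"
    using homotopic_paths_lid[of "p +++ linepath x x" S] by (simp add: path_image_join)
  also have "homotopic_paths S \<dots> p"
    using homotopic_paths_rid[of p S] by simp
  finally show ?thesis
    unfolding path_value_def by (intro path_class_eqI) (simp add: l assms(2))
qed

lemma path_functor_cong:
  assumes "path_functor G S \<Phi>" "\<And>p. path_in S p \<Longrightarrow> \<Psi> p = \<Phi> p"
  shows "path_functor G S \<Psi>"
proof -
  interpret path_functor G S \<Phi> by fact
  show ?thesis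
  proof
    fix p q assume "homotopic_paths S p q"
    with assms(2) homotopic show "\<Psi> p = \<Psi> q"
      by (metis homotopic_paths_imp_path homotopic_paths_imp_subset)
  next
    fix p q assume "path_in S p" "path_in S q" "pathfinish p = pathstart q"
    then show "\<Psi> (p +++ q) = \<Psi> p \<otimes>\<^bsub>G\<^esub> \<Psi> q" using assms(2) join path_in_join by metis
  qed (use assms(2) closed in auto)
qed

text \<open>In contrast to \<open>subpath\<close>, the path has to stay in \<open>S\<close> only
  over \<open>{a..b}\<close>, which is all that a single piece of a subdivision guarantees.\<close>

lemma (in path_functor) subpath_interval:
  assumes p: "continuous_on {a..b} p" "p ` {a..b} \<subseteq> S" and uvw: "u \<in> {a..b}" "v \<in> {a..b}" "w \<in> {a..b}"
  shows "\<Phi> (Path_Connected.subpath u v p) \<otimes> \<Phi> (Path_Connected.subpath v w p)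
    = \<Phi> (Path_Connected.subpath u w p)"
proof -
  interpret I: path_functor G "{a..b}" "\<lambda>r. \<Phi> (p \<circ> r)" by (rule compose[OF p])
  have eq: "Path_Connected.subpath u v p = p \<circ> linepath u v" for u v
    by (auto simp: subpath_def linepath_def fun_eq_iff algebra_simps)
  have l: "path_in {a..b} (linepath x y)" if "x \<in> {a..b}" "y \<in> {a..b}" for x y
    using that by (intro path_in_linepath) auto
  have "\<Phi> (p \<circ> (linepath u v +++ linepath v w)) = \<Phi> (p \<circ> linepath u w)"
    by (rule I.convex[of "{a..b}"]) (use l uvw path_in_join[OF l l] in auto)
  moreover have "\<Phi> (p \<circ> (linepath u v +++ linepath v w)) = \<Phi> (p \<circ> linepath u v) \<otimes> \<Phi> (p \<circ> linepath v w)"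
    by (rule I.join) (use l uvw in auto)
  ultimately show ?thesis by (simp add: eq)
qed

subsection \<open>Gluing path functors along an open cover\<close>

primrec grid_prod :: "('g, 'm) monoid_scheme \<Rightarrow> (nat \<Rightarrow> 'g) \<Rightarrow> nat \<Rightarrow> 'g" where
  "grid_prod G f 0 = \<one>\<^bsub>G\<^esub>"
| "grid_prod G f (Suc n) = grid_prod G f n \<otimes>\<^bsub>G\<^esub> f n"

context group
begin

lemma grid_prod_closed: "(\<And>k. k < n \<Longrightarrow> f k \<in> carrier G) \<Longrightarrow> grid_prod G f n \<in> carrier G"
  by (induction n) auto

lemma grid_prod_cong: "(\<And>k. k < n \<Longrightarrow> f k = g k) \<Longrightarrow> grid_prod G f n = grid_prod G g n"
  by (induction n) auto

lemma grid_prod_add: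
  assumes "\<And>k. k < m + n \<Longrightarrow> f k \<in> carrier G"
  shows "grid_prod G f (m + n) = grid_prod G f m \<otimes> grid_prod G (\<lambda>k. f (m + k)) n"
  using assms
  by (induction n) (simp_all add: grid_prod_closed m_assoc)

end

lemma path_in_subpath_image:
  assumes "path p" "p ` {a..b} \<subseteq> C" "0 \<le> a" "b \<le> 1" "u \<in> {a..b}" "v \<in> {a..b}"
  shows "path_in C (subpath u v p)"
proof -
  have "closed_segment u v \<subseteq> {a..b}" using assms(5,6) by (auto simp: closed_segment_eq_real_ivl)
  then show ?thesis using assms by (auto simp: path_image_subpath_gen)
qed

text \<open>The cover is pulled back to the compact set, and a Lebesgue number is taken there. One
  radius for all points makes uniform grids sufficient.\<close>

lemma Lebesgue_image:
  fixes f :: "'a::metric_space \<Rightarrow> 'b::topological_space"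
  assumes "compact S" "continuous_on S f" "f ` S \<subseteq> \<Union>\<C>" "\<And>C. C \<in> \<C> \<Longrightarrow> open C"
  obtains e where "e > 0" "\<And>x. x \<in> S \<Longrightarrow> \<exists>C\<in>\<C>. f ` (S \<inter> ball x e) \<subseteq> C"
proof -
  have "\<exists>T. open T \<and> T \<inter> S = f -` C \<inter> S" if "C \<in> \<C>" for C
    using assms(2,4) that continuous_on_open_invariant by blast
  then obtain T where T: "\<And>C. C \<in> \<C> \<Longrightarrow> open (T C) \<and> T C \<inter> S = f -` C \<inter> S" by metis
  have "S \<subseteq> \<Union>(T ` \<C>)" using assms(3) T by blast
  from Heine_Borel_lemma[OF assms(1) this] T obtain e where e: "e > 0"
      "\<And>x. x \<in> S \<Longrightarrow> \<exists>B\<in>T ` \<C>. ball x e \<subseteq> B" by blast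
  have "\<exists>C\<in>\<C>. f ` (S \<inter> ball x e) \<subseteq> C" if x: "x \<in> S" for x
  proof -
    obtain C where C: "C \<in> \<C>" "ball x e \<subseteq> T C" using e(2)[OF x] by blast
    then show ?thesis using T[OF C(1)] by blast
  qed
  with e(1) that show ?thesis by blast
qed

text \<open>A single \<open>\<Psi>\<close> serves all members of the cover, so agreement on overlaps
  is built in.\<close>

locale open_cover_functor = group G for G (structure) +
  fixes \<C> :: "'b::real_normed_vector set set" and \<Psi> :: "(real \<Rightarrow> 'b) \<Rightarrow> 'a"
  assumes open_cover: "C \<in> \<C> \<Longrightarrow> open C"
    and cover_functor: "C \<in> \<C> \<Longrightarrow> path_functor G C \<Psi>"
begin

definition piece :: "nat \<Rightarrow> (real \<Rightarrow> 'b) \<Rightarrow> nat \<Rightarrow> real \<Rightarrow> 'b" where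
  "piece N p k = Path_Connected.subpath (real k / real N) (real (Suc k) / real N) p"

definition fits :: "nat \<Rightarrow> (real \<Rightarrow> 'b) \<Rightarrow> bool" where
  "fits N p \<longleftrightarrow> N > 0 \<and> (\<forall>k<N. \<exists>C\<in>\<C>. p ` {real k / real N..real (Suc k) / real N} \<subseteq> C)"

definition grid_value :: "nat \<Rightarrow> (real \<Rightarrow> 'b) \<Rightarrow> 'a" where
  "grid_value N p = grid_prod G (\<lambda>k. \<Psi> (piece N p k)) N"

lemma grid_bounds: "k < N \<Longrightarrow> 0 \<le> real k / real N \<and> real k / real N \<le> real (Suc k) / real N
    \<and> real (Suc k) / real N \<le> 1"
  by (auto simp: divide_simps)

lemma grid_subset: "k < N \<Longrightarrow> {real k / real N..real (Suc k) / real N} \<subseteq> {0..1}"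
  using grid_bounds unfolding atLeastatMost_subset_iff by blast

lemma piece_closed:
  assumes "path p" "fits N p" "k < N"
  shows "\<Psi> (piece N p k) \<in> carrier G"
proof -
  obtain C where C: "C \<in> \<C>" "p ` {real k / real N..real (Suc k) / real N} \<subseteq> C"
    using assms by (auto simp: fits_def)
  interpret path_functor G C \<Psi> using cover_functor C by blast
  have "path_in C (piece N p k)"
    unfolding piece_def using grid_bounds[OF assms(3)]
    by (intro path_in_subpath_image[OF assms(1) C(2)]) auto
  then show ?thesis using closed by blast
qed

lemma refine_aux:
  assumes "0 < M" "k < N" "j \<le> M"
  shows "real k / real N \<le> real (M * k + j) / real (M * N)"
    "real (M * k + j) / real (M * N) \<le> real (Suc k) / real N"
proof -
  have N: "real N > 0" and M: "real M > 0" using assms by auto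
  show "real k / real N \<le> real (M * k + j) / real (M * N)"
    using N M by (simp add: field_simps)
  have "real (M * k + j) \<le> real (M * Suc k)" using assms(3) by (simp only: of_nat_le_iff) simp
  then show "real (M * k + j) / real (M * N) \<le> real (Suc k) / real N"
    using N M by (simp add: field_simps)
qed

text \<open>The \<open>M\<close> fine pieces of a coarse piece lie in one member of the cover, where
  functoriality multiplies them together again. Two subdivisions can therefore be compared through
  the one with \<open>M * N\<close> pieces.\<close>

lemma grid_value_refine:
  assumes p: "path p" "fits N p" and M: "M > 0"
  shows "fits (M * N) p" "grid_value (M * N) p = grid_value N p"
proof -
  have N: "N > 0" using p by (simp add: fits_def)
  show f: "fits (M * N) p"
    unfolding fits_def
  proof (intro conjI allI impI)
    show "0 < M * N" using N M by simp
    fix i assume i: "i < M * N"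
    define k j where "k = i div M" and "j = i mod M"
    have k: "k < N" using i M by (simp add: k_def less_mult_imp_div_less mult.commute)
    have j: "j < M" and ij: "i = M * k + j" using M by (auto simp: k_def j_def)
    obtain C where C: "C \<in> \<C>" "p ` {real k / real N..real (Suc k) / real N} \<subseteq> C"
      using p k by (auto simp: fits_def)
    have "{real i / real (M * N)..real (Suc i) / real (M * N)} \<subseteq> {real k / real N..real (Suc k) / real N}"
      using refine_aux[OF M k, of j] refine_aux[OF M k, of "Suc j"] j unfolding ij by auto
    with C show "\<exists>C\<in>\<C>. p ` {real i / real (M * N)..real (Suc i) / real (M * N)} \<subseteq> C" by blast
  qed
  have inner: "grid_prod G (\<lambda>j. \<Psi> (piece (M * N) p (M * k + j))) j
      = \<Psi> (Path_Connected.subpath (real k / real N) (real (M * k + j) / real (M * N)) p)"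
    if k: "k < N" and "j \<le> M" for k j
  proof -
    obtain C where C: "C \<in> \<C>" "p ` {real k / real N..real (Suc k) / real N} \<subseteq> C"
      using p k by (auto simp: fits_def)
    interpret C: path_functor G C \<Psi> using cover_functor C by blast
    let ?s = "\<lambda>j. real (M * k + j) / real (M * N)"
    have inC: "path_in C (Path_Connected.subpath (?s i) (?s j) p)" if "i \<le> M" "j \<le> M" for i j
      using refine_aux[OF M k that(1)] refine_aux[OF M k that(2)] grid_bounds[OF k]
      by (intro path_in_subpath_image[OF p(1) C(2)]) auto
    have s0: "?s 0 = real k / real N" using M by simp
    have cont: "continuous_on {real k / real N..real (Suc k) / real N} p"
      by (rule continuous_on_subset[of "{0..1}"]) (use p grid_bounds[OF k] in \<open>auto simp: path_def\<close>)
    show ?thesis using \<open>j \<le> M\<close>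
    proof (induction j)
      case 0
      have "p (?s 0) \<in> C" using C(2) grid_bounds[OF k] unfolding s0 by fastforce
      moreover have "Path_Connected.subpath (?s 0) (?s 0) p = (\<lambda>_. p (?s 0))"
        by (auto simp: subpath_def)
      ultimately show ?case using C.const unfolding s0[symmetric] by simp
    next
      case (Suc j)
      have "\<Psi> (Path_Connected.subpath (?s 0) (?s j) p) \<otimes> \<Psi> (Path_Connected.subpath (?s j) (?s (Suc j)) p)
          = \<Psi> (Path_Connected.subpath (?s 0) (?s (Suc j)) p)"
        using refine_aux[OF M k, of 0] refine_aux[OF M k, of j] refine_aux[OF M k, of "Suc j"] Suc.prems
        by (intro C.subpath_interval[OF cont C(2)]) auto
      then show ?case using Suc unfolding s0[symmetric] by (simp add: piece_def)
    qed
  qed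
  have cl: "\<Psi> (piece (M * N) p k) \<in> carrier G" if "k < M * N" for k
    by (rule piece_closed[OF p(1) f that])
  have "grid_prod G (\<lambda>k. \<Psi> (piece (M * N) p k)) (M * n) = grid_prod G (\<lambda>k. \<Psi> (piece N p k)) n"
    if "n \<le> N" for n
    using that
  proof (induction n)
    case (Suc n)
    have le: "M * n + M \<le> M * N" using Suc.prems using mult_le_mono2[OF Suc.prems, of M] by (simp add: add.commute)
    have "M * Suc n = M * n + M" by simp
    then have "grid_prod G (\<lambda>k. \<Psi> (piece (M * N) p k)) (M * Suc n)
       = grid_prod G (\<lambda>k. \<Psi> (piece (M * N) p k)) (M * n) \<otimes> grid_prod G (\<lambda>j. \<Psi> (piece (M * N) p (M * n + j))) M"
      by (simp only:) (rule grid_prod_add, use le cl in simp)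
    also have "grid_prod G (\<lambda>j. \<Psi> (piece (M * N) p (M * n + j))) M = \<Psi> (piece N p n)"
    proof -
      have "real (M * n + M) / real (M * N) = real (M * Suc n) / real (M * N)" by simp
      also have "\<dots> = real (Suc n) / real N"
        unfolding of_nat_mult by (rule mult_divide_mult_cancel_left) (use M in simp)
      finally show ?thesis using inner[of n M] Suc.prems by (simp only: piece_def)
    qed
    finally show ?case using Suc by simp
  qed simp
  then show "grid_value (M * N) p = grid_value N p" unfolding grid_value_def by blast
qed

lemma fits_exists:
  assumes "path_in (\<Union>\<C>) p"
  shows "\<exists>N. fits N p"
proof -
  obtain e where e: "e > 0" "\<And>x. x \<in> {0..1::real} \<Longrightarrow> \<exists>C\<in>\<C>. p ` ({0..1} \<inter> ball x e) \<subseteq> C"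
    by (rule Lebesgue_image[of "{0..1}" p \<C>]) (use assms open_cover in \<open>auto simp: path_def path_image_def\<close>)
  obtain n where n: "1 / real (Suc n) < e" by (rule nat_approx_posE[OF e(1)])
  define N where "N = Suc n"
  have N: "N > 0" "1 / real N < e" using n by (simp_all add: N_def)
  have "fits N p" unfolding fits_def
  proof (intro conjI allI impI)
    fix k assume k: "k < N"
    have "{real k / real N..real (Suc k) / real N} \<subseteq> {0..1} \<inter> ball (real k / real N) e"
      using grid_bounds[OF k] N by (auto simp: dist_real_def add_divide_distrib)
    note sub = image_mono[OF this, of p]
    have "real k / real N \<in> {0..1}" using grid_bounds[OF k] by auto
    from e(2)[OF this] obtain C where "C \<in> \<C>" "p ` ({0..1} \<inter> ball (real k / real N) e) \<subseteq> C" ..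
    with sub show "\<exists>C\<in>\<C>. p ` {real k / real N..real (Suc k) / real N} \<subseteq> C"
      by (meson order_trans)
  qed (use N in simp)
  then show ?thesis ..
qed

definition glued :: "(real \<Rightarrow> 'b) \<Rightarrow> 'a" where
  "glued p = grid_value (SOME N. fits N p) p"

lemma glued_eq: "path p \<Longrightarrow> fits N p \<Longrightarrow> glued p = grid_value N p"
proof -
  assume p: "path p" and f: "fits N p"
  define M where "M = (SOME N. fits N p)"
  have M: "fits M p" unfolding M_def using f by (rule someI)
  have "grid_value M p = grid_value (N * M) p"
    using grid_value_refine[OF p M] f by (simp add: fits_def)
  also have "\<dots> = grid_value N p"
    using grid_value_refine[OF p f, of M] M by (simp add: fits_def mult.commute)
  finally show ?thesis by (simp add: glued_def M_def)
qed

lemma glued_extends: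
  assumes "C \<in> \<C>" "path_in C p"
  shows "glued p = \<Psi> p"
proof -
  interpret path_functor G C \<Psi> using cover_functor assms(1) .
  have "fits 1 p" using assms by (auto simp: fits_def path_image_def)
  then have "glued p = grid_value 1 p" using glued_eq assms by blast
  also have "\<dots> = \<Psi> p" using assms closed by (simp add: grid_value_def piece_def)
  finally show ?thesis .
qed

lemma glued_closed: "path_in (\<Union>\<C>) p \<Longrightarrow> glued p \<in> carrier G"
  using fits_exists[of p] glued_eq[of p] piece_closed[of p]
  by (auto simp: grid_value_def intro!: grid_prod_closed)

text \<open>A join runs at double speed: its grid of \<open>N + N\<close> pieces is the grid of
  \<open>p\<close> with \<open>N\<close> pieces followed by that of \<open>q\<close>. A common
  \<open>N\<close> is the product of two fitting numbers.\<close>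

lemma glued_join:
  assumes p: "path_in (\<Union>\<C>) p" and q: "path_in (\<Union>\<C>) q" and pq: "pathfinish p = pathstart q"
  shows "glued (p +++ q) = glued p \<otimes> glued q"
proof -
  obtain K M where KM: "fits K p" "fits M q" using fits_exists p q by blast
  define N where "N = K * M"
  have fp: "fits N p" and fq: "fits N q"
    using grid_value_refine(1)[of p K M] grid_value_refine(1)[of q M K] KM p q
    by (auto simp: N_def fits_def mult.commute)
  have N: "N > 0" using fp by (simp add: fits_def)
  have jp: "(p +++ q) t = p (2 * t)" if "t \<le> 1/2" for t
    using that by (simp add: joinpaths_def)
  \<comment> \<open>At \<open>t = 1/2\<close> the join is defined by the branch of \<open>p\<close>;
    \<open>pq\<close> makes the branch of \<open>q\<close> valid there too.\<close>
  have jq: "(p +++ q) t = q (2 * t - 1)" if "t \<ge> 1/2" for t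
  proof (cases "t = 1/2")
    case True
    show ?thesis unfolding True using pq by (simp add: joinpaths_def pathfinish_def pathstart_def)
  qed (use that in \<open>auto simp: joinpaths_def\<close>)
  have pjq: "path (p +++ q)" using p q pq by simp
  have p1: "\<exists>C\<in>\<C>. (p +++ q) ` {real k / real (N + N)..real (Suc k) / real (N + N)} \<subseteq> C \<and>
      \<Psi> (piece (N + N) (p +++ q) k) = \<Psi> (piece N p k)" if k: "k < N" for k
  proof -
    obtain C where C: "C \<in> \<C>" "p ` {real k / real N..real (Suc k) / real N} \<subseteq> C"
      using fp k by (auto simp: fits_def)
    interpret path_functor G C \<Psi> using cover_functor C by blast
    have half: "t \<le> 1/2" "2 * t \<in> {real k / real N..real (Suc k) / real N}"
      if "t \<in> {real k / real (N + N)..real (Suc k) / real (N + N)}" for t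
    proof -
      have "real (Suc k) / real (N + N) \<le> 1/2" using k N by (simp add: divide_simps)
      then show "t \<le> 1/2" using that unfolding atLeastAtMost_iff by linarith
      show "2 * t \<in> {real k / real N..real (Suc k) / real N}" using that N by (auto simp: field_simps)
    qed
    have sub: "(p +++ q) ` {real k / real (N + N)..real (Suc k) / real (N + N)} \<subseteq> C"
      using half jp C(2) by fastforce
    have "path_in C (piece (N + N) (p +++ q) k)" unfolding piece_def
      by (rule path_in_subpath_image[OF pjq sub]) (use k N in \<open>auto simp: divide_simps\<close>)
    moreover have "piece (N + N) (p +++ q) k t = piece N p k t" if "t \<in> {0..1}" for t
    proof -
      have "(real (Suc k) / real (N + N) - real k / real (N + N)) * t + real k / real (N + N) = (real k + t) / real (N + N)"
        using N by (simp add: field_simps)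
      moreover have "(real k + t) / real (N + N) \<le> 1/2" using that k N by (simp add: divide_simps)
      moreover have "2 * ((real k + t) / real (N + N)) = (real (Suc k) / real N - real k / real N) * t + real k / real N"
        using N by (simp add: field_simps)
      ultimately show ?thesis by (simp only: piece_def subpath_def jp)
    qed
    ultimately show ?thesis using sub C(1) eq_on by blast
  qed
  have q1: "\<exists>C\<in>\<C>. (p +++ q) ` {real (N + k) / real (N + N)..real (Suc (N + k)) / real (N + N)} \<subseteq> C \<and>
      \<Psi> (piece (N + N) (p +++ q) (N + k)) = \<Psi> (piece N q k)" if k: "k < N" for k
  proof -
    obtain C where C: "C \<in> \<C>" "q ` {real k / real N..real (Suc k) / real N} \<subseteq> C"
      using fq k by (auto simp: fits_def)
    interpret path_functor G C \<Psi> using cover_functor C by blast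
    have half: "t \<ge> 1/2" "2 * t - 1 \<in> {real k / real N..real (Suc k) / real N}"
      if "t \<in> {real (N + k) / real (N + N)..real (Suc (N + k)) / real (N + N)}" for t
    proof -
      have "real (N + k) / real (N + N) \<ge> 1/2" using N by (simp add: divide_simps)
      then show "t \<ge> 1/2" using that unfolding atLeastAtMost_iff by linarith
      show "2 * t - 1 \<in> {real k / real N..real (Suc k) / real N}" using that N by (auto simp: field_simps)
    qed
    have sub: "(p +++ q) ` {real (N + k) / real (N + N)..real (Suc (N + k)) / real (N + N)} \<subseteq> C"
      using half jq C(2) by fastforce
    have "path_in C (piece (N + N) (p +++ q) (N + k))" unfolding piece_def
      by (rule path_in_subpath_image[OF pjq sub]) (use k N in \<open>auto simp: divide_simps\<close>)
    moreover have "piece (N + N) (p +++ q) (N + k) t = piece N q k t" if "t \<in> {0..1}" for t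
    proof -
      have "(real (Suc (N + k)) / real (N + N) - real (N + k) / real (N + N)) * t + real (N + k) / real (N + N)
          = (real (N + k) + t) / real (N + N)"
        using N by (simp add: field_simps)
      moreover have "(real (N + k) + t) / real (N + N) \<ge> 1/2" using that k N by (simp add: divide_simps)
      moreover have "2 * ((real (N + k) + t) / real (N + N)) - 1 = (real (Suc k) / real N - real k / real N) * t + real k / real N"
        using N by (simp add: field_simps)
      ultimately show ?thesis by (simp only: piece_def subpath_def jq)
    qed
    ultimately show ?thesis using sub C(1) eq_on by blast
  qed
  have f: "fits (N + N) (p +++ q)" unfolding fits_def
  proof (intro conjI allI impI)
    fix k assume "k < N + N"
    show "\<exists>C\<in>\<C>. (p +++ q) ` {real k / real (N + N)..real (Suc k) / real (N + N)} \<subseteq> C"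
    proof (cases "k < N")
      case True
      with p1 show ?thesis by blast
    next
      case False
      define j where "j = k - N"
      have "k = N + j" "j < N" using False \<open>k < N + N\<close> by (auto simp: j_def)
      with q1[of j] show ?thesis by blast
    qed
  qed (use N in simp)
  have "glued (p +++ q) = grid_value (N + N) (p +++ q)" by (rule glued_eq[OF pjq f])
  also have "\<dots> = grid_prod G (\<lambda>k. \<Psi> (piece (N + N) (p +++ q) k)) N
      \<otimes> grid_prod G (\<lambda>k. \<Psi> (piece (N + N) (p +++ q) (N + k))) N"
    unfolding grid_value_def by (rule grid_prod_add) (rule piece_closed[OF pjq f])
  also have "\<dots> = grid_value N p \<otimes> grid_value N q"
    unfolding grid_value_def using p1 q1
    by (intro arg_cong2[where f = "\<lambda>a b. a \<otimes> b"] grid_prod_cong) blast+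
  also have "\<dots> = glued p \<otimes> glued q"
    using glued_eq p q fp fq by simp
  finally show ?thesis .
qed

text \<open>On a grid so fine that each cell of the homotopy lies in one member of the cover, every
  cell commutes. The cells between two neighbouring rows telescope, and the outer sides are trivial
  because the homotopy fixes end points.\<close>

lemma glued_homotopic:
  assumes "homotopic_paths (\<Union>\<C>) p q"
  shows "glued p = glued q"
proof -
  obtain h where h: "continuous_on ({0..1} \<times> {0..1}) h" "h ` ({0..1} \<times> {0..1}) \<subseteq> \<Union>\<C>"
      "\<And>x. x \<in> {0..1} \<Longrightarrow> h (0, x) = p x" "\<And>x. x \<in> {0..1} \<Longrightarrow> h (1, x) = q x"
      "\<And>t. t \<in> {0..1::real} \<Longrightarrow> h (t, 0) = h (0, 0)" "\<And>t. t \<in> {0..1::real} \<Longrightarrow> h (t, 1) = h (0, 1)"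
    using assms unfolding homotopic_paths by (fastforce simp: pathstart_def pathfinish_def)
  obtain e where e: "e > 0" "\<And>x. x \<in> {0..1} \<times> {0..1} \<Longrightarrow> \<exists>C\<in>\<C>. h ` (({0..1} \<times> {0..1}) \<inter> ball x e) \<subseteq> C"
    by (rule Lebesgue_image[of "{0..1} \<times> {0..1}" h \<C>]) (use h open_cover in \<open>auto intro: compact_Times\<close>)
  \<comment> \<open>Cells have sides \<open>1 / N\<close>, and the distance in the product is at
    most the sum of the two coordinate distances; hence half of \<open>e\<close>.\<close>
  have "e / 2 > 0" using e(1) by simp
  then obtain n where n: "1 / real (Suc n) < e / 2" by (rule nat_approx_posE)
  define N where "N = Suc n"
  have N: "N > 0" "1 / real N < e / 2" using n by (simp_all add: N_def)
  define r where "r i t = h (real i / real N, t)" for i t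
  have cell: "\<exists>C\<in>\<C>. h ` ({real i / real N..real (Suc i) / real N} \<times> {real k / real N..real (Suc k) / real N}) \<subseteq> C"
    if "i < N" "k < N" for i k
  proof -
    have "{real i / real N..real (Suc i) / real N} \<times> {real k / real N..real (Suc k) / real N}
        \<subseteq> ({0..1} \<times> {0..1}) \<inter> ball (real i / real N, real k / real N) e"
    proof
      fix z assume z: "z \<in> {real i / real N..real (Suc i) / real N} \<times> {real k / real N..real (Suc k) / real N}"
      then obtain a b where zab: "z = (a, b)" "a \<in> {real i / real N..real (Suc i) / real N}"
        "b \<in> {real k / real N..real (Suc k) / real N}" by auto
      have "0 \<le> a" "0 \<le> b"
        using zab(2,3) by (meson atLeastAtMost_iff divide_nonneg_nonneg of_nat_0_le_iff order_trans)+
      have "dist (real i / real N, real k / real N) z \<le> dist (real i / real N) a + dist (real k / real N) b"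
        unfolding zab dist_prod_def by (simp add: sqrt_sum_squares_le_sum)
      also have "\<dots> < e"
        using zab N by (auto simp: dist_real_def add_divide_distrib)
      finally have "z \<in> ball (real i / real N, real k / real N) e" by simp
      moreover have "a \<le> 1" "b \<le> 1"
        using zab(2,3) grid_bounds[OF that(1)] grid_bounds[OF that(2)] by (meson atLeastAtMost_iff order_trans)+
      ultimately show "z \<in> ({0..1} \<times> {0..1}) \<inter> ball (real i / real N, real k / real N) e"
        using \<open>0 \<le> a\<close> \<open>0 \<le> b\<close> zab(1) by simp
    qed
    note sub = image_mono[OF this, of h]
    have "(real i / real N, real k / real N) \<in> {0..1} \<times> {0..1}"
      using grid_bounds[OF that(1)] grid_bounds[OF that(2)] by auto
    from e(2)[OF this] obtain C where "C \<in> \<C>"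
      "h ` (({0..1} \<times> {0..1}) \<inter> ball (real i / real N, real k / real N) e) \<subseteq> C" ..
    with sub show ?thesis by (meson order_trans)
  qed
  have rp: "path (r i)" if "i \<le> N" for i
    unfolding r_def path_def
    by (rule continuous_on_compose2[OF h(1)]) (use that N in \<open>auto intro!: continuous_intros simp: divide_simps\<close>)
  have rf: "fits N (r i)" if "i \<le> N" for i
    unfolding fits_def
  proof (intro conjI allI impI)
    fix k assume k: "k < N"
    \<comment> \<open>Row \<open>N\<close> starts no strip of cells; it is the far edge of strip
      \<open>N - 1\<close>.\<close>
    obtain i' where i': "i' < N" "real i / real N \<in> {real i' / real N..real (Suc i') / real N}"
    proof (cases "i = N")
      case True
      with N show ?thesis by (intro that[of "N - 1"]) (auto simp: divide_simps)
    next
      case False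
      with \<open>i \<le> N\<close> show ?thesis by (intro that[of i]) (auto simp: divide_simps)
    qed
    obtain C where C: "C \<in> \<C>"
      "h ` ({real i' / real N..real (Suc i') / real N} \<times> {real k / real N..real (Suc k) / real N}) \<subseteq> C"
      using cell[OF i'(1) k] ..
    have "r i ` {real k / real N..real (Suc k) / real N} \<subseteq> C"
    proof (rule image_subsetI)
      fix t assume "t \<in> {real k / real N..real (Suc k) / real N}"
      with i'(2) have "(real i / real N, t) \<in> {real i' / real N..real (Suc i') / real N} \<times> {real k / real N..real (Suc k) / real N}"
        by (rule SigmaI)
      then show "r i t \<in> C" unfolding r_def using C(2) by (meson image_subset_iff)
    qed
    with C(1) show "\<exists>C\<in>\<C>. r i ` {real k / real N..real (Suc k) / real N} \<subseteq> C" ..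
  qed (use N in simp)
  have step: "grid_value N (r i) = grid_value N (r (Suc i))" if i: "i < N" for i
  proof -
    define V where "V k = \<Psi> (\<lambda>t. h ((real i + t) / real N, real k / real N))" for k
    have ib: "(real i + t) / real N \<in> {real i / real N..real (Suc i) / real N}" if "t \<in> {0..1}" for i t
      using that N by (auto simp: divide_simps)
    have sq: "V k \<in> carrier G \<and> V (Suc k) \<in> carrier G \<and>
        \<Psi> (piece N (r i) k) \<otimes> V (Suc k) = V k \<otimes> \<Psi> (piece N (r (Suc i)) k)" if k: "k < N" for k
    proof -
      obtain C where C: "C \<in> \<C>"
        "h ` ({real i / real N..real (Suc i) / real N} \<times> {real k / real N..real (Suc k) / real N}) \<subseteq> C"
        using cell[OF i k] by blast
      interpret C: path_functor G C \<Psi> using cover_functor C by blast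
      define K where "K s t = h ((real i + t) / real N, (real k + s) / real N)" for s t
      have K: "continuous_on ({0..1} \<times> {0..1}) (\<lambda>z. K (fst z) (snd z))"
      proof -
        have "(real i + snd z) / real N \<in> {0..1} \<and> (real k + fst z) / real N \<in> {0..1}"
          if "z \<in> {0..1} \<times> {0..1}" for z
        proof -
          have "fst z \<in> {0..1}" "snd z \<in> {0..1}" using that by auto
          from ib[OF this(1), of k] ib[OF this(2), of i] show ?thesis
            using grid_bounds[OF i] grid_bounds[OF k] unfolding atLeastAtMost_iff by linarith
        qed
        then show ?thesis unfolding K_def
          by (intro continuous_on_compose2[OF h(1)]) (use N in \<open>auto intro!: continuous_intros\<close>)
      qed
      have KC: "K s t \<in> C" if "s \<in> {0..1}" "t \<in> {0..1}" for s t
        unfolding K_def using SigmaI[OF ib[OF that(2), of i] ib[OF that(1), of k]] C(2)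
        by (meson image_subset_iff)
      have pieces: "piece N (r i) k = (\<lambda>t. K t 0)" "piece N (r (Suc i)) k = (\<lambda>t. K t 1)"
        using N by (auto simp: piece_def subpath_def r_def K_def fun_eq_iff field_simps)
      have Vs: "V k = \<Psi> (\<lambda>t. K 0 t)" "V (Suc k) = \<Psi> (\<lambda>t. K 1 t)"
        by (simp_all add: V_def K_def add.commute)
      have side: "path_in C (\<lambda>t. K a t)" if "a \<in> {0..1}" for a
      proof -
        have "continuous_on {0..1} (\<lambda>t. (\<lambda>z. K (fst z) (snd z)) (a, t))"
          by (rule continuous_on_compose2[OF K]) (use that in \<open>auto intro!: continuous_intros\<close>)
        then show ?thesis using KC that by (auto simp: path_def path_image_def)
      qed
      have "V k \<in> carrier G" "V (Suc k) \<in> carrier G"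
        unfolding Vs using side[of 0] side[of 1] C.closed by auto
      with C.square[of K, OF K KC] show ?thesis unfolding pieces Vs by simp
    qed
    have cl: "\<Psi> (piece N (r j) k) \<in> carrier G" if "k < N" "j \<le> N" for k j
      using piece_closed[OF rp rf] that by blast
    have gcl: "grid_prod G (\<lambda>k. \<Psi> (piece N (r j) k)) n \<in> carrier G" if "n \<le> N" "j \<le> N" for n j
      by (rule grid_prod_closed) (use cl that in auto)
    \<comment> \<open>The crossings between rows at the columns 0 and \<open>N\<close> run along the
      fixed end points, hence are constant paths.\<close>
    have edge: "V k = \<one>" if "k = 0 \<or> k = N" for k
    proof -
      have *: "h ((real i + t) / real N, real k / real N) = h (0, real k / real N)" if "t \<in> {0..1}" for t
      proof -
        have "(real i + t) / real N \<in> {0..1}"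
          using ib[OF that, of i] grid_bounds[OF i] unfolding atLeastAtMost_iff by linarith
        note t = this
        have "real k / real N = 0 \<or> real k / real N = 1" using \<open>k = 0 \<or> k = N\<close> N(1) by auto
        then show ?thesis
        proof
          assume eq: "real k / real N = 0"
          show ?thesis unfolding eq by (rule h(5)[OF t])
        next
          assume eq: "real k / real N = 1"
          show ?thesis unfolding eq by (rule h(6)[OF t])
        qed
      qed
      obtain j where j: "j < N" "real k / real N \<in> {real j / real N..real (Suc j) / real N}"
      proof (cases "k = 0")
        case True
        then show ?thesis using N by (intro that[of 0]) auto
      next
        case False
        with \<open>k = 0 \<or> k = N\<close> N(1) show ?thesis by (intro that[of "N - 1"]) (auto simp: divide_simps)
      qed
      obtain C where C: "C \<in> \<C>"
        "h ` ({real i / real N..real (Suc i) / real N} \<times> {real j / real N..real (Suc j) / real N}) \<subseteq> C"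
        using cell[OF i j(1)] ..
      interpret C: path_functor G C \<Psi> using cover_functor C by blast
      have "real i / real N \<in> {real i / real N..real (Suc i) / real N}" using grid_bounds[OF i] by simp
      from SigmaI[OF this j(2)]
      have "(real i / real N, real k / real N) \<in> {real i / real N..real (Suc i) / real N} \<times> {real j / real N..real (Suc j) / real N}" .
      then have "h (real i / real N, real k / real N) \<in> C" using C(2) by (meson image_subset_iff)
      moreover have "h (real i / real N, real k / real N) = h (0, real k / real N)" using *[of 0] by simp
      ultimately have hC: "h (0, real k / real N) \<in> C" by simp
      have "V k = \<Psi> (\<lambda>_. h (0, real k / real N))" unfolding V_def
        by (rule C.eq_on[symmetric, OF path_in_const[OF hC]]) (use * in simp)
      then show ?thesis using C.const[OF hC] by simp
    qed
    \<comment> \<open>The first \<open>n\<close> pieces of row \<open>i\<close>, followed by the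
      crossing \<open>V n\<close>, have the value of the first \<open>n\<close> pieces of the next
      row. Each commuting cell moves the crossing by one column.\<close>
    have "grid_prod G (\<lambda>k. \<Psi> (piece N (r i) k)) n \<otimes> V n = grid_prod G (\<lambda>k. \<Psi> (piece N (r (Suc i)) k)) n"
      if "n \<le> N" for n
      using that
    proof (induction n)
      case (Suc n)
      then have n: "n < N" by simp
      note c = cl[OF n, of i] cl[OF n, of "Suc i"] gcl[of n i] sq[OF n]
      have "grid_prod G (\<lambda>k. \<Psi> (piece N (r i) k)) (Suc n) \<otimes> V (Suc n)
          = (grid_prod G (\<lambda>k. \<Psi> (piece N (r i) k)) n \<otimes> V n) \<otimes> \<Psi> (piece N (r (Suc i)) n)"
        using c i n by (simp add: m_assoc)
      then show ?case using Suc by simp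
    qed (simp add: edge)
    from this[of N] show ?thesis
      using gcl[of N i] i by (simp add: grid_value_def edge)
  qed
  have "grid_value N (r 0) = grid_value N (r n)" if "n \<le> N" for n
    using that by (induction n) (use step in auto)
  then have eq: "glued (r 0) = glued (r N)"
    using glued_eq[OF rp rf] by simp
  have "glued (r 0) = glued p" "glued (r N) = glued q"
  proof -
    have pp: "path p" "path q" using assms homotopic_paths_imp_path by blast+
    have *: "grid_value N a = grid_value N b" if ab: "\<And>t. t \<in> {0..1} \<Longrightarrow> a t = b t" "path a" "fits N a" for a b
      unfolding grid_value_def
    proof (rule grid_prod_cong)
      fix k assume k: "k < N"
      obtain C where C: "C \<in> \<C>" "a ` {real k / real N..real (Suc k) / real N} \<subseteq> C"
        using ab(3) k by (auto simp: fits_def)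
      interpret C: path_functor G C \<Psi> using cover_functor C by blast
      show "\<Psi> (piece N a k) = \<Psi> (piece N b k)"
      proof (rule C.eq_on)
        show "path_in C (piece N a k)" unfolding piece_def
          using grid_bounds[OF k] by (intro path_in_subpath_image[OF ab(2) C(2)]) auto
        fix t :: real assume "t \<in> {0..1}"
        then have "(real (Suc k) / real N - real k / real N) * t + real k / real N \<in> {0..1}"
          using k by (auto simp: divide_simps)
        then show "piece N a k t = piece N b k t" unfolding piece_def subpath_def using ab(1) by blast
      qed
    qed
    have fin: "fits N b" if f: "fits N a" and eq: "\<And>t. t \<in> {0..1} \<Longrightarrow> a t = b t" for a b
    proof -
      have "a ` {real k / real N..real (Suc k) / real N} = b ` {real k / real N..real (Suc k) / real N}"
        if "k < N" for k
        by (rule image_cong[OF refl]) (use eq grid_subset[OF that] in blast)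
      with f show ?thesis by (simp add: fits_def)
    qed
    show "glued (r 0) = glued p"
      using *[of "r 0" p] fin[of "r 0" p] rp[of 0] rf[of 0] h(3) pp glued_eq by (simp add: r_def)
    show "glued (r N) = glued q"
      using *[of "r N" q] fin[of "r N" q] rp[of N] rf[of N] h(4) pp glued_eq N by (simp add: r_def)
  qed
  with eq show ?thesis by simp
qed

lemma path_functor_glued: "path_functor G (\<Union>\<C>) glued"
  by standard (use glued_closed glued_join glued_homotopic in auto)

end

lemma path_functor_glue:
  assumes "group G" "\<And>C. C \<in> \<C> \<Longrightarrow> open C" "\<And>C. C \<in> \<C> \<Longrightarrow> path_functor G C \<Psi>"
  obtains \<Phi> where "path_functor G (\<Union>\<C>) \<Phi>" "\<And>C p. C \<in> \<C> \<Longrightarrow> path_in C p \<Longrightarrow> \<Phi> p = \<Psi> p"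
proof -
  interpret open_cover_functor G \<C> \<Psi>
    using assms by (simp add: open_cover_functor_def open_cover_functor_axioms_def)
  show ?thesis using that path_functor_glued glued_extends by blast
qed

subsection \<open>Generation of fundamental groups by loops\<close>

lemma (in group) cancel_left:
  assumes "x \<in> carrier G" "y \<in> carrier G"
  shows "x \<otimes> (inv x \<otimes> y) = y" "inv x \<otimes> (x \<otimes> y) = y"
  using assms by (simp_all add: m_assoc[symmetric])

text \<open>A naturally isomorphic functor: the inner factors \<open>g\<close> cancel at the point
  where two paths are joined.\<close>

lemma (in path_functor) gauge:
  assumes "\<And>u. u \<in> S \<Longrightarrow> g u \<in> carrier G"
  shows "path_functor G S (\<lambda>p. g (pathstart p) \<otimes> \<Phi> p \<otimes> inv (g (pathfinish p)))"
proof -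
  have ends: "pathstart p \<in> S" "pathfinish p \<in> S" if "path_in S p" for p :: "real \<Rightarrow> 'b"
    using that by auto
  have g: "g (pathstart p) \<in> carrier G" "g (pathfinish p) \<in> carrier G" if "path_in S p" for p
    using ends[OF that] assms by auto
  show ?thesis
  proof
    fix p assume "path p" "path_image p \<subseteq> S"
    then show "g (pathstart p) \<otimes> \<Phi> p \<otimes> inv (g (pathfinish p)) \<in> carrier G"
      using g[of p] closed by auto
  next
    fix p q assume *: "path_in S p" "path_in S q" "pathfinish p = pathstart q"
    have c: "\<Phi> p \<in> carrier G" "\<Phi> q \<in> carrier G" using * closed by auto
    show "g (pathstart (p +++ q)) \<otimes> \<Phi> (p +++ q) \<otimes> inv (g (pathfinish (p +++ q))) =
        (g (pathstart p) \<otimes> \<Phi> p \<otimes> inv (g (pathfinish p))) \<otimes>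
        (g (pathstart q) \<otimes> \<Phi> q \<otimes> inv (g (pathfinish q)))"
      using * c g[OF *(1)] g[OF *(2)] by (simp add: join m_assoc cancel_left)
  next
    fix p q assume "homotopic_paths S p q"
    then show "g (pathstart p) \<otimes> \<Phi> p \<otimes> inv (g (pathfinish p)) = g (pathstart q) \<otimes> \<Phi> q \<otimes> inv (g (pathfinish q))"
      using homotopic homotopic_paths_imp_pathstart homotopic_paths_imp_pathfinish by metis
  qed
qed

lemma (in path_functor) conjugate:
  assumes "path_in S b" "path_in S c" "pathstart c = pathfinish b" "pathfinish c = pathfinish b"
  shows "\<Phi> (b +++ (c +++ reversepath b)) = \<Phi> b \<otimes> \<Phi> c \<otimes> inv (\<Phi> b)"
proof -
  have "\<Phi> (b +++ (c +++ reversepath b)) = \<Phi> b \<otimes> (\<Phi> c \<otimes> \<Phi> (reversepath b))"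
    using assms by (simp add: join path_image_join)
  then show ?thesis using assms closed by (simp add: reverse m_assoc)
qed

text \<open>A lasso: out along \<open>b\<close>, once around a loop in \<open>N\<close>, and back.
  Keeping the loop inside \<open>N\<close> makes local arguments applicable to generators.\<close>

definition tethered :: "'a::topological_space set \<Rightarrow> 'a \<Rightarrow> 'a set \<Rightarrow> (real \<Rightarrow> 'a) \<Rightarrow> bool" where
  "tethered X x N c \<longleftrightarrow> (\<exists>b k. path_in X b \<and> pathstart b = x \<and> path_in (X \<inter> N) k \<and>
     pathstart k = pathfinish b \<and> pathfinish k = pathfinish b \<and> c = b +++ (k +++ reversepath b))"

text \<open>Generation of the fundamental group, tested by functors into groups on the type
  \<open>'k\<close> and their subgroups. The \<open>itself\<close> argument fixes this type.\<close>

definition generates ::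
    "'k itself \<Rightarrow> 'a::real_normed_vector set \<Rightarrow> 'a \<Rightarrow> (real \<Rightarrow> 'a) set \<Rightarrow> bool" where
  "generates T X x L \<longleftrightarrow> (\<forall>(K :: 'k monoid) \<Phi> J. path_functor K X \<Phi> \<longrightarrow> subgroup J K \<longrightarrow>
     \<Phi> ` L \<subseteq> J \<longrightarrow> \<Phi> ` loops X x \<subseteq> J)"

text \<open>The freeness half of a universal property: values on the \<open>c i\<close> can be
  chosen at will. Uniqueness is left to \<open>generates\<close>.\<close>

definition prescribable ::
    "'h itself \<Rightarrow> 'a::real_normed_vector set \<Rightarrow> 'i set \<Rightarrow> ('i \<Rightarrow> real \<Rightarrow> 'a) \<Rightarrow> bool" where
  "prescribable T X I c \<longleftrightarrow> (\<forall>(H :: 'h monoid) h. group H \<longrightarrow> h ` I \<subseteq> carrier H \<longrightarrow>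
     (\<exists>\<Phi>. path_functor H X \<Phi> \<and> (\<forall>i\<in>I. \<Phi> (c i) = h i)))"

lemma tethered_mono: "tethered X x N c \<Longrightarrow> X \<subseteq> Y \<Longrightarrow> tethered Y x N c"
  unfolding tethered_def by blast

lemma tethered_loop: "tethered X x N c \<Longrightarrow> c \<in> loops X x"
  unfolding tethered_def loops_iff by (auto simp: path_image_join)

text \<open>The generation half of van Kampen's theorem. Every point gets a tether to
  \<open>x\<close>; a short piece of a loop, closed by the tethers of its ends, is a loop in
  \<open>A\<close> or in \<open>B\<close>.\<close>

lemma generates_union:
  fixes A B :: "'a::real_normed_vector set"
  assumes "open A" "open B" "path_connected A" "path_connected B" "path_connected (A \<inter> B)" "x \<in> A \<inter> B"
    and gen: "generates TYPE('k) A x L" "generates TYPE('k) B x M"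
  shows "generates TYPE('k) (A \<union> B) x (L \<union> M)"
  unfolding generates_def
proof (intro allI impI image_subsetI)
  fix K :: "'k monoid" and \<Phi> J q
  assume f: "path_functor K (A \<union> B) \<Phi>" and J: "subgroup J K" and LM: "\<Phi> ` (L \<union> M) \<subseteq> J"
    and q: "q \<in> loops (A \<union> B) x"
  interpret path_functor K "A \<union> B" \<Phi> by fact
  have sub: "\<Phi> ` loops C x \<subseteq> J" if "C = A \<or> C = B" for C
    using gen LM J subset[of A] subset[of B] that unfolding generates_def by (metis Un_subset_iff image_Un sup_ge1 sup_ge2)
  have "\<exists>p. \<forall>C\<in>{A, B}. u \<in> C \<longrightarrow> path_in C p \<and> pathstart p = x \<and> pathfinish p = u" if "u \<in> A \<union> B" for u
  proof -
    \<comment> \<open>The smallest of the three sets containing \<open>u\<close>; a tether chosen in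
      it lies in each of \<open>A\<close> and \<open>B\<close> that contains
      \<open>u\<close>.\<close>
    define D where "D = (if u \<in> A \<inter> B then A \<inter> B else if u \<in> A then A else B)"
    have "path_connected D" "x \<in> D" "u \<in> D" using assms that by (auto simp: D_def)
    then obtain p where p: "path_in D p" "pathstart p = x" "pathfinish p = u"
      unfolding path_connected_def by blast
    show ?thesis
    proof (intro exI[of _ p] ballI impI)
      fix C assume "C \<in> {A, B}" "u \<in> C"
      then have "D \<subseteq> C" using that by (auto simp: D_def)
      with p show "path_in C p \<and> pathstart p = x \<and> pathfinish p = u" by blast
    qed
  qed
  then obtain r where r: "\<And>u C. u \<in> A \<union> B \<Longrightarrow> C \<in> {A, B} \<Longrightarrow> u \<in> C \<Longrightarrow>
      path_in C (r u) \<and> pathstart (r u) = x \<and> pathfinish (r u) = u" by metis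
  have qp: "path_in (A \<union> B) q" "q 0 = x" "q 1 = x"
    using q by (auto simp: loops_iff pathstart_def pathfinish_def)
  have qU: "q t \<in> A \<union> B" if "t \<in> {0..1}" for t
    using qp(1) that unfolding path_image_def by blast
  have xA: "x \<in> A \<union> B" using assms by blast
  have rU: "path_in (A \<union> B) (r u)" "pathstart (r u) = x" "pathfinish (r u) = u" if "u \<in> A \<union> B" for u
    using r[OF that] that by blast+
  have Jm: "a \<otimes>\<^bsub>K\<^esub> b \<in> J" if "a \<in> J" "b \<in> J" for a b using J that by (simp add: subgroup.m_closed)
  have rx: "\<Phi> (r x) \<in> J"
    using r[OF xA, of A] assms(6) sub[of A] by (auto simp: loops_iff)
  \<comment> \<open>The part of \<open>q\<close> up to time \<open>t\<close>, followed by the return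
    along the tether of \<open>q t\<close>, has its value in \<open>J\<close>.\<close>
  define Q where "Q t \<longleftrightarrow> \<Phi> (Path_Connected.subpath 0 t q) \<otimes>\<^bsub>K\<^esub> inv\<^bsub>K\<^esub> (\<Phi> (r (q t))) \<in> J" for t
  have "Q 1"
  proof (rule unit_interval_induct)
    have "Path_Connected.subpath 0 0 q = (\<lambda>_. x)" using qp by (auto simp: subpath_def)
    then show "Q 0" unfolding Q_def using rx qp const[OF xA] rU[OF xA] closed J
      by (simp add: subgroup.m_inv_closed)
  next
    fix t :: real assume t: "t \<in> {0..1}"
    obtain C where C: "C \<in> {A, B}" "q t \<in> C" using qU[OF t] by blast
    have "open C" using C assms by auto
    then obtain d where d: "d > 0" "ball (q t) d \<subseteq> C" using C(2) open_contains_ball by blast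
    have "continuous_on {0..1} q" using qp by (simp add: path_def)
    with t d(1) obtain e where e: "e > 0" "\<And>s. s \<in> {0..1} \<Longrightarrow> dist s t < e \<Longrightarrow> dist (q s) (q t) < d"
      unfolding continuous_on_iff by metis
    have inC: "q s \<in> C" if "s \<in> {0..1}" "\<bar>s - t\<bar> < e" for s
      using e(2)[of s] that d(2) by (auto simp: dist_real_def dist_commute subset_iff)
    have "Q s'" if s: "s \<in> {0..1}" "s' \<in> {0..1}" "\<bar>s - t\<bar> < e" "\<bar>s' - t\<bar> < e" and Qs: "Q s" for s s'
    proof -
      let ?c = "Path_Connected.subpath s s' q"
      have seg: "q ` closed_segment s s' \<subseteq> C"
      proof (rule image_subsetI)
        fix v assume "v \<in> closed_segment s s'"
        then have "v \<in> {0..1}" "\<bar>v - t\<bar> < e" using s by (auto simp: closed_segment_eq_real_ivl split: if_splits)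
        then show "q v \<in> C" by (rule inC)
      qed
      have c: "path_in C ?c" "path_in (A \<union> B) ?c"
        using seg s qp C(1) by (auto simp: path_image_subpath_gen)
      have rs: "path_in C (r (q s))" "path_in C (r (q s'))" using r[OF qU C(1)] inC s by auto
      note rs' = rU[OF qU[OF s(1)]] rU[OF qU[OF s(2)]]
      have "r (q s) +++ (?c +++ reversepath (r (q s'))) \<in> loops C x"
        using c rs rs' by (simp add: loops_iff path_image_join)
      then have "\<Phi> (r (q s) +++ (?c +++ reversepath (r (q s')))) \<in> J" using sub C(1) by blast
      also have "\<Phi> (r (q s) +++ (?c +++ reversepath (r (q s')))) = \<Phi> (r (q s)) \<otimes>\<^bsub>K\<^esub> (\<Phi> ?c \<otimes>\<^bsub>K\<^esub> inv\<^bsub>K\<^esub> (\<Phi> (r (q s'))))"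
        using c rs' by (simp add: join path_image_join reverse)
      finally have 1: "\<Phi> (r (q s)) \<otimes>\<^bsub>K\<^esub> (\<Phi> ?c \<otimes>\<^bsub>K\<^esub> inv\<^bsub>K\<^esub> (\<Phi> (r (q s')))) \<in> J" .
      have p0: "path_in (A \<union> B) (Path_Connected.subpath 0 s q)" using path_in_subpath[OF qp(1), of 0 s] s by simp
      have cl: "\<Phi> (Path_Connected.subpath 0 s q) \<in> carrier K" "\<Phi> ?c \<in> carrier K" "\<Phi> (r (q s)) \<in> carrier K" "\<Phi> (r (q s')) \<in> carrier K"
        using closed p0 c rs' by auto
      have "\<Phi> (Path_Connected.subpath 0 s' q) \<otimes>\<^bsub>K\<^esub> inv\<^bsub>K\<^esub> (\<Phi> (r (q s'))) =
          (\<Phi> (Path_Connected.subpath 0 s q) \<otimes>\<^bsub>K\<^esub> inv\<^bsub>K\<^esub> (\<Phi> (r (q s)))) \<otimes>\<^bsub>K\<^esub> (\<Phi> (r (q s)) \<otimes>\<^bsub>K\<^esub> (\<Phi> ?c \<otimes>\<^bsub>K\<^esub> inv\<^bsub>K\<^esub> (\<Phi> (r (q s')))))"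
        using subpath[OF qp(1), of 0 s s', symmetric] s cl
        by (simp add: m_assoc cancel_left)
      also have "\<dots> \<in> J" by (rule Jm[OF Qs[unfolded Q_def] 1])
      finally show ?thesis unfolding Q_def .
    qed
    with e(1) show "\<exists>e>0. \<forall>s\<in>{0..1}. \<forall>s'\<in>{0..1}. \<bar>s - t\<bar> < e \<longrightarrow> \<bar>s' - t\<bar> < e \<longrightarrow> Q s \<longrightarrow> Q s'"
      by blast
  qed
  then have "\<Phi> q \<otimes>\<^bsub>K\<^esub> inv\<^bsub>K\<^esub> (\<Phi> (r x)) \<in> J" by (simp add: Q_def qp)
  \<comment> \<open>The tether of \<open>x\<close> itself may be a nonconstant loop, and its value
    is cancelled here.\<close>
  from Jm[OF this rx] show "\<Phi> q \<in> J"
    using closed qp rU[OF xA] by (simp add: m_assoc)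
qed

text \<open>Functors on \<open>A\<close> and \<open>B\<close> need not agree on the overlap. A gauge
  transformation along the segments from \<open>x\<close>, available because the overlap is convex,
  makes both trivial there; then they glue.\<close>

lemma prescribable_union:
  fixes A B :: "'a::real_normed_vector set"
  assumes "open A" "open B" "convex (A \<inter> B)" "x \<in> A \<inter> B"
    and pr: "prescribable TYPE('h) A I c" "prescribable TYPE('h) B I' c'"
    and loops: "\<And>i. i \<in> I \<Longrightarrow> c i \<in> loops A x" "\<And>i. i \<in> I' \<Longrightarrow> c' i \<in> loops B x"
    and disj: "I \<inter> I' = {}"
  shows "prescribable TYPE('h) (A \<union> B) (I \<union> I') (\<lambda>i. if i \<in> I then c i else c' i)"
  unfolding prescribable_def
proof (intro allI impI)
  fix H :: "'h monoid" and h
  assume "group H" and h: "h ` (I \<union> I') \<subseteq> carrier H"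
  interpret group H by fact
  obtain \<Phi>A \<Phi>B where A: "path_functor H A \<Phi>A" "\<And>i. i \<in> I \<Longrightarrow> \<Phi>A (c i) = h i"
    and B: "path_functor H B \<Phi>B" "\<And>i. i \<in> I' \<Longrightarrow> \<Phi>B (c' i) = h i"
    using pr h \<open>group H\<close> unfolding prescribable_def by (metis Un_subset_iff image_Un)
  interpret A: path_functor H A \<Phi>A by fact
  interpret B: path_functor H B \<Phi>B by fact
  \<comment> \<open>At \<open>x\<close> the segment is constant and \<open>g\<close> is the
    identity, so values on loops at \<open>x\<close> survive the normalisation.\<close>
  define g where "g \<Phi> u = (if u \<in> A \<inter> B then \<Phi> (linepath x u) else \<one>\<^bsub>H\<^esub>)" for \<Phi> :: "(real \<Rightarrow> 'a) \<Rightarrow> 'h" and u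
  define N where "N \<Phi> p = g \<Phi> (pathstart p) \<otimes>\<^bsub>H\<^esub> \<Phi> p \<otimes>\<^bsub>H\<^esub> inv\<^bsub>H\<^esub> (g \<Phi> (pathfinish p))"
    for \<Phi> :: "(real \<Rightarrow> 'a) \<Rightarrow> 'h" and p
  have lp: "path_in (A \<inter> B) (linepath x u)" if "u \<in> A \<inter> B" for u
    using path_in_linepath[OF assms(3,4) that] .
  have key: "path_functor H C (N \<Phi>)" "\<And>p. path_in (A \<inter> B) p \<Longrightarrow> N \<Phi> p = \<one>\<^bsub>H\<^esub>"
    "\<And>p. p \<in> loops C x \<Longrightarrow> N \<Phi> p = \<Phi> p" if C: "path_functor H C \<Phi>" "A \<inter> B \<subseteq> C" for C \<Phi>
  proof -
    interpret C: path_functor H C \<Phi> by fact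
    have lpC: "path_in C (linepath x u)" if "u \<in> A \<inter> B" for u
      using lp[OF that] C(2) by (metis order_trans)
    show "path_functor H C (N \<Phi>)" unfolding N_def
      by (rule C.gauge) (use lpC C.closed in \<open>auto simp: g_def\<close>)
    show "N \<Phi> p = \<one>\<^bsub>H\<^esub>" if p: "path_in (A \<inter> B) p" for p
    proof -
      have e: "pathstart p \<in> A \<inter> B" "pathfinish p \<in> A \<inter> B" using p by auto
      have pC: "path_in C p" using p C(2) by blast
      have "\<Phi> (linepath x (pathstart p) +++ (p +++ reversepath (linepath x (pathfinish p)))) = \<one>\<^bsub>H\<^esub>"
      proof (rule C.null[OF assms(3) C(2)])
        have "path_in (A \<inter> B) (reversepath (linepath x (pathfinish p)))"
          unfolding reversepath_linepath by (rule path_in_linepath[OF assms(3) e(2) assms(4)])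
        from path_in_join[OF lp[OF e(1)] path_in_join[OF p this]]
        show "path_in (A \<inter> B) (linepath x (pathstart p) +++ (p +++ reversepath (linepath x (pathfinish p))))"
          by simp
      qed simp
      moreover have "\<Phi> (linepath x (pathstart p) +++ (p +++ reversepath (linepath x (pathfinish p)))) = N \<Phi> p"
      proof -
        have "path_in C (reversepath (linepath x (pathfinish p)))"
          by (rule path_in_reverse[THEN iffD2, OF lpC[OF e(2)]])
        then have "\<Phi> (linepath x (pathstart p) +++ (p +++ reversepath (linepath x (pathfinish p))))
          = \<Phi> (linepath x (pathstart p)) \<otimes>\<^bsub>H\<^esub> (\<Phi> p \<otimes>\<^bsub>H\<^esub> \<Phi> (reversepath (linepath x (pathfinish p))))"
          using lpC[OF e(1)] pC path_in_join[OF pC] by (subst C.join; (subst C.join)?) auto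
        also have "\<dots> = N \<Phi> p"
          unfolding C.reverse[OF lpC[OF e(2)]] N_def g_def
          using e C.closed lpC[OF e(1)] lpC[OF e(2)] pC by (simp add: m_assoc)
        finally show ?thesis .
      qed
      ultimately show ?thesis by simp
    qed
    show "N \<Phi> p = \<Phi> p" if "p \<in> loops C x" for p
    proof -
      have "g \<Phi> x = \<one>\<^bsub>H\<^esub>" using C.const C(2) assms(4) by (auto simp: g_def linepath_refl)
      then show ?thesis using that C.closed by (simp add: N_def loops_iff)
    qed
  qed
  \<comment> \<open>A path in \<open>B\<close> for which the first branch applies lies in the
    overlap, where both normalised functors are trivial.\<close>
  define \<Psi> where "\<Psi> p = (if path_in A p then N \<Phi>A p else N \<Phi>B p)" for p
  have fA: "path_functor H A \<Psi>"
    by (rule path_functor_cong[OF key(1)[OF A(1)]]) (auto simp: \<Psi>_def)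
  have fB: "path_functor H B \<Psi>"
    by (rule path_functor_cong[OF key(1)[OF B(1)]])
      (use key(2)[OF A(1)] key(2)[OF B(1)] in \<open>auto simp: \<Psi>_def\<close>)
  obtain \<Phi> where \<Phi>: "path_functor H (\<Union>{A, B}) \<Phi>" "\<And>C p. C \<in> {A, B} \<Longrightarrow> path_in C p \<Longrightarrow> \<Phi> p = \<Psi> p"
    using path_functor_glue[of H "{A, B}" \<Psi>] \<open>group H\<close> assms(1,2) fA fB by blast
  show "\<exists>\<Phi>. path_functor H (A \<union> B) \<Phi> \<and> (\<forall>i\<in>I \<union> I'. \<Phi> (if i \<in> I then c i else c' i) = h i)"
  proof (intro exI[of _ \<Phi>] conjI ballI)
    show "path_functor H (A \<union> B) \<Phi>" using \<Phi>(1) by simp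
    fix i assume i: "i \<in> I \<union> I'"
    show "\<Phi> (if i \<in> I then c i else c' i) = h i"
    proof (cases "i \<in> I")
      case True
      have "path_in A (c i)" using loops(1)[OF True] by (simp add: loops_iff)
      then show ?thesis using True \<Phi>(2)[of A "c i"] key(3)[OF A(1) _ loops(1)[OF True]] A(2)[OF True]
        by (simp add: \<Psi>_def)
    next
      case False
      with i have i': "i \<in> I'" by simp
      have pB: "path_in B (c' i)" using loops(2)[OF i'] by (simp add: loops_iff)
      have "\<Psi> (c' i) = N \<Phi>B (c' i)"
        using key(2)[OF A(1), of "c' i"] key(2)[OF B(1), of "c' i"] pB by (simp add: \<Psi>_def)
      then show ?thesis using False \<Phi>(2)[of B "c' i"] pB key(3)[OF B(1) _ loops(2)[OF i']] B(2)[OF i']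
        by simp
    qed
  qed
qed

subsection \<open>Punctured convex planar regions\<close>

text \<open>Free generation by lassos around the punctures \<open>P\<close>. The radius
  \<open>e\<close> is at the disposal of the caller; near a line it keeps the generators inside the
  discs where commutation is known.\<close>

definition freely_generated ::
    "'k itself \<Rightarrow> 'h itself \<Rightarrow> complex set \<Rightarrow> complex \<Rightarrow> complex set \<Rightarrow> real \<Rightarrow> (complex \<Rightarrow> real \<Rightarrow> complex) \<Rightarrow> bool"
where
  "freely_generated K H X x P e c \<longleftrightarrow> (\<forall>p\<in>P. tethered X x (ball p e) (c p)) \<and>
     generates K X x (c ` P) \<and> prescribable H X P c"

text \<open>Lengthening the tethers by \<open>b\<close> conjugates all values by
  \<open>\<Phi> b\<close>. Gauge transformations by this constant or its inverse transfer generation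
  and prescribed values.\<close>

lemma freely_generated_change_base:
  assumes fg: "freely_generated TYPE('k) TYPE('h) X y P e c"
    and b: "path_in X b" "pathstart b = x" "pathfinish b = y"
  shows "\<exists>c'. freely_generated TYPE('k) TYPE('h) X x P e c'"
proof -
  have "\<exists>u k. path_in X u \<and> pathstart u = y \<and> path_in (X \<inter> ball p e) k \<and>
     pathstart k = pathfinish u \<and> pathfinish k = pathfinish u \<and> c p = u +++ (k +++ reversepath u)"
    if "p \<in> P" for p
    using fg that by (auto simp: freely_generated_def tethered_def)
  then obtain u k where uk: "\<And>p. p \<in> P \<Longrightarrow> path_in X (u p) \<and> pathstart (u p) = y \<and>
     path_in (X \<inter> ball p e) (k p) \<and> pathstart (k p) = pathfinish (u p) \<and>
     pathfinish (k p) = pathfinish (u p) \<and> c p = u p +++ (k p +++ reversepath (u p))" by metis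
  define c' where "c' p = (b +++ u p) +++ (k p +++ reversepath (b +++ u p))" for p
  have bu: "path_in X (b +++ u p)" if "p \<in> P" for p
    using path_in_join[OF b(1)] uk[OF that] b by simp
  have val: "\<Phi> (c' p) = \<Phi> b \<otimes>\<^bsub>G\<^esub> \<Phi> (c p) \<otimes>\<^bsub>G\<^esub> inv\<^bsub>G\<^esub> (\<Phi> b)"
    if f: "path_functor G X \<Phi>" and p: "p \<in> P" for p \<Phi> and G :: "'g monoid"
  proof -
    interpret path_functor G X \<Phi> by fact
    have k: "path_in X (k p)" using uk[OF p] by auto
    have cl: "\<Phi> b \<in> carrier G" "\<Phi> (u p) \<in> carrier G" "\<Phi> (k p) \<in> carrier G"
      using closed b uk[OF p] k by auto
    have "\<Phi> (c' p) = \<Phi> (b +++ u p) \<otimes>\<^bsub>G\<^esub> \<Phi> (k p) \<otimes>\<^bsub>G\<^esub> inv\<^bsub>G\<^esub> (\<Phi> (b +++ u p))"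
      unfolding c'_def by (rule conjugate[OF bu[OF p] k]) (use uk[OF p] in auto)
    moreover have "\<Phi> (c p) = \<Phi> (u p) \<otimes>\<^bsub>G\<^esub> \<Phi> (k p) \<otimes>\<^bsub>G\<^esub> inv\<^bsub>G\<^esub> (\<Phi> (u p))"
      using conjugate[of "u p" "k p"] k uk[OF p] by simp
    moreover have "\<Phi> (b +++ u p) = \<Phi> b \<otimes>\<^bsub>G\<^esub> \<Phi> (u p)" using join b uk[OF p] by simp
    ultimately show ?thesis using cl by (simp add: m_assoc inv_mult_group)
  qed
  have "tethered X x (ball p e) (c' p)" if "p \<in> P" for p
    unfolding tethered_def c'_def
    by (intro exI[of _ "b +++ u p"] exI[of _ "k p"]) (use bu[OF that] uk[OF that] b in simp)
  moreover have "generates TYPE('k) X x (c' ` P)"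
    unfolding generates_def
  proof (intro allI impI image_subsetI)
    fix K :: "'k monoid" and \<Phi> J q
    assume f: "path_functor K X \<Phi>" and J: "subgroup J K" and P: "\<Phi> ` (c' ` P) \<subseteq> J" and q: "q \<in> loops X x"
    interpret path_functor K X \<Phi> by fact
    have bc: "\<Phi> b \<in> carrier K" using b closed by blast
    define \<Psi> where "\<Psi> p = \<Phi> b \<otimes>\<^bsub>K\<^esub> \<Phi> p \<otimes>\<^bsub>K\<^esub> inv\<^bsub>K\<^esub> (\<Phi> b)" for p
    have "path_functor K X \<Psi>" unfolding \<Psi>_def using gauge[of "\<lambda>_. \<Phi> b"] bc by simp
    moreover have "\<Psi> (c i) \<in> J" if "i \<in> P" for i
      using P val[OF f that] that unfolding \<Psi>_def by (metis image_eqI subsetD)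
    then have "\<Psi> ` (c ` P) \<subseteq> J" by blast
    ultimately have *: "\<Psi> ` loops X y \<subseteq> J"
      using fg J unfolding freely_generated_def generates_def by blast
    have "reversepath b +++ (q +++ b) \<in> loops X y"
      using q b by (auto simp: loops_iff path_image_join)
    with * have "\<Psi> (reversepath b +++ (q +++ b)) \<in> J" by blast
    also have "\<Psi> (reversepath b +++ (q +++ b)) = \<Phi> q"
    proof -
      have qc: "\<Phi> q \<in> carrier K" and qin: "path_in X q" "pathstart q = x" "pathfinish q = x"
        using q closed by (auto simp: loops_iff)
      have "\<Phi> (reversepath b +++ (q +++ b)) = inv\<^bsub>K\<^esub> (\<Phi> b) \<otimes>\<^bsub>K\<^esub> (\<Phi> q \<otimes>\<^bsub>K\<^esub> \<Phi> b)"
        using qin b by (simp add: join path_image_join reverse)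
      then show ?thesis unfolding \<Psi>_def using qc bc by (simp add: m_assoc) (simp add: m_assoc[symmetric])
    qed
    finally show "\<Phi> q \<in> J" .
  qed
  moreover have "prescribable TYPE('h) X P c'"
    unfolding prescribable_def
  proof (intro allI impI)
    fix H :: "'h monoid" and h assume "group H" and h: "h ` P \<subseteq> carrier H"
    then obtain \<Phi> where \<Phi>: "path_functor H X \<Phi>" "\<forall>i\<in>P. \<Phi> (c i) = h i"
      using fg unfolding freely_generated_def prescribable_def by blast
    interpret path_functor H X \<Phi> by fact
    have bc: "\<Phi> b \<in> carrier H" using b closed by blast
    have "path_functor H X (\<lambda>p. inv\<^bsub>H\<^esub> (\<Phi> b) \<otimes>\<^bsub>H\<^esub> \<Phi> p \<otimes>\<^bsub>H\<^esub> inv\<^bsub>H\<^esub> (inv\<^bsub>H\<^esub> (\<Phi> b)))"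
      using gauge[of "\<lambda>_. inv\<^bsub>H\<^esub> (\<Phi> b)"] bc by simp
    moreover have "inv\<^bsub>H\<^esub> (\<Phi> b) \<otimes>\<^bsub>H\<^esub> \<Phi> (c' i) \<otimes>\<^bsub>H\<^esub> inv\<^bsub>H\<^esub> (inv\<^bsub>H\<^esub> (\<Phi> b)) = h i" if i: "i \<in> P" for i
    proof -
      have "h i \<in> carrier H" using h i by blast
      then show ?thesis unfolding val[OF \<Phi>(1) i] using \<Phi>(2) i bc
        by (simp add: m_assoc) (simp add: m_assoc[symmetric])
    qed
    ultimately show "\<exists>\<Phi>. path_functor H X \<Phi> \<and> (\<forall>i\<in>P. \<Phi> (c' i) = h i)" by blast
  qed
  ultimately show ?thesis unfolding freely_generated_def by blast
qed

lemma freely_generated_empty: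
  assumes "convex X"
  shows "freely_generated K H X x {} e c"
  unfolding freely_generated_def generates_def prescribable_def
proof (intro conjI allI impI image_subsetI ballI)
  fix G :: "'a monoid" and \<Phi> J q
  assume "path_functor G X \<Phi>" and J: "subgroup J G" and q: "q \<in> loops X x"
  interpret path_functor G X \<Phi> by fact
  have "\<Phi> q = \<one>\<^bsub>G\<^esub>" by (rule null[OF assms order.refl]) (use q in \<open>auto simp: loops_iff\<close>)
  then show "\<Phi> q \<in> J" using J by (simp add: subgroup.one_closed)
next
  fix G :: "'b monoid" and h :: "complex \<Rightarrow> 'b"
  assume "group G"
  then interpret group G .
  have "path_functor G X (\<lambda>_. \<one>\<^bsub>G\<^esub>)" by standard auto
  then show "\<exists>\<Phi>. path_functor G X \<Phi> \<and> (\<forall>i\<in>{}. \<Phi> (c i) = h i)" by auto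
qed simp

section \<open>Winding numbers and multiples of a circle\<close>

definition add_group :: "complex monoid" where
  "add_group = \<lparr>carrier = UNIV, mult = (+), one = 0\<rparr>"

lemma group_add_group: "group add_group"
  by (rule groupI) (auto simp: add_group_def intro: exI[of _ "- _"] add.left_inverse)

lemma inv_add_group [simp]: "inv\<^bsub>add_group\<^esub> a = - a"
proof -
  interpret group add_group by (rule group_add_group)
  show ?thesis by (rule inv_equality) (auto simp: add_group_def)
qed

lemma add_group_simps [simp]: "carrier add_group = UNIV" "a \<otimes>\<^bsub>add_group\<^esub> b = a + b" "\<one>\<^bsub>add_group\<^esub> = 0"
  by (simp_all add: add_group_def)

text \<open>On open paths winding numbers are complex, hence the target is the additive group of
  complex numbers.\<close>

lemma path_functor_winding:
  assumes "p \<notin> X"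
  shows "path_functor add_group X (\<lambda>q. winding_number q p)"
proof -
  interpret group add_group by (rule group_add_group)
  show ?thesis
  proof
    fix q r assume "path_in X q" "path_in X r" "pathfinish q = pathstart r"
    then show "winding_number (q +++ r) p = winding_number q p \<otimes>\<^bsub>add_group\<^esub> winding_number r p"
      using assms by (auto intro!: winding_number_join)
  next
    fix q r assume "homotopic_paths X q r"
    then have "homotopic_paths (- {p}) q r" by (rule homotopic_paths_subset) (use assms in auto)
    then show "winding_number q p = winding_number r p" by (rule winding_number_homotopic_paths)
  qed auto
qed

definition turns :: "complex \<Rightarrow> real \<Rightarrow> int \<Rightarrow> real \<Rightarrow> complex" where
  "turns p r n t = p + of_real r * exp (2 * of_real pi * \<i> * of_real (of_int n * t))"

lemma turns_ends: "pathstart (turns p r n) = p + r" "pathfinish (turns p r n) = p + r"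
proof -
  show "pathstart (turns p r n) = p + r" by (simp add: turns_def pathstart_def)
  have "exp (2 * of_real pi * \<i> * of_int n) = 1"
    using exp_integer_2pi[of "of_int n"] by (simp add: mult_ac)
  then show "pathfinish (turns p r n) = p + r" by (simp add: turns_def pathfinish_def)
qed

lemma turns_1: "turns p r 1 = circlepath p r"
  by (simp add: turns_def circlepath fun_eq_iff mult_ac)

lemma path_in_turns: "r > 0 \<Longrightarrow> path_in (sphere p r) (turns p r n)"
  unfolding path_in_iff turns_def
  by (auto intro!: continuous_intros simp: dist_norm norm_mult)

text \<open>The circle is covered by the real line via \<open>E\<close>. On the line, which is
  convex, consecutive segments add up, and by periodicity every segment of length \<open>n\<close>
  starting at an integer becomes \<open>turns p r n\<close>.\<close>

lemma path_functor_turns: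
  assumes \<Phi>: "path_functor G S \<Phi>" and "r > 0" "sphere p r \<subseteq> S"
  shows "\<Phi> (turns p r n) = \<Phi> (turns p r 1) [^]\<^bsub>G\<^esub> n"
proof -
  interpret path_functor G S \<Phi> by fact
  define E where "E t = p + of_real r * exp (2 * of_real pi * \<i> * of_real t)" for t
  have ES: "continuous_on UNIV E" "E ` UNIV \<subseteq> S"
    using assms by (auto simp: E_def dist_norm norm_mult intro!: continuous_intros) 
  interpret R: path_functor G "UNIV :: real set" "\<lambda>q. \<Phi> (E \<circ> q)" by (rule compose[OF ES])
  have per: "E (t + of_int m) = E t" for t m
  proof -
    have "exp (2 * of_real pi * \<i> * of_int m) = 1"
      using exp_integer_2pi[of "of_int m"] by (simp add: mult_ac)
    then show ?thesis by (simp add: E_def distrib_left exp_add)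
  qed
  have seg: "E \<circ> linepath (of_int m) (of_int m + of_int n) = turns p r n" for m n
  proof
    fix t
    have "linepath (real_of_int m) (of_int m + of_int n) t = of_int n * t + of_int m"
      by (simp add: linepath_def algebra_simps)
    then show "(E \<circ> linepath (of_int m) (of_int m + of_int n)) t = turns p r n t"
      using per[of "of_int n * t" m] by (simp add: E_def turns_def)
  qed
  have add: "\<Phi> (turns p r (m + n)) = \<Phi> (turns p r m) \<otimes>\<^bsub>G\<^esub> \<Phi> (turns p r n)" for m n
  proof -
    have "\<Phi> (E \<circ> linepath 0 (of_int (m + n))) = \<Phi> (E \<circ> (linepath 0 (of_int m) +++ linepath (of_int m) (of_int m + of_int n)))"
      by (rule R.convex[of UNIV]) auto
    also have "\<dots> = \<Phi> (E \<circ> linepath 0 (of_int m)) \<otimes>\<^bsub>G\<^esub> \<Phi> (E \<circ> linepath (of_int m) (of_int m + of_int n))"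
      by (rule R.join) auto
    finally show ?thesis using seg[of 0 "m + n"] seg[of 0 m] seg[of m n] by simp
  qed
  have cl: "\<Phi> (turns p r m) \<in> carrier G" for m
    using path_in_turns[OF assms(2), of p m] assms(3) by (intro closed) auto
  have zero: "\<Phi> (turns p r 0) = \<one>\<^bsub>G\<^esub>"
  proof -
    have "\<Phi> (turns p r 0) \<otimes>\<^bsub>G\<^esub> \<Phi> (turns p r 0) = \<Phi> (turns p r 0)" using add[of 0 0] by simp
    with cl[of 0] show ?thesis by (metis r_cancel_one)
  qed
  have nat: "\<Phi> (turns p r (int k)) = \<Phi> (turns p r 1) [^]\<^bsub>G\<^esub> k" for k
  proof (induction k)
    case (Suc k)
    have "int (Suc k) = int k + 1" by simp
    then show ?case using add[of "int k" 1] Suc by (simp only: nat_pow_Suc)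
  qed (use zero in simp)
  show ?thesis
  proof (cases "n \<ge> 0")
    case True
    then show ?thesis using nat[of "nat n"] by (simp add: int_pow_int[symmetric])
  next
    case False
    define k where "k = nat (- n)"
    have k: "n = - int k" using False by (simp add: k_def)
    have "\<Phi> (turns p r n) \<otimes>\<^bsub>G\<^esub> \<Phi> (turns p r (int k)) = \<one>\<^bsub>G\<^esub>" using add[of n "int k"] zero k by simp
    then have "\<Phi> (turns p r n) = inv\<^bsub>G\<^esub> (\<Phi> (turns p r (int k)))" using cl by (simp add: inv_equality)
    then show ?thesis using nat[of k] cl k by (simp add: int_pow_neg_int)
  qed
qed

lemma winding_number_turns: "r > 0 \<Longrightarrow> winding_number (turns p r n) p = of_int n"
proof -
  assume r: "r > 0"
  interpret path_functor add_group "- {p}" "\<lambda>q. winding_number q p"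
    by (rule path_functor_winding) simp
  have "winding_number (turns p r n) p = winding_number (turns p r 1) p [^]\<^bsub>add_group\<^esub> n"
    by (rule path_functor_turns[OF path_functor_axioms' r]) (use r in auto)
  moreover have "(a::complex) [^]\<^bsub>add_group\<^esub> (k::nat) = of_nat k * a" for a k
    by (induction k) (simp_all add: algebra_simps)
  then have "(a::complex) [^]\<^bsub>add_group\<^esub> n = of_int n * a" for a
    by (cases n rule: int_cases2) (simp_all add: int_pow_neg_int int_pow_int)
  ultimately show ?thesis using r by (simp add: turns_1 winding_number_circlepath_centre)
qed

text \<open>The winding number classifies loops in the plane without \<open>p\<close>, but the
  homotopy may leave \<Omega>. The radial retraction \<open>R\<close> onto the circle brings it
  back; \<open>q\<close> and \<open>R \<circ> q\<close> are joined by segments along rays from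
  \<open>p\<close>, which stay in the convex \<Omega>.\<close>

lemma loop_homotopic_turns:
  assumes \<Omega>: "convex \<Omega>" "cball p r \<subseteq> \<Omega>" "r > 0" and q: "q \<in> loops (\<Omega> - {p}) (p + r)"
  obtains n where "homotopic_paths (\<Omega> - {p}) q (turns p r n)"
proof -
  have qp: "path_in (\<Omega> - {p}) q" "pathstart q = p + r" "pathfinish q = p + r"
    using q by (auto simp: loops_iff)
  then have np: "p \<notin> path_image q" by auto
  obtain n where n: "winding_number q p = of_int n"
    using integer_winding_number[of q p] qp np by (auto elim: Ints_cases)
  define R where "R z = p + of_real r * ((z - p) / of_real (norm (z - p)))" for z
  have Rc: "continuous_on (- {p}) R" unfolding R_def by (intro continuous_intros) auto
  have Rs: "R ` (- {p}) \<subseteq> sphere p r"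
  proof (rule image_subsetI)
    fix z assume "z \<in> - {p}"
    then have "norm (z - p) \<noteq> 0" by simp
    then show "R z \<in> sphere p r" using \<Omega>(3) by (simp add: R_def dist_norm norm_mult norm_divide)
  qed
  have sph: "sphere p r \<subseteq> \<Omega> - {p}" using \<Omega> sphere_cball by fastforce
  have Rid: "R z = z" if "z \<in> sphere p r" for z
    using that \<Omega>(3) by (auto simp: R_def dist_norm norm_minus_commute)
  have tp: "path (turns p r n)" "path_image (turns p r n) \<subseteq> sphere p r"
    using path_in_turns[OF \<Omega>(3), of p n] by auto
  have "homotopic_paths (- {p}) q (turns p r n)"
    by (subst winding_number_homotopic_paths_eq[symmetric])
      (use qp np tp sph turns_ends winding_number_turns[OF \<Omega>(3)] n in auto)
  then have "homotopic_paths (\<Omega> - {p}) (R \<circ> q) (R \<circ> turns p r n)"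
    by (rule homotopic_paths_continuous_image[OF _ Rc]) (use Rs sph in auto)
  moreover have "homotopic_paths (\<Omega> - {p}) (R \<circ> turns p r n) (turns p r n)"
  proof (rule homotopic_paths_sym, rule homotopic_paths_eq)
    show "path (turns p r n)" "path_image (turns p r n) \<subseteq> \<Omega> - {p}" using tp sph by auto
    fix t :: real assume "t \<in> {0..1}"
    then have "turns p r n t \<in> sphere p r" using tp(2) unfolding path_image_def by blast
    then show "turns p r n t = (R \<circ> turns p r n) t" using Rid by simp
  qed
  moreover have "homotopic_paths (\<Omega> - {p}) q (R \<circ> q)"
  proof (rule homotopic_paths_linear)
    show "path q" using qp by simp
    show "path (R \<circ> q)"
      by (rule path_continuous_image) (use qp np Rc in \<open>auto intro: continuous_on_subset\<close>)
    have "R (p + r) = p + r" by (rule Rid) (use \<Omega>(3) in \<open>simp add: dist_norm\<close>)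
    then show "pathstart (R \<circ> q) = pathstart q" "pathfinish (R \<circ> q) = pathfinish q"
      using qp by (simp_all add: pathstart_compose pathfinish_compose)
    fix t :: real assume "t \<in> {0..1}"
    then have "q t \<in> \<Omega> - {p}" using qp(1) unfolding path_image_def by blast
    then have z: "q t \<in> \<Omega>" "q t \<noteq> p" by auto
    have "R (q t) \<in> \<Omega>" using Rs sph z by blast
    then have "closed_segment (q t) (R (q t)) \<subseteq> \<Omega>" using z \<Omega>(1) by (simp add: closed_segment_subset)
    moreover have "p \<notin> closed_segment (q t) (R (q t))"
    proof
      assume "p \<in> closed_segment (q t) (R (q t))"
      then obtain u where u: "0 \<le> u" "u \<le> 1" "p = (1 - u) *\<^sub>R q t + u *\<^sub>R R (q t)"
        by (auto simp: closed_segment_def)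
      \<comment> \<open>On the segment from \<open>q t\<close> to \<open>R (q t)\<close> the vector
        from \<open>p\<close> is \<open>s\<close> times \<open>q t - p\<close>, and \<open>s\<close>
        is positive.\<close>
      define s where "s = (1 - u) + u * (r / norm (q t - p))"
      have "of_real s * (q t - p) = (1 - u) *\<^sub>R q t + u *\<^sub>R R (q t) - p"
        by (simp add: s_def R_def scaleR_conv_of_real algebra_simps divide_inverse)
      then have "s = 0" using u(3) z by simp
      moreover have "r / norm (q t - p) > 0" using \<Omega>(3) z by simp
      ultimately show False using u(1,2) unfolding s_def
        by (smt (verit) mult_nonneg_nonneg mult_pos_pos)
    qed
    ultimately show "closed_segment (q t) ((R \<circ> q) t) \<subseteq> \<Omega> - {p}" unfolding comp_apply by blast
  qed
  ultimately have "homotopic_paths (\<Omega> - {p}) q (turns p r n)" using homotopic_paths_trans by metis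
  then show ?thesis by (rule that)
qed

lemma path_connected_punctured:
  "open \<Omega> \<Longrightarrow> convex \<Omega> \<Longrightarrow> finite P \<Longrightarrow> path_connected (\<Omega> - P :: complex set)"
  by (rule path_connected_open_diff_countable) (auto simp: convex_connected countable_finite)

text \<open>Based on a small circle around \<open>p\<close>, every loop is a number of turns, which
  gives generation; winding numbers as exponents give arbitrary values. The base point is moved to
  \<open>x\<close> at the end.\<close>

lemma freely_generated_single:
  fixes \<Omega> :: "complex set"
  assumes \<Omega>: "open \<Omega>" "convex \<Omega>" "p \<in> \<Omega>" "x \<in> \<Omega> - {p}" "e > 0"
  shows "\<exists>c. freely_generated TYPE('k) TYPE('h) (\<Omega> - {p}) x {p} e c"
proof -
  let ?X = "\<Omega> - {p}"
  obtain d where d: "d > 0" "cball p d \<subseteq> \<Omega>" using \<Omega> open_contains_cball by blast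
  define r where "r = min d (e / 2)"
  have r: "r > 0" "r < e" "cball p r \<subseteq> \<Omega>" using d \<Omega>(5) by (auto simp: r_def)
  define y where "y = p + of_real r"
  have sph: "sphere p r \<subseteq> ?X" "sphere p r \<subseteq> ball p e" using r sphere_cball by fastforce+
  have yX: "y \<in> ?X" using r sph by (auto simp: y_def dist_norm)
  have pcX: "path_connected ?X" using path_connected_punctured[OF \<Omega>(1,2), of "{p}"] by simp
  let ?k = "turns p r 1"
  have k: "path_in (?X \<inter> ball p e) ?k" "pathstart ?k = y" "pathfinish ?k = y" "path_in ?X ?k"
    using path_in_turns[OF r(1), of p 1] sph turns_ends by (auto simp: y_def)
  define c where "c q = linepath y y +++ (?k +++ reversepath (linepath y y))" for q :: complex
  have val: "\<Phi> (c q) = \<Phi> ?k" if "path_functor G ?X \<Phi>" for q \<Phi> and G :: "'g monoid"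
  proof -
    interpret path_functor G ?X \<Phi> by fact
    have "\<Phi> (c q) = \<Phi> (linepath y y) \<otimes>\<^bsub>G\<^esub> \<Phi> ?k \<otimes>\<^bsub>G\<^esub> inv\<^bsub>G\<^esub> (\<Phi> (linepath y y))"
      unfolding c_def by (rule conjugate) (use k yX in auto)
    also have "\<Phi> (linepath y y) = \<one>\<^bsub>G\<^esub>" using const[OF yX] by (simp add: linepath_refl)
    finally show ?thesis using k closed by simp
  qed
  have "freely_generated TYPE('k) TYPE('h) ?X y {p} e c"
    unfolding freely_generated_def
  proof (intro conjI ballI)
    show "tethered ?X y (ball q e) (c q)" if "q \<in> {p}" for q
      unfolding tethered_def c_def
      by (rule exI[of _ "linepath y y"], rule exI[of _ ?k]) (use that k yX in auto)
    show "generates TYPE('k) ?X y (c ` {p})"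
      unfolding generates_def
    proof (intro allI impI image_subsetI)
      fix K :: "'k monoid" and \<Phi> J q
      assume f: "path_functor K ?X \<Phi>" and J: "subgroup J K" "\<Phi> ` (c ` {p}) \<subseteq> J" and q: "q \<in> loops ?X y"
      interpret path_functor K ?X \<Phi> by fact
      obtain n where n: "homotopic_paths ?X q (turns p r n)"
        by (rule loop_homotopic_turns[OF \<Omega>(2) r(3,1) q[unfolded y_def]])
      have "\<Phi> q = \<Phi> ?k [^]\<^bsub>K\<^esub> n"
        unfolding homotopic[OF n] by (rule path_functor_turns[OF f r(1) sph(1)])
      moreover have "\<Phi> ?k \<in> J" using J(2) val[OF f] by simp
      ultimately show "\<Phi> q \<in> J" using subgroup_int_pow_closed[OF J(1)] by simp
    qed
    show "prescribable TYPE('h) ?X {p} c"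
      unfolding prescribable_def
    proof (intro allI impI)
      fix H :: "'h monoid" and h assume "group H" and h: "h ` {p} \<subseteq> carrier H"
      interpret H: group H by fact
      have "\<exists>q. path_in ?X q \<and> pathstart q = y \<and> pathfinish q = u" if "u \<in> ?X" for u
        using pcX yX that unfolding path_connected_def by blast
      then obtain tr where tr: "\<And>u. u \<in> ?X \<Longrightarrow> path_in ?X (tr u) \<and> pathstart (tr u) = y \<and> pathfinish (tr u) = u"
        by metis
      interpret W: path_functor add_group ?X "\<lambda>q. winding_number q p"
        by (rule path_functor_winding) simp
      \<comment> \<open>Corrected by the tethers, the winding number becomes that of a closed path.
        It is then an integer on every path and can serve as an exponent.\<close>
      define w where "w q = winding_number (tr (pathstart q)) p + winding_number q p - winding_number (tr (pathfinish q)) p" for q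
      have Wf: "path_functor add_group ?X w"
        using W.gauge[of "\<lambda>u. winding_number (tr u) p"] unfolding w_def by simp
      interpret w: path_functor add_group ?X w by fact
      have int: "w q = of_int \<lfloor>Re (w q)\<rfloor>" if q: "path_in ?X q" for q
      proof -
        have e: "pathstart q \<in> ?X" "pathfinish q \<in> ?X" using q by auto
        let ?l = "tr (pathstart q) +++ (q +++ reversepath (tr (pathfinish q)))"
        have l: "path_in ?X (tr (pathstart q))" "path_in ?X (reversepath (tr (pathfinish q)))"
            "path_in ?X (q +++ reversepath (tr (pathfinish q)))"
          using q tr[OF e(1)] tr[OF e(2)] by (auto simp: path_image_join)
        have "winding_number ?l p = w q"
          unfolding w_def using W.join[OF l(1,3)] W.join[OF q l(2)] W.reverse[of "tr (pathfinish q)"] tr[OF e(1)] tr[OF e(2)]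
          by simp
        moreover have "winding_number ?l p \<in> \<int>"
          by (rule integer_winding_number) (use l tr[OF e(1)] tr[OF e(2)] q in \<open>auto simp: path_image_join\<close>)
        ultimately show ?thesis by (metis Ints_cases complex_Re_of_int floor_of_int)
      qed
      define \<Phi> where "\<Phi> q = h p [^]\<^bsub>H\<^esub> \<lfloor>Re (w q)\<rfloor>" for q
      have hp: "h p \<in> carrier H" using h by simp
      have \<Phi>f: "path_functor H ?X \<Phi>"
      proof
        fix q r assume *: "path_in ?X q" "path_in ?X r" "pathfinish q = pathstart r"
        have "w (q +++ r) = w q + w r" using w.join[OF *] by simp
        also have "\<dots> = of_int (\<lfloor>Re (w q)\<rfloor> + \<lfloor>Re (w r)\<rfloor>)" using int[OF *(1)] int[OF *(2)] by simp
        finally have "\<lfloor>Re (w (q +++ r))\<rfloor> = \<lfloor>Re (w q)\<rfloor> + \<lfloor>Re (w r)\<rfloor>" by (metis complex_Re_of_int floor_of_int)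
        then show "\<Phi> (q +++ r) = \<Phi> q \<otimes>\<^bsub>H\<^esub> \<Phi> r" using hp by (simp add: \<Phi>_def H.int_pow_mult)
      next
        fix q r assume "homotopic_paths ?X q r"
        then show "\<Phi> q = \<Phi> r" unfolding \<Phi>_def by (simp only: w.homotopic)
      qed (use hp in \<open>auto simp: \<Phi>_def\<close>)
      have "w ?k = 1" using k winding_number_turns[OF r(1), of p 1] by (simp add: w_def)
      then have "\<Phi> (c p) = h p" using val[OF \<Phi>f, of p] hp by (simp add: \<Phi>_def)
      with \<Phi>f show "\<exists>\<Phi>. path_functor H ?X \<Phi> \<and> (\<forall>i\<in>{p}. \<Phi> (c i) = h i)" by blast
    qed
  qed
  moreover obtain b where "path_in ?X b" "pathstart b = x" "pathfinish b = y"
    using pcX yX \<Omega>(4) unfolding path_connected_def by blast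
  ultimately show ?thesis using freely_generated_change_base by blast
qed

text \<open>Two half-plane pieces of \<Omega> overlap in a strip without punctures. The overlap is
  convex, as the gluing of prescribed values demands, and each piece has fewer punctures.\<close>

theorem freely_generated_punctured:
  fixes \<Omega> :: "complex set"
  assumes "finite P" "open \<Omega>" "convex \<Omega>" "P \<subseteq> \<Omega>" "x \<in> \<Omega> - P" "e > 0"
  shows "\<exists>c. freely_generated TYPE('k) TYPE('h) (\<Omega> - P) x P e c"
  using assms
proof (induction P arbitrary: \<Omega> x rule: finite_psubset_induct)
  case (psubset P)
  show ?case
  proof (cases "P = {} \<or> (\<exists>p. P = {p})")
    case True
    then show ?thesis
    proof
      assume "P = {}"
      show ?thesis unfolding \<open>P = {}\<close> Diff_empty
        by (rule exI, rule freely_generated_empty[OF psubset.prems(2)])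
    next
      assume "\<exists>p. P = {p}"
      then obtain p where "P = {p}" ..
      then show ?thesis using freely_generated_single[of \<Omega> p x e] psubset.prems by simp
    qed
  next
    case False
    then obtain p q where pq: "p \<in> P" "q \<in> P" "p \<noteq> q" by blast
    \<comment> \<open>Measuring along \<open>q - p\<close> separates \<open>p\<close> from
      \<open>q\<close> in whatever direction they lie.\<close>
    define f where "f z = (q - p) \<bullet> z" for z
    have fpq: "f p < f q"
    proof -
      have "f q - f p = (q - p) \<bullet> (q - p)" by (simp add: f_def inner_diff_right)
      also have "\<dots> > 0" using pq(3) by simp
      finally show ?thesis by simp
    qed
    define m where "m = Min (f ` {z \<in> P. f p < f z})"
    have fin: "finite {z \<in> P. f p < f z}" using psubset.hyps by simp
    have ne: "{z \<in> P. f p < f z} \<noteq> {}" using pq fpq by blast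
    have m: "f p < m" "\<And>z. z \<in> P \<Longrightarrow> f z \<le> f p \<or> m \<le> f z" "m \<le> f q"
    proof -
      show "f p < m" unfolding m_def using fin ne by (subst Min_gr_iff) auto
      have *: "m \<le> f z" if "z \<in> P" "f p < f z" for z
        unfolding m_def using fin that by (intro Min_le) auto
      then show "f z \<le> f p \<or> m \<le> f z" if "z \<in> P" for z using that by (meson not_le)
      show "m \<le> f q" by (rule *[OF pq(2) fpq])
    qed
    \<comment> \<open>\<open>m\<close> is the smallest value of \<open>f\<close> on punctures above
      \<open>f p\<close>, so no puncture has a value strictly between. The strip is the middle third
      of this gap.\<close>
    define a b where "a = f p + (m - f p) / 3" and "b = f p + 2 * (m - f p) / 3"
    have ab: "f p < a" "a < b" "b < m" using m(1) by (auto simp: a_def b_def field_simps)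
    define \<Omega>A \<Omega>B where "\<Omega>A = \<Omega> \<inter> {z. f z < b}" and "\<Omega>B = \<Omega> \<inter> {z. f z > a}"
    define A B where "A = {z \<in> P. f z \<le> f p}" and "B = {z \<in> P. m \<le> f z}"
    have op: "open \<Omega>A" "open \<Omega>B" "convex \<Omega>A" "convex \<Omega>B"
      unfolding \<Omega>A_def \<Omega>B_def f_def using psubset.prems
      by (auto intro!: open_Int convex_Int open_halfspace_lt open_halfspace_gt convex_halfspace_lt convex_halfspace_gt)
    have AB: "P = A \<union> B" "A \<inter> B = {}" "A \<subset> P" "B \<subset> P"
      using m ab pq fpq unfolding A_def B_def by (force+)
    have sub: "A \<subseteq> \<Omega>A" "B \<subseteq> \<Omega>B" using psubset.prems ab AB unfolding A_def B_def \<Omega>A_def \<Omega>B_def by force+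
    have cap: "(\<Omega>A - A) \<inter> (\<Omega>B - B) = \<Omega>A \<inter> \<Omega>B"
      using ab unfolding A_def B_def \<Omega>A_def \<Omega>B_def by force
    have cup: "(\<Omega>A - A) \<union> (\<Omega>B - B) = \<Omega> - P"
      using ab AB(1) unfolding A_def B_def \<Omega>A_def \<Omega>B_def by force
    obtain y where y: "y \<in> \<Omega>A \<inter> \<Omega>B"
    proof -
      define t where "t = ((a + b) / 2 - f p) / (f q - f p)"
      have t: "0 \<le> t" "t \<le> 1" using ab m fpq by (auto simp: t_def divide_simps)
      define z where "z = (1 - t) *\<^sub>R p + t *\<^sub>R q"
      have "z \<in> \<Omega>" unfolding z_def using psubset.prems(2,3) pq t by (auto intro!: convexD)
      moreover have "f z = f p + t * (f q - f p)" by (simp add: z_def f_def inner_add_right algebra_simps)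
      then have "f z = (a + b) / 2" using fpq by (simp add: t_def)
      then have "f z < b" "a < f z" using ab by (simp_all add: field_simps)
      ultimately show ?thesis using that[of z] by (simp add: \<Omega>A_def \<Omega>B_def)
    qed
    have fins: "finite A" "finite B" using psubset.hyps AB by (auto simp: finite_subset)
    obtain cA where cA: "freely_generated TYPE('k) TYPE('h) (\<Omega>A - A) y A e cA"
      using psubset.IH[OF AB(3) op(1,3) sub(1) _ psubset.prems(5)] y cap by blast
    obtain cB where cB: "freely_generated TYPE('k) TYPE('h) (\<Omega>B - B) y B e cB"
      using psubset.IH[OF AB(4) op(2,4) sub(2) _ psubset.prems(5)] y cap by blast
    define c where "c i = (if i \<in> A then cA i else cB i)" for i
    have opAB: "open (\<Omega>A - A)" "open (\<Omega>B - B)"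
      using op fins by (auto intro: open_Diff finite_imp_closed)
    have cvx: "convex ((\<Omega>A - A) \<inter> (\<Omega>B - B))" unfolding cap using op by (intro convex_Int)
    have yAB: "y \<in> (\<Omega>A - A) \<inter> (\<Omega>B - B)" using y cap by blast
    have cimg: "c ` P = cA ` A \<union> cB ` B"
      using AB(1,2) unfolding c_def by (auto simp: image_iff)
    have 1: "generates TYPE('k) (\<Omega> - P) y (c ` P)"
      unfolding cimg cup[symmetric]
      by (rule generates_union[OF opAB _ _ _ yAB])
        (use cA cB path_connected_punctured[OF op(1,3) fins(1)] path_connected_punctured[OF op(2,4) fins(2)] convex_imp_path_connected[OF cvx]
          in \<open>auto simp: freely_generated_def\<close>)
    have tA: "tethered (\<Omega>A - A) y (ball i e) (cA i)" if "i \<in> A" for i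
      using cA that by (simp add: freely_generated_def)
    have tB: "tethered (\<Omega>B - B) y (ball i e) (cB i)" if "i \<in> B" for i
      using cB that by (simp add: freely_generated_def)
    have 2: "prescribable TYPE('h) (\<Omega> - P) P c"
      unfolding AB(1) c_def
      using prescribable_union[OF opAB cvx yAB, where I = A and I' = B and c = cA and c' = cB and 'h = 'h]
        cA cB tethered_loop[OF tA] tethered_loop[OF tB] AB(2) cup[unfolded AB(1)]
      by (auto simp: freely_generated_def)
    have 3: "tethered (\<Omega> - P) y (ball i e) (c i)" if "i \<in> P" for i
    proof (cases "i \<in> A")
      case True
      then show ?thesis using tethered_mono[OF tA] cup by (auto simp: c_def)
    next
      case False
      then have "i \<in> B" using that AB(1) by blast
      then show ?thesis using False tethered_mono[OF tB] cup by (auto simp: c_def)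
    qed
    have "freely_generated TYPE('k) TYPE('h) (\<Omega> - P) y P e c"
      using 1 2 3 by (simp add: freely_generated_def)
    moreover have "path_connected (\<Omega> - P)"
      using path_connected_punctured psubset.prems psubset.hyps by blast
    then obtain b where "path_in (\<Omega> - P) b" "pathstart b = x" "pathfinish b = y"
      using yAB cup psubset.prems(4) unfolding path_connected_def by (metis UnI1 IntD1)
    ultimately show ?thesis using freely_generated_change_base by blast
  qed
qed

subsection \<open>Complements of complex lines\<close>

definition line_complement :: "(complex \<times> complex \<times> complex) set \<Rightarrow> (complex \<times> complex) set" where
  "line_complement F = {v. \<forall>(a, b, c)\<in>F. a * fst v + b * snd v \<noteq> c}"

definition proper_lines :: "(complex \<times> complex \<times> complex) set \<Rightarrow> bool" where
  "proper_lines F \<longleftrightarrow> finite F \<and> (\<forall>(a, b, c)\<in>F. (a, b) \<noteq> (0, 0))"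

lemma open_line_complement: "finite F \<Longrightarrow> open (line_complement F)"
proof -
  assume F: "finite F"
  have "line_complement F = (\<Inter>f\<in>F. {v. fst f * fst v + fst (snd f) * snd v \<noteq> snd (snd f)})"
    by (auto simp: line_complement_def case_prod_beta)
  also have "open \<dots>"
    by (intro open_INT F ballI open_Collect_neq continuous_intros)
  finally show ?thesis .
qed

lemma line_complement_dense:
  assumes "proper_lines F" "open W" "W \<noteq> {}"
  shows "W \<inter> line_complement F \<noteq> {}"
proof -
  have "finite F" using assms by (simp add: proper_lines_def)
  then show ?thesis using assms
  proof (induction F arbitrary: W rule: finite_induct)
    case empty
    then show ?case by (auto simp: line_complement_def)
  next
    case (insert f F)
    obtain a b c where f: "f = (a, b, c)" by (cases f)
    have nz: "(a, b) \<noteq> (0, 0)" using insert.prems(1) by (auto simp: proper_lines_def f)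
    have "proper_lines F" using insert.prems(1) by (simp add: proper_lines_def)
    from insert.IH[OF this insert.prems(2,3)] obtain w where w: "w \<in> W \<inter> line_complement F" by blast
    have "open (W \<inter> line_complement F)"
      using insert.prems insert.hyps by (intro open_Int open_line_complement)
    then obtain d where d: "d > 0" "ball w d \<subseteq> W \<inter> line_complement F"
      using w open_contains_ball by blast
    show ?case
    proof (cases "a * fst w + b * snd w = c")
      case False
      with w show ?thesis by (auto simp: line_complement_def f)
    next
      case True
      \<comment> \<open>A step along \<open>(cnj a, cnj b)\<close> changes \<open>a x + b y\<close>
        by a positive multiple of |a|^2 + |b|^2, hence leaves the line. The step has half the length
        \<open>d\<close>.\<close>
      define n where "n = norm (cnj a, cnj b)"
      have n: "n > 0" using nz by (auto simp: n_def zero_prod_def)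
      define e where "e = d / (2 * n)"
      have e: "e > 0" using d n by (simp add: e_def)
      define w' where "w' = w + e *\<^sub>R (cnj a, cnj b)"
      have "norm (e *\<^sub>R (cnj a, cnj b)) = e * n" using e norm_scaleR[of e "(cnj a, cnj b)"] by (simp only: n_def abs_of_pos)
      also have "\<dots> < d" using n d by (simp add: e_def)
      finally have "w' \<in> ball w d" unfolding w'_def mem_ball dist_commute[of w] by (simp add: dist_norm)
      moreover have "a * fst w' + b * snd w' = c + e *\<^sub>R (a * cnj a + b * cnj b)"
        using True by (simp add: w'_def algebra_simps scaleR_conv_of_real)
      then have "a * fst w' + b * snd w' = c + of_real (e * ((cmod a)\<^sup>2 + (cmod b)\<^sup>2))"
        by (simp add: complex_norm_square[symmetric] scaleR_conv_of_real)
      moreover have "complex_of_real (e * ((cmod a)\<^sup>2 + (cmod b)\<^sup>2)) \<noteq> 0"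
        using e nz unfolding of_real_eq_0_iff by (auto simp: sum_power2_eq_zero_iff)
      ultimately have "w' \<in> W \<inter> line_complement F" "a * fst w' + b * snd w' \<noteq> c"
        using d(2) by auto
      then have "w' \<in> W \<inter> line_complement (insert f F)" by (simp add: line_complement_def f)
      then show ?thesis by blast
    qed
  qed
qed

text \<open>The complex line through \<open>u\<close> and \<open>v\<close> meets each line of the
  arrangement in at most one point, since \<open>u\<close> avoids them all. What remains is a convex
  open subset of the plane without finitely many points.\<close>

lemma path_connected_diff_lines:
  assumes F: "proper_lines F" and \<Omega>: "open \<Omega>" "convex \<Omega>"
  shows "path_connected (\<Omega> \<inter> line_complement F)"
  unfolding path_connected_def
proof (intro ballI)
  fix u v assume u: "u \<in> \<Omega> \<inter> line_complement F" and v: "v \<in> \<Omega> \<inter> line_complement F"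
  define g where "g t = (fst u + t * (fst v - fst u), snd u + t * (snd v - snd u))" for t :: complex
  have gc: "continuous_on UNIV g" unfolding g_def by (intro continuous_intros)
  define T where "T = g -` \<Omega>"
  have T: "open T" using open_vimage[OF \<Omega>(1) gc] by (simp add: T_def)
  have "g ((1 - s) *\<^sub>R a + s *\<^sub>R b) = (1 - s) *\<^sub>R g a + s *\<^sub>R g b" for a b s
    by (simp add: g_def scaleR_conv_of_real algebra_simps)
  then have cT: "convex T" using \<Omega>(2) by (auto simp: T_def convex_alt)
  define N where "N = (\<Union>(a, b, c)\<in>F. {t. a * fst (g t) + b * snd (g t) = c})"
  have "finite {t. a * fst (g t) + b * snd (g t) = c}" if f: "(a, b, c) \<in> F" for a b c
  proof -
    define A B where "A = a * fst u + b * snd u - c" and "B = a * (fst v - fst u) + b * (snd v - snd u)"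
    have A: "A \<noteq> 0" using u f by (auto simp: A_def line_complement_def)
    have "{t. a * fst (g t) + b * snd (g t) = c} = {t. A + t * B = 0}"
      by (auto simp: g_def A_def B_def algebra_simps)
    also have "\<dots> \<subseteq> {- A / B}"
    proof clarify
      fix t assume t: "A + t * B = 0"
      have "B \<noteq> 0" "t * B = - A" using t A by (auto simp: eq_neg_iff_add_eq_0 add.commute)
      then show "t = - A / B" by (metis nonzero_mult_div_cancel_right)
    qed
    finally show ?thesis using finite_subset by blast
  qed
  then have N: "finite N" using F by (auto simp: N_def proper_lines_def)
  have "path_connected (T - N)"
    by (rule path_connected_open_diff_countable) (use T cT N in \<open>auto simp: convex_connected countable_finite\<close>)
  moreover have "g 0 = u" "g 1 = v" by (auto simp: g_def)
  then have "0 \<in> T - N" "1 \<in> T - N" using u v by (auto simp: T_def N_def line_complement_def)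
  ultimately obtain p where p: "path_in (T - N) p" "pathstart p = 0" "pathfinish p = 1"
    unfolding path_connected_def by blast
  have "g ` (T - N) \<subseteq> \<Omega> \<inter> line_complement F"
    by (auto simp: T_def N_def line_complement_def)
  with p(1) have "path_in (\<Omega> \<inter> line_complement F) (g \<circ> p)"
    by (intro path_in_compose[OF p(1)]) (auto intro: continuous_on_subset[OF gc])
  then show "\<exists>q. path q \<and> path_image q \<subseteq> \<Omega> \<inter> line_complement F \<and> pathstart q = u \<and> pathfinish q = v"
    using p \<open>g 0 = u\<close> \<open>g 1 = v\<close> by (intro exI[of _ "g \<circ> p"]) (simp add: pathstart_compose pathfinish_compose)
qed

lemma line_complement_Un: "line_complement (F \<union> F') = line_complement F \<inter> line_complement F'"
  by (simp add: line_complement_def ball_Un Collect_conj_eq)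

lemma proper_lines_Un: "proper_lines (F \<union> F') \<longleftrightarrow> proper_lines F \<and> proper_lines F'"
  by (auto simp: proper_lines_def)

text \<open>Lines have real codimension 2, so a loop can be pushed off further lines. Only its value
  is tracked, by carrying a path that avoids the new lines and ends close to
  \<open>q t\<close>.\<close>

lemma loop_avoiding_more_lines:
  assumes \<Phi>: "path_functor G (line_complement F) \<Phi>"
    and F: "proper_lines F" "proper_lines F'"
    and x: "x \<in> line_complement (F \<union> F')" and q: "q \<in> loops (line_complement F) x"
  shows "\<exists>q'\<in>loops (line_complement (F \<union> F')) x. \<Phi> q' = \<Phi> q"
proof -
  let ?U = "line_complement F" and ?V = "line_complement (F \<union> F')"
  interpret path_functor G ?U \<Phi> by fact
  have FF: "proper_lines (F \<union> F')" using F by (simp add: proper_lines_Un)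
  have VU: "?V \<subseteq> ?U" by (simp add: line_complement_Un)
  have qp: "path_in ?U q" "q 0 = x" "q 1 = x" using q by (auto simp: loops_iff pathstart_def pathfinish_def)
  have qU: "q t \<in> ?U" if "t \<in> {0..1}" for t using qp(1) that unfolding path_image_def by blast
  have oU: "open ?U" "open ?V" using F FF by (auto intro!: open_line_complement simp: proper_lines_def)
  have xU: "x \<in> ?U" using x VU by blast
  \<comment> \<open>\<open>q t\<close> may lie on a new line, so the replacement ends at a nearby
    \<open>v\<close>, and the segment from \<open>v\<close> to \<open>q t\<close> accounts for the
    difference. Once the ball lies in the complement, this segment has a meaningful value.\<close>
  define Q where "Q t \<longleftrightarrow> (\<forall>e>0. \<exists>v r. v \<in> ball (q t) e \<and> (ball (q t) e \<subseteq> ?U \<longrightarrow>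
      path_in ?V r \<and> pathstart r = x \<and> pathfinish r = v \<and>
      \<Phi> (Path_Connected.subpath 0 t q) = \<Phi> r \<otimes>\<^bsub>G\<^esub> \<Phi> (linepath v (q t))))" for t
  have "Q 1"
  proof (rule unit_interval_induct)
    have "Path_Connected.subpath 0 0 q = (\<lambda>_. x)" using qp by (auto simp: subpath_def)
    then show "Q 0" unfolding Q_def using const[OF xU] qp(2) x
      by (intro allI impI exI[of _ x] exI[of _ "\<lambda>_. x"])
        (auto simp: linepath_refl path_in_const path_def path_image_def pathstart_def pathfinish_def)
  next
    fix t :: real assume t: "t \<in> {0..1}"
    obtain d where d: "d > 0" "ball (q t) d \<subseteq> ?U" using qU[OF t] oU(1) open_contains_ball by blast
    let ?B = "ball (q t) d"
    have "continuous_on {0..1} q" using qp by (simp add: path_def)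
    with t d(1) obtain e where e: "e > 0" "\<And>s. s \<in> {0..1} \<Longrightarrow> dist s t < e \<Longrightarrow> dist (q s) (q t) < d"
      unfolding continuous_on_iff by metis
    have inB: "q s \<in> ?B" if "s \<in> {0..1}" "\<bar>s - t\<bar> < e" for s
      using e(2)[of s] that by (auto simp: dist_real_def dist_commute)
    have "Q s'" if s: "s \<in> {0..1}" "s' \<in> {0..1}" "\<bar>s - t\<bar> < e" "\<bar>s' - t\<bar> < e" and Qs: "Q s" for s s'
      unfolding Q_def
    proof (intro allI impI)
      fix e' :: real assume e': "e' > 0"
      have B: "q s \<in> ?B" "q s' \<in> ?B" using inB s by auto
      obtain d' where d': "d' > 0" "ball (q s) d' \<subseteq> ?B" using B(1) openE[OF open_ball] by metis
      obtain v r where vr: "v \<in> ball (q s) d'" "path_in ?V r" "pathstart r = x" "pathfinish r = v"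
          "\<Phi> (Path_Connected.subpath 0 s q) = \<Phi> r \<otimes>\<^bsub>G\<^esub> \<Phi> (linepath v (q s))"
        using Qs d' d(2) unfolding Q_def by (meson order_trans)
      have "q s' \<in> ball (q s') e' \<inter> ?B" using B e' by simp
      then obtain v' where v': "v' \<in> ball (q s') e' \<inter> ?B" "v' \<in> ?V"
        using line_complement_dense[OF FF, of "ball (q s') e' \<inter> ?B"] by blast
      have vB: "v \<in> ?B" "v' \<in> ?B" using vr d' v' by blast+
      have vV: "v \<in> ?V" using vr by (metis pathfinish_in_path_image subsetD)
      have "path_connected (?B \<inter> ?V)" by (rule path_connected_diff_lines[OF FF]) auto
      then obtain m where m: "path_in (?B \<inter> ?V) m" "pathstart m = v" "pathfinish m = v'"
        using vB vV v' unfolding path_connected_def by blast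
      have mU: "path_in ?V m" "path_in ?B m" "path_in ?U m" "path_in ?U r" using m VU vr by auto
      have lB: "path_in ?B (linepath a b)" "path_in ?U (linepath a b)" if "a \<in> ?B" "b \<in> ?B" for a b
        using path_in_linepath[OF convex_ball that] d(2) by auto
      let ?c = "Path_Connected.subpath s s' q"
      have cB: "path_in ?B ?c"
      proof -
        have "q ` closed_segment s s' \<subseteq> ?B"
        proof (rule image_subsetI)
          fix v assume "v \<in> closed_segment s s'"
          then have "v \<in> {0..1}" "\<bar>v - t\<bar> < e" using s by (auto simp: closed_segment_eq_real_ivl split: if_splits)
          then show "q v \<in> ?B" by (rule inB)
        qed
        then show ?thesis using s qp by (auto simp: path_image_subpath_gen)
      qed
      have cU: "path_in ?U ?c" using cB d(2) by blast
      have cs: "pathstart ?c = q s" "pathfinish ?c = q s'" by auto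
      have "\<Phi> (linepath v (q s) +++ ?c) = \<Phi> (m +++ linepath v' (q s'))"
        by (rule convex[OF convex_ball d(2)])
          (use path_in_join[OF lB(1)[OF vB(1) B(1)] cB] path_in_join[OF mU(2) lB(1)[OF vB(2) B(2)]] cs m in auto)
      then have 1: "\<Phi> (linepath v (q s)) \<otimes>\<^bsub>G\<^esub> \<Phi> ?c = \<Phi> m \<otimes>\<^bsub>G\<^esub> \<Phi> (linepath v' (q s'))"
        using join[OF lB(2)[OF vB(1) B(1)] cU] join[OF mU(3) lB(2)[OF vB(2) B(2)]] cs m by simp
      have cl: "\<Phi> r \<in> carrier G" "\<Phi> (linepath v (q s)) \<in> carrier G" "\<Phi> ?c \<in> carrier G" "\<Phi> m \<in> carrier G"
          "\<Phi> (linepath v' (q s')) \<in> carrier G"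
        using closed mU cU lB(2) vB B by auto
      have "\<Phi> (Path_Connected.subpath 0 s' q) = \<Phi> r \<otimes>\<^bsub>G\<^esub> (\<Phi> (linepath v (q s)) \<otimes>\<^bsub>G\<^esub> \<Phi> ?c)"
        using subpath[OF qp(1), of 0 s s', symmetric] s vr(5) cl by (simp add: m_assoc)
      also have "\<dots> = \<Phi> (r +++ m) \<otimes>\<^bsub>G\<^esub> \<Phi> (linepath v' (q s'))"
        unfolding 1 using join[OF mU(4,3)] m vr cl by (simp add: m_assoc)
      finally show "\<exists>v r. v \<in> ball (q s') e' \<and> (ball (q s') e' \<subseteq> ?U \<longrightarrow>
          path_in ?V r \<and> pathstart r = x \<and> pathfinish r = v \<and>
          \<Phi> (Path_Connected.subpath 0 s' q) = \<Phi> r \<otimes>\<^bsub>G\<^esub> \<Phi> (linepath v (q s')))"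
        using v' path_in_join[OF vr(2) mU(1)] m vr
        by (intro exI[of _ v'] exI[of _ "r +++ m"]) auto
    qed
    with e(1) show "\<exists>e>0. \<forall>s\<in>{0..1}. \<forall>s'\<in>{0..1}. \<bar>s - t\<bar> < e \<longrightarrow> \<bar>s' - t\<bar> < e \<longrightarrow> Q s \<longrightarrow> Q s'"
      by blast
  qed
  moreover obtain e where e: "e > 0" "ball x e \<subseteq> ?V" using oU(2) x open_contains_ball by blast
  ultimately obtain v r where vr: "v \<in> ball x e" "path_in ?V r" "pathstart r = x" "pathfinish r = v"
      "\<Phi> (Path_Connected.subpath 0 1 q) = \<Phi> r \<otimes>\<^bsub>G\<^esub> \<Phi> (linepath v x)"
    using VU unfolding Q_def qp(3) by (meson order_trans)
  have l: "path_in ?V (linepath v x)" using path_in_linepath[OF convex_ball vr(1), of x] e by auto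
  have "r +++ linepath v x \<in> loops ?V x" using l vr by (simp add: loops_iff path_image_join)
  moreover have "\<Phi> (r +++ linepath v x) = \<Phi> q"
    using vr l VU by (subst join) auto
  ultimately show ?thesis by blast
qed

subsection \<open>Fibrations by punctured lines\<close>

lemma subpath_compose: "f \<circ> Path_Connected.subpath u v p = Path_Connected.subpath u v (f \<circ> p)"
  by (auto simp: subpath_def)

definition bump :: "real \<Rightarrow> real \<Rightarrow> real" where
  "bump d r = max 0 (min 1 (2 - 2 * r / d))"

lemma bump: "0 \<le> bump d r" "bump d r \<le> 1" "d > 0 \<Longrightarrow> r \<ge> d \<Longrightarrow> bump d r = 0"
    "d > 0 \<Longrightarrow> r \<le> d / 2 \<Longrightarrow> bump d r = 1"
  by (auto simp: bump_def divide_simps)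

text \<open>Moving the punctures \<open>c i\<close> to nearby points \<open>w i\<close> extends to a map of the plane that is the
  identity outside the discs of radius \<open>d\<close> around the \<open>c i\<close>.\<close>

definition push :: "'i set \<Rightarrow> real \<Rightarrow> ('i \<Rightarrow> complex) \<Rightarrow> ('i \<Rightarrow> complex) \<Rightarrow> complex \<Rightarrow> complex" where
  "push I d c w x = x + (\<Sum>i\<in>I. of_real (bump d (norm (x - c i))) * (w i - c i))"

lemma push_outside: "push I d c w x = x" if "d > 0" "\<And>i. i \<in> I \<Longrightarrow> norm (x - c i) \<ge> d"
  using that by (simp add: push_def bump(3))

lemma push_id: "push I d c c x = x"
  by (simp add: push_def)

text \<open>The discs are disjoint, so at most one bump acts on \<open>x\<close>. Within half the
  radius the map translates \<open>c i\<close> to \<open>w i\<close>; farther out, hitting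
  \<open>w i\<close> would force \<open>x - c i\<close> to be no longer than
  \<open>w i - c i\<close>, which is shorter than \<open>d / 2\<close>.\<close>

lemma push_avoids:
  assumes "finite I" "d > 0" and sep: "\<And>i j. i \<in> I \<Longrightarrow> j \<in> I \<Longrightarrow> i \<noteq> j \<Longrightarrow> norm (c i - c j) \<ge> 3 * d"
    and w: "\<And>i. i \<in> I \<Longrightarrow> norm (w i - c i) < d / 2"
    and x: "x \<notin> c ` I" and j: "j \<in> I"
  shows "push I d c w x \<noteq> w j"
proof (cases "\<exists>i\<in>I. norm (x - c i) < d")
  case False
  then have "push I d c w x = x" by (intro push_outside assms(2)) (auto simp: not_less)
  moreover have "norm (x - c j) \<ge> d" using False j by (auto simp: not_less)
  ultimately show ?thesis using w[OF j] assms(2) by auto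
next
  case True
  then obtain i where i: "i \<in> I" "norm (x - c i) < d" by blast
  have far: "norm (x - c k) \<ge> 2 * d" if "k \<in> I" "k \<noteq> i" for k
    using sep[OF i(1) that(1)] that(2) i(2) norm_triangle_ineq[of "c i - x" "x - c k"]
    by (simp add: norm_minus_commute)
  define b where "b = bump d (norm (x - c i))"
  have b: "0 \<le> b" "b \<le> 1" using bump by (auto simp: b_def)
  have "(\<Sum>k\<in>I. of_real (bump d (norm (x - c k))) * (w k - c k)) = of_real b * (w i - c i)"
  proof (subst sum.remove[OF assms(1) i(1)])
    have "(\<Sum>k\<in>I - {i}. of_real (bump d (norm (x - c k))) * (w k - c k)) = 0"
      using far assms(2) by (intro sum.neutral ballI) (force simp: bump(3))
    then show "of_real (bump d (norm (x - c i))) * (w i - c i) + (\<Sum>k\<in>I - {i}. of_real (bump d (norm (x - c k))) * (w k - c k))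
        = of_real b * (w i - c i)" by (simp add: b_def)
  qed
  then have P: "push I d c w x = x + of_real b * (w i - c i)" by (simp add: push_def)
  have sm: "norm (of_real b * (w i - c i)) < d / 2"
    using w[OF i(1)] b by (simp add: norm_mult) (smt (verit) mult_left_le_one_le norm_ge_zero)
  show ?thesis
  proof (cases "j = i")
    case False
    have "norm (x - c j) \<ge> 2 * d" by (rule far[OF j False])
    moreover have "norm (x - c j) \<le> norm (push I d c w x - w j) + norm (of_real b * (w i - c i)) + norm (w j - c j)"
      if "push I d c w x = w j"
    proof -
      have "x - c j = (w j - c j) - of_real b * (w i - c i)" using that P by (simp add: algebra_simps)
      then have "norm (x - c j) \<le> norm (w j - c j) + norm (of_real b * (w i - c i))"
        by (simp only: norm_triangle_ineq4)
      then show ?thesis using norm_ge_zero[of "push I d c w x - w j"] by linarith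
    qed
    ultimately show ?thesis using sm w[OF j] assms(2) by force
  next
    case True
    show ?thesis
    proof
      assume "push I d c w x = w j"
      then have e: "x - c i = of_real (1 - b) * (w i - c i)" using P True by (simp add: algebra_simps)
      show False
      proof (cases "norm (x - c i) \<le> d / 2")
        case True
        then have "b = 1" using assms(2) by (simp add: b_def bump(4))
        with e have "x = c i" by simp
        with x i(1) show False by blast
      next
        case False
        have "norm (x - c i) = (1 - b) * norm (w i - c i)"
          unfolding e using b by (simp only: norm_mult norm_of_real)
        also have "\<dots> \<le> norm (w i - c i)" using b by (simp add: mult_left_le_one_le)
        finally show False using w[OF i(1)] False by simp
      qed
    qed
  qed
qed

text \<open>A family of planes over \<open>Y\<close>, punctured at the moving points
  \<open>l i y\<close>, with a continuous section \<open>S\<close>.\<close>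

locale punctured_fibration =
  fixes I :: "'i set" and l :: "'i \<Rightarrow> complex \<Rightarrow> complex" and Y :: "complex set" and S :: "complex \<Rightarrow> complex"
  assumes finite_I: "finite I"
    and cont_l: "i \<in> I \<Longrightarrow> continuous_on Y (l i)"
    and cont_S: "continuous_on Y S"
    and l_inj: "i \<in> I \<Longrightarrow> j \<in> I \<Longrightarrow> i \<noteq> j \<Longrightarrow> y \<in> Y \<Longrightarrow> l i y \<noteq> l j y"
    and S_off: "i \<in> I \<Longrightarrow> y \<in> Y \<Longrightarrow> S y \<noteq> l i y"
begin

definition total :: "(complex \<times> complex) set" where
  "total = {v. snd v \<in> Y \<and> (\<forall>i\<in>I. fst v \<noteq> l i (snd v))}"

definition fibre :: "complex \<Rightarrow> complex set" where
  "fibre y = - (\<lambda>i. l i y) ` I"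

definition sec :: "complex \<Rightarrow> complex \<times> complex" where
  "sec y = (S y, y)"

lemma sec_total: "y \<in> Y \<Longrightarrow> sec y \<in> total"
  using S_off by (auto simp: sec_def total_def)

lemma cont_sec: "continuous_on Y sec"
  unfolding sec_def by (intro continuous_intros cont_S)

lemma fibre_incl: "y \<in> Y \<Longrightarrow> (\<lambda>x. (x, y)) ` fibre y \<subseteq> total"
  by (auto simp: fibre_def total_def)

text \<open>The lifting argument for a fibration with section: a path that starts on the section
  equals the section over its projection, followed by a path in the last fibre. That fibre path is
  carried along by pushing it with the punctures.\<close>

lemma path_decomposition:
  assumes \<Phi>: "path_functor G total \<Phi>" and p: "path_in total p" "pathstart p = sec y0" "y0 \<in> Y"
  shows "\<exists>h. path_in (fibre (snd (pathfinish p))) h \<and> pathstart h = S (snd (pathfinish p)) \<and>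
    pathfinish h = fst (pathfinish p) \<and>
    \<Phi> p = \<Phi> (sec \<circ> (snd \<circ> p)) \<otimes>\<^bsub>G\<^esub> \<Phi> (\<lambda>t. (h t, snd (pathfinish p)))"
proof -
  interpret path_functor G total \<Phi> by fact
  define X Z where "X = fst \<circ> p" and "Z = snd \<circ> p"
  have pXZ: "p t = (X t, Z t)" for t by (simp add: X_def Z_def)
  have pc: "continuous_on {0..1} p" using p(1) by (simp add: path_def)
  have Xc: "continuous_on {0..1} X" and Zc: "continuous_on {0..1} Z"
    unfolding X_def Z_def using pc by (auto intro!: continuous_intros)
  have tot: "Z t \<in> Y" "i \<in> I \<Longrightarrow> X t \<noteq> l i (Z t)" if "t \<in> {0..1}" for t i
  proof -
    have "p t \<in> total" using p(1) that by (auto simp: path_image_def)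
    then show "Z t \<in> Y" "i \<in> I \<Longrightarrow> X t \<noteq> l i (Z t)" by (auto simp: total_def pXZ)
  qed
  have p0: "X 0 = S (Z 0)" using p(2) by (simp add: X_def Z_def sec_def pathstart_def)
  have lZc: "continuous_on {0..1} (\<lambda>t. l i (Z t))" if "i \<in> I" for i
    by (rule continuous_on_compose2[OF cont_l[OF that] Zc]) (use tot in auto)
  have SZc: "continuous_on {0..1} (\<lambda>t. S (Z t))"
    by (rule continuous_on_compose2[OF cont_S Zc]) (use tot in auto)
  let ?sub = "\<lambda>u v. Path_Connected.subpath u v p"
  let ?sz = "\<lambda>u v. sec \<circ> (snd \<circ> ?sub u v)"
  have secin: "path_in total (sec \<circ> (snd \<circ> p))"
  proof -
    have "path_in Y (snd \<circ> p)" using Zc tot unfolding Z_def by (auto simp: path_def path_image_def)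
    then show ?thesis by (rule path_in_compose[OF _ cont_sec]) (use sec_total in auto)
  qed
  have fib: "path_functor G (fibre y) (\<lambda>h. \<Phi> ((\<lambda>x. (x, y)) \<circ> h))" if "y \<in> Y" for y
    by (rule compose) (use fibre_incl[OF that] in \<open>auto intro!: continuous_intros\<close>)
  define Q where "Q t \<longleftrightarrow> (\<exists>h. path_in (fibre (Z t)) h \<and> pathstart h = S (Z t) \<and> pathfinish h = X t \<and>
    \<Phi> (?sub 0 t) = \<Phi> (?sz 0 t) \<otimes>\<^bsub>G\<^esub> \<Phi> ((\<lambda>x. (x, Z t)) \<circ> h))" for t
  have "Q 1"
  proof (rule unit_interval_induct)
    have z: "(0::real) \<in> {0..1}" by simp
    have S0: "S (Z 0) \<in> fibre (Z 0)" using S_off tot(1)[OF z] by (auto simp: fibre_def)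
    have in0: "(S (Z 0), Z 0) \<in> total" using sec_total[OF tot(1)[OF z]] by (simp add: sec_def)
    have "?sub 0 0 = (\<lambda>_. (S (Z 0), Z 0))" "?sz 0 0 = (\<lambda>_. (S (Z 0), Z 0))"
      by (auto simp: subpath_def pXZ p0 sec_def)
    moreover have "(\<lambda>x. (x, Z 0)) \<circ> (\<lambda>_. S (Z 0)) = (\<lambda>_::real. (S (Z 0), Z 0))" by auto
    ultimately show "Q 0" unfolding Q_def using const[OF in0] path_in_const[OF S0]
      by (intro exI[of _ "\<lambda>_. S (Z 0)"]) (simp add: pathstart_def pathfinish_def p0)
  next
    fix t :: real assume t: "t \<in> {0..1}"
    \<comment> \<open>Distances among the punctures over \<open>Z t\<close>, and from these to
      \<open>X t\<close> and \<open>S (Z t)\<close>. A tenth of the minimum allows motions below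
      \<open>d / 4\<close> while keeping all separations above \<open>3 * d\<close>. The entry 1
      keeps the set nonempty.\<close>
    define D where "D = insert 1 ((\<lambda>(i, j). norm (l i (Z t) - l j (Z t))) ` {(i, j) \<in> I \<times> I. i \<noteq> j}
        \<union> (\<lambda>i. norm (X t - l i (Z t))) ` I \<union> (\<lambda>i. norm (S (Z t) - l i (Z t))) ` I)"
    have finD: "finite D" unfolding D_def using finite_I
      by (intro finite.insertI finite_UnI finite_imageI) (auto intro: finite_subset[of _ "I \<times> I"])
    have posD: "r > 0" if "r \<in> D" for r
      using that tot[OF t] l_inj[OF _ _ _ tot(1)[OF t]] S_off[OF _ tot(1)[OF t]] by (auto simp: D_def)
    define d where "d = Min D / 10"
    have d: "d > 0" using posD finD by (auto simp: d_def D_def Min_gr_iff)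
    have Dge: "r \<ge> 10 * d" if "r \<in> D" for r using finD that by (simp add: d_def)
    have ev: "eventually (\<lambda>s. dist (f s) (f t) < d / 4) (at t within {0..1})" if "continuous_on {0..1} f" for f :: "real \<Rightarrow> complex"
      using that t d unfolding continuous_on_def by (metis divide_pos_pos tendstoD zero_less_numeral)
    have "eventually (\<lambda>s. (\<forall>i\<in>I. dist (l i (Z s)) (l i (Z t)) < d / 4) \<and> dist (S (Z s)) (S (Z t)) < d / 4 \<and>
        dist (X s) (X t) < d / 4) (at t within {0..1})"
      by (intro eventually_conj eventually_ball_finite ballI finite_I ev) (use lZc SZc Xc in auto)
    then obtain e where e: "e > 0" "\<And>s. s \<in> {0..1} \<Longrightarrow> s \<noteq> t \<Longrightarrow> dist s t < e \<Longrightarrow> 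
        (\<forall>i\<in>I. dist (l i (Z s)) (l i (Z t)) < d / 4) \<and> dist (S (Z s)) (S (Z t)) < d / 4 \<and> dist (X s) (X t) < d / 4"
      unfolding eventually_at by blast
    have near: "i \<in> I \<Longrightarrow> norm (l i (Z s) - l i (Z t)) < d / 4" "norm (S (Z s) - S (Z t)) < d / 4"
        "norm (X s - X t) < d / 4" if "s \<in> {0..1}" "\<bar>s - t\<bar> < e" for s i
      using e(2)[OF that(1)] that(2) d by (cases "s = t"; auto simp: dist_norm)+
    have "Q s'" if s: "s \<in> {0..1}" "s' \<in> {0..1}" "\<bar>s - t\<bar> < e" "\<bar>s' - t\<bar> < e" and Qs: "Q s" for s s'
    proof -
      obtain h where h: "path_in (fibre (Z s)) h" "pathstart h = S (Z s)" "pathfinish h = X s"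
          "\<Phi> (?sub 0 s) = \<Phi> (?sz 0 s) \<otimes>\<^bsub>G\<^esub> \<Phi> ((\<lambda>x. (x, Z s)) \<circ> h)"
        using Qs unfolding Q_def by blast
      define \<tau> where "\<tau> b = s + (s' - s) * b" for b
      have \<tau>: "\<tau> b \<in> {0..1}" "\<bar>\<tau> b - t\<bar> < e" if "b \<in> {0..1}" for b
      proof -
        have "\<tau> b \<in> closed_segment s s'" unfolding closed_segment_def
          using that by (intro CollectI exI[of _ b]) (auto simp: \<tau>_def algebra_simps)
        then show "\<tau> b \<in> {0..1}" "\<bar>\<tau> b - t\<bar> < e"
          using s by (auto simp: closed_segment_eq_real_ivl split: if_splits)
      qed
      have \<tau>01: "\<tau> 0 = s" "\<tau> 1 = s'" by (auto simp: \<tau>_def)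
      have \<tau>c: "continuous_on A \<tau>" for A unfolding \<tau>_def by (intro continuous_intros)
      have cZ: "continuous_on {0..1} (\<lambda>b. Z (\<tau> b))" and cX: "continuous_on {0..1} (\<lambda>b. X (\<tau> b))"
        and cS: "continuous_on {0..1} (\<lambda>b. S (Z (\<tau> b)))"
        by (rule continuous_on_compose2[OF Zc \<tau>c] continuous_on_compose2[OF Xc \<tau>c]
            continuous_on_compose2[OF SZc \<tau>c]; use \<tau> in auto)+
      have cl': "continuous_on {0..1} (\<lambda>b. l i (Z (\<tau> b)))" if "i \<in> I" for i
        by (rule continuous_on_compose2[OF lZc[OF that] \<tau>c]) (use \<tau> in auto)
      have fs: "continuous_on ({0..1} \<times> {0..1}) (\<lambda>z. f (fst z))" "continuous_on ({0..1} \<times> {0..1}) (\<lambda>z. f (snd z))"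
        if "continuous_on {0..1} f" for f :: "real \<Rightarrow> complex"
        using that by (auto intro!: continuous_on_compose2[OF that] continuous_intros)
      note n\<tau> = near[OF \<tau>(1) \<tau>(2)]
      have b: "norm (X t - l i (Z t)) \<ge> 10 * d" "norm (S (Z t) - l i (Z t)) \<ge> 10 * d" if "i \<in> I" for i
        using that by (auto intro!: Dge simp: D_def)
      have bb: "norm (l i (Z t) - l j (Z t)) \<ge> 10 * d" if "i \<in> I" "j \<in> I" "i \<noteq> j" for i j
        using that by (intro Dge) (auto simp: D_def)
      have offX: "norm (X (\<tau> a) - l i (Z (\<tau> b))) \<ge> 3 * d" if "i \<in> I" "a \<in> {0..1}" "b \<in> {0..1}" for i a b
      proof -
        have "X t - l i (Z t) = (X (\<tau> a) - l i (Z (\<tau> b))) - (X (\<tau> a) - X t) + (l i (Z (\<tau> b)) - l i (Z t))" by simp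
        then have "norm (X t - l i (Z t)) \<le> norm (X (\<tau> a) - l i (Z (\<tau> b))) + norm (X (\<tau> a) - X t) + norm (l i (Z (\<tau> b)) - l i (Z t))"
          by (metis norm_triangle_ineq norm_triangle_ineq4 add_right_mono order_trans)
        then show ?thesis using b(1)[OF that(1)] n\<tau>(3)[OF that(2,2)] n\<tau>(1)[OF that(3,3,1)] d by linarith
      qed
      have offS: "norm (S (Z (\<tau> a)) - l i (Z (\<tau> b))) \<ge> 3 * d" if "i \<in> I" "a \<in> {0..1}" "b \<in> {0..1}" for i a b
      proof -
        have "S (Z t) - l i (Z t) = (S (Z (\<tau> a)) - l i (Z (\<tau> b))) - (S (Z (\<tau> a)) - S (Z t)) + (l i (Z (\<tau> b)) - l i (Z t))" by simp
        then have "norm (S (Z t) - l i (Z t)) \<le> norm (S (Z (\<tau> a)) - l i (Z (\<tau> b))) + norm (S (Z (\<tau> a)) - S (Z t)) + norm (l i (Z (\<tau> b)) - l i (Z t))"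
          by (metis norm_triangle_ineq norm_triangle_ineq4 add_right_mono order_trans)
        then show ?thesis using b(2)[OF that(1)] n\<tau>(2)[OF that(2,2)] n\<tau>(1)[OF that(3,3,1)] d by linarith
      qed
      have sep: "norm (l i (Z s) - l j (Z s)) \<ge> 3 * d" if "i \<in> I" "j \<in> I" "i \<noteq> j" for i j
      proof -
        have "l i (Z t) - l j (Z t) = (l i (Z s) - l j (Z s)) - (l i (Z s) - l i (Z t)) + (l j (Z s) - l j (Z t))" by simp
        then have "norm (l i (Z t) - l j (Z t)) \<le> norm (l i (Z s) - l j (Z s)) + norm (l i (Z s) - l i (Z t)) + norm (l j (Z s) - l j (Z t))"
          by (metis norm_triangle_ineq norm_triangle_ineq4 add_right_mono order_trans)
        then show ?thesis using bb[OF that] near(1)[OF s(1,3) that(1)] near(1)[OF s(1,3) that(2)] d by linarith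
      qed
      have small: "norm (l i (Z (\<tau> b)) - l i (Z s)) < d / 2" if "i \<in> I" "b \<in> {0..1}" for i b
      proof -
        have "l i (Z (\<tau> b)) - l i (Z s) = (l i (Z (\<tau> b)) - l i (Z t)) - (l i (Z s) - l i (Z t))" by simp
        then have "norm (l i (Z (\<tau> b)) - l i (Z s)) \<le> norm (l i (Z (\<tau> b)) - l i (Z t)) + norm (l i (Z s) - l i (Z t))"
          by (metis norm_triangle_ineq4)
        then show ?thesis using n\<tau>(1)[OF that(2,2,1)] near(1)[OF s(1,3) that(1)] by linarith
      qed
      \<comment> \<open>The fibre path over \<open>Z s\<close> is dragged along with the punctures.
        Its ends are at distance at least \<open>3 * d\<close> from all of them and stay
        fixed.\<close>
      define P where "P x b = push I d (\<lambda>i. l i (Z s)) (\<lambda>i. l i (Z (\<tau> b))) x" for x b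
      have hin: "h a \<notin> (\<lambda>i. l i (Z s)) ` I" if "a \<in> {0..1}" for a
        using h(1) that unfolding path_image_def fibre_def by blast
      have Pav: "P (h a) b \<noteq> l j (Z (\<tau> b))" if "a \<in> {0..1}" "b \<in> {0..1}" "j \<in> I" for a b j
        unfolding P_def by (rule push_avoids[OF finite_I d sep small hin]) (use that in auto)
      have hc: "continuous_on {0..1} h" using h(1) by (simp add: path_def)
      have PS: "P (S (Z s)) b = S (Z s)" "P (X s) b = X s" for b
        unfolding P_def
        using offS[of _ 0 0] offX[of _ 0 0] d by (auto intro!: push_outside simp: \<tau>01 intro: order_trans[of d "3 * d"])
      have P0: "P x 0 = x" for x by (simp add: P_def \<tau>01 push_id)
      define c where "c = ?sub s s'"
      have c: "c b = (X (\<tau> b), Z (\<tau> b))" for b by (simp add: c_def subpath_def pXZ \<tau>_def mult.commute add.commute)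
      have secc: "sec \<circ> (snd \<circ> c) = (\<lambda>b. (S (Z (\<tau> b)), Z (\<tau> b)))" by (auto simp: c sec_def)
      have K1: "continuous_on ({0..1} \<times> {0..1}) (\<lambda>z. (P (h (fst z)) (snd z), Z (\<tau> (snd z))))"
        unfolding P_def push_def bump_def
        by (intro continuous_intros fs hc cZ cl') (use d in auto)
      have sq: "\<Phi> (\<lambda>a. (P (h a) 0, Z (\<tau> 0))) \<otimes>\<^bsub>G\<^esub> \<Phi> (\<lambda>b. (P (h 1) b, Z (\<tau> b)))
          = \<Phi> (\<lambda>b. (P (h 0) b, Z (\<tau> b))) \<otimes>\<^bsub>G\<^esub> \<Phi> (\<lambda>a. (P (h a) 1, Z (\<tau> 1)))"
        by (rule square[where K = "\<lambda>a b. (P (h a) b, Z (\<tau> b))"])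
          (use K1 Pav tot(1)[OF \<tau>(1)] in \<open>auto simp: total_def\<close>)
      \<comment> \<open>A simultaneous motion is split into a motion over the base with the first
        coordinate frozen and a motion inside the last fibre; \<open>d2\<close> does the same for
        the section.\<close>
      have d1: "\<Phi> (\<lambda>b. (X (\<tau> b), Z (\<tau> b))) = \<Phi> (\<lambda>b. (X (\<tau> 0), Z (\<tau> b))) \<otimes>\<^bsub>G\<^esub> \<Phi> (\<lambda>b. (X (\<tau> b), Z (\<tau> 1)))"
        by (rule diagonal[where K = "\<lambda>a b. (X (\<tau> a), Z (\<tau> b))"])
          (use offX d tot(1)[OF \<tau>(1)] in \<open>force intro!: continuous_intros fs cX cZ simp: total_def\<close>)+
      have d2: "\<Phi> (\<lambda>b. (S (Z (\<tau> b)), Z (\<tau> b))) = \<Phi> (\<lambda>b. (S (Z (\<tau> 0)), Z (\<tau> b))) \<otimes>\<^bsub>G\<^esub> \<Phi> (\<lambda>b. (S (Z (\<tau> b)), Z (\<tau> 1)))"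
        by (rule diagonal[where K = "\<lambda>a b. (S (Z (\<tau> a)), Z (\<tau> b))"])
          (use offS d tot(1)[OF \<tau>(1)] in \<open>force intro!: continuous_intros fs cS cZ simp: total_def\<close>)+
      let ?F = "\<lambda>r. \<Phi> ((\<lambda>x. (x, Z s')) \<circ> r)"
      interpret F: path_functor G "fibre (Z s')" ?F by (rule fib[OF tot(1)[OF s(2)]])
      define hS hP hX where "hS = (\<lambda>b. S (Z (\<tau> b)))" and "hP = (\<lambda>a. P (h a) 1)" and "hX = (\<lambda>b. X (\<tau> b))"
      have one: "(1::real) \<in> {0..1}" by simp
      have hPc: "continuous_on {0..1} hP"
        unfolding hP_def P_def push_def bump_def by (intro continuous_intros hc) (use d in auto)
      have hin': "path_in (fibre (Z s')) hS" "path_in (fibre (Z s')) hP" "path_in (fibre (Z s')) hX"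
        using cS cX hPc offS[OF _ _ one] offX[OF _ _ one] Pav[OF _ one] d
        unfolding hS_def hX_def by (fastforce simp: path_def path_image_def fibre_def \<tau>01 hP_def)+
      have ends: "pathstart hS = S (Z s)" "pathfinish hS = S (Z s')" "pathstart hX = X s" "pathfinish hX = X s'"
          "pathstart hP = S (Z s)" "pathfinish hP = X s"
        using h(2,3) PS by (auto simp: hS_def hX_def hP_def pathstart_def pathfinish_def \<tau>01)
      \<comment> \<open>From the new point of the section back to the old one, along the pushed
        path, then on to the current point, all in the fibre over \<open>Z s'\<close>.\<close>
      define h' where "h' = reversepath hS +++ (hP +++ hX)"
      have h': "path_in (fibre (Z s')) h'" "pathstart h' = S (Z s')" "pathfinish h' = X s'"
        unfolding h'_def using hin' ends by (auto simp: path_image_join)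
      have Fh': "?F h' = inv\<^bsub>G\<^esub> (?F hS) \<otimes>\<^bsub>G\<^esub> (?F hP \<otimes>\<^bsub>G\<^esub> ?F hX)"
      proof -
        have "path_in (fibre (Z s')) (hP +++ hX)" using hin' ends by (auto simp: path_image_join)
        then show ?thesis unfolding h'_def
          using F.join[of "reversepath hS" "hP +++ hX"] F.join[of hP hX] F.reverse[of hS] hin' ends by simp
      qed
      have cc: "path_in total c" unfolding c_def using path_in_subpath[OF p(1)] s by blast
      have cF: "?F hS \<in> carrier G" "?F hP \<in> carrier G" "?F hX \<in> carrier G"
        using F.closed hin' by auto
      have rw: "(\<lambda>b. (S (Z (\<tau> b)), Z (\<tau> 1))) = (\<lambda>x. (x, Z s')) \<circ> hS" "(\<lambda>b. (X (\<tau> b), Z (\<tau> 1))) = (\<lambda>x. (x, Z s')) \<circ> hX"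
          "(\<lambda>a. (P (h a) 1, Z (\<tau> 1))) = (\<lambda>x. (x, Z s')) \<circ> hP" "(\<lambda>a. (P (h a) 0, Z (\<tau> 0))) = (\<lambda>x. (x, Z s)) \<circ> h"
          "(\<lambda>b. (X (\<tau> b), Z (\<tau> b))) = c"
        by (auto simp: hS_def hX_def hP_def \<tau>01 P0 c)
      define L R where "L = \<Phi> (\<lambda>b. (S (Z s), Z (\<tau> b)))" and "R = \<Phi> (\<lambda>b. (X s, Z (\<tau> b)))"
      have LR: "L \<in> carrier G" "R \<in> carrier G"
      proof -
        have z: "(0::real) \<in> {0..1}" by simp
        have "path_in total (\<lambda>b. (S (Z s), Z (\<tau> b)))" "path_in total (\<lambda>b. (X s, Z (\<tau> b)))"
          unfolding path_in_iff
          using offS[OF _ z] offX[OF _ z] d tot(1)[OF \<tau>(1)]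
          by (fastforce intro!: continuous_intros cZ simp: total_def \<tau>01)+
        then show "L \<in> carrier G" "R \<in> carrier G" unfolding L_def R_def using closed by auto
      qed
      have h01: "h 0 = S (Z s)" "h 1 = X s" using h(2,3) by (auto simp: pathstart_def pathfinish_def)
      have e1: "\<Phi> ((\<lambda>x. (x, Z s)) \<circ> h) \<otimes>\<^bsub>G\<^esub> R = L \<otimes>\<^bsub>G\<^esub> ?F hP"
        using sq unfolding h01 PS rw(3,4) L_def R_def .
      have e2: "\<Phi> c = R \<otimes>\<^bsub>G\<^esub> ?F hX" using d1 unfolding rw(2,5) \<tau>01(1) R_def .
      have e3: "\<Phi> (?sz s s') = L \<otimes>\<^bsub>G\<^esub> ?F hS"
        using d2 unfolding rw(1) \<tau>01(1) L_def secc[symmetric] c_def .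
      have A: "\<Phi> (?sz 0 s) \<in> carrier G" "\<Phi> (?sz s s') \<in> carrier G" "\<Phi> (?sz 0 s) \<otimes>\<^bsub>G\<^esub> \<Phi> (?sz s s') = \<Phi> (?sz 0 s')"
      proof -
        have "?sz u v = Path_Connected.subpath u v (sec \<circ> (snd \<circ> p))" for u v
          by (simp add: subpath_compose)
        then show "\<Phi> (?sz 0 s) \<in> carrier G" "\<Phi> (?sz s s') \<in> carrier G"
          "\<Phi> (?sz 0 s) \<otimes>\<^bsub>G\<^esub> \<Phi> (?sz s s') = \<Phi> (?sz 0 s')"
          using subpath[OF secin, of 0 s s'] closed path_in_subpath[OF secin] s by auto
      qed
      have Hc: "\<Phi> ((\<lambda>x. (x, Z s)) \<circ> h) \<in> carrier G"
      proof -
        interpret Fs: path_functor G "fibre (Z s)" "\<lambda>r. \<Phi> ((\<lambda>x. (x, Z s)) \<circ> r)" by (rule fib[OF tot(1)[OF s(1)]])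
        show ?thesis using Fs.closed h(1) by blast
      qed
      have "\<Phi> (?sub 0 s') = \<Phi> (?sub 0 s) \<otimes>\<^bsub>G\<^esub> \<Phi> c"
        unfolding c_def using subpath[OF p(1), of 0 s s'] s by simp
      also have "\<dots> = \<Phi> (?sz 0 s) \<otimes>\<^bsub>G\<^esub> ((\<Phi> ((\<lambda>x. (x, Z s)) \<circ> h) \<otimes>\<^bsub>G\<^esub> R) \<otimes>\<^bsub>G\<^esub> ?F hX)"
        unfolding h(4) e2 using A Hc LR cF by (simp add: m_assoc)
      also have "\<dots> = \<Phi> (?sz 0 s) \<otimes>\<^bsub>G\<^esub> \<Phi> (?sz s s') \<otimes>\<^bsub>G\<^esub> ?F h'"
        unfolding e1 e3 Fh' using A(1) LR cF by (simp add: m_assoc cancel_left)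
      finally have "\<Phi> (?sub 0 s') = \<Phi> (?sz 0 s') \<otimes>\<^bsub>G\<^esub> ?F h'" unfolding A(3) .
      with h' show ?thesis unfolding Q_def by blast
    qed
    with e(1) show "\<exists>e>0. \<forall>s\<in>{0..1}. \<forall>s'\<in>{0..1}. \<bar>s - t\<bar> < e \<longrightarrow> \<bar>s' - t\<bar> < e \<longrightarrow> Q s \<longrightarrow> Q s'"
      by blast
  qed
  then show ?thesis unfolding Q_def
    by (auto simp: pathfinish_def Z_def X_def comp_def)
qed

end

subsection \<open>Rotation loops and total winding\<close>

lemma path_in_point: "path_in A p \<Longrightarrow> t \<in> {0..1} \<Longrightarrow> p t \<in> A"
  unfolding path_image_def by blast

lemma generatesD:
  fixes K :: "'k monoid"
  assumes "generates TYPE('k) X x L" "path_functor K X \<Phi>" "subgroup J K" "\<And>c. c \<in> L \<Longrightarrow> \<Phi> c \<in> J"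
    "q \<in> loops X x"
  shows "\<Phi> q \<in> J"
proof -
  have "\<Phi> ` L \<subseteq> J" using assms(4) by (rule image_subsetI)
  from assms(1)[unfolded generates_def, rule_format, OF assms(2,3) this]
  have "\<Phi> ` loops X x \<subseteq> J" .
  then show ?thesis using assms(5) by (rule image_subset_iff[THEN iffD1, rule_format])
qed

definition lin :: "complex \<times> complex \<times> complex \<Rightarrow> complex \<times> complex \<Rightarrow> complex" where
  "lin f v = fst f * fst v + fst (snd f) * snd v - snd (snd f)"

lemma line_complement_lin: "line_complement F = {v. \<forall>f\<in>F. lin f v \<noteq> 0}"
  by (auto simp: line_complement_def lin_def case_prod_beta)

definition total_winding :: "(complex \<times> complex \<times> complex) set \<Rightarrow> (real \<Rightarrow> complex \<times> complex) \<Rightarrow> complex" where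
  "total_winding F q = (\<Sum>f\<in>F. winding_number (lin f \<circ> q) 0)"

lemma continuous_lin: "continuous_on A (lin f)"
  unfolding lin_def by (intro continuous_intros)

lemma path_functor_winding_lin:
  assumes "f \<in> F"
  shows "path_functor add_group (line_complement F) (\<lambda>q. winding_number (lin f \<circ> q) 0)"
proof -
  interpret path_functor add_group "- {0}" "\<lambda>q. winding_number q 0"
    by (rule path_functor_winding) simp
  show ?thesis by (rule compose[OF continuous_lin]) (use assms in \<open>auto simp: line_complement_lin\<close>)
qed

lemma path_functor_total_winding: "path_functor add_group (line_complement F) (total_winding F)"
proof -
  interpret group add_group by (rule group_add_group)
  show ?thesis
  proof
    fix p q assume *: "path_in (line_complement F) p" "path_in (line_complement F) q" "pathfinish p = pathstart q"
    have "winding_number (lin f \<circ> (p +++ q)) 0 = winding_number (lin f \<circ> p) 0 + winding_number (lin f \<circ> q) 0"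
      if "f \<in> F" for f
      using path_functor.join[OF path_functor_winding_lin[OF that] *] by simp
    then show "total_winding F (p +++ q) = total_winding F p \<otimes>\<^bsub>add_group\<^esub> total_winding F q"
      by (simp add: total_winding_def sum.distrib)
  next
    fix p q assume "homotopic_paths (line_complement F) p q"
    then have "winding_number (lin f \<circ> p) 0 = winding_number (lin f \<circ> q) 0" if "f \<in> F" for f
      by (rule path_functor.homotopic[OF path_functor_winding_lin[OF that]])
    then show "total_winding F p = total_winding F q" by (simp add: total_winding_def)
  qed simp
qed

definition cis_turn :: "real \<Rightarrow> complex" where
  "cis_turn t = exp (2 * of_real pi * \<i> * of_real t)"

lemma cis_turn: "norm (cis_turn t) = 1" "cis_turn 0 = 1" "cis_turn 1 = 1" "cis_turn t \<noteq> 0"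
  "continuous_on A cis_turn"
  by (auto simp: cis_turn_def intro!: continuous_intros)

text \<open>The path is a circle with centre \<open>A\<close> through \<open>A + B\<close>. If
  \<open>B\<close> is smaller it stays in a disc that omits 0; if \<open>B\<close> is larger the
  centre can be moved to 0 linearly.\<close>

lemma winding_number_rotation:
  assumes "cmod A \<noteq> cmod B"
  shows "winding_number (\<lambda>t. A + cis_turn t * B) 0 = (if cmod A < cmod B then 1 else 0)"
proof (cases "cmod A < cmod B")
  case False
  then have lt: "cmod B < cmod A" using assms by simp
  interpret path_functor add_group "- {0}" "\<lambda>q. winding_number q 0"
    by (rule path_functor_winding) simp
  have "winding_number (\<lambda>t. A + cis_turn t * B) 0 = \<one>\<^bsub>add_group\<^esub>"
  proof (rule null[of "ball A (cmod A)"])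
    show "ball A (cmod A) \<subseteq> - {0}" by auto
    show "path_in (ball A (cmod A)) (\<lambda>t. A + cis_turn t * B)"
      using lt by (auto simp: path_in_iff dist_norm norm_mult cis_turn intro!: continuous_intros cis_turn)
  qed (auto simp: pathstart_def pathfinish_def cis_turn)
  then show ?thesis using False by simp
next
  case True
  then have B: "B \<noteq> 0" by auto
  then obtain b where b: "B = exp b" by (metis exp_Ln)
  have eq: "(\<lambda>t. cis_turn t * B) = exp \<circ> linepath b (b + 2 * of_real pi * \<i>)"
    by (auto simp: fun_eq_iff cis_turn_def b linepath_def scaleR_conv_of_real algebra_simps simp flip: exp_add)
  have "winding_number (\<lambda>t. cis_turn t * B) 0 = 1"
    unfolding eq by (subst winding_number_compose_exp) simp_all
  moreover have "winding_number (\<lambda>t. A + cis_turn t * B) 0 = winding_number (\<lambda>t. cis_turn t * B) 0"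
  proof (rule winding_number_loops_linear_eq)
    fix t :: real assume "t \<in> {0..1}"
    show "0 \<notin> closed_segment (cis_turn t * B) (A + cis_turn t * B)"
    proof
      assume "0 \<in> closed_segment (cis_turn t * B) (A + cis_turn t * B)"
      then obtain s where s: "0 \<le> s" "s \<le> 1" "0 = (1 - s) *\<^sub>R (cis_turn t * B) + s *\<^sub>R (A + cis_turn t * B)"
        by (auto simp: closed_segment_def)
      then have "cis_turn t * B = - (s *\<^sub>R A)"
        by (simp add: algebra_simps scaleR_conv_of_real eq_neg_iff_add_eq_0)
      then have "norm (cis_turn t * B) = norm (s *\<^sub>R A)" by simp
      then have "cmod B = s * cmod A" using s by (simp add: norm_mult cis_turn)
      then have "cmod B \<le> cmod A" using s by (simp add: mult_left_le_one_le)
      with True show False by simp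
    qed
  qed (auto simp: path_def pathstart_def pathfinish_def cis_turn intro!: continuous_intros cis_turn)
  ultimately show ?thesis using True by simp
qed

text \<open>One full rotation of \<open>u\<close> about \<open>p\<close> inside the complex line
  that joins them.\<close>

definition rot :: "complex \<times> complex \<Rightarrow> complex \<times> complex \<Rightarrow> real \<Rightarrow> complex \<times> complex" where
  "rot p u t = (fst p + cis_turn t * (fst u - fst p), snd p + cis_turn t * (snd u - snd p))"

lemma lin_rot: "lin f (rot p u t) = lin f p + cis_turn t * (lin f u - lin f p)"
  by (simp add: lin_def rot_def algebra_simps)

lemma rot_ends: "pathstart (rot p u) = u" "pathfinish (rot p u) = u" "rot p u 0 = u" "rot p u 1 = u"
  by (auto simp: rot_def pathstart_def pathfinish_def cis_turn)

text \<open>Along the rotation \<open>lin f\<close> runs over a circle with centre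
  \<open>lin f p\<close> and radius \<open>cmod (lin f u - lin f p)\<close>. It passes through 0
  exactly when the two moduli agree.\<close>

definition rotatable :: "(complex \<times> complex \<times> complex) set \<Rightarrow> complex \<times> complex \<Rightarrow> complex \<times> complex \<Rightarrow> bool" where
  "rotatable F p u \<longleftrightarrow> (\<forall>f\<in>F. cmod (lin f p) \<noteq> cmod (lin f u - lin f p))"

lemma rotatable_rot:
  assumes "rotatable F p u"
  shows "rot p u t \<in> line_complement F"
  unfolding line_complement_lin
proof (intro CollectI ballI)
  fix f assume "f \<in> F"
  then have "cmod (lin f p) \<noteq> cmod (cis_turn t * (lin f u - lin f p))"
    using assms by (simp add: rotatable_def norm_mult cis_turn)
  then have "lin f p \<noteq> - (cis_turn t * (lin f u - lin f p))" by (metis norm_minus_cancel)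
  then show "lin f (rot p u t) \<noteq> 0" unfolding lin_rot by (simp add: eq_neg_iff_add_eq_0)
qed

lemma path_in_rot: "rotatable F p u \<Longrightarrow> path_in (line_complement F) (rot p u)"
  using rotatable_rot unfolding path_in_iff
  by (auto simp: rot_def intro!: continuous_intros cis_turn)

lemma total_winding_rot:
  assumes "rotatable F p u" "finite F"
  shows "total_winding F (rot p u) = of_nat (card {f \<in> F. cmod (lin f p) < cmod (lin f u - lin f p)})"
proof -
  have "winding_number (lin f \<circ> rot p u) 0 = (if cmod (lin f p) < cmod (lin f u - lin f p) then 1 else 0)"
    if "f \<in> F" for f
    using winding_number_rotation assms that by (simp add: comp_def lin_rot rotatable_def)
  then have "total_winding F (rot p u) = (\<Sum>f\<in>F. if cmod (lin f p) < cmod (lin f u - lin f p) then 1 else 0)"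
    by (simp add: total_winding_def)
  then show ?thesis using assms(2) by (simp add: sum.If_cases Int_def)
qed

lemma total_winding_rot_nonzero:
  assumes "rotatable F p u" "finite F" "f \<in> F" "cmod (lin f p) < cmod (lin f u - lin f p)"
  shows "total_winding F (rot p u) \<noteq> 0"
proof -
  have "{f \<in> F. cmod (lin f p) < cmod (lin f u - lin f p)} \<noteq> {}" using assms(3,4) by blast
  then have "card {f \<in> F. cmod (lin f p) < cmod (lin f u - lin f p)} \<noteq> 0" using assms(2) by simp
  then show ?thesis unfolding total_winding_rot[OF assms(1,2)] by (simp only: of_nat_eq_0_iff not_False_eq_True)
qed

text \<open>The rotations of a moving pair fill a square whose two remaining sides are both
  \<open>q\<close>. For a closed \<open>q\<close> and equal centres at its ends, the rotation
  commutes with \<open>q\<close>; otherwise the rotation is transported along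
  \<open>q\<close>.\<close>

lemma sweep:
  assumes \<Phi>: "path_functor G (line_complement F) \<Phi>"
    and P: "continuous_on {0..1} P" and q: "continuous_on {0..1} q"
    and rt: "\<And>b. b \<in> {0..1} \<Longrightarrow> rotatable F (P b) (q b)"
  shows "\<Phi> (rot (P 0) (q 0)) \<otimes>\<^bsub>G\<^esub> \<Phi> q = \<Phi> q \<otimes>\<^bsub>G\<^esub> \<Phi> (rot (P 1) (q 1))"
proof -
  interpret path_functor G "line_complement F" \<Phi> by fact
  have fs: "continuous_on ({0..1} \<times> {0..1}) (\<lambda>z. f (snd z))" if "continuous_on {0..1} f" for f :: "real \<Rightarrow> complex \<times> complex"
    using that by (auto intro!: continuous_on_compose2[OF that] continuous_intros)
  have c: "continuous_on ({0..1} \<times> {0..1 :: real}) (\<lambda>z. cis_turn (fst z))"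
    unfolding cis_turn_def by (intro continuous_intros)
  have "\<Phi> (\<lambda>a. rot (P 0) (q 0) a) \<otimes>\<^bsub>G\<^esub> \<Phi> (\<lambda>b. rot (P b) (q b) 1) = \<Phi> (\<lambda>b. rot (P b) (q b) 0) \<otimes>\<^bsub>G\<^esub> \<Phi> (\<lambda>a. rot (P 1) (q 1) a)"
  proof (rule square[where K = "\<lambda>a b. rot (P b) (q b) a"])
    show "continuous_on ({0..1} \<times> {0..1}) (\<lambda>z. rot (P (snd z)) (q (snd z)) (fst z))"
      unfolding rot_def by (intro continuous_intros c fs P q)
  qed (use rotatable_rot rt in blast)
  then show ?thesis by (simp add: rot_ends)
qed

subsection \<open>Arrangements with two directions\<close>

text \<open>\<open>E\<close> holds the heights of the horizontal lines \<open>y = c\<close>, and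
  \<open>L\<close> the pairs of the graphs \<open>x = a y + b\<close>.\<close>

definition std_lines :: "complex set \<Rightarrow> (complex \<times> complex) set \<Rightarrow> (complex \<times> complex \<times> complex) set" where
  "std_lines E L = (\<lambda>c. (0, 1, c)) ` E \<union> (\<lambda>(a, b). (1, - a, b)) ` L"

lemma proper_std_lines: "finite E \<Longrightarrow> finite L \<Longrightarrow> proper_lines (std_lines E L)"
  by (auto simp: proper_lines_def std_lines_def)

lemma in_std_complement:
  "v \<in> line_complement (std_lines E L) \<longleftrightarrow> snd v \<notin> E \<and> (\<forall>(a, b)\<in>L. fst v \<noteq> a * snd v + b)"
  unfolding line_complement_lin std_lines_def lin_def by (force simp: algebra_simps)

lemma rotatable_std:
  "rotatable (std_lines E L) p u \<longleftrightarrow> (\<forall>c\<in>E. cmod (snd p - c) \<noteq> cmod (snd u - snd p)) \<and>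
    (\<forall>(a, b)\<in>L. cmod (fst p - a * snd p - b) \<noteq> cmod ((fst u - fst p) - a * (snd u - snd p)))"
  by (simp add: rotatable_def std_lines_def lin_def ball_Un case_prod_beta algebra_simps)

text \<open>\<open>d_loop\<close> speaks of loops only: \<Phi> will involve tethers, which
  contribute to \<open>d\<close> on open paths and cancel on loops. The condition on
  \<open>d\<close> in \<open>R_trans\<close> reflects that transitivity amounts to dividing by a
  quantity attached to the middle element.\<close>

locale std_arrangement = path_functor G "line_complement (std_lines E L)" \<Phi>
  for G :: "'g monoid" (structure) and E L \<Phi> +
  fixes d :: "'g \<Rightarrow> complex" and R :: "'g \<Rightarrow> 'g \<Rightarrow> bool"
  assumes finite_E: "finite E" and finite_L: "finite L" and E_ne: "E \<noteq> {}" and L_ne: "L \<noteq> {}"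
    and d_mult: "g \<in> carrier G \<Longrightarrow> h \<in> carrier G \<Longrightarrow> d (g \<otimes> h) = d g + d h"
    and d_loop: "path_in (line_complement (std_lines E L)) q \<Longrightarrow> pathstart q = pathfinish q \<Longrightarrow>
      d (\<Phi> q) = total_winding (std_lines E L) q"
    and R_comm: "g \<in> carrier G \<Longrightarrow> h \<in> carrier G \<Longrightarrow> g \<otimes> h = h \<otimes> g \<Longrightarrow> R g h"
    and R_sym: "g \<in> carrier G \<Longrightarrow> h \<in> carrier G \<Longrightarrow> R g h \<Longrightarrow> R h g"
    and R_mult: "g \<in> carrier G \<Longrightarrow> h \<in> carrier G \<Longrightarrow> k \<in> carrier G \<Longrightarrow> R g h \<Longrightarrow> R g k \<Longrightarrow> R g (h \<otimes> k)"
    and R_inv: "g \<in> carrier G \<Longrightarrow> h \<in> carrier G \<Longrightarrow> R g h \<Longrightarrow> R g (inv h)"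
    and R_trans: "g \<in> carrier G \<Longrightarrow> h \<in> carrier G \<Longrightarrow> k \<in> carrier G \<Longrightarrow> R g h \<Longrightarrow> R h k \<Longrightarrow>
      d h \<noteq> 0 \<Longrightarrow> R g k"
begin

abbreviation "F \<equiv> std_lines E L"
abbreviation "U \<equiv> line_complement F"

lemma finite_F: "finite F"
  using finite_E finite_L by (simp add: std_lines_def)

lemma subgroup_R: "z \<in> carrier G \<Longrightarrow> subgroup {g \<in> carrier G. R z g} G"
proof -
  assume z: "z \<in> carrier G"
  then have "\<one> \<in> {g \<in> carrier G. R z g}" using R_comm[of z \<one>] by simp
  with z show ?thesis by (intro subgroupI) (auto intro: R_mult R_inv)
qed

lemma d_conj: "g \<in> carrier G \<Longrightarrow> h \<in> carrier G \<Longrightarrow> d (g \<otimes> h \<otimes> inv g) = d h"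
proof -
  assume g: "g \<in> carrier G" and h: "h \<in> carrier G"
  have 1: "d \<one> = 0" using d_mult[of \<one> \<one>] by simp
  have "d (inv g) = - d g" using d_mult[OF g, of "inv g"] g 1 by (simp add: eq_neg_iff_add_eq_0 add.commute)
  then show ?thesis using g h by (simp add: d_mult)
qed

lemma conj_commute:
  assumes "T \<in> carrier G" "g \<in> carrier G" "h \<in> carrier G" "g \<otimes> h = h \<otimes> g"
  shows "R (T \<otimes> g \<otimes> inv T) (T \<otimes> h \<otimes> inv T)"
proof (rule R_comm)
  have "(T \<otimes> g \<otimes> inv T) \<otimes> (T \<otimes> h \<otimes> inv T) = T \<otimes> (g \<otimes> h) \<otimes> inv T"
    "(T \<otimes> h \<otimes> inv T) \<otimes> (T \<otimes> g \<otimes> inv T) = T \<otimes> (h \<otimes> g) \<otimes> inv T"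
    using assms(1-3) by (simp_all add: m_assoc cancel_left)
  then show "(T \<otimes> g \<otimes> inv T) \<otimes> (T \<otimes> h \<otimes> inv T) = (T \<otimes> h \<otimes> inv T) \<otimes> (T \<otimes> g \<otimes> inv T)"
    using assms(4) by simp
qed (use assms in auto)

text \<open>The factor 2 on \<open>cmod a\<close> lets the section clear the graphs also over
  heights within distance 1, where both |c| and |a| |y - c| cost one further |a|.\<close>

definition rad :: real where
  "rad = (\<Sum>(a, b)\<in>L. 2 * cmod a + cmod b) + 1"

definition S :: "complex \<Rightarrow> complex" where
  "S y = of_real (rad * (1 + cmod y))"

lemma rad: "(a, b) \<in> L \<Longrightarrow> 2 * cmod a + cmod b < rad" "rad > 0"
proof -
  have *: "(\<Sum>(a, b)\<in>L. 2 * cmod a + cmod b) \<ge> 0" by (intro sum_nonneg) auto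
  then show "rad > 0" by (simp add: rad_def)
  assume "(a, b) \<in> L"
  then have "2 * cmod a + cmod b \<le> (\<Sum>(a, b)\<in>L. 2 * cmod a + cmod b)"
    using member_le_sum[of "(a, b)" L "\<lambda>(a, b). 2 * cmod a + cmod b"] finite_L by auto
  then show "2 * cmod a + cmod b < rad" by (simp add: rad_def)
qed

lemma S_far:
  assumes "(a, b) \<in> L" "cmod (y - c) \<le> 1"
  shows "cmod (a * c + b) + cmod a * cmod (y - c) < cmod (S y)"
proof -
  have "cmod c \<le> cmod y + 1" using assms(2) norm_triangle_ineq2[of c y] by (simp add: norm_minus_commute)
  then have "cmod a * cmod c \<le> cmod a * (cmod y + 1)" by (simp add: mult_left_mono)
  moreover have "cmod (a * c + b) \<le> cmod a * cmod c + cmod b" by (metis norm_mult norm_triangle_ineq)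
  moreover have "cmod a * cmod (y - c) \<le> cmod a" using assms(2) by (simp add: mult_left_le)
  ultimately have "cmod (a * c + b) + cmod a * cmod (y - c) \<le> cmod a * (cmod y + 1) + cmod b + cmod a" by linarith
  also have "\<dots> \<le> (2 * cmod a + cmod b) * (1 + cmod y)" by (simp add: algebra_simps)
  also have "\<dots> < rad * (1 + cmod y)" using rad(1)[OF assms(1)] by (simp add: mult_strict_right_mono add_pos_nonneg)
  also have "\<dots> = cmod (S y)"
  proof -
    have "rad * (1 + cmod y) \<ge> 0" using rad(2) by simp
    then show ?thesis unfolding S_def norm_of_real by simp
  qed
  finally show ?thesis .
qed

lemma S_avoids: "(a, b) \<in> L \<Longrightarrow> cmod (a * y + b) < cmod (S y)"
  using S_far[of a b y y] by simp

definition crit :: "complex set" where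
  "crit = {y. \<exists>(a, b)\<in>L. \<exists>(a', b')\<in>L. (a, b) \<noteq> (a', b') \<and> a * y + b = a' * y + b'}"

lemma finite_crit: "finite crit"
proof -
  have "crit \<subseteq> (\<lambda>((a, b), (a', b')). (b' - b) / (a - a')) ` (L \<times> L)"
  proof
    fix y assume "y \<in> crit"
    then obtain a b a' b' where *: "(a, b) \<in> L" "(a', b') \<in> L" "(a, b) \<noteq> (a', b')" "a * y + b = a' * y + b'"
      unfolding crit_def by blast
    then have "a \<noteq> a'" by auto
    moreover have "y * (a - a') = b' - b" using *(4) by (simp add: algebra_simps)
    ultimately have "y = (b' - b) / (a - a')" by (simp add: eq_divide_eq)
    then show "y \<in> (\<lambda>((a, b), (a', b')). (b' - b) / (a - a')) ` (L \<times> L)"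
      using *(1,2) by (intro image_eqI[of _ _ "((a, b), (a', b'))"]) auto
  qed
  then show ?thesis using finite_L finite_subset by blast
qed

definition Y :: "complex set" where "Y = - (E \<union> crit)"

sublocale fib: punctured_fibration L "\<lambda>(a, b) y. a * y + b" Y S
proof
  show "continuous_on Y S" unfolding S_def by (intro continuous_intros)
  show "S y \<noteq> (case i of (a, b) \<Rightarrow> \<lambda>y. a * y + b) y" if "i \<in> L" for i y
    using S_avoids[of "fst i" "snd i" y] that by (auto simp: case_prod_beta)
  show "(case i of (a, b) \<Rightarrow> \<lambda>y. a * y + b) y \<noteq> (case j of (a, b) \<Rightarrow> \<lambda>y. a * y + b) y"
    if "i \<in> L" "j \<in> L" "i \<noteq> j" "y \<in> Y" for i j y
    using that unfolding Y_def crit_def by (auto simp: case_prod_beta prod_eq_iff)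
  show "continuous_on Y (case i of (a, b) \<Rightarrow> \<lambda>y. a * y + b)" for i
    by (cases i) (auto intro!: continuous_intros)
qed (rule finite_L)

abbreviation "V \<equiv> fib.total"
abbreviation "sec \<equiv> fib.sec"

text \<open>Restricting to generic heights only removes the horizontal lines through crossings of
  graphs, so \<open>V\<close> is again a line complement and loops can be pushed into it.\<close>

lemma V_eq: "V = line_complement (F \<union> (\<lambda>c. (0, 1, c)) ` crit)"
proof -
  have eq: "F \<union> (\<lambda>c. (0, 1, c)) ` crit = std_lines (E \<union> crit) L" by (auto simp: std_lines_def)
  show ?thesis
    unfolding fib.total_def eq set_eq_iff in_std_complement mem_Collect_eq
    by (simp add: Y_def case_prod_beta)
qed

lemma V_sub: "V \<subseteq> U"
  unfolding V_eq line_complement_Un by blast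

lemma V_functor: "path_functor G V \<Phi>"
  by (rule subset[OF V_sub])

lemma fibre_functor:
  assumes "y \<in> Y"
  shows "path_functor G (fib.fibre y) (\<lambda>h. \<Phi> (\<lambda>t. (h t, y)))"
proof -
  have "path_functor G (fib.fibre y) (\<lambda>h. \<Phi> ((\<lambda>x. (x, y)) \<circ> h))"
    by (rule compose) (use fib.fibre_incl[OF assms] V_sub in \<open>auto intro!: continuous_intros\<close>)
  then show ?thesis by (simp add: comp_def)
qed

lemma sec_U: "y \<notin> E \<Longrightarrow> sec y \<in> U"
proof -
  assume y: "y \<notin> E"
  have "S y \<noteq> a * y + b" if "(a, b) \<in> L" for a b
    using S_avoids[OF that, of y] by auto
  with y show ?thesis by (auto simp: in_std_complement fib.sec_def)
qed

text \<open>The section avoids the graphs over every height, crossings included. It therefore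
  extends over the critical heights outside \<open>E\<close>, and loops around these will
  contract.\<close>

lemma sec_functor: "path_functor G (- E) (\<lambda>q. \<Phi> (sec \<circ> q))"
  by (rule compose) (use sec_U in \<open>auto simp: fib.sec_def[abs_def] S_def intro!: continuous_intros\<close>)

end

text \<open>Near a horizontal line \<open>y = c\<close>: every point of a nearby horizontal line is rotatable about its
  projection to \<open>y = c\<close> or about a multiple point, and the two loops commute where both are defined.\<close>

locale std_local = std_arrangement G E L \<Phi> d R
  for G :: "'g monoid" (structure) and E L \<Phi> d R +
  fixes c :: complex and de :: real and ep :: real
  assumes c: "c \<in> E" and de: "de > 0" and ep: "ep > 0" "ep \<le> 1"
    and gap: "\<And>a b a' b'. (a, b) \<in> L \<Longrightarrow> (a', b') \<in> L \<Longrightarrow> a * c + b \<noteq> a' * c + b' \<Longrightarrow>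
      cmod ((a * c + b) - (a' * c + b')) \<ge> 4 * de"
    and slope: "\<And>a b. (a, b) \<in> L \<Longrightarrow> cmod a * ep < de"
    and gapE: "\<And>e. e \<in> E \<Longrightarrow> e \<noteq> c \<Longrightarrow> ep \<le> cmod (e - c)"
begin

definition near :: "complex \<Rightarrow> bool" where "near y \<longleftrightarrow> y \<noteq> c \<and> cmod (y - c) < ep"

text \<open>Rotating \<open>(x, y)\<close> about its projection \<open>(x, c)\<close> moves
  \<open>y\<close> only; the form of a graph then runs over a circle with centre
  \<open>x - (a * c + b)\<close> and radius |a| |y - c|. In \<open>W\<close> all these circles leave
  0 outside.\<close>

definition W :: "(complex \<times> complex) set" where
  "W = {(x, y). near y \<and> (\<forall>(a, b)\<in>L. cmod a * cmod (y - c) < cmod (x - (a * c + b)))}"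

definition B :: "complex \<Rightarrow> (complex \<times> complex) set" where
  "B z = {(x, y). near y \<and> cmod (x - z) < 2 * de \<and> (x, y) \<in> U}"

lemma slope': "(a, b) \<in> L \<Longrightarrow> near y \<Longrightarrow> cmod a * cmod (y - c) < de"
proof -
  assume "(a, b) \<in> L" "near y"
  then have "cmod a * cmod (y - c) \<le> cmod a * ep" by (simp add: near_def mult_left_mono)
  with slope[OF \<open>(a, b) \<in> L\<close>] show ?thesis by simp
qed

lemma near_E: "near y \<Longrightarrow> e \<in> E \<Longrightarrow> cmod (c - e) \<noteq> cmod (y - c)"
  using gapE[of e] by (cases "e = c") (auto simp: near_def norm_minus_commute)

lemma W_rot: "u \<in> W \<Longrightarrow> rotatable F (fst u, c) u"
  unfolding rotatable_std
proof (intro conjI ballI)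
  assume u: "u \<in> W"
  then have n: "near (snd u)" by (auto simp: W_def)
  show "cmod (snd (fst u, c) - e) \<noteq> cmod (snd u - snd (fst u, c))" if "e \<in> E" for e
    using near_E[OF n that] by simp
  fix i assume "i \<in> L"
  then obtain a b where i: "i = (a, b)" "(a, b) \<in> L" by (cases i) auto
  have "cmod a * cmod (snd u - c) < cmod (fst u - (a * c + b))" using u i by (auto simp: W_def)
  then show "case i of (a, b) \<Rightarrow> cmod (fst (fst u, c) - a * snd (fst u, c) - b)
      \<noteq> cmod (fst u - fst (fst u, c) - a * (snd u - snd (fst u, c)))"
    by (simp add: i norm_mult diff_diff_eq)
qed

text \<open>On lines through \<open>(a * c + b, c)\<close> the form vanishes at the centre but not
  at \<open>u\<close>. For the other graphs its modulus at the centre is at least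
  \<open>4 * de\<close>, and the radius of rotation stays below \<open>3 * de\<close>.\<close>

lemma B_rot:
  assumes ab: "(a, b) \<in> L" and u: "u \<in> B (a * c + b)"
  shows "rotatable F (a * c + b, c) u"
  unfolding rotatable_std
proof (intro conjI ballI)
  let ?z = "a * c + b"
  have n: "near (snd u)" and x: "cmod (fst u - ?z) < 2 * de" and uU: "u \<in> U" using u by (auto simp: B_def)
  show "cmod (snd (?z, c) - e) \<noteq> cmod (snd u - snd (?z, c))" if "e \<in> E" for e
    using near_E[OF n that] by simp
  fix i assume "i \<in> L"
  then obtain a' b' where i: "i = (a', b')" "(a', b') \<in> L" by (cases i) auto
  have "cmod (?z - a' * c - b') \<noteq> cmod (fst u - ?z - a' * (snd u - c))"
  proof (cases "?z = a' * c + b'")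
    case True
    have "fst u - ?z - a' * (snd u - c) = fst u - (a' * snd u + b')" using True by (simp add: algebra_simps)
    also have "\<dots> \<noteq> 0" using uU i(2) unfolding in_std_complement by auto
    finally show ?thesis using True by (simp add: diff_diff_eq)
  next
    case False
    have "cmod (fst u - ?z - a' * (snd u - c)) \<le> cmod (fst u - ?z) + cmod a' * cmod (snd u - c)"
      by (metis norm_mult norm_triangle_ineq4)
    also have "\<dots> < 3 * de" using x slope'[OF i(2) n] by simp
    finally have "cmod (fst u - ?z - a' * (snd u - c)) < 3 * de" .
    moreover have "cmod (?z - a' * c - b') \<ge> 4 * de" using gap[OF ab i(2) False] by (simp add: diff_diff_eq)
    ultimately show ?thesis using de by linarith
  qed
  then show "case i of (a', b') \<Rightarrow> cmod (fst (?z, c) - a' * snd (?z, c) - b')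
      \<noteq> cmod (fst u - fst (?z, c) - a' * (snd u - snd (?z, c)))" by (simp add: i)
qed

definition centre :: "complex \<times> complex \<Rightarrow> complex \<times> complex \<Rightarrow> bool" where
  "centre u p \<longleftrightarrow> u \<in> W \<and> p = (fst u, c) \<or> (\<exists>(a, b)\<in>L. u \<in> B (a * c + b) \<and> p = (a * c + b, c))"

lemma centre_cases:
  assumes "centre u p"
  obtains "u \<in> W" "p = (fst u, c)" | a b where "(a, b) \<in> L" "u \<in> B (a * c + b)" "p = (a * c + b, c)"
  using assms unfolding centre_def by blast

lemma centre_rot: "centre u p \<Longrightarrow> rotatable F p u"
  by (erule centre_cases) (use W_rot B_rot in auto)

lemma centre_near: "centre u p \<Longrightarrow> near (snd u) \<and> snd p = c"
  by (erule centre_cases) (auto simp: W_def B_def)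

lemma centre_closed: "centre u p \<Longrightarrow> \<Phi> (rot p u) \<in> carrier G"
  using closed path_in_rot[OF centre_rot] by blast

lemma centre_d: "centre u p \<Longrightarrow> d (\<Phi> (rot p u)) \<noteq> 0"
proof -
  assume *: "centre u p"
  have "total_winding F (rot p u) \<noteq> 0"
    by (rule total_winding_rot_nonzero[OF centre_rot[OF *] finite_F, of "(0, 1, c)"])
      (use centre_near[OF *] c in \<open>auto simp: std_lines_def lin_def near_def\<close>)
  then show ?thesis using d_loop[OF path_in_rot[OF centre_rot[OF *]]] rot_ends by simp
qed

lemma W_in_U: "W \<subseteq> U"
proof
  fix u assume u: "u \<in> W"
  then have "u = rot (fst u, c) u 0" by (simp add: rot_ends)
  then show "u \<in> U" using rotatable_rot[OF W_rot[OF u], of 0] by simp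
qed

text \<open>The rotation about the projection keeps the first coordinate and the distance to
  \<open>c\<close>, hence stays in \<open>B z\<close>; sweeping with the constant centre
  \<open>(z, c)\<close> along it gives commutation. Two multiple points that serve the same
  \<open>u\<close> coincide by \<open>gap\<close>.\<close>

lemma centres_commute:
  assumes "centre u p" "centre u p'"
  shows "\<Phi> (rot p u) \<otimes> \<Phi> (rot p' u) = \<Phi> (rot p' u) \<otimes> \<Phi> (rot p u)"
proof -
  have key: "\<Phi> (rot (a * c + b, c) u) \<otimes> \<Phi> (rot (fst u, c) u) = \<Phi> (rot (fst u, c) u) \<otimes> \<Phi> (rot (a * c + b, c) u)"
    if u: "u \<in> W" "(a, b) \<in> L" "u \<in> B (a * c + b)" for a b
  proof -
    let ?q = "rot (fst u, c) u"
    have q: "path_in U ?q" by (rule path_in_rot[OF W_rot[OF u(1)]])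
    have "?q t \<in> B (a * c + b)" for t
    proof -
      have "?q t \<in> U" by (rule rotatable_rot[OF W_rot[OF u(1)]])
      moreover have "near (snd (?q t))" using u(3) by (auto simp: B_def near_def rot_def norm_mult cis_turn)
      moreover have "fst (?q t) = fst u" by (simp add: rot_def)
      moreover from calculation have "(fst u, snd (?q t)) \<in> U" by (metis prod.collapse)
      ultimately show ?thesis using u(3) by (auto simp: B_def case_prod_beta)
    qed
    then show ?thesis
      using sweep[OF path_functor_axioms', of "\<lambda>_. (a * c + b, c)" ?q] q B_rot[OF u(2)]
      by (simp add: path_def rot_ends)
  qed
  show ?thesis using assms(1)
  proof (cases rule: centre_cases)
    case 1
    from assms(2) show ?thesis
      by (cases rule: centre_cases) (use 1 key in auto)
  next
    case (2 a b)
    note ab = 2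
    from assms(2) show ?thesis
    proof (cases rule: centre_cases)
      case 1
      then show ?thesis using key ab by simp
    next
      case (2 a' b')
      have "a * c + b = a' * c + b'"
      proof (rule ccontr)
        assume ne: "a * c + b \<noteq> a' * c + b'"
        have "(a * c + b) - (a' * c + b') = (fst u - (a' * c + b')) - (fst u - (a * c + b))" by simp
        then have "cmod ((a * c + b) - (a' * c + b')) \<le> cmod (fst u - (a' * c + b')) + cmod (fst u - (a * c + b))"
          by (metis norm_triangle_ineq4)
        also have "\<dots> < 4 * de" using ab(2) 2(2) by (auto simp: B_def)
        finally show False using gap[OF ab(1) 2(1) ne] by simp
      qed
      then show ?thesis using ab 2 by simp
    qed
  qed
qed

text \<open>Failing \<open>W\<close> means |x - (a c + b)| \<le> |a| |y - c| < \<open>de\<close> for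
  some graph, which is well inside \<open>B (a * c + b)\<close>.\<close>

lemma centre_exists:
  assumes "u \<in> U" "near (snd u)"
  shows "\<exists>p. centre u p"
proof (cases "u \<in> W")
  case False
  then obtain a b where ab: "(a, b) \<in> L" "cmod (fst u - (a * c + b)) \<le> cmod a * cmod (snd u - c)"
    using assms(2) unfolding W_def by (auto simp: not_less case_prod_beta)
  then have "u \<in> B (a * c + b)"
    using slope'[OF ab(1) assms(2)] assms de by (auto simp: B_def case_prod_beta)
  then show ?thesis using ab(1) unfolding centre_def by blast
qed (auto simp: centre_def)

lemma sec_W: "near y \<Longrightarrow> sec y \<in> W"
proof -
  assume n: "near y"
  have "cmod a * cmod (y - c) < cmod (S y - (a * c + b))" if "(a, b) \<in> L" for a b
    using S_far[OF that, of y c] n ep norm_triangle_ineq2[of "S y" "a * c + b"] by (simp add: near_def)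
  then show ?thesis using n by (auto simp: W_def fib.sec_def)
qed

lemma fibre_in_U: "y \<in> Y \<Longrightarrow> x \<in> fib.fibre y \<Longrightarrow> (x, y) \<in> U"
  using fib.fibre_incl V_sub by blast

text \<open>While the centre varies continuously, the tethered rotation does not change. Where the
  centre has to be exchanged, old and new rotation commute and have nonzero \<open>d\<close>, so the
  relation passes on. \<open>T\<close> leaves room for a tether from another fibre.\<close>

lemma transport:
  assumes y: "y \<in> Y" "near y" and T: "T \<in> carrier G"
    and b: "path_in (fib.fibre y) b" "pathstart b = S y" and p: "centre (pathfinish b, y) p"
  shows "R (T \<otimes> \<Phi> (rot (S y, c) (sec y)) \<otimes> inv T)
    (T \<otimes> (\<Phi> (\<lambda>t. (b t, y)) \<otimes> \<Phi> (rot p (pathfinish b, y)) \<otimes> inv (\<Phi> (\<lambda>t. (b t, y)))) \<otimes> inv T)"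
proof -
  let ?i = "\<lambda>h. \<Phi> (\<lambda>t. (h t, y))"
  interpret fb: path_functor G "fib.fibre y" ?i by (rule fibre_functor[OF y(1)])
  let ?sub = "\<lambda>u v. Path_Connected.subpath u v b"
  define z where "z = T \<otimes> \<Phi> (rot (S y, c) (sec y)) \<otimes> inv T"
  define A where "A t = T \<otimes> ?i (?sub 0 t)" for t
  have subc: "?i (?sub s t) \<in> carrier G" if "s \<in> {0..1}" "t \<in> {0..1}" for s t
    using fb.closed path_in_subpath[OF b(1) that] by blast
  have Ac: "A t \<in> carrier G" if "t \<in> {0..1}" for t using subc[of 0 t] that T by (simp add: A_def)
  have s0: "centre (sec y) (S y, c)" using sec_W[OF y(2)] by (auto simp: centre_def fib.sec_def)
  have zc: "z \<in> carrier G" using T centre_closed[OF s0] by (simp add: z_def)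
  have bU: "(b t, y) \<in> U" if "t \<in> {0..1}" for t
    by (rule fibre_in_U[OF y(1) path_in_point[OF b(1) that]])
  have bc: "continuous_on {0..1} b" using b by (simp add: path_def)
  define Q where "Q t \<longleftrightarrow> (\<forall>p. centre (b t, y) p \<longrightarrow> R z (A t \<otimes> \<Phi> (rot p (b t, y)) \<otimes> inv (A t)))" for t
  \<comment> \<open>It is enough to reach one centre at \<open>b t\<close>; any other is reached by
    \<open>R_trans\<close> through the first.\<close>
  have upgrade: "Q t" if t: "t \<in> {0..1}" and "centre (b t, y) p" "R z (A t \<otimes> \<Phi> (rot p (b t, y)) \<otimes> inv (A t))" for t p
    unfolding Q_def
  proof (intro allI impI)
    fix p' assume p': "centre (b t, y) p'"
    show "R z (A t \<otimes> \<Phi> (rot p' (b t, y)) \<otimes> inv (A t))"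
    proof (rule R_trans[OF zc _ _ that(3)])
      show "R (A t \<otimes> \<Phi> (rot p (b t, y)) \<otimes> inv (A t)) (A t \<otimes> \<Phi> (rot p' (b t, y)) \<otimes> inv (A t))"
        by (rule conj_commute[OF Ac[OF t] centre_closed centre_closed centres_commute]) (use that p' in auto)
      show "d (A t \<otimes> \<Phi> (rot p (b t, y)) \<otimes> inv (A t)) \<noteq> 0"
        using d_conj[OF Ac[OF t] centre_closed[OF that(2)]] centre_d[OF that(2)] by simp
    qed (use Ac[OF t] centre_closed[OF that(2)] centre_closed[OF p'] in auto)
  qed
  have "Q 1"
  proof (rule unit_interval_induct)
    have b0: "b 0 = S y" using b(2) by (simp add: pathstart_def)
    have "?sub 0 0 = (\<lambda>_. S y)" by (auto simp: subpath_def b0)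
    moreover have "(S y, y) \<in> U" using sec_W[OF y(2)] W_in_U by (auto simp: fib.sec_def)
    ultimately have "A 0 = T" using const[of "(S y, y)"] T by (simp add: A_def)
    then have "R z (A 0 \<otimes> \<Phi> (rot (S y, c) (b 0, y)) \<otimes> inv (A 0))"
      using R_comm[OF zc zc] by (simp add: z_def b0 fib.sec_def)
    with s0 show "Q 0" by (intro upgrade[of 0 "(S y, c)"]) (auto simp: b0 fib.sec_def)
  next
    fix t :: real assume t: "t \<in> {0..1}"
    obtain p where p: "centre (b t, y) p" using centre_exists[OF bU[OF t]] y(2) by auto
    \<comment> \<open>Near \<open>b t\<close> one continuous choice of centre works: the projection
      in the case of \<open>W\<close>, a fixed point in the case of \<open>B\<close>.\<close>
    have "\<exists>N P. open N \<and> b t \<in> N \<and> continuous_on UNIV P \<and> (\<forall>x. x \<in> N \<longrightarrow> (x, y) \<in> U \<longrightarrow> centre (x, y) (P x))"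
      using p
    proof (cases rule: centre_cases)
      case 1
      define N where "N = (\<Inter>i\<in>L. {x. cmod (fst i) * cmod (y - c) < cmod (x - (fst i * c + snd i))})"
      have "open N" unfolding N_def
        by (intro open_INT finite_L ballI open_Collect_less continuous_intros)
      moreover have "b t \<in> N" using 1(1) by (auto simp: W_def N_def)
      moreover have "centre (x, y) (x, c)" if "x \<in> N" for x
        using that y(2) by (auto simp: centre_def W_def N_def)
      moreover have "continuous_on UNIV (\<lambda>x. (x, c))" by (intro continuous_intros)
      ultimately show ?thesis by blast
    next
      case (2 a b')
      have "open {x. cmod (x - (a * c + b')) < 2 * de}" by (intro open_Collect_less continuous_intros)
      moreover have "b t \<in> {x. cmod (x - (a * c + b')) < 2 * de}" using 2(2) by (auto simp: B_def)
      moreover have "centre (x, y) (a * c + b', c)" if "cmod (x - (a * c + b')) < 2 * de" "(x, y) \<in> U" for x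
        using that y(2) 2(1) unfolding centre_def B_def by blast
      moreover have "continuous_on UNIV (\<lambda>x :: complex. (a * c + b', c))" by (intro continuous_intros)
      ultimately show ?thesis by (metis (no_types, lifting) mem_Collect_eq)
    qed
    then obtain N P where N: "open N" "b t \<in> N" and P: "continuous_on UNIV P"
      "\<And>x. x \<in> N \<Longrightarrow> (x, y) \<in> U \<Longrightarrow> centre (x, y) (P x)" by blast
    obtain r where r: "r > 0" "ball (b t) r \<subseteq> N" using N open_contains_ball by blast
    with t bc obtain e where e: "e > 0" "\<And>s. s \<in> {0..1} \<Longrightarrow> dist s t < e \<Longrightarrow> dist (b s) (b t) < r"
      unfolding continuous_on_iff by metis
    have inN: "b s \<in> N" if "s \<in> {0..1}" "\<bar>s - t\<bar> < e" for s
      using e(2)[of s] that r(2) by (auto simp: dist_real_def dist_commute subset_iff)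
    have "Q s'" if s: "s \<in> {0..1}" "s' \<in> {0..1}" "\<bar>s - t\<bar> < e" "\<bar>s' - t\<bar> < e" and Qs: "Q s" for s s'
    proof -
      let ?q = "\<lambda>a. (?sub s s' a, y)"
      define \<tau> where "\<tau> a = (s' - s) * a + s" for a
      have \<tau>: "\<tau> a \<in> {0..1}" "\<bar>\<tau> a - t\<bar> < e" if "a \<in> {0..1}" for a
      proof -
        have "\<tau> a \<in> closed_segment s s'" unfolding closed_segment_def
          using that by (intro CollectI exI[of _ a]) (auto simp: \<tau>_def algebra_simps)
        then show "\<tau> a \<in> {0..1}" "\<bar>\<tau> a - t\<bar> < e"
          using s by (auto simp: closed_segment_eq_real_ivl split: if_splits)
      qed
      have qa: "?q a = (b (\<tau> a), y)" for a by (simp add: subpath_def \<tau>_def)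
      have \<tau>c: "continuous_on {0..1} (\<lambda>a. b (\<tau> a))"
        by (rule continuous_on_compose2[OF bc]) (use \<tau> in \<open>auto simp: \<tau>_def intro!: continuous_intros\<close>)
      have cen: "centre (b (\<tau> a), y) (P (b (\<tau> a)))" if "a \<in> {0..1}" for a
        by (rule P(2)[OF inN bU]) (use \<tau>[OF that] in auto)
      have \<tau>01: "\<tau> 0 = s" "\<tau> 1 = s'" by (auto simp: \<tau>_def)
      have "\<Phi> (rot (P (b (\<tau> 0))) (b (\<tau> 0), y)) \<otimes> \<Phi> (\<lambda>a. (b (\<tau> a), y)) = \<Phi> (\<lambda>a. (b (\<tau> a), y)) \<otimes> \<Phi> (rot (P (b (\<tau> 1))) (b (\<tau> 1), y))"
        by (rule sweep[OF path_functor_axioms', where P = "\<lambda>a. P (b (\<tau> a))"])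
          (use cen centre_rot \<tau>c in \<open>auto intro!: continuous_on_compose2[OF P(1) \<tau>c] continuous_intros\<close>)
      then have sw: "\<Phi> (rot (P (b s)) (b s, y)) \<otimes> ?i (?sub s s') = ?i (?sub s s') \<otimes> \<Phi> (rot (P (b s')) (b s', y))"
        by (simp add: \<tau>01 qa[symmetric])
      have cs: "centre (b s, y) (P (b s))" "centre (b s', y) (P (b s'))"
        using cen[of 0] cen[of 1] by (simp_all add: \<tau>01)
      have As': "A s' = A s \<otimes> ?i (?sub s s')"
        using fb.subpath[OF b(1), of 0 s s'] s subc[of 0 s] subc[of s s'] T by (simp add: A_def m_assoc)
      note cl = Ac[OF s(1)] subc[OF s(1,2)] centre_closed[OF cs(1)] centre_closed[OF cs(2)]
      \<comment> \<open>Extending the tether by the piece from \<open>s\<close> to \<open>s'\<close>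
        is exactly compensated by \<open>sweep\<close>.\<close>
      have "A s' \<otimes> \<Phi> (rot (P (b s')) (b s', y)) \<otimes> inv (A s') =
          A s \<otimes> (?i (?sub s s') \<otimes> \<Phi> (rot (P (b s')) (b s', y))) \<otimes> inv (?i (?sub s s')) \<otimes> inv (A s)"
        unfolding As' using cl by (simp add: m_assoc inv_mult_group)
      also have "\<dots> = A s \<otimes> \<Phi> (rot (P (b s)) (b s, y)) \<otimes> inv (A s)"
        unfolding sw[symmetric] using cl by (simp add: m_assoc)
      finally have eq: "A s' \<otimes> \<Phi> (rot (P (b s')) (b s', y)) \<otimes> inv (A s') =
          A s \<otimes> \<Phi> (rot (P (b s)) (b s, y)) \<otimes> inv (A s)" .
      have "R z (A s' \<otimes> \<Phi> (rot (P (b s')) (b s', y)) \<otimes> inv (A s'))"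
        unfolding eq using Qs cs(1) unfolding Q_def by blast
      then show ?thesis by (rule upgrade[OF s(2) cs(2)])
    qed
    with e(1) show "\<exists>e>0. \<forall>s\<in>{0..1}. \<forall>s'\<in>{0..1}. \<bar>s - t\<bar> < e \<longrightarrow> \<bar>s' - t\<bar> < e \<longrightarrow> Q s \<longrightarrow> Q s'"
      by blast
  qed
  then have "R z (A 1 \<otimes> \<Phi> (rot p (b 1, y)) \<otimes> inv (A 1))"
    using p unfolding Q_def pathfinish_def by blast
  moreover have "b 1 = pathfinish b" by (simp add: pathfinish_def)
  moreover have "A 1 = T \<otimes> ?i b" by (simp add: A_def)
  ultimately have r: "R z ((T \<otimes> ?i b) \<otimes> \<Phi> (rot p (pathfinish b, y)) \<otimes> inv (T \<otimes> ?i b))" by simp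
  have "?i b \<in> carrier G" using fb.closed b(1) by blast
  then have "(T \<otimes> ?i b) \<otimes> \<Phi> (rot p (pathfinish b, y)) \<otimes> inv (T \<otimes> ?i b) =
      T \<otimes> (?i b \<otimes> \<Phi> (rot p (pathfinish b, y)) \<otimes> inv (?i b)) \<otimes> inv T"
    using T centre_closed[OF p] by (simp add: m_assoc inv_mult_group)
  with r show ?thesis unfolding z_def by (simp only:)
qed

text \<open>Generators of the fibre are lassos in discs of radius \<open>de\<close>; over a near
  height they stay within \<open>2 * de\<close> of \<open>a * c + b\<close>. There the rotation
  about that point commutes with the lasso's loop, and \<open>transport\<close> relates it to the
  rotation on the section.\<close>

lemma fibre_loops:
  assumes y: "y \<in> Y" "near y" and T: "T \<in> carrier G" and h: "h \<in> loops (fib.fibre y) (S y)"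
  shows "R (T \<otimes> \<Phi> (rot (S y, c) (sec y)) \<otimes> inv T) (T \<otimes> \<Phi> (\<lambda>t. (h t, y)) \<otimes> inv T)"
proof -
  let ?i = "\<lambda>h. \<Phi> (\<lambda>t. (h t, y))"
  interpret fb: path_functor G "fib.fibre y" ?i by (rule fibre_functor[OF y(1)])
  define z where "z = T \<otimes> \<Phi> (rot (S y, c) (sec y)) \<otimes> inv T"
  have s0: "centre (sec y) (S y, c)" using sec_W[OF y(2)] by (auto simp: centre_def fib.sec_def)
  have zc: "z \<in> carrier G" using T centre_closed[OF s0] by (simp add: z_def)
  let ?P = "(\<lambda>i. (case i of (a, b) \<Rightarrow> \<lambda>y. a * y + b) y) ` L"
  have Sy: "S y \<in> UNIV - ?P" using fib.S_off[OF _ y(1)] by auto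
  obtain k where k: "freely_generated TYPE('g) TYPE(unit) (UNIV - ?P) (S y) ?P de k"
    using freely_generated_punctured[of ?P UNIV "S y" de] finite_L Sy de by auto
  have fe: "UNIV - ?P = fib.fibre y" by (auto simp: fib.fibre_def)
  have gf: "path_functor G (fib.fibre y) (\<lambda>h. T \<otimes> ?i h \<otimes> inv T)"
    using fb.gauge[of "\<lambda>_. T"] T by simp
  have gen: "T \<otimes> ?i (k x) \<otimes> inv T \<in> {g \<in> carrier G. R z g}" if x: "x \<in> ?P" for x
  proof -
    obtain i where i: "i \<in> L" "x = (case i of (a, b) \<Rightarrow> \<lambda>y. a * y + b) y" using x by auto
    obtain a b where ab: "i = (a, b)" by (cases i)
    have L: "(a, b) \<in> L" and xe: "x = a * y + b" using i ab by auto
    from k x have "tethered (fib.fibre y) (S y) (ball x de) (k x)" unfolding freely_generated_def fe by blast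
    then obtain q m where q: "path_in (fib.fibre y) q" "pathstart q = S y"
      and m: "path_in (fib.fibre y \<inter> ball x de) m" "pathstart m = pathfinish q" "pathfinish m = pathfinish q"
      and kx: "k x = q +++ (m +++ reversepath q)" unfolding tethered_def by blast
    have mB: "(m t, y) \<in> B (a * c + b)" if "t \<in> {0..1}" for t
    proof -
      have mt: "m t \<in> fib.fibre y" "m t \<in> ball x de" using path_in_point[OF m(1) that] by auto
      have "m t - (a * c + b) = (m t - x) + a * (y - c)" by (simp add: xe algebra_simps)
      then have "cmod (m t - (a * c + b)) \<le> cmod (m t - x) + cmod a * cmod (y - c)"
        by (metis norm_mult norm_triangle_ineq)
      then have "cmod (m t - (a * c + b)) < 2 * de"
        using mt(2) slope'[OF L y(2)] by (simp add: dist_norm norm_minus_commute)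
      then show ?thesis using y(2) fibre_in_U[OF y(1) mt(1)] by (auto simp: B_def)
    qed
    let ?p = "(a * c + b, c)" and ?u = "(pathfinish q, y)"
    have m0: "m 0 = pathfinish q" "m 1 = pathfinish q" using m by (auto simp: pathstart_def pathfinish_def)
    have cen: "centre ?u ?p" using mB[of 0] L m0 unfolding centre_def by auto
    have mf: "path_in (fib.fibre y) m" using m by auto
    have mc: "continuous_on {0..1} m" using m by (simp add: path_def)
    have comm: "\<Phi> (rot ?p ?u) \<otimes> ?i m = ?i m \<otimes> \<Phi> (rot ?p ?u)"
    proof -
      have "continuous_on {0..1} (\<lambda>t. (m t, y))" by (intro continuous_intros mc)
      from sweep[OF path_functor_axioms' continuous_on_const this B_rot[OF L mB]] show ?thesis
        by (simp add: m0)
    qed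
    have cl: "?i q \<in> carrier G" "?i m \<in> carrier G" using fb.closed q mf by auto
    have ki: "?i (k x) = ?i q \<otimes> ?i m \<otimes> inv (?i q)"
      unfolding kx by (rule fb.conjugate[OF q(1) mf m(2,3)])
    have tr: "R z (T \<otimes> (?i q \<otimes> \<Phi> (rot ?p ?u) \<otimes> inv (?i q)) \<otimes> inv T)"
      unfolding z_def by (rule transport[OF y T q cen])
    have eq: "T \<otimes> (?i q \<otimes> g \<otimes> inv (?i q)) \<otimes> inv T = (T \<otimes> ?i q) \<otimes> g \<otimes> inv (T \<otimes> ?i q)" if "g \<in> carrier G" for g
      using that T cl by (simp add: m_assoc inv_mult_group)
    have Tq: "T \<otimes> ?i q \<in> carrier G" using T cl by simp
    note cc = centre_closed[OF cen]
    have "R z (T \<otimes> (?i q \<otimes> ?i m \<otimes> inv (?i q)) \<otimes> inv T)"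
    proof (rule R_trans[OF zc _ _ tr])
      show "R (T \<otimes> (?i q \<otimes> \<Phi> (rot ?p ?u) \<otimes> inv (?i q)) \<otimes> inv T) (T \<otimes> (?i q \<otimes> ?i m \<otimes> inv (?i q)) \<otimes> inv T)"
        unfolding eq[OF cc] eq[OF cl(2)] by (rule conj_commute[OF Tq cc cl(2) comm])
      show "d (T \<otimes> (?i q \<otimes> \<Phi> (rot ?p ?u) \<otimes> inv (?i q)) \<otimes> inv T) \<noteq> 0"
        unfolding eq[OF cc] d_conj[OF Tq cc] by (rule centre_d[OF cen])
    qed (use T cl cc in auto)
    then show ?thesis using T cl unfolding ki by simp
  qed
  have "generates TYPE('g) (fib.fibre y) (S y) (k ` ?P)" using k unfolding freely_generated_def fe by blast
  then have "T \<otimes> ?i h \<otimes> inv T \<in> {g \<in> carrier G. R z g}"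
  proof (rule generatesD[where \<Phi> = "\<lambda>h. T \<otimes> ?i h \<otimes> inv T" and q = h, OF _ gf subgroup_R[OF zc] _ h])
    fix q assume "q \<in> k ` ?P"
    then obtain x where q: "q = k x" and x: "x \<in> ?P" by (rule imageE)
    show "T \<otimes> ?i q \<otimes> inv T \<in> {g \<in> carrier G. R z g}" unfolding q by (rule gen[OF x])
  qed
  then show ?thesis by (simp add: z_def)
qed

text \<open>Along the section the projection to \<open>y = c\<close> is always an admissible centre,
  so the rotation returns to itself and commutes with the loop.\<close>

lemma base_loops:
  assumes T: "T \<in> carrier G" and k: "path k" "path_image k \<subseteq> {y. near y}" "pathfinish k = pathstart k"
  shows "R (T \<otimes> \<Phi> (rot (S (pathstart k), c) (sec (pathstart k))) \<otimes> inv T) (T \<otimes> \<Phi> (sec \<circ> k) \<otimes> inv T)"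
proof -
  have kn: "near (k t)" if "t \<in> {0..1}" for t using path_in_point[where A = "{y. near y}" and p = k] k that by simp
  have kc: "continuous_on {0..1} k" using k by (simp add: path_def)
  have Sk: "continuous_on {0..1} (\<lambda>t. S (k t))" unfolding S_def by (intro continuous_intros kc)
  have sc: "continuous_on {0..1} (sec \<circ> k)" unfolding fib.sec_def comp_def by (intro continuous_intros kc Sk)
  have s0: "centre (sec (k t)) (S (k t), c)" if "t \<in> {0..1}" for t
    using sec_W[OF kn[OF that]] by (auto simp: centre_def fib.sec_def)
  have comm: "\<Phi> (rot (S (k 0), c) (sec (k 0))) \<otimes> \<Phi> (sec \<circ> k) = \<Phi> (sec \<circ> k) \<otimes> \<Phi> (rot (S (k 1), c) (sec (k 1)))"
  proof -
    have "continuous_on {0..1} (\<lambda>t. (S (k t), c))" by (intro continuous_intros Sk)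
    from sweep[OF path_functor_axioms' this sc] centre_rot[OF s0] show ?thesis by simp
  qed
  have k01: "k 0 = pathstart k" "k 1 = pathstart k" using k(3) by (auto simp: pathstart_def pathfinish_def)
  have "path_in U (sec \<circ> k)"
    using sc sec_W kn W_in_U by (auto simp: path_def path_image_def)
  then have cl: "\<Phi> (sec \<circ> k) \<in> carrier G" using closed by blast
  show ?thesis
    by (rule conj_commute[OF T _ cl]) (use comm s0[of 0] centre_closed in \<open>auto simp: k01\<close>)
qed

lemma base_d: "T \<in> carrier G \<Longrightarrow> near y \<Longrightarrow> d (T \<otimes> \<Phi> (rot (S y, c) (sec y)) \<otimes> inv T) \<noteq> 0 \<and>
    T \<otimes> \<Phi> (rot (S y, c) (sec y)) \<otimes> inv T \<in> carrier G"
proof -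
  assume T: "T \<in> carrier G" and "near y"
  then have s0: "centre (sec y) (S y, c)" using sec_W by (auto simp: centre_def fib.sec_def)
  show ?thesis using d_conj[OF T centre_closed[OF s0]] centre_d[OF s0] centre_closed[OF s0] T by simp
qed

end

section \<open>From neighbourhoods of single horizontal lines to the whole group\<close>

context std_arrangement
begin

lemma local_data: "c \<in> E \<Longrightarrow> \<exists>de ep. std_local G E L \<Phi> d R c de ep"
proof -
  assume c: "c \<in> E"
  \<comment> \<open>The minimum of \<open>D\<close> is to be \<open>4 * de\<close>; the entry 4
    covers the case that all graphs meet \<open>y = c\<close> in one point.\<close>
  define D where "D = insert 4 ((\<lambda>((a, b), (a', b')). cmod ((a * c + b) - (a' * c + b'))) `
      {((a, b), (a', b')) \<in> L \<times> L. a * c + b \<noteq> a' * c + b'})"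
  have D: "finite D" "\<And>r. r \<in> D \<Longrightarrow> r > 0"
    unfolding D_def using finite_L
    by (auto intro!: finite_imageI intro: finite_subset[of _ "L \<times> L"])
  define de where "de = Min D / 4"
  have "Min D \<in> D" using D by (intro Min_in) (auto simp: D_def)
  then have de: "de > 0" using D(2) by (simp add: de_def)
  \<comment> \<open>The entries bound \<open>ep\<close> by 1, by
    \<open>de / (2 * (cmod a + 1))\<close> to make \<open>cmod a * ep\<close> smaller than
    \<open>de\<close>, and by the distances to the other horizontal lines.\<close>
  define H where "H = insert 1 ((\<lambda>(a, b). de / (2 * (cmod a + 1))) ` L \<union> (\<lambda>e. cmod (e - c)) ` (E - {c}))"
  have H: "finite H" "\<And>r. r \<in> H \<Longrightarrow> r > 0"
    unfolding H_def using finite_L finite_E de by (auto intro!: divide_pos_pos add_nonneg_pos)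
  define ep where "ep = Min H"
  have "Min H \<in> H" using H by (intro Min_in) (auto simp: H_def)
  then have ep: "ep > 0" using H(2) by (simp add: ep_def)
  have le: "ep \<le> r" if "r \<in> H" for r using H(1) that by (simp add: ep_def)
  have "std_local G E L \<Phi> d R c de ep"
  proof (unfold_locales)
    show "ep \<le> 1" by (rule le) (simp add: H_def)
    fix a b a' b' assume "(a, b) \<in> L" "(a', b') \<in> L" "a * c + b \<noteq> a' * c + b'"
    then have "cmod ((a * c + b) - (a' * c + b')) \<in> D"
      unfolding D_def by (intro insertI2 image_eqI[of _ _ "((a, b), (a', b'))"]) auto
    then show "4 * de \<le> cmod ((a * c + b) - (a' * c + b'))" using D(1) by (simp add: de_def)
  next
    fix a b assume "(a, b) \<in> L"
    then have "de / (2 * (cmod a + 1)) \<in> H"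
      unfolding H_def by (intro insertI2 UnI1 image_eqI[of _ _ "(a, b)"]) auto
    then have "cmod a * ep \<le> cmod a * (de / (2 * (cmod a + 1)))" by (intro mult_left_mono le) auto
    also have "\<dots> = de * (cmod a / (2 * (cmod a + 1)))" by simp
    also have "\<dots> < de * 1"
    proof (rule mult_strict_left_mono[OF _ de])
      have "cmod a < 2 * (cmod a + 1)" using norm_ge_zero[of a] by (simp add: add_nonneg_pos)
      then show "cmod a / (2 * (cmod a + 1)) < 1" by (simp add: add_nonneg_pos divide_less_eq_1_pos)
    qed
    finally show "cmod a * ep < de" by simp
  next
    fix e assume "e \<in> E" "e \<noteq> c"
    then show "ep \<le> cmod (e - c)" by (intro le) (auto simp: H_def)
  qed (use c de ep in auto)
  then show ?thesis by blast
qed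

text \<open>The circle through the section encloses all punctures of the fibre. Being the rotation
  about \<open>(0, y)\<close>, it winds once around every graph and not at all around horizontal
  lines; \<open>L_ne\<close> makes its \<open>d\<close> nonzero.\<close>

lemma big_circle:
  assumes "y \<in> Y"
  shows "(\<lambda>t. cis_turn t * S y) \<in> loops (fib.fibre y) (S y)"
    "d (\<Phi> (\<lambda>t. (cis_turn t * S y, y))) \<noteq> 0"
proof -
  have eq: "(\<lambda>t. (cis_turn t * S y, y)) = rot (0, y) (sec y)"
    by (auto simp: rot_def fib.sec_def)
  have lt: "cmod (a * y + b) < cmod (S y)" if "(a, b) \<in> L" for a b by (rule S_avoids[OF that])
  have ym: "cmod (- (a * y) - b) = cmod (a * y + b)" for a b
    by (metis add.commute minus_add_distrib norm_minus_cancel uminus_add_conv_diff add_uminus_conv_diff)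
  have yE: "y \<notin> E" using assms by (simp add: Y_def)
  have "cmod (y - c) \<noteq> 0" if "c \<in> E" for c using yE that by auto
  then have rt: "rotatable F (0, y) (sec y)"
    unfolding rotatable_std using lt ym by (force simp: fib.sec_def)
  obtain a b where ab: "(a, b) \<in> L" using L_ne by fast
  have "total_winding F (rot (0, y) (sec y)) \<noteq> 0"
    by (rule total_winding_rot_nonzero[OF rt finite_F, of "(1, - a, b)"])
      (use ab lt[OF ab] ym in \<open>auto simp: std_lines_def lin_def fib.sec_def\<close>)
  then show "d (\<Phi> (\<lambda>t. (cis_turn t * S y, y))) \<noteq> 0"
    unfolding eq using d_loop[OF path_in_rot[OF rt]] by (simp add: rot_ends)
  have "cis_turn t * S y \<in> fib.fibre y" for t
  proof -
    have "cis_turn t * S y \<noteq> a * y + b" if "(a, b) \<in> L" for a b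
    proof
      assume "cis_turn t * S y = a * y + b"
      then have "cmod (cis_turn t * S y) = cmod (a * y + b)" by simp
      with lt[OF that] show False by (simp add: norm_mult cis_turn)
    qed
    then show ?thesis by (auto simp: fib.fibre_def)
  qed
  then show "(\<lambda>t. cis_turn t * S y) \<in> loops (fib.fibre y) (S y)"
    unfolding loops_iff path_in_iff
    by (auto simp: pathstart_def pathfinish_def cis_turn intro!: continuous_intros cis_turn)
qed

lemma sec_path: "path_in Y q \<Longrightarrow> path_in V (sec \<circ> q)"
  by (rule path_in_compose[OF _ fib.cont_sec]) (use fib.sec_total in auto)

lemma fibre_path: "y \<in> Y \<Longrightarrow> path_in (fib.fibre y) h \<Longrightarrow> path_in V (\<lambda>t. (h t, y))"
  using path_in_compose[where S = "fib.fibre y" and p = h and f = "\<lambda>x. (x, y)" and T = V] fib.fibre_incl[of y]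
  by (simp add: comp_def continuous_intros)

text \<open>Normality of the fibre group: a fibre loop conjugated by a path on the section projects
  to a contractible loop, so its decomposition has only a fibre part.\<close>

lemma fibre_transport:
  assumes y: "y \<in> Y" and q: "path_in Y q" "pathstart q = y" and h: "h \<in> loops (fib.fibre y) (S y)"
  shows "\<exists>h'\<in>loops (fib.fibre (pathfinish q)) (S (pathfinish q)).
    \<Phi> (\<lambda>t. (h t, y)) = \<Phi> (sec \<circ> q) \<otimes> \<Phi> (\<lambda>t. (h' t, pathfinish q)) \<otimes> inv (\<Phi> (sec \<circ> q))"
proof -
  interpret v: path_functor G V \<Phi> by (rule V_functor)
  let ?z = "pathfinish q" and ?h = "\<lambda>t. (h t, y)"
  have z: "?z \<in> Y" using q by auto
  have sq: "path_in V (sec \<circ> q)" "pathstart (sec \<circ> q) = sec y" "pathfinish (sec \<circ> q) = sec ?z"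
    using sec_path[OF q(1)] q by (auto simp: pathstart_compose pathfinish_compose)
  have hp: "path_in V ?h" "pathstart ?h = sec y" "pathfinish ?h = sec y"
    using fibre_path[OF y, of h] h by (auto simp: loops_iff fib.sec_def pathstart_def pathfinish_def)
  define p where "p = reversepath (sec \<circ> q) +++ (?h +++ (sec \<circ> q))"
  have p: "path_in V p" "pathstart p = sec ?z" "pathfinish p = sec ?z"
    unfolding p_def using sq hp by (auto simp: path_image_join)
  obtain h' where h': "path_in (fib.fibre ?z) h'" "pathstart h' = S ?z" "pathfinish h' = S ?z"
      "\<Phi> p = \<Phi> (sec \<circ> (snd \<circ> p)) \<otimes> \<Phi> (\<lambda>t. (h' t, ?z))"
    using fib.path_decomposition[OF V_functor p(1,2) z] p(3) by (auto simp: fib.sec_def)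
  define T where "T = \<Phi> (sec \<circ> q)"
  have T: "T \<in> carrier G" unfolding T_def using v.closed sq by blast
  have hc: "\<Phi> ?h \<in> carrier G" using v.closed hp by blast
  have Pp: "\<Phi> p = inv T \<otimes> (\<Phi> ?h \<otimes> T)"
    unfolding p_def T_def using sq hp by (simp add: v.join v.reverse path_image_join)
  have ss: "sec \<circ> (snd \<circ> (sec \<circ> r)) = sec \<circ> r" for r by (auto simp: fib.sec_def)
  \<comment> \<open>Projected to the section, the fibre loop becomes constant, and only a path and
    its reverse remain.\<close>
  have "sec \<circ> (snd \<circ> p) = reversepath (sec \<circ> q) +++ ((\<lambda>_. sec y) +++ (sec \<circ> q))"
    unfolding p_def by (auto simp: joinpaths_def reversepath_def fib.sec_def fun_eq_iff)
  moreover have cy: "path_in V (\<lambda>_. sec y)" using fib.sec_total[OF y] by (rule path_in_const)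
  moreover have "pathstart (\<lambda>_::real. sec y) = sec y" "pathfinish (\<lambda>_::real. sec y) = sec y"
    by (simp_all add: pathstart_def pathfinish_def)
  ultimately have "\<Phi> (sec \<circ> (snd \<circ> p)) = inv T \<otimes> (\<Phi> (\<lambda>_. sec y) \<otimes> T)"
    unfolding T_def using sq by (simp add: v.join v.reverse path_image_join)
  then have "\<Phi> (sec \<circ> (snd \<circ> p)) = \<one>" using v.const[OF fib.sec_total[OF y]] T by simp
  moreover have h'c: "\<Phi> (\<lambda>t. (h' t, ?z)) \<in> carrier G"
    using v.closed fibre_path[OF z h'(1)] by blast
  ultimately have "\<Phi> (\<lambda>t. (h' t, ?z)) = inv T \<otimes> (\<Phi> ?h \<otimes> T)" using h'(4) Pp by simp
  then have "T \<otimes> \<Phi> (\<lambda>t. (h' t, ?z)) \<otimes> inv T = \<Phi> ?h" using T hc by (simp add: m_assoc cancel_left)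
  then show ?thesis using h' unfolding T_def by (intro bexI[of _ h']) (auto simp: loops_iff)
qed

text \<open>One rotation \<open>z0\<close> near a horizontal line is related to all fibre loops and
  all section loops, hence to all their products. As \<open>d z0\<close> is nonzero, any two
  elements are related through it.\<close>

theorem R_total:
  assumes x: "x \<in> U" and surj: "\<And>g. g \<in> carrier G \<Longrightarrow> \<exists>q\<in>loops U x. \<Phi> q = g"
  shows "(\<forall>g\<in>carrier G. \<forall>h\<in>carrier G. R g h) \<and> (\<exists>g\<in>carrier G. d g \<noteq> 0)"
proof -
  obtain DE EP where loc: "\<And>c. c \<in> E \<Longrightarrow> std_local G E L \<Phi> d R c (DE c) (EP c)"
    using local_data by metis
  have EP: "EP c > 0" if "c \<in> E" for c using std_local.ep(1)[OF loc[OF that]] .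
  obtain c0 where c0: "c0 \<in> E" using E_ne by blast
  interpret l0: std_local G E L \<Phi> d R c0 "DE c0" "EP c0" by (rule loc[OF c0])
  interpret v: path_functor G V \<Phi> by (rule V_functor)
  have fin: "finite (E \<union> crit)" using finite_E finite_crit by simp
  have "uncountable (ball c0 (EP c0) - (E \<union> crit))"
    by (rule uncountable_minus_countable) (use uncountable_ball[OF EP[OF c0]] countable_finite[OF fin] in blast)+
  then obtain y0 where y0: "y0 \<in> ball c0 (EP c0)" "y0 \<notin> E \<union> crit"
    by (metis countable_empty equals0I Diff_iff)
  have yY: "y0 \<in> Y" using y0 by (simp add: Y_def)
  have near0: "l0.near y0" using y0 c0 by (auto simp: l0.near_def dist_norm norm_minus_commute)
  define z0 where "z0 = \<one> \<otimes> \<Phi> (rot (S y0, c0) (sec y0)) \<otimes> inv \<one>"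
  have z0: "z0 \<in> carrier G" "d z0 \<noteq> 0" using l0.base_d[OF one_closed near0] by (auto simp: z0_def)
  have Rz1: "R z0 \<one>" using z0 by (intro R_comm) auto
  have fibre0: "R z0 (\<Phi> (\<lambda>t. (h t, y0)))" if "h \<in> loops (fib.fibre y0) (S y0)" for h
  proof -
    have "path_in V (\<lambda>t. (h t, y0))" using fibre_path[OF yY] that by (auto simp: loops_iff)
    then have "\<Phi> (\<lambda>t. (h t, y0)) \<in> carrier G" using v.closed by blast
    then show ?thesis using l0.fibre_loops[OF yY near0 one_closed that] by (simp add: z0_def)
  qed
  \<comment> \<open>This circle is the bridge between horizontal lines: it is a fibre loop over
    \<open>y0\<close> and, transported, also over heights near any other line.\<close>
  define h0 where "h0 = (\<lambda>t. cis_turn t * S y0)"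
  define g0 where "g0 = \<Phi> (\<lambda>t. (h0 t, y0))"
  have h0: "h0 \<in> loops (fib.fibre y0) (S y0)" and g0d: "d g0 \<noteq> 0"
    using big_circle[OF yY] by (auto simp: h0_def g0_def)
  have g0: "g0 \<in> carrier G" "R z0 g0"
    using v.closed fibre_path[OF yY, of h0] h0 fibre0 by (auto simp: g0_def loops_iff)
  \<comment> \<open>Discs of radius \<open>e\<close> around heights of \<open>E\<close> fit into the
    neighbourhoods of the local analysis, and those around critical heights outside \<open>E\<close>
    miss \<open>E\<close>.\<close>
  define K where "K = insert 1 (EP ` E \<union> (\<lambda>(n, c). cmod (n - c)) ` ((crit - E) \<times> E))"
  have K: "finite K" "\<And>r. r \<in> K \<Longrightarrow> r > 0" unfolding K_def using finite_E finite_crit EP by auto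
  define e where "e = Min K"
  have "Min K \<in> K" using K by (intro Min_in) (auto simp: K_def)
  then have e: "e > 0" using K(2) by (simp add: e_def)
  have e_le: "e \<le> r" if "r \<in> K" for r using K(1) that by (simp add: e_def)
  obtain k where k: "freely_generated TYPE('g) TYPE(unit) (UNIV - (E \<union> crit)) y0 (E \<union> crit) e k"
    using freely_generated_punctured[OF fin open_UNIV convex_UNIV subset_UNIV _ e, of y0] y0 by blast
  have YU: "UNIV - (E \<union> crit) = Y" by (auto simp: Y_def)
  have YE: "Y \<subseteq> - E" by (auto simp: Y_def)
  interpret sE: path_functor G "- E" "\<lambda>q. \<Phi> (sec \<circ> q)" by (rule sec_functor)
  interpret sY: path_functor G Y "\<lambda>q. \<Phi> (sec \<circ> q)" by (rule sE.subset[OF YE])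
  have gen: "\<Phi> (sec \<circ> k p) \<in> {g \<in> carrier G. R z0 g}" if p: "p \<in> E \<union> crit" for p
  proof -
    have "tethered Y y0 (ball p e) (k p)" using k p unfolding freely_generated_def YU by blast
    then obtain q m where q: "path_in Y q" "pathstart q = y0"
      and m: "path_in (Y \<inter> ball p e) m" "pathstart m = pathfinish q" "pathfinish m = pathfinish q"
      and kp: "k p = q +++ (m +++ reversepath q)" unfolding tethered_def by blast
    have mY: "path_in Y m" using m by auto
    define T where "T = \<Phi> (sec \<circ> q)"
    have T: "T \<in> carrier G" and mc: "\<Phi> (sec \<circ> m) \<in> carrier G" unfolding T_def using sY.closed q mY by auto
    have val: "\<Phi> (sec \<circ> k p) = T \<otimes> \<Phi> (sec \<circ> m) \<otimes> inv T"
      unfolding kp T_def by (rule sY.conjugate[OF q(1) mY m(2,3)])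
    have "R z0 (T \<otimes> \<Phi> (sec \<circ> m) \<otimes> inv T)"
    proof (cases "p \<in> E")
      case False
      have "ball p e \<subseteq> - E"
      proof
        fix w assume w: "w \<in> ball p e"
        show "w \<in> - E"
        proof
          assume "w \<in> E"
          then have "cmod (p - w) \<in> K" using False p unfolding K_def by auto
          from e_le[OF this] w show False by (simp add: dist_norm)
        qed
      qed
      \<comment> \<open>The section extends over this critical height, so the loop contracts in a
        disc.\<close>
      then have "\<Phi> (sec \<circ> m) = \<one>"
        by (rule sE.null[OF convex_ball]) (use m in auto)
      then show ?thesis using Rz1 T by simp
    next
      case True
      interpret l: std_local G E L \<Phi> d R p "DE p" "EP p" by (rule loc[OF True])
      have eEP: "e \<le> EP p" by (rule e_le) (use True in \<open>auto simp: K_def\<close>)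
      have nearm: "path_image m \<subseteq> {y. l.near y}"
      proof
        fix w assume "w \<in> path_image m"
        then have "w \<in> Y" "w \<in> ball p e" using m(1) by auto
        then show "w \<in> {y. l.near y}" using eEP True
          by (auto simp: l.near_def Y_def dist_norm norm_minus_commute)
      qed
      have near1: "l.near (pathstart m)" using nearm by auto
      define z where "z = T \<otimes> \<Phi> (rot (S (pathstart m), p) (sec (pathstart m))) \<otimes> inv T"
      have z: "z \<in> carrier G" "d z \<noteq> 0" using l.base_d[OF T near1] by (auto simp: z_def)
      have r1: "R z (T \<otimes> \<Phi> (sec \<circ> m) \<otimes> inv T)"
        unfolding z_def by (rule l.base_loops[OF T _ nearm]) (use m in auto)
      have mst: "pathstart m = pathfinish q" by (rule m(2))
      obtain h' where h': "h' \<in> loops (fib.fibre (pathfinish q)) (S (pathfinish q))"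
          "g0 = T \<otimes> \<Phi> (\<lambda>t. (h' t, pathfinish q)) \<otimes> inv T"
        using fibre_transport[OF yY q h0] unfolding g0_def T_def by blast
      have fY: "pathfinish q \<in> Y" using q by auto
      have "R z g0" unfolding z_def h'(2) mst
        by (rule l.fibre_loops[OF fY _ T h'(1)]) (use near1 mst in simp)
      \<comment> \<open>The chain is \<open>z0\<close>, the circle \<open>g0\<close>, then the
        rotation \<open>z\<close> near the line at height \<open>p\<close>; both inner elements have
        nonzero \<open>d\<close>.\<close>
      then have "R g0 z" by (rule R_sym[OF z(1) g0(1)])
      from R_trans[OF z0(1) g0(1) z(1) g0(2) this g0d]
      show ?thesis by (intro R_trans[OF z0(1) z(1) _ _ r1 z(2)]) (use T mc in simp_all)
    qed
    then show ?thesis unfolding val using T mc by simp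
  qed
  have base0: "R z0 (\<Phi> (sec \<circ> q))" if "q \<in> loops Y y0" for q
  proof -
    have "generates TYPE('g) Y y0 (k ` (E \<union> crit))" using k unfolding freely_generated_def YU by blast
    then have "\<Phi> (sec \<circ> q) \<in> {g \<in> carrier G. R z0 g}"
    proof (rule generatesD[where \<Phi> = "\<lambda>q. \<Phi> (sec \<circ> q)" and q = q, OF _ sY.path_functor_axioms' subgroup_R[OF z0(1)] _ that])
      fix r assume "r \<in> k ` (E \<union> crit)"
      then obtain p where r: "r = k p" and p: "p \<in> E \<union> crit" by (rule imageE)
      show "\<Phi> (sec \<circ> r) \<in> {g \<in> carrier G. R z0 g}" unfolding r by (rule gen[OF p])
    qed
    then show ?thesis by simp
  qed
  have all: "R z0 g" if g: "g \<in> carrier G" for g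
  proof -
    have PF: "proper_lines F" by (rule proper_std_lines[OF finite_E finite_L])
    have PF': "proper_lines ((\<lambda>c. (0, 1, c)) ` crit)" using finite_crit by (auto simp: proper_lines_def)
    have u0: "sec y0 \<in> V" by (rule fib.sec_total[OF yY])
    have "path_connected U" using path_connected_diff_lines[OF PF open_UNIV convex_UNIV] by simp
    then obtain w where w: "path_in U w" "pathstart w = x" "pathfinish w = sec y0"
      using x u0 V_sub unfolding path_connected_def by blast
    define T where "T = \<Phi> w"
    have T: "T \<in> carrier G" unfolding T_def using closed w by blast
    obtain q where q: "q \<in> loops U x" "\<Phi> q = T \<otimes> g \<otimes> inv T" using surj[of "T \<otimes> g \<otimes> inv T"] T g by auto
    have qp: "path_in U q" "pathstart q = x" "pathfinish q = x" using q by (auto simp: loops_iff)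
    \<comment> \<open>Moving the base point conjugates by \<open>T\<close>; this is why a loop with
      value \<open>T \<otimes> g \<otimes> inv T\<close> was taken.\<close>
    define q1 where "q1 = reversepath w +++ (q +++ w)"
    have q1: "q1 \<in> loops U (sec y0)" unfolding q1_def using w qp by (simp add: loops_iff path_image_join)
    have "\<Phi> q1 = inv T \<otimes> ((T \<otimes> g \<otimes> inv T) \<otimes> T)"
      unfolding q1_def T_def using w qp q(2) by (simp add: join reverse path_image_join T_def)
    then have q1g: "\<Phi> q1 = g" using T g by (simp add: m_assoc cancel_left)
    obtain q2 where q2: "q2 \<in> loops V (sec y0)" "\<Phi> q2 = g"
      using loop_avoiding_more_lines[OF path_functor_axioms' PF PF' _ q1] u0 q1g unfolding V_eq by blast
    have q2p: "path_in V q2" "pathstart q2 = sec y0" "pathfinish q2 = sec y0" using q2 by (auto simp: loops_iff)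
    obtain h where h: "path_in (fib.fibre y0) h" "pathstart h = S y0" "pathfinish h = S y0"
      "\<Phi> q2 = \<Phi> (sec \<circ> (snd \<circ> q2)) \<otimes> \<Phi> (\<lambda>t. (h t, y0))"
      using fib.path_decomposition[OF V_functor q2p(1,2) yY] q2p(3) by (auto simp: fib.sec_def)
    have sV: "snd ` V \<subseteq> Y" by (auto simp: fib.total_def)
    have b: "snd \<circ> q2 \<in> loops Y y0" unfolding loops_iff
      using path_in_compose[OF q2p(1), where f = snd and T = Y] sV q2p(2,3)
      by (auto simp: pathstart_compose pathfinish_compose fib.sec_def continuous_intros)
    have bc: "\<Phi> (sec \<circ> (snd \<circ> q2)) \<in> carrier G" using b sY.closed by (auto simp: loops_iff)
    have hl: "h \<in> loops (fib.fibre y0) (S y0)" using h by (simp add: loops_iff)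
    have hc: "\<Phi> (\<lambda>t. (h t, y0)) \<in> carrier G" using v.closed fibre_path[OF yY h(1)] by blast
    have "R z0 (\<Phi> (sec \<circ> (snd \<circ> q2)) \<otimes> \<Phi> (\<lambda>t. (h t, y0)))"
      by (rule R_mult[OF z0(1) bc hc base0[OF b] fibre0[OF hl]])
    then show ?thesis using h(4) q2(2) by simp
  qed
  have "R g h" if "g \<in> carrier G" "h \<in> carrier G" for g h
    by (rule R_trans[OF that(1) z0(1) that(2) R_sym[OF z0(1) that(1) all[OF that(1)]] all[OF that(2)] z0(2)])
  with z0 show ?thesis by blast
qed

end

subsection \<open>Arrangement groups\<close>

text \<open>Homotopy invariance makes the choice of representative immaterial; this is how a functor
  descends to the fundamental group.\<close>

definition class_value :: "((real \<Rightarrow> 'a) \<Rightarrow> 'h) \<Rightarrow> (real \<Rightarrow> 'a) set \<Rightarrow> 'h" where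
  "class_value \<Psi> X = \<Psi> (SOME p. p \<in> X)"

lemma (in path_functor) class_value:
  assumes "path_in S p"
  shows "class_value \<Phi> (path_class S p) = \<Phi> p"
proof -
  have "p \<in> path_class S p" using assms by (simp add: path_class_def)
  then have "(SOME q. q \<in> path_class S p) \<in> path_class S p" by (rule someI[of "\<lambda>q. q \<in> path_class S p"])
  then show ?thesis unfolding class_value_def by (metis homotopic mem_Collect_eq path_class_def)
qed

lemma (in path_functor) class_value_hom: "class_value \<Phi> \<in> hom (fundamental_group S x) G"
proof (rule homI)
  fix X assume "X \<in> carrier (fundamental_group S x)"
  then obtain p where "p \<in> loops S x" "X = path_class S p" by (auto simp: carrier_fundamental_group)
  then show "class_value \<Phi> X \<in> carrier G" using class_value closed by (auto simp: loops_iff)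
next
  fix X Z assume "X \<in> carrier (fundamental_group S x)" "Z \<in> carrier (fundamental_group S x)"
  then obtain p q where p: "p \<in> loops S x" "X = path_class S p" and q: "q \<in> loops S x" "Z = path_class S q"
    by (auto simp: carrier_fundamental_group)
  have *: "path_in S p" "path_in S q" "pathfinish p = pathstart q" using p q by (auto simp: loops_iff)
  show "class_value \<Phi> (X \<otimes>\<^bsub>fundamental_group S x\<^esub> Z) = class_value \<Phi> X \<otimes> class_value \<Phi> Z"
    unfolding p(2) q(2) fundamental_group_mult[OF *] class_value[OF *(1)] class_value[OF *(2)]
      class_value[OF path_in_join[OF *]] by (rule join[OF *])
qed

lemma tethers_exist:
  fixes U :: "'a::real_normed_vector set"
  assumes "path_connected U" "x \<in> U"
  obtains tr where "\<And>u. u \<in> U \<Longrightarrow> path_in U (tr u) \<and> pathstart (tr u) = x \<and> pathfinish (tr u) = u"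
    "tr x = (\<lambda>_. x)"
proof -
  have "\<exists>p. path_in U p \<and> pathstart p = x \<and> pathfinish p = u" if "u \<in> U" for u
    using assms that unfolding path_connected_def by blast
  then obtain t where t: "\<And>u. u \<in> U \<Longrightarrow> path_in U (t u) \<and> pathstart (t u) = x \<and> pathfinish (t u) = u" by metis
  define tr where "tr u = (if u = x then (\<lambda>_. x) else t u)" for u
  have "path_in U (tr u) \<and> pathstart (tr u) = x \<and> pathfinish (tr u) = u" if "u \<in> U" for u
    using t[OF that] path_in_const[OF assms(2)] by (auto simp: tr_def pathstart_def pathfinish_def)
  moreover have "tr x = (\<lambda>_. x)" by (simp add: tr_def)
  ultimately show ?thesis using that by blast
qed

text \<open>Abstracts the relations "\<open>g\<close> and \<open>h\<close> have commuting images" for a homomorphism into a group in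
  which the image of \<open>h\<close> has a commutative centralizer whenever \<open>d h\<close> is nonzero.\<close>

definition commutation_like :: "('g, 'm) monoid_scheme \<Rightarrow> ('g \<Rightarrow> complex) \<Rightarrow> ('g \<Rightarrow> 'g \<Rightarrow> bool) \<Rightarrow> bool" where
  "commutation_like G d R \<longleftrightarrow>
    (\<forall>g\<in>carrier G. \<forall>h\<in>carrier G. g \<otimes>\<^bsub>G\<^esub> h = h \<otimes>\<^bsub>G\<^esub> g \<longrightarrow> R g h) \<and>
    (\<forall>g\<in>carrier G. \<forall>h\<in>carrier G. R g h \<longrightarrow> R h g \<and> R g (inv\<^bsub>G\<^esub> h)) \<and>
    (\<forall>g\<in>carrier G. \<forall>h\<in>carrier G. \<forall>k\<in>carrier G. R g h \<longrightarrow> R g k \<longrightarrow> R g (h \<otimes>\<^bsub>G\<^esub> k)) \<and>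
    (\<forall>g\<in>carrier G. \<forall>h\<in>carrier G. \<forall>k\<in>carrier G. R g h \<longrightarrow> R h k \<longrightarrow> d h \<noteq> 0 \<longrightarrow> R g k)"

lemma line_coordinates:
  assumes "line_arrangement A"
  obtains co where "\<And>l. l \<in> A \<Longrightarrow> (fst (co l), fst (snd (co l))) \<noteq> (0, 0) \<and> l = {v. lin (co l) v = 0}"
proof -
  have "\<exists>f. (fst f, fst (snd f)) \<noteq> (0, 0) \<and> l = {v. lin f v = 0}" if "l \<in> A" for l
  proof -
    have "affine_line l" using assms that by (simp add: line_arrangement_def)
    then obtain a b c where abc: "(a, b) \<noteq> (0, 0)" "l = {(x, y). a * x + b * y = c}"
      unfolding affine_line_def by (elim exE conjE)
    have "l = {v. lin (a, b, c) v = 0}" unfolding abc(2) by (auto simp: lin_def)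
    with abc(1) show ?thesis by (intro exI[of _ "(a, b, c)"]) simp
  qed
  then have "\<exists>co. \<forall>l\<in>A. (fst (co l), fst (snd (co l))) \<noteq> (0, 0) \<and> l = {v. lin (co l) v = 0}"
    by (intro bchoice ballI)
  then show ?thesis using that by blast
qed

lemma complement_lines:
  assumes "line_arrangement A"
    and "\<And>l. l \<in> A \<Longrightarrow> (fst (co l), fst (snd (co l))) \<noteq> (0, 0) \<and> l = {v. lin (co l) v = 0}"
  shows "proper_lines (co ` A)" "- \<Union>A = line_complement (co ` A)"
  using assms unfolding proper_lines_def line_arrangement_def line_complement_lin
  by (auto simp: case_prod_beta)

text \<open>The linear parts differ by a factor \<open>k\<close>. A translation along
  \<open>(cnj a, cnj b)\<close>, the direction conjugate to the form, adjusts the constant.\<close>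

lemma parallel_if_proportional:
  assumes f: "(fst f, fst (snd f)) \<noteq> (0, 0)" and g: "(fst g, fst (snd g)) \<noteq> (0, 0)"
    and pro: "fst g * fst (snd f) = fst (snd g) * fst f"
  shows "parallel {v. lin f v = 0} {v. lin g v = 0}"
proof -
  obtain a b c where fe: "f = (a, b, c)" by (cases f)
  obtain a' b' c' where ge: "g = (a', b', c')" by (cases g)
  have nz: "(a, b) \<noteq> (0, 0)" "(a', b') \<noteq> (0, 0)" "a' * b = b' * a" using f g pro by (auto simp: fe ge)
  obtain k where k: "k \<noteq> 0" "a' = k * a" "b' = k * b"
  proof (cases "a = 0")
    case True
    then have b: "b \<noteq> 0" using nz by simp
    then have "a' = 0" using nz(3) True by simp
    with b nz True show ?thesis by (intro that[of "b' / b"]) auto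
  next
    case False
    then have eq: "b' = a' / a * b" using nz(3) by (simp add: field_simps)
    have "a' \<noteq> 0"
    proof
      assume "a' = 0"
      with eq have "b' = 0" by simp
      with \<open>a' = 0\<close> nz(2) show False by simp
    qed
    with False eq show ?thesis by (intro that[of "a' / a"]) simp_all
  qed
  define N where "N = a * cnj a + b * cnj b"
  have "N = of_real ((cmod a)\<^sup>2 + (cmod b)\<^sup>2)" by (simp only: N_def of_real_add complex_norm_square)
  then have N: "N \<noteq> 0" using nz(1) by (simp only: of_real_eq_0_iff sum_power2_eq_zero_iff) auto
  define q where "q = (c' / k - c) / N"
  define v where "v = (q * cnj a, q * cnj b)"
  have "a * fst v + b * snd v = q * N" by (simp add: v_def N_def algebra_simps)
  then have v: "a * fst v + b * snd v = c' / k - c" using N by (simp add: q_def)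
  have iff: "lin g w = 0 \<longleftrightarrow> lin f (w - v) = 0" for w
  proof -
    have "lin g w = k * (a * fst w + b * snd w - c' / k)" using k by (simp add: lin_def ge algebra_simps)
    also have "a * fst w + b * snd w - c' / k = lin f (w - v)" using v by (simp add: lin_def fe algebra_simps)
    finally show ?thesis using k(1) by simp
  qed
  have "{v. lin g v = 0} = (+) v ` {v. lin f v = 0}"
  proof (rule equalityI; rule subsetI)
    fix w assume "w \<in> {v. lin g v = 0}"
    then have "w - v \<in> {v. lin f v = 0}" by (simp only: mem_Collect_eq iff)
    then show "w \<in> (+) v ` {v. lin f v = 0}" by (intro image_eqI[of _ _ "w - v"]) simp_all
  next
    fix w assume "w \<in> (+) v ` {v. lin f v = 0}"
    then obtain u where "w = v + u" "lin f u = 0" by blast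
    then have "lin f (w - v) = 0" by simp
    then show "w \<in> {v. lin g v = 0}" by (simp only: mem_Collect_eq iff)
  qed
  then show ?thesis unfolding parallel_def by blast
qed

text \<open>In coordinates whose second one is the form of \<open>l\<close>, the parallels of
  \<open>l\<close> become horizontal and all other lines become graphs over the second coordinate;
  \<open>m\<close> provides at least one graph.\<close>

theorem nonparallel_commutation:
  assumes A: "line_arrangement A" and l: "l \<in> A" and m: "m \<in> A" and np: "\<not> parallel l m"
    and x: "x \<notin> \<Union>A" and G: "G = arrangement_group A x"
  shows "\<exists>d. d \<in> hom G add_group \<and> (\<forall>g\<in>carrier G. d g \<in> \<int>) \<and> (\<exists>g\<in>carrier G. d g \<noteq> 0) \<and>
    (\<forall>R. commutation_like G d R \<longrightarrow> (\<forall>g\<in>carrier G. \<forall>h\<in>carrier G. R g h))"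
proof -
  obtain co where co: "\<And>l. l \<in> A \<Longrightarrow> (fst (co l), fst (snd (co l))) \<noteq> (0, 0) \<and> l = {v. lin (co l) v = 0}"
    using line_coordinates[OF A] by blast
  define W where "W = - \<Union>A"
  have W: "proper_lines (co ` A)" "W = line_complement (co ` A)"
    unfolding W_def by (rule complement_lines[OF A co]; assumption)+
  have GW: "G = fundamental_group W x" by (simp add: G arrangement_group_def W_def)
  have xW: "x \<in> W" using x by (simp add: W_def)
  have pcW: "path_connected W"
    using path_connected_diff_lines[OF W(1) open_UNIV convex_UNIV] W(2) by simp
  obtain a b c where col: "co l = (a, b, c)" by (cases "co l")
  define N where "N = a * cnj a + b * cnj b"
  have "N = of_real ((cmod a)\<^sup>2 + (cmod b)\<^sup>2)" by (simp only: N_def of_real_add complex_norm_square)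
  then have N: "N \<noteq> 0" using co[OF l] col by (simp only: of_real_eq_0_iff sum_power2_eq_zero_iff) auto
  \<comment> \<open>The first coordinate is chosen conjugate to the form of \<open>l\<close>, so
    that the determinant is \<open>- N\<close> and hence nonzero.\<close>
  define f where "f v = (- cnj b * fst v + cnj a * snd v, a * fst v + b * snd v)" for v
  define g where "g w = ((cnj a * snd w - b * fst w) / N, (cnj b * snd w + a * fst w) / N)" for w
  have fg: "f (g w) = w" for w
  proof -
    have "- cnj b * ((cnj a * snd w - b * fst w) / N) + cnj a * ((cnj b * snd w + a * fst w) / N) = (N * fst w) / N"
      by (simp add: N_def algebra_simps diff_divide_distrib add_divide_distrib)
    moreover have "a * ((cnj a * snd w - b * fst w) / N) + b * ((cnj b * snd w + a * fst w) / N) = (N * snd w) / N"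
      by (simp add: N_def algebra_simps diff_divide_distrib add_divide_distrib)
    ultimately show ?thesis using N by (simp add: f_def g_def)
  qed
  have gf: "g (f v) = v" for v
  proof -
    have "cnj a * (a * fst v + b * snd v) - b * (- cnj b * fst v + cnj a * snd v) = N * fst v"
      "cnj b * (a * fst v + b * snd v) + a * (- cnj b * fst v + cnj a * snd v) = N * snd v"
      by (simp_all add: N_def algebra_simps)
    then show ?thesis using N by (simp add: f_def g_def)
  qed
  \<comment> \<open>The coefficients of the form of \<open>t\<close> in the new coordinates;
    \<open>D t\<close> vanishes exactly for the lines parallel to \<open>l\<close>.\<close>
  define D P where "D t = (fst (snd (co t)) * a - fst (co t) * b) / N"
    and "P t = (fst (co t) * cnj a + fst (snd (co t)) * cnj b) / N" for t
  have lin_g: "lin (co t) (g w) = D t * fst w + P t * snd w - snd (snd (co t))" for t w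
    by (simp add: lin_def g_def D_def P_def algebra_simps diff_divide_distrib add_divide_distrib)
  have DP: "D t \<noteq> 0 \<or> P t \<noteq> 0" if "t \<in> A" for t
  proof (rule ccontr)
    assume "\<not> (D t \<noteq> 0 \<or> P t \<noteq> 0)"
    then have "lin (co t) (g w) = - snd (snd (co t))" for w by (simp add: lin_g)
    then have const: "lin (co t) v = - snd (snd (co t))" for v by (metis gf)
    from const[of "(1, 0)"] const[of "(0, 1)"] co[OF that] show False by (auto simp: lin_def)
  qed
  define E where "E = (\<lambda>t. snd (snd (co t)) / P t) ` {t \<in> A. D t = 0}"
  define L where "L = (\<lambda>t. (- P t / D t, snd (snd (co t)) / D t)) ` {t \<in> A. D t \<noteq> 0}"
  have finA: "finite A" using A by (simp add: line_arrangement_def)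
  have fin: "finite E" "finite L" using finA by (auto simp: E_def L_def)
  have "D l = 0" using N by (simp add: D_def col)
  then have Ene: "E \<noteq> {}" using l by (auto simp: E_def)
  have "D m \<noteq> 0"
  proof
    assume "D m = 0"
    then have "fst (co m) * fst (snd (co l)) = fst (snd (co m)) * fst (co l)" using N by (simp add: D_def col)
    then have "parallel {v. lin (co l) v = 0} {v. lin (co m) v = 0}"
      using parallel_if_proportional[of "co l" "co m"] co[OF l] co[OF m] by blast
    moreover have "l = {v. lin (co l) v = 0}" "m = {v. lin (co m) v = 0}" using co l m by blast+
    ultimately show False using np by simp
  qed
  then have Lne: "L \<noteq> {}" using m by (auto simp: L_def)
  let ?U = "line_complement (std_lines E L)"
  have mem: "g w \<in> W \<longleftrightarrow> w \<in> ?U" for w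
  proof -
    have "g w \<in> W \<longleftrightarrow> (\<forall>t\<in>A. D t * fst w + P t * snd w - snd (snd (co t)) \<noteq> 0)"
      unfolding W(2) line_complement_lin by (simp add: lin_g)
    also have "\<dots> \<longleftrightarrow> (\<forall>t\<in>A. if D t = 0 then snd w \<noteq> snd (snd (co t)) / P t
        else fst w \<noteq> - P t / D t * snd w + snd (snd (co t)) / D t)"
    proof (rule ball_cong[OF refl])
      fix t assume t: "t \<in> A"
      show "(D t * fst w + P t * snd w - snd (snd (co t)) \<noteq> 0) = (if D t = 0 then snd w \<noteq> snd (snd (co t)) / P t
        else fst w \<noteq> - P t / D t * snd w + snd (snd (co t)) / D t)"
        using DP[OF t] by (cases "D t = 0") (auto simp: field_simps add_eq_0_iff)
    qed
    also have "\<dots> \<longleftrightarrow> w \<in> ?U" unfolding in_std_complement E_def L_def by auto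
    finally show ?thesis .
  qed
  have gc: "continuous_on S g" and fc: "continuous_on S f" for S
    unfolding g_def f_def by (intro continuous_intros; use N in simp)+
  have gU: "g ` ?U \<subseteq> W" using mem by blast
  have fW: "f ` W \<subseteq> ?U" using mem gf by (metis image_subsetI)
  obtain tr where tr: "\<And>u. u \<in> W \<Longrightarrow> path_in W (tr u) \<and> pathstart (tr u) = x \<and> pathfinish (tr u) = u"
    "tr x = (\<lambda>_. x)" using tethers_exist[OF pcW xW] by blast
  interpret val: path_functor G W "path_value W tr" unfolding GW by (rule path_functor_path_value[OF xW tr(1)])
  define \<Phi> where "\<Phi> q = path_value W tr (g \<circ> q)" for q
  have \<Phi>f: "path_functor G ?U \<Phi>" unfolding \<Phi>_def by (rule val.compose[OF gc gU])
  let ?F = "std_lines E L"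
  interpret tw: path_functor add_group ?U "total_winding ?F" by (rule path_functor_total_winding)
  interpret twf: path_functor add_group W "\<lambda>q. total_winding ?F (f \<circ> q)" by (rule tw.compose[OF fc fW])
  define d where "d = class_value (\<lambda>q. total_winding ?F (f \<circ> q))"
  have dhom: "d \<in> hom G add_group" unfolding d_def GW by (rule twf.class_value_hom)
  have dcl: "d (path_class W q) = total_winding ?F (f \<circ> q)" if "path_in W q" for q
    unfolding d_def by (rule twf.class_value[OF that])
  \<comment> \<open>For a loop both tethers are the same path, and the commutative target cancels
    them.\<close>
  have dloop: "d (\<Phi> q) = total_winding ?F q" if q: "path_in ?U q" "pathstart q = pathfinish q" for q
  proof -
    define r where "r = g \<circ> q"
    have r: "path_in W r" unfolding r_def by (rule path_in_compose[OF q(1) gc gU])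
    have re: "pathstart r = pathfinish r" using q(2) by (simp add: r_def pathstart_compose pathfinish_compose)
    have t: "path_in W (tr (pathfinish r))" "pathfinish (tr (pathfinish r)) = pathfinish r"
      using tr(1)[of "pathfinish r"] r by auto
    have "d (\<Phi> q) = total_winding ?F (f \<circ> (tr (pathfinish r) +++ (r +++ reversepath (tr (pathfinish r)))))"
      unfolding \<Phi>_def path_value_def r_def[symmetric] re
      by (rule dcl) (use t r re in \<open>auto simp: path_image_join\<close>)
    also have "\<dots> = total_winding ?F (f \<circ> r)"
      using twf.conjugate[OF t(1) r] t re by simp
    also have "f \<circ> r = q" by (auto simp: r_def fg)
    finally show ?thesis .
  qed
  have surj: "\<exists>q\<in>loops ?U (f x). \<Phi> q = X" if X: "X \<in> carrier G" for X
  proof -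
    obtain q where q: "q \<in> loops W x" "X = path_class W q" using X by (auto simp: GW carrier_fundamental_group)
    have "g \<circ> (f \<circ> q) = q" by (auto simp: gf)
    then have "\<Phi> (f \<circ> q) = X" using path_value_loop[where tr = tr, OF q(1) tr(2)] q(2) by (simp add: \<Phi>_def)
    moreover have "f \<circ> q \<in> loops ?U (f x)"
      using q(1) path_in_compose[OF _ fc fW] by (auto simp: loops_iff pathstart_compose pathfinish_compose)
    ultimately show ?thesis by blast
  qed
  have dint: "d X \<in> \<int>" if X: "X \<in> carrier G" for X
  proof -
    obtain q where q: "q \<in> loops ?U (f x)" "\<Phi> q = X" using surj[OF X] by blast
    have qp: "path_in ?U q" "pathstart q = f x" "pathfinish q = f x" using q by (auto simp: loops_iff)
    have "winding_number (lin h \<circ> q) 0 \<in> \<int>" if "h \<in> ?F" for h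
    proof (rule integer_winding_number)
      show "path (lin h \<circ> q)" by (rule path_continuous_image[OF _ continuous_lin]) (use qp in simp)
      show "pathfinish (lin h \<circ> q) = pathstart (lin h \<circ> q)" using qp by (simp add: pathstart_compose pathfinish_compose)
      show "0 \<notin> path_image (lin h \<circ> q)" using qp(1) that by (auto simp: path_image_compose line_complement_lin)
    qed
    then have "total_winding ?F q \<in> \<int>" unfolding total_winding_def by (rule Ints_sum)
    then show ?thesis using dloop[OF qp(1)] qp q(2) by simp
  qed
  have arr: "std_arrangement G E L \<Phi> d R" if "commutation_like G d R" for R
  proof -
    note c = that[unfolded commutation_like_def]
    note c1 = c[THEN conjunct1, rule_format] and c2 = c[THEN conjunct2, THEN conjunct1, rule_format]
      and c3 = c[THEN conjunct2, THEN conjunct2, THEN conjunct1, rule_format]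
      and c4 = c[THEN conjunct2, THEN conjunct2, THEN conjunct2, rule_format]
    have "std_arrangement_axioms G E L \<Phi> d R"
    proof
      show "d (X \<otimes>\<^bsub>G\<^esub> Z) = d X + d Z" if "X \<in> carrier G" "Z \<in> carrier G" for X Z
        using hom_mult[OF dhom that] by simp
    qed (fact fin Ene Lne dloop c1 c2[THEN conjunct1] c2[THEN conjunct2] c3 c4)+
    with \<Phi>f show ?thesis by (rule std_arrangement.intro)
  qed
  have fx: "f x \<in> ?U" using fW xW by blast
  \<comment> \<open>The relation that always holds is a legitimate instance, and it already yields
    an element with nonzero \<open>d\<close>.\<close>
  have "commutation_like G d (\<lambda>_ _. True)" by (simp add: commutation_like_def)
  from std_arrangement.R_total[OF arr[OF this] fx surj] have "\<exists>X\<in>carrier G. d X \<noteq> 0" by simp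
  moreover have "\<forall>X\<in>carrier G. \<forall>Z\<in>carrier G. R X Z" if "commutation_like G d R" for R
    using std_arrangement.R_total[OF arr[OF that] fx surj] by blast
  ultimately show ?thesis using dhom dint by blast
qed

section \<open>Free groups\<close>

definition word_eval :: "('h, 'm) monoid_scheme \<Rightarrow> ('x \<Rightarrow> 'h) \<Rightarrow> ('x \<times> bool) list \<Rightarrow> 'h" where
  "word_eval H h w = foldr (\<lambda>(x, b) y. (if b then h x else inv\<^bsub>H\<^esub> (h x)) \<otimes>\<^bsub>H\<^esub> y) w \<one>\<^bsub>H\<^esub>"

lemma word_eval_simps [simp]:
  "word_eval H h [] = \<one>\<^bsub>H\<^esub>"
  "word_eval H h ((x, b) # w) = (if b then h x else inv\<^bsub>H\<^esub> (h x)) \<otimes>\<^bsub>H\<^esub> word_eval H h w"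
  by (simp_all add: word_eval_def)

lemma word_value_eval: "word_value G w = word_eval G (\<lambda>x. x) w"
  by (simp add: word_value_def word_eval_def)

text \<open>Left multiplication by a letter in the free group, on reduced words: the only possible
  cancellation is with the first letter.\<close>

definition push_letter :: "'x \<times> bool \<Rightarrow> ('x \<times> bool) list \<Rightarrow> ('x \<times> bool) list" where
  "push_letter l w = (case w of [] \<Rightarrow> [l] | m # v \<Rightarrow> if fst m = fst l \<and> snd m \<noteq> snd l then v else l # w)"

lemma reduced_Cons2_iff:
  "(x, b) # (y, c) # v \<in> reduced_words X \<longleftrightarrow>
    x \<in> X \<and> (y, c) # v \<in> reduced_words X \<and> (x = y \<longrightarrow> b = c)"
  unfolding reduced_words_def mem_Collect_eq successively.simps
  by simp (rule iffI; elim conjE; intro conjI; assumption)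

lemma reduced_Cons_iff:
  "(x, b) # w \<in> reduced_words X \<longleftrightarrow>
    x \<in> X \<and> w \<in> reduced_words X \<and> (case w of [] \<Rightarrow> True | m # v \<Rightarrow> x = fst m \<longrightarrow> b = snd m)"
proof (cases w)
  case Nil
  show ?thesis unfolding Nil by (simp add: reduced_words_def)
next
  case (Cons m v)
  show ?thesis unfolding Cons list.case
    by (rule reduced_Cons2_iff[of x b "fst m" "snd m" v X, unfolded prod.collapse])
qed

lemma Nil_reduced [simp]: "[] \<in> reduced_words X"
  by (simp add: reduced_words_def)

lemma push_letter_reduced:
  assumes "x \<in> X" "w \<in> reduced_words X"
  shows "push_letter (x, b) w \<in> reduced_words X"
proof (cases w)
  case Nil
  show ?thesis unfolding Nil push_letter_def list.case using assms(1) by (simp add: reduced_Cons_iff)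
next
  case (Cons m v)
  show ?thesis
  proof (cases "fst m = x \<and> snd m \<noteq> b")
    case True
    have "v \<in> reduced_words X"
      using assms(2) reduced_Cons_iff[of "fst m" "snd m" v X] unfolding Cons prod.collapse by (elim iffE) blast
    with True show ?thesis unfolding Cons push_letter_def list.case fst_conv snd_conv by (simp only: if_True simp_thms)
  next
    case False
    then have "push_letter (x, b) w = (x, b) # w"
      unfolding Cons push_letter_def list.case fst_conv snd_conv by (simp only: if_False)
    moreover have "(x, b) # w \<in> reduced_words X"
      using assms False reduced_Cons_iff[of x b w X] unfolding Cons list.case by metis
    ultimately show ?thesis by (simp only:)
  qed
qed

lemma push_letter_Cons:
  assumes "(x, b) # w \<in> reduced_words X"
  shows "push_letter (x, b) w = (x, b) # w"
proof (cases w)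
  case (Cons m v)
  have "x = fst m \<longrightarrow> b = snd m"
    using assms reduced_Cons_iff[of x b w X] unfolding Cons list.case by metis
  then show ?thesis unfolding Cons push_letter_def list.case fst_conv snd_conv by (metis (full_types))
qed (simp add: push_letter_def)

lemma push_letter_cancel:
  assumes "w \<in> reduced_words X"
  shows "push_letter (x, b) (push_letter (x, \<not> b) w) = w"
proof (cases w)
  case (Cons m v)
  obtain y c where m: "m = (y, c)" by (cases m)
  show ?thesis
  proof (cases "y = x \<and> c = b")
    case True
    then have "push_letter (x, b) v = (x, b) # v"
      using assms push_letter_Cons[of x b v X] by (simp add: Cons m)
    with True show ?thesis by (simp add: push_letter_def[of "(x, \<not> b)"] Cons m)
  next
    case False
    then have "push_letter (x, \<not> b) w = (x, \<not> b) # w"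
      by (auto simp: push_letter_def Cons m)
    then show ?thesis by (simp add: push_letter_def)
  qed
qed (simp add: push_letter_def)

context group
begin

lemma word_eval_closed: "h ` X \<subseteq> carrier G \<Longrightarrow> fst ` set w \<subseteq> X \<Longrightarrow> word_eval G h w \<in> carrier G"
  by (induction w) (auto simp: image_subset_iff)

lemma word_eval_reduced_closed:
  "h ` X \<subseteq> carrier G \<Longrightarrow> w \<in> reduced_words X \<Longrightarrow> word_eval G h w \<in> carrier G"
  by (rule word_eval_closed) (auto simp: reduced_words_def)

lemma word_eval_push_letter:
  assumes "h ` X \<subseteq> carrier G" "x \<in> X" "w \<in> reduced_words X"
  shows "word_eval G h (push_letter (x, b) w) = (if b then h x else inv (h x)) \<otimes> word_eval G h w"
proof (cases "\<exists>v. w = (x, \<not> b) # v")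
  case True
  then obtain v where w: "w = (x, \<not> b) # v" ..
  have "word_eval G h v \<in> carrier G" "h x \<in> carrier G"
    using assms w word_eval_reduced_closed by (auto simp: reduced_Cons_iff)
  then show ?thesis unfolding w push_letter_def by (cases b) (simp_all add: m_assoc[symmetric])
next
  case False
  then have "push_letter (x, b) w = (x, b) # w" by (auto simp: push_letter_def split: list.splits prod.splits)
  then show ?thesis by simp
qed

end

text \<open>The reduced word of an element is evaluated in \<open>H\<close>. Multiplicativity is
  proved one letter at a time through \<open>push_letter\<close>, so concatenated words never have
  to be normalised.\<close>

lemma free_basis_universal:
  assumes G: "group G" and X: "free_basis G X" and H: "group H" and h: "h ` X \<subseteq> carrier H"
  shows "\<exists>\<theta>\<in>hom G H. \<forall>x\<in>X. \<theta> x = h x"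
proof -
  interpret G: group G by fact
  interpret H: group H by fact
  have XG: "X \<subseteq> carrier G" and bij: "bij_betw (word_value G) (reduced_words X) (carrier G)"
    using X by (auto simp: free_basis_def)
  have XG': "(\<lambda>x. x) ` X \<subseteq> carrier G" using XG by auto
  define \<theta> where "\<theta> g = word_eval H h (inv_into (reduced_words X) (word_value G) g)" for g
  have val: "\<theta> (word_value G w) = word_eval H h w" if "w \<in> reduced_words X" for w
    using bij_betw_inv_into_left[OF bij that] by (simp add: \<theta>_def)
  have rep: "\<exists>w\<in>reduced_words X. g = word_value G w" if "g \<in> carrier G" for g
    using bij that by (auto simp: bij_betw_def)
  have closed: "\<theta> g \<in> carrier H" if "g \<in> carrier G" for g
    using rep[OF that] val H.word_eval_reduced_closed[OF h] by auto
  have step: "\<theta> ((if b then x else inv\<^bsub>G\<^esub> x) \<otimes>\<^bsub>G\<^esub> g) = (if b then h x else inv\<^bsub>H\<^esub> (h x)) \<otimes>\<^bsub>H\<^esub> \<theta> g"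
    if x: "x \<in> X" and g: "g \<in> carrier G" for x b g
  proof -
    obtain w where w: "w \<in> reduced_words X" "g = word_value G w" using rep[OF g] by blast
    have "(if b then x else inv\<^bsub>G\<^esub> x) \<otimes>\<^bsub>G\<^esub> g = word_value G (push_letter (x, b) w)"
      using G.word_eval_push_letter[OF XG' x w(1), of b] by (simp add: word_value_eval w(2))
    then have "\<theta> ((if b then x else inv\<^bsub>G\<^esub> x) \<otimes>\<^bsub>G\<^esub> g) = word_eval H h (push_letter (x, b) w)"
      using val[OF push_letter_reduced[OF x w(1)]] by simp
    also have "\<dots> = (if b then h x else inv\<^bsub>H\<^esub> (h x)) \<otimes>\<^bsub>H\<^esub> word_eval H h w"
      by (rule H.word_eval_push_letter[OF h x w(1)])
    finally show ?thesis by (simp only: w(2) val[OF w(1)])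
  qed
  have mult: "\<theta> (word_eval G (\<lambda>x. x) u \<otimes>\<^bsub>G\<^esub> g) = word_eval H h u \<otimes>\<^bsub>H\<^esub> \<theta> g"
    if "g \<in> carrier G" "fst ` set u \<subseteq> X" for u g
    using that(2)
  proof (induction u)
    case Nil
    then show ?case using that(1) closed by simp
  next
    case (Cons l u)
    obtain x b where l: "l = (x, b)" by (cases l)
    have x: "x \<in> X" "x \<in> carrier G" "h x \<in> carrier H" and u: "fst ` set u \<subseteq> X" using Cons.prems XG h l by auto
    have c: "word_eval G (\<lambda>x. x) u \<in> carrier G" "word_eval H h u \<in> carrier H"
      using G.word_eval_closed[OF XG' u] H.word_eval_closed[OF h u] by auto
    have "\<theta> (word_eval G (\<lambda>x. x) (l # u) \<otimes>\<^bsub>G\<^esub> g)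
        = \<theta> ((if b then x else inv\<^bsub>G\<^esub> x) \<otimes>\<^bsub>G\<^esub> (word_eval G (\<lambda>x. x) u \<otimes>\<^bsub>G\<^esub> g))"
      unfolding l using x c that(1) by (simp add: G.m_assoc)
    also have "\<dots> = (if b then h x else inv\<^bsub>H\<^esub> (h x)) \<otimes>\<^bsub>H\<^esub> (word_eval H h u \<otimes>\<^bsub>H\<^esub> \<theta> g)"
      using step[OF x(1), of "word_eval G (\<lambda>x. x) u \<otimes>\<^bsub>G\<^esub> g" b] Cons.IH[OF u] c that(1) by simp
    also have "\<dots> = word_eval H h (l # u) \<otimes>\<^bsub>H\<^esub> \<theta> g"
      unfolding l using x c closed[OF that(1)] by (simp add: H.m_assoc)
    finally show ?case .
  qed
  have "\<theta> \<in> hom G H"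
  proof (rule homI)
    fix g k assume g: "g \<in> carrier G" and k: "k \<in> carrier G"
    obtain w where w: "w \<in> reduced_words X" "g = word_value G w" using rep[OF g] by blast
    have "fst ` set w \<subseteq> X" using w(1) by (auto simp: reduced_words_def)
    from mult[OF k this] show "\<theta> (g \<otimes>\<^bsub>G\<^esub> k) = \<theta> g \<otimes>\<^bsub>H\<^esub> \<theta> k"
      using val[OF w(1)] by (simp add: w(2) word_value_eval)
  qed (rule closed)
  moreover have "\<theta> x = h x" if x: "x \<in> X" for x
  proof -
    have "[(x, True)] \<in> reduced_words X" using x by (simp add: reduced_Cons_iff)
    moreover have "x \<in> carrier G" "h x \<in> carrier H" using x XG h by auto
    ultimately show ?thesis using val[of "[(x, True)]"] by (simp add: word_value_eval)
  qed
  ultimately show ?thesis by blast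
qed

lemma hom_eq_on_basis:
  assumes G: "group G" and X: "free_basis G X" and H: "group H"
    and f: "f \<in> hom G H" and f': "f' \<in> hom G H" and eq: "\<And>x. x \<in> X \<Longrightarrow> f x = f' x" and g: "g \<in> carrier G"
  shows "f g = f' g"
proof -
  interpret G: group G by fact
  interpret f: group_hom G H f using G H f by (simp add: group_hom_def group_hom_axioms_def)
  interpret f': group_hom G H f' using G H f' by (simp add: group_hom_def group_hom_axioms_def)
  have XG: "X \<subseteq> carrier G" using X by (simp add: free_basis_def)
  then have XG': "(\<lambda>x. x) ` X \<subseteq> carrier G" by auto
  obtain w where w: "w \<in> reduced_words X" "g = word_eval G (\<lambda>x. x) w"
    using X g by (auto simp: free_basis_def bij_betw_def word_value_eval)
  have "f (word_eval G (\<lambda>x. x) u) = f' (word_eval G (\<lambda>x. x) u)" if "fst ` set u \<subseteq> X" for u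
    using that
  proof (induction u)
    case (Cons l u)
    obtain x b where l: "l = (x, b)" by (cases l)
    have x: "x \<in> X" "x \<in> carrier G" "word_eval G (\<lambda>x. x) u \<in> carrier G" 
      using Cons.prems XG l G.word_eval_closed[OF XG', of u] by auto
    then show ?case unfolding l using Cons eq by simp
  qed simp
  moreover have "fst ` set w \<subseteq> X" using w(1) by (auto simp: reduced_words_def)
  ultimately show ?thesis using w(2) by simp
qed

section \<open>The permutation action on reduced words\<close>

definition perm_group :: "('a \<Rightarrow> 'a) monoid" where
  "perm_group = \<lparr>carrier = {f. bij f}, mult = (\<circ>), one = id\<rparr>"

lemma group_perm_group: "group (perm_group :: ('a \<Rightarrow> 'a) monoid)"
proof (rule groupI)
  fix f :: "'a \<Rightarrow> 'a" assume "f \<in> carrier perm_group"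
  then have "bij f" by (simp add: perm_group_def)
  then show "\<exists>g\<in>carrier perm_group. g \<otimes>\<^bsub>perm_group\<^esub> f = \<one>\<^bsub>perm_group\<^esub>"
    by (intro bexI[of _ "inv_into UNIV f"]) (auto simp: perm_group_def bij_imp_bij_inv bij_is_inj)
qed (auto simp: perm_group_def bij_comp)

text \<open>The identity off the reduced words makes each letter a bijection of the whole type of
  words.\<close>

definition letter_perm :: "'x set \<Rightarrow> 'x \<times> bool \<Rightarrow> ('x \<times> bool) list \<Rightarrow> ('x \<times> bool) list" where
  "letter_perm X l w = (if w \<in> reduced_words X then push_letter l w else w)"

lemma letter_perm_cancel: "x \<in> X \<Longrightarrow> letter_perm X (x, b) \<circ> letter_perm X (x, \<not> b) = id"
  by (auto simp: letter_perm_def fun_eq_iff push_letter_reduced push_letter_cancel)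

lemma letter_perm_group:
  assumes "x \<in> X"
  shows "letter_perm X (x, b) \<in> carrier perm_group"
    "inv\<^bsub>perm_group\<^esub> (letter_perm X (x, True)) = letter_perm X (x, False)"
proof -
  have c: "letter_perm X (x, b) \<in> carrier perm_group" for b
    using letter_perm_cancel[OF assms, of b] letter_perm_cancel[OF assms, of "\<not> b"]
    by (auto simp: perm_group_def intro: o_bij)
  then show "letter_perm X (x, b) \<in> carrier perm_group" .
  interpret group "perm_group :: (('a \<times> bool) list \<Rightarrow> _) monoid" by (rule group_perm_group)
  show "inv\<^bsub>perm_group\<^esub> (letter_perm X (x, True)) = letter_perm X (x, False)"
    by (rule inv_equality[OF _ c c]) (use letter_perm_cancel[OF assms, of False] in \<open>simp add: perm_group_def\<close>)
qed

text \<open>The permutation action on reduced words recovers a reduced word from its value.\<close>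

lemma free_basisI:
  assumes G: "group G" and X: "X \<subseteq> carrier G"
    and gen: "\<And>J. subgroup J G \<Longrightarrow> X \<subseteq> J \<Longrightarrow> carrier G \<subseteq> J"
    and \<theta>: "\<theta> \<in> hom G perm_group" "\<And>x. x \<in> X \<Longrightarrow> \<theta> x = letter_perm X (x, True)"
  shows "free_basis G X"
proof -
  interpret G: group G by fact
  interpret \<theta>: group_hom G perm_group \<theta>
    using G group_perm_group \<theta>(1) by (simp add: group_hom_def group_hom_axioms_def)
  have X': "(\<lambda>x. x) ` X \<subseteq> carrier G" using X by auto
  \<comment> \<open>Acting on the empty word, a reduced word is rebuilt letter by letter without
    cancellation; so its value determines it.\<close>
  have act: "\<theta> (word_eval G (\<lambda>x. x) w) [] = w" if "w \<in> reduced_words X" for w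
    using that
  proof (induction w)
    case Nil
    then show ?case by (simp add: perm_group_def)
  next
    case (Cons l w)
    obtain x b where l: "l = (x, b)" by (cases l)
    have x: "x \<in> X" "w \<in> reduced_words X" using Cons.prems by (auto simp: l reduced_Cons_iff)
    have c: "x \<in> carrier G" "word_eval G (\<lambda>x. x) w \<in> carrier G"
      using x X G.word_eval_reduced_closed[OF X' x(2)] by auto
    have "\<theta> (if b then x else inv\<^bsub>G\<^esub> x) = letter_perm X (x, b)"
      using \<theta>(2)[OF x(1)] letter_perm_group(2)[OF x(1)] c by simp
    moreover have e: "(if b then x else inv\<^bsub>G\<^esub> x) \<in> carrier G" using c by simp
    ultimately have "\<theta> (word_eval G (\<lambda>x. x) (l # w)) [] = letter_perm X (x, b) w"
      using \<theta>.hom_mult[OF e c(2)] Cons.IH[OF x(2)]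
      by (simp add: l perm_group_def split del: if_split)
    then show ?case using push_letter_Cons[of x b w X] Cons.prems x(2) by (simp add: l letter_perm_def)
  qed
  have inj: "inj_on (word_value G) (reduced_words X)"
    by (rule inj_on_inverseI[of _ "\<lambda>g. \<theta> g []"]) (simp add: word_value_eval act)
  let ?J = "word_value G ` reduced_words X"
  have sub: "?J \<subseteq> carrier G" using G.word_eval_reduced_closed[OF X'] by (auto simp: word_value_eval)
  have lett: "(if b then x else inv\<^bsub>G\<^esub> x) \<otimes>\<^bsub>G\<^esub> g \<in> ?J" if xg: "x \<in> X" "g \<in> ?J" for x b g
  proof -
    obtain w where w: "w \<in> reduced_words X" "g = word_value G w" using xg(2) by blast
    show ?thesis
      using G.word_eval_push_letter[OF X' xg(1) w(1), of b] push_letter_reduced[OF xg(1) w(1), of b]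
      unfolding w(2) word_value_eval by (metis image_eqI)
  qed
  \<comment> \<open>The elements that preserve the set of values under multiplication by themselves
    and by their inverses. Including the inverses makes \<open>K\<close> a subgroup, and applying it
    to the identity gives surjectivity.\<close>
  define K where "K = {k \<in> carrier G. \<forall>g\<in>?J. k \<otimes>\<^bsub>G\<^esub> g \<in> ?J \<and> inv\<^bsub>G\<^esub> k \<otimes>\<^bsub>G\<^esub> g \<in> ?J}"
  have "subgroup K G"
  proof (rule G.subgroupI)
    show "K \<subseteq> carrier G" by (auto simp: K_def)
    have "\<one>\<^bsub>G\<^esub> \<in> K" using sub by (auto simp: K_def subset_iff)
    then show "K \<noteq> {}" by blast
    show "inv\<^bsub>G\<^esub> k \<in> K" if "k \<in> K" for k using that by (simp add: K_def)
    fix k k' assume k: "k \<in> K" "k' \<in> K"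
    then have c: "k \<in> carrier G" "k' \<in> carrier G" by (auto simp: K_def)
    have "k \<otimes>\<^bsub>G\<^esub> k' \<otimes>\<^bsub>G\<^esub> g \<in> ?J \<and> inv\<^bsub>G\<^esub> (k \<otimes>\<^bsub>G\<^esub> k') \<otimes>\<^bsub>G\<^esub> g \<in> ?J" if g: "g \<in> ?J" for g
    proof -
      have gc: "g \<in> carrier G" using g sub by blast
      have 1: "k' \<otimes>\<^bsub>G\<^esub> g \<in> ?J" "inv\<^bsub>G\<^esub> k \<otimes>\<^bsub>G\<^esub> g \<in> ?J" using k g unfolding K_def by blast+
      have "k \<otimes>\<^bsub>G\<^esub> (k' \<otimes>\<^bsub>G\<^esub> g) \<in> ?J" "inv\<^bsub>G\<^esub> k' \<otimes>\<^bsub>G\<^esub> (inv\<^bsub>G\<^esub> k \<otimes>\<^bsub>G\<^esub> g) \<in> ?J"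
        using k 1 unfolding K_def by blast+
      then show ?thesis using c gc by (simp add: G.m_assoc G.inv_mult_group)
    qed
    then show "k \<otimes>\<^bsub>G\<^esub> k' \<in> K" using c by (simp add: K_def)
  qed
  moreover have "X \<subseteq> K"
  proof
    fix x assume x: "x \<in> X"
    have "x \<otimes>\<^bsub>G\<^esub> g \<in> ?J \<and> inv\<^bsub>G\<^esub> x \<otimes>\<^bsub>G\<^esub> g \<in> ?J" if "g \<in> ?J" for g
      using lett[OF x that, of True] lett[OF x that, of False] by simp
    then show "x \<in> K" using x X by (auto simp: K_def)
  qed
  ultimately have K: "carrier G \<subseteq> K" by (rule gen)
  have "carrier G \<subseteq> ?J"
  proof
    fix g assume g: "g \<in> carrier G"
    have "\<one>\<^bsub>G\<^esub> \<in> ?J" by (rule image_eqI[of _ _ "[]"]) (simp_all add: word_value_eval)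
    then have "g \<otimes>\<^bsub>G\<^esub> \<one>\<^bsub>G\<^esub> \<in> ?J" using K g unfolding K_def by blast
    then show "g \<in> ?J" using g by simp
  qed
  with inj sub X show ?thesis by (auto simp: free_basis_def bij_betw_def)
qed

section \<open>Quotients of complex vector spaces\<close>

lemma complex_vectorspaceI:
  fixes V :: "(complex, 'v) module"
  assumes "\<And>u v. u \<in> carrier V \<Longrightarrow> v \<in> carrier V \<Longrightarrow> u \<oplus>\<^bsub>V\<^esub> v \<in> carrier V"
    and "\<zero>\<^bsub>V\<^esub> \<in> carrier V"
    and "\<And>u v w. u \<in> carrier V \<Longrightarrow> v \<in> carrier V \<Longrightarrow> w \<in> carrier V \<Longrightarrow>
      u \<oplus>\<^bsub>V\<^esub> v \<oplus>\<^bsub>V\<^esub> w = u \<oplus>\<^bsub>V\<^esub> (v \<oplus>\<^bsub>V\<^esub> w)"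
    and "\<And>u v. u \<in> carrier V \<Longrightarrow> v \<in> carrier V \<Longrightarrow> u \<oplus>\<^bsub>V\<^esub> v = v \<oplus>\<^bsub>V\<^esub> u"
    and "\<And>v. v \<in> carrier V \<Longrightarrow> \<zero>\<^bsub>V\<^esub> \<oplus>\<^bsub>V\<^esub> v = v"
    and "\<And>v. v \<in> carrier V \<Longrightarrow> \<exists>u\<in>carrier V. u \<oplus>\<^bsub>V\<^esub> v = \<zero>\<^bsub>V\<^esub>"
    and "\<And>a v. v \<in> carrier V \<Longrightarrow> a \<odot>\<^bsub>V\<^esub> v \<in> carrier V"
    and "\<And>a b v. v \<in> carrier V \<Longrightarrow> (a + b) \<odot>\<^bsub>V\<^esub> v = a \<odot>\<^bsub>V\<^esub> v \<oplus>\<^bsub>V\<^esub> b \<odot>\<^bsub>V\<^esub> v"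
    and "\<And>a u v. u \<in> carrier V \<Longrightarrow> v \<in> carrier V \<Longrightarrow>
      a \<odot>\<^bsub>V\<^esub> (u \<oplus>\<^bsub>V\<^esub> v) = a \<odot>\<^bsub>V\<^esub> u \<oplus>\<^bsub>V\<^esub> a \<odot>\<^bsub>V\<^esub> v"
    and "\<And>a b v. v \<in> carrier V \<Longrightarrow> (a * b) \<odot>\<^bsub>V\<^esub> v = a \<odot>\<^bsub>V\<^esub> (b \<odot>\<^bsub>V\<^esub> v)"
    and "\<And>v. v \<in> carrier V \<Longrightarrow> 1 \<odot>\<^bsub>V\<^esub> v = v"
  shows "vectorspace class_ring V"
proof -
  have "module class_ring V"
    by (rule moduleI) (use assms in \<open>auto intro!: abelian_groupI class_cring.is_cring\<close>)
  then show ?thesis unfolding vectorspace_def using class_field.field_axioms by blast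
qed

text \<open>A space without finite generating set satisfies the left side by definition, and the
  right side because the zero space is spanned by the empty set.\<close>

lemma dim_at_least_1:
  fixes V :: "(complex, 'v) module"
  assumes "vectorspace class_ring V"
  shows "dim_at_least 1 V \<longleftrightarrow> carrier V \<noteq> {\<zero>\<^bsub>V\<^esub>}"
proof -
  interpret vectorspace class_ring V by fact
  have "dim = 0" if "carrier V = {\<zero>\<^bsub>V\<^esub>}"
    unfolding dim_def by (rule Least_eq_0) (use that span_empty in \<open>auto intro!: exI[of _ "{}"]\<close>)
  moreover have "fin_dim" if "carrier V = {\<zero>\<^bsub>V\<^esub>}"
    unfolding fin_dim_def by (rule exI[of _ "{}"]) (use that span_empty in auto)
  moreover have "carrier V = {\<zero>\<^bsub>V\<^esub>}" if f: "fin_dim" and d: "dim = 0"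
  proof -
    obtain A where "finite A" "A \<subseteq> carrier V" "gen_set A" using f unfolding fin_dim_def by blast
    then have ex: "\<exists>n A. finite A \<and> card A = n \<and> A \<subseteq> carrier V \<and> gen_set A" by blast
    obtain A where A: "finite A" "card A = dim" "A \<subseteq> carrier V" "gen_set A"
      using LeastI_ex[OF ex] unfolding dim_def by blast
    then have "A = {}" using d by simp
    then show ?thesis using A(4) span_empty by simp
  qed
  ultimately show ?thesis unfolding dim_at_least_def by fastforce
qed

text \<open>All claims on dimensions reduce through this to whether cycles are boundaries.\<close>

lemma quotient_space:
  fixes V :: "(complex, 'v) module"
  assumes V: "vectorspace class_ring V" and W: "W \<subseteq> carrier V" "\<zero>\<^bsub>V\<^esub> \<in> W"
    "\<And>u v. u \<in> W \<Longrightarrow> v \<in> W \<Longrightarrow> u \<oplus>\<^bsub>V\<^esub> v \<in> W" "\<And>a v. v \<in> W \<Longrightarrow> a \<odot>\<^bsub>V\<^esub> v \<in> W"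
  shows "vectorspace class_ring (quotient_space V W)"
    and "dim_at_least 1 (quotient_space V W) \<longleftrightarrow> \<not> carrier V \<subseteq> W"
proof -
  interpret V: vectorspace class_ring V by fact
  have neg: "\<ominus>\<^bsub>V\<^esub> v \<in> W" if "v \<in> W" for v
  proof -
    have vc: "v \<in> carrier V" using that W(1) by blast
    have "(- 1) \<odot>\<^bsub>V\<^esub> v \<oplus>\<^bsub>V\<^esub> 1 \<odot>\<^bsub>V\<^esub> v = \<zero>\<^bsub>V\<^esub>"
      using V.smult_l_distr[of "-1" 1 v] V.smult_l_null[of v] vc by simp
    then have "(- 1) \<odot>\<^bsub>V\<^esub> v \<oplus>\<^bsub>V\<^esub> v = \<zero>\<^bsub>V\<^esub>" using V.smult_one[of v] vc by simp
    moreover have "(- 1) \<odot>\<^bsub>V\<^esub> v \<in> W" by (rule W(4)[OF that])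
    ultimately show ?thesis using V.minus_equality[of "(- 1) \<odot>\<^bsub>V\<^esub> v" v] vc W(1) by auto
  qed
  have sg: "additive_subgroup W V"
    unfolding additive_subgroup_def
    by (rule group.subgroupI[OF V.a_group]) (use W neg in \<open>auto simp flip: a_inv_def\<close>)
  interpret S: abelian_subgroup W V
    by (rule abelian_subgroupI3[OF sg V.abelian_group_axioms])
  let ?Q = "quotient_space V W"
  have car: "carrier ?Q = (\<lambda>v. W +>\<^bsub>V\<^esub> v) ` carrier V"
    by (auto simp: quotient_space_def A_RCOSETS_def')
  have zero: "\<zero>\<^bsub>?Q\<^esub> = W +>\<^bsub>V\<^esub> \<zero>\<^bsub>V\<^esub>"
    using V.a_coset_join2[OF _ S.a_subgroup W(2)] by (simp add: quotient_space_def)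
  have sum: "(W +>\<^bsub>V\<^esub> u) \<oplus>\<^bsub>?Q\<^esub> (W +>\<^bsub>V\<^esub> v) = W +>\<^bsub>V\<^esub> (u \<oplus>\<^bsub>V\<^esub> v)"
    if "u \<in> carrier V" "v \<in> carrier V" for u v
    using S.a_rcos_sum[OF that] by (simp add: quotient_space_def)
  have scale: "c \<odot>\<^bsub>?Q\<^esub> (W +>\<^bsub>V\<^esub> v) = W +>\<^bsub>V\<^esub> (c \<odot>\<^bsub>V\<^esub> v)" if v: "v \<in> carrier V" for c v
  proof -
    have cs: "c \<odot>\<^bsub>V\<^esub> u \<in> carrier V" if "u \<in> carrier V" for u using V.smult_closed[of c u] that by simp
    have "W +>\<^bsub>V\<^esub> (c \<odot>\<^bsub>V\<^esub> u) = W +>\<^bsub>V\<^esub> (c \<odot>\<^bsub>V\<^esub> v)" if u: "u \<in> W +>\<^bsub>V\<^esub> v" for u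
    proof -
      obtain w where w: "w \<in> W" "u = w \<oplus>\<^bsub>V\<^esub> v" using u by (auto simp: a_r_coset_def')
      then have wc: "w \<in> carrier V" using W(1) by blast
      have "c \<odot>\<^bsub>V\<^esub> u = c \<odot>\<^bsub>V\<^esub> w \<oplus>\<^bsub>V\<^esub> c \<odot>\<^bsub>V\<^esub> v"
        using V.smult_r_distr[of c w v] w wc v by simp
      then have "c \<odot>\<^bsub>V\<^esub> u \<in> W +>\<^bsub>V\<^esub> (c \<odot>\<^bsub>V\<^esub> v)"
        using V.a_rcosI[OF W(4)[OF w(1)] W(1) cs[OF v], of c] by simp
      then show ?thesis using V.a_repr_independence[OF _ cs[OF v] S.a_subgroup] by simp
    qed
    moreover have "W +>\<^bsub>V\<^esub> v \<noteq> {}" using V.a_rcosI[OF W(2) W(1) v] by blast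
    ultimately have "(\<Union>u\<in>W +>\<^bsub>V\<^esub> v. W +>\<^bsub>V\<^esub> (c \<odot>\<^bsub>V\<^esub> u)) = W +>\<^bsub>V\<^esub> (c \<odot>\<^bsub>V\<^esub> v)"
      by (intro SUP_eq_const)
    then show ?thesis by (simp add: quotient_space_def)
  qed
  show vs: "vectorspace class_ring ?Q"
  proof (rule complex_vectorspaceI)
    fix X assume "X \<in> carrier ?Q"
    then obtain v where v: "v \<in> carrier V" "X = W +>\<^bsub>V\<^esub> v" using car by blast
    show "\<exists>Y\<in>carrier ?Q. Y \<oplus>\<^bsub>?Q\<^esub> X = \<zero>\<^bsub>?Q\<^esub>"
      by (rule bexI[of _ "W +>\<^bsub>V\<^esub> (\<ominus>\<^bsub>V\<^esub> v)"]) (use v in \<open>auto simp: car sum zero V.l_neg\<close>)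
  qed (use V.smult_closed V.smult_l_distr V.smult_r_distr V.smult_assoc1 V.smult_one
      in \<open>auto simp: car zero sum scale V.a_ac\<close>)
  have "W +>\<^bsub>V\<^esub> v = W \<longleftrightarrow> v \<in> W" if "v \<in> carrier V" for v
    using V.a_coset_join1[OF _ that S.a_subgroup] V.a_coset_join2[OF that S.a_subgroup] by blast
  moreover have "\<zero>\<^bsub>?Q\<^esub> = W" by (simp add: quotient_space_def)
  ultimately have "(\<forall>v\<in>carrier V. W +>\<^bsub>V\<^esub> v = \<zero>\<^bsub>?Q\<^esub>) \<longleftrightarrow> carrier V \<subseteq> W" by (auto simp: subset_iff)
  moreover have "carrier ?Q = {\<zero>\<^bsub>?Q\<^esub>} \<longleftrightarrow> (\<forall>v\<in>carrier V. W +>\<^bsub>V\<^esub> v = \<zero>\<^bsub>?Q\<^esub>)"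
    unfolding car using zero V.M.zero_closed by (auto simp only: image_iff; force)
  ultimately have "carrier ?Q = {\<zero>\<^bsub>?Q\<^esub>} \<longleftrightarrow> carrier V \<subseteq> W" by simp
  then show "dim_at_least 1 ?Q \<longleftrightarrow> \<not> carrier V \<subseteq> W" using dim_at_least_1[OF vs] by simp
qed

lemma vectorspace_restrict:
  fixes V :: "(complex, 'v) module"
  assumes V: "vectorspace class_ring V" and W: "W \<subseteq> carrier V" "\<zero>\<^bsub>V\<^esub> \<in> W"
    "\<And>u v. u \<in> W \<Longrightarrow> v \<in> W \<Longrightarrow> u \<oplus>\<^bsub>V\<^esub> v \<in> W" "\<And>a v. v \<in> W \<Longrightarrow> a \<odot>\<^bsub>V\<^esub> v \<in> W"
  shows "vectorspace class_ring (V\<lparr>carrier := W\<rparr>)"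
proof -
  interpret V: vectorspace class_ring V by fact
  have "subspace class_ring W V"
    by (intro subspace.intro V submodule.intro V.module_axioms) (use W in auto)
  then show ?thesis by (rule V.subspace_is_vs)
qed


section \<open>Bar chains with coefficients in a character\<close>

abbreviation scale :: "complex \<Rightarrow> ('k \<Rightarrow>\<^sub>0 complex) \<Rightarrow> ('k \<Rightarrow>\<^sub>0 complex)" where
  "scale a \<equiv> Poly_Mapping.map ((*) a)"

lemma lookup_scale [simp]: "Poly_Mapping.lookup (scale a c) k = a * Poly_Mapping.lookup c k"
  by (simp add: map.rep_eq when_def)

lemma keys_scale: "Poly_Mapping.keys (scale a c) \<subseteq> Poly_Mapping.keys c"
  by (auto simp: in_keys_iff)

lemma scale_add: "scale a (c + c') = scale a c + scale a c'"
  by (rule poly_mapping_eqI) (simp add: lookup_add algebra_simps)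

lemma scale_single [simp]: "scale a (Poly_Mapping.single k b) = Poly_Mapping.single k (a * b)"
  by (rule poly_mapping_eqI) (simp add: lookup_single when_def)

lemma scale_0 [simp]: "scale a 0 = 0"
  by (rule poly_mapping_eqI) simp

lemma scale_scale: "scale a (scale b c) = scale (a * b) c"
  by (rule poly_mapping_eqI) simp

lemma scale_1: "scale 1 c = c"
  by (rule poly_mapping_eqI) simp

lemma scale_minus_1: "scale (- 1) c = - c"
  by (rule poly_mapping_eqI) simp

lemma chain_induct [consumes 1, case_names zero add]:
  fixes c :: "'k \<Rightarrow>\<^sub>0 complex"
  assumes "Poly_Mapping.keys c \<subseteq> A" "P 0"
    and step: "\<And>k a c. k \<in> A \<Longrightarrow> Poly_Mapping.keys c \<subseteq> A \<Longrightarrow> P c \<Longrightarrow> P (Poly_Mapping.single k a + c)"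
  shows "P c"
  using assms(1)
proof (induction "card (Poly_Mapping.keys c)" arbitrary: c)
  case 0
  then have "c = 0" by simp
  then show ?case using assms(2) by simp
next
  case (Suc n)
  then obtain k where k: "k \<in> Poly_Mapping.keys c" by (metis card.empty equals0I nat.distinct(1))
  define c' where "c' = c - Poly_Mapping.single k (Poly_Mapping.lookup c k)"
  have keys: "Poly_Mapping.keys c' = Poly_Mapping.keys c - {k}"
    by (auto simp: c'_def in_keys_iff lookup_minus lookup_single when_def split: if_splits)
  have "P c'" by (rule Suc.hyps(1)) (use keys k Suc in auto)
  then have "P (Poly_Mapping.single k (Poly_Mapping.lookup c k) + c')"
    by (intro step) (use k keys Suc in auto)
  then show ?case by (simp add: c'_def)
qed

definition lin_extend :: "('k \<Rightarrow> complex \<Rightarrow> 'b::comm_monoid_add) \<Rightarrow> ('k \<Rightarrow>\<^sub>0 complex) \<Rightarrow> 'b" where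
  "lin_extend \<phi> c = (\<Sum>k\<in>Poly_Mapping.keys c. \<phi> k (Poly_Mapping.lookup c k))"

lemma lin_extend_zero [simp]: "lin_extend \<phi> 0 = 0"
  by (simp add: lin_extend_def)

lemma lin_extend_single: "\<phi> k 0 = 0 \<Longrightarrow> lin_extend \<phi> (Poly_Mapping.single k a) = \<phi> k a"
  by (simp add: lin_extend_def)

lemma lin_extend_add:
  assumes "\<And>k. \<phi> k 0 = 0" "\<And>k a b. \<phi> k (a + b) = \<phi> k a + \<phi> k b"
  shows "lin_extend \<phi> (c + c') = lin_extend \<phi> c + lin_extend \<phi> c'"
proof -
  let ?K = "Poly_Mapping.keys c \<union> Poly_Mapping.keys c'"
  have "lin_extend \<phi> b = (\<Sum>k\<in>?K. \<phi> k (Poly_Mapping.lookup b k))" if "Poly_Mapping.keys b \<subseteq> ?K" for b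
    unfolding lin_extend_def using that by (intro sum.mono_neutral_left) (auto simp: in_keys_iff assms(1))
  then show ?thesis
    using Poly_Mapping.keys_add[of c c'] by (simp add: lookup_add assms(2) sum.distrib)
qed

lemma bar_boundary_extend:
  "bar_boundary G \<rho> = lin_extend (\<lambda>xs a. if xs = [] then 0 else \<Sum>i\<le>length xs.
     Poly_Mapping.single (bar_face G i xs) ((- 1) ^ i * (if i = 0 then \<rho> (hd xs) else 1) * a))"
  (is "_ = lin_extend ?\<phi>")
proof
  fix c :: "'a list \<Rightarrow>\<^sub>0 complex"
  have eq: "lin_extend ?\<phi> c = (\<Sum>xs\<in>Poly_Mapping.keys c - {[]}. ?\<phi> xs (Poly_Mapping.lookup c xs))"
    unfolding lin_extend_def by (intro sum.mono_neutral_right) auto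
  show "bar_boundary G \<rho> c = lin_extend ?\<phi> c"
    unfolding eq bar_boundary_def by (intro sum.cong) auto
qed

lemma bar_boundary_add: "bar_boundary G \<rho> (c + c') = bar_boundary G \<rho> c + bar_boundary G \<rho> c'"
  unfolding bar_boundary_extend
  by (rule lin_extend_add) (auto simp: distrib_left single_add sum.distrib)

lemma bar_boundary_0 [simp]: "bar_boundary G \<rho> 0 = 0"
  by (simp add: bar_boundary_extend)

lemma bar_boundary_single:
  "bar_boundary G \<rho> (Poly_Mapping.single xs a) = (if xs = [] then 0 else \<Sum>i\<le>length xs.
     Poly_Mapping.single (bar_face G i xs) ((- 1) ^ i * (if i = 0 then \<rho> (hd xs) else 1) * a))"
  unfolding bar_boundary_extend by (subst lin_extend_single) auto

lemma bar_boundary_single_1: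
  "bar_boundary G \<rho> (Poly_Mapping.single [g] a) = Poly_Mapping.single [] ((\<rho> g - 1) * a)"
  by (simp add: bar_boundary_single bar_face_def left_diff_distrib flip: single_add single_diff)

lemma bar_boundary_single_2:
  "bar_boundary G \<rho> (Poly_Mapping.single [g, h] a) =
     Poly_Mapping.single [h] (\<rho> g * a) - Poly_Mapping.single [g \<otimes>\<^bsub>G\<^esub> h] a + Poly_Mapping.single [g] a"
  by (simp add: bar_boundary_single bar_face_def numeral_2_eq_2 single_uminus)

lemma bar_boundary_scale: "bar_boundary G \<rho> (scale a c) = scale a (bar_boundary G \<rho> c)"
  using subset_UNIV[of "Poly_Mapping.keys c"]
proof (induction rule: chain_induct)
  case (add k b c)
  have "bar_boundary G \<rho> (Poly_Mapping.single k (a * b)) = scale a (bar_boundary G \<rho> (Poly_Mapping.single k b))"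
  proof (cases "k = []")
    case False
    have sc: "scale a (sum f I) = (\<Sum>i\<in>I. scale a (f i))" for f and I :: "nat set"
      by (induction I rule: infinite_finite_induct) (simp_all add: scale_add)
    show ?thesis using False by (simp add: bar_boundary_single sc mult_ac)
  qed (simp add: bar_boundary_single)
  then show ?case using add by (simp add: bar_boundary_add scale_add)
qed simp_all

lemma tuples_1: "xs \<in> tuples G 1 \<longleftrightarrow> (\<exists>g\<in>carrier G. xs = [g])"
  by (auto simp: tuples_def length_Suc_conv)

lemma tuples_2: "xs \<in> tuples G 2 \<longleftrightarrow> (\<exists>g\<in>carrier G. \<exists>h\<in>carrier G. xs = [g, h])"
  by (auto simp: tuples_def length_Suc_conv numeral_2_eq_2)

lemma vectorspace_bar_chains: "vectorspace class_ring (bar_chains G k)"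
proof (rule complex_vectorspaceI)
  fix v assume "v \<in> carrier (bar_chains G k)"
  then show "\<exists>u\<in>carrier (bar_chains G k). u \<oplus>\<^bsub>bar_chains G k\<^esub> v = \<zero>\<^bsub>bar_chains G k\<^esub>"
    by (intro bexI[of _ "- v"]) (auto simp: bar_chains_def)
next
  fix u v assume "u \<in> carrier (bar_chains G k)" "v \<in> carrier (bar_chains G k)"
  then show "u \<oplus>\<^bsub>bar_chains G k\<^esub> v \<in> carrier (bar_chains G k)"
    using Poly_Mapping.keys_add[of u v] by (auto simp: bar_chains_def)
next
  fix a v assume "v \<in> carrier (bar_chains G k)"
  then show "a \<odot>\<^bsub>bar_chains G k\<^esub> v \<in> carrier (bar_chains G k)"
    using keys_scale[of a v] by (auto simp: bar_chains_def)
next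
  fix a b v
  show "(a + b) \<odot>\<^bsub>bar_chains G k\<^esub> v = a \<odot>\<^bsub>bar_chains G k\<^esub> v \<oplus>\<^bsub>bar_chains G k\<^esub> b \<odot>\<^bsub>bar_chains G k\<^esub> v"
    by (simp add: bar_chains_def) (rule poly_mapping_eqI, simp add: lookup_add distrib_right)
qed (simp_all add: bar_chains_def add_ac scale_add scale_scale scale_1)

definition boundaries_1 :: "('g, 'm) monoid_scheme \<Rightarrow> ('g \<Rightarrow> complex) \<Rightarrow> ('g list \<Rightarrow>\<^sub>0 complex) set" where
  "boundaries_1 G \<rho> = bar_boundary G \<rho> ` {c. Poly_Mapping.keys c \<subseteq> tuples G 2}"

lemma boundaries_1_closed:
  "0 \<in> boundaries_1 G \<rho>"
  "b \<in> boundaries_1 G \<rho> \<Longrightarrow> b' \<in> boundaries_1 G \<rho> \<Longrightarrow> b + b' \<in> boundaries_1 G \<rho>"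
  "b \<in> boundaries_1 G \<rho> \<Longrightarrow> scale a b \<in> boundaries_1 G \<rho>"
proof -
  show "0 \<in> boundaries_1 G \<rho>" unfolding boundaries_1_def by (rule image_eqI[of _ _ 0]) auto
next
  assume "b \<in> boundaries_1 G \<rho>" "b' \<in> boundaries_1 G \<rho>"
  then obtain c c' where c: "Poly_Mapping.keys c \<subseteq> tuples G 2" "b = bar_boundary G \<rho> c"
    "Poly_Mapping.keys c' \<subseteq> tuples G 2" "b' = bar_boundary G \<rho> c'" by (auto simp: boundaries_1_def)
  then show "b + b' \<in> boundaries_1 G \<rho>" unfolding boundaries_1_def
    using Poly_Mapping.keys_add[of c c'] by (intro image_eqI[of _ _ "c + c'"]) (auto simp: bar_boundary_add)
next
  assume "b \<in> boundaries_1 G \<rho>"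
  then obtain c where c: "Poly_Mapping.keys c \<subseteq> tuples G 2" "b = bar_boundary G \<rho> c"
    by (auto simp: boundaries_1_def)
  then show "scale a b \<in> boundaries_1 G \<rho>" unfolding boundaries_1_def
    using keys_scale[of a c] by (intro image_eqI[of _ _ "scale a c"]) (auto simp: bar_boundary_scale)
qed

lemma boundaries_1_diff:
  "b \<in> boundaries_1 G \<rho> \<Longrightarrow> b' \<in> boundaries_1 G \<rho> \<Longrightarrow> b - b' \<in> boundaries_1 G \<rho>"
  using boundaries_1_closed(2)[of b G \<rho> "scale (- 1) b'"] boundaries_1_closed(3)[of b' G \<rho> "- 1"]
  by (simp add: scale_minus_1)

text \<open>The boundaries have to lie among the cycles for the quotient to make sense; this is
  checked on tuples \<open>[g, h]\<close> and rests on multiplicativity of \<rho>.\<close>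

lemma dim_twisted_homology_1:
  assumes G: "group G" and \<rho>: "\<rho> \<in> hom G Cstar"
  shows "dim_at_least 1 (twisted_homology G \<rho> 1) \<longleftrightarrow>
    (\<exists>c. Poly_Mapping.keys c \<subseteq> tuples G 1 \<and> bar_boundary G \<rho> c = 0 \<and> c \<notin> boundaries_1 G \<rho>)"
proof -
  interpret G: group G by fact
  have mult: "\<rho> (g \<otimes>\<^bsub>G\<^esub> h) = \<rho> g * \<rho> h" if "g \<in> carrier G" "h \<in> carrier G" for g h
    using hom_mult[OF \<rho> that] by (simp add: Cstar_def)
  let ?Z = "{c \<in> carrier (bar_chains G 1). bar_boundary G \<rho> c = 0}"
  have Z: "c \<in> ?Z \<longleftrightarrow> Poly_Mapping.keys c \<subseteq> tuples G 1 \<and> bar_boundary G \<rho> c = 0" for c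
    by (simp add: bar_chains_def)
  have B: "bar_boundary G \<rho> ` carrier (bar_chains G (1 + 1)) = boundaries_1 G \<rho>"
    by (simp add: boundaries_1_def bar_chains_def numeral_2_eq_2)
  have vs: "vectorspace class_ring (bar_chains G 1\<lparr>carrier := ?Z\<rparr>)"
  proof (rule vectorspace_restrict[OF vectorspace_bar_chains])
    fix u v assume "u \<in> ?Z" "v \<in> ?Z"
    then show "u \<oplus>\<^bsub>bar_chains G 1\<^esub> v \<in> ?Z"
      unfolding Z using Poly_Mapping.keys_add[of u v] by (auto simp: bar_chains_def bar_boundary_add)
  next
    fix a v assume "v \<in> ?Z"
    then show "a \<odot>\<^bsub>bar_chains G 1\<^esub> v \<in> ?Z"
      unfolding Z using keys_scale[of a v] by (auto simp: bar_chains_def bar_boundary_scale)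
  qed (auto simp: bar_chains_def)
  have "bar_boundary G \<rho> c \<in> ?Z" if "Poly_Mapping.keys c \<subseteq> tuples G 2" for c
    using that
  proof (induction rule: chain_induct)
    case zero
    then show ?case by (simp add: bar_chains_def)
  next
    case (add k a c)
    obtain g h where k: "k = [g, h]" "g \<in> carrier G" "h \<in> carrier G" using add(1) by (auto simp: tuples_2)
    let ?b = "bar_boundary G \<rho> (Poly_Mapping.single k a)"
    have eq: "?b = Poly_Mapping.single [h] (\<rho> g * a) + (Poly_Mapping.single [g \<otimes>\<^bsub>G\<^esub> h] (- a) + Poly_Mapping.single [g] a)"
      by (simp add: k bar_boundary_single_2 single_uminus)
    have "bar_boundary G \<rho> ?b = 0"
      unfolding eq by (simp add: bar_boundary_add bar_boundary_single_1 mult k algebra_simps flip: single_add)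
    moreover have ks: "Poly_Mapping.keys ?b \<subseteq> {[h], [g \<otimes>\<^bsub>G\<^esub> h], [g]}"
      by (auto simp: eq in_keys_iff lookup_add lookup_single when_def split: if_splits)
    moreover have "{[h], [g \<otimes>\<^bsub>G\<^esub> h], [g]} \<subseteq> tuples G 1" using k by (simp add: tuples_def)
    ultimately show ?case
      using add(3) Poly_Mapping.keys_add[of ?b "bar_boundary G \<rho> c"]
      unfolding Z bar_boundary_add by auto
  qed
  then have sub: "boundaries_1 G \<rho> \<subseteq> ?Z" unfolding boundaries_1_def by blast
  have "dim_at_least 1 (twisted_homology G \<rho> 1) \<longleftrightarrow> \<not> ?Z \<subseteq> boundaries_1 G \<rho>"
  proof -
    have "dim_at_least 1 (quotient_space (bar_chains G 1\<lparr>carrier := ?Z\<rparr>) (boundaries_1 G \<rho>)) \<longleftrightarrow>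
        \<not> carrier (bar_chains G 1\<lparr>carrier := ?Z\<rparr>) \<subseteq> boundaries_1 G \<rho>"
      by (rule quotient_space(2)[OF vs]) (use sub boundaries_1_closed in \<open>auto simp: bar_chains_def\<close>)
    then show ?thesis unfolding twisted_homology_def B by simp
  qed
  then show ?thesis using Z by blast
qed


text \<open>Modulo boundaries, (\<rho> k - 1) [g] equals (\<rho> g - 1) [k]. Hence
  \<open>\<rho> k - 1\<close> times any chain is congruent to [k] times the coefficient of its own
  boundary, which is 0 for a cycle.\<close>

lemma in_boundaries_1_if_total:
  fixes \<rho> :: "'g \<Rightarrow> complex"
  assumes k: "k \<in> carrier G" "\<rho> k \<noteq> 1"
    and R: "\<And>g. g \<in> carrier G \<Longrightarrow>
      Poly_Mapping.single [g] (\<rho> k - 1) - Poly_Mapping.single [k] (\<rho> g - 1) \<in> boundaries_1 G \<rho>"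
    and c: "Poly_Mapping.keys c \<subseteq> tuples G 1" "bar_boundary G \<rho> c = 0"
  shows "c \<in> boundaries_1 G \<rho>"
proof -
  let ?e = "\<lambda>c. Poly_Mapping.lookup (bar_boundary G \<rho> c) []"
  have "scale (\<rho> k - 1) c - Poly_Mapping.single [k] (?e c) \<in> boundaries_1 G \<rho>" using c(1)
  proof (induction rule: chain_induct)
    case zero
    then show ?case by (simp add: boundaries_1_closed)
  next
    case (add xs a c)
    then obtain g where g: "xs = [g]" "g \<in> carrier G" unfolding tuples_1 by blast
    let ?s = "Poly_Mapping.single [g] a"
    have e: "?e (?s + c) = (\<rho> g - 1) * a + ?e c"
      by (simp add: bar_boundary_add bar_boundary_single_1 lookup_add)
    have "scale a (Poly_Mapping.single [g] (\<rho> k - 1) - Poly_Mapping.single [k] (\<rho> g - 1)) +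
        (scale (\<rho> k - 1) c - Poly_Mapping.single [k] (?e c)) \<in> boundaries_1 G \<rho>"
      by (intro boundaries_1_closed add(3) R g)
    moreover have "scale a (Poly_Mapping.single [g] (\<rho> k - 1) - Poly_Mapping.single [k] (\<rho> g - 1)) +
        (scale (\<rho> k - 1) c - Poly_Mapping.single [k] (?e c)) =
        scale (\<rho> k - 1) (?s + c) - Poly_Mapping.single [k] (?e (?s + c))"
      unfolding e
      by (rule poly_mapping_eqI) (simp add: lookup_add lookup_minus lookup_single when_def algebra_simps)
    ultimately show ?case by (simp add: g)
  qed
  then have "scale (\<rho> k - 1) c \<in> boundaries_1 G \<rho>" using c(2) by simp
  from boundaries_1_closed(3)[OF this, of "1 / (\<rho> k - 1)"] show ?thesis using k by (simp add: scale_scale scale_1)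
qed

text \<open>Modulo the boundaries \<open>D g h\<close> one has [g h] = [g] + \<rho>(g) [h]. For
  commuting elements the two expansions of the product are compared; transitivity divides by
  \<open>\<rho> h - 1\<close>.\<close>

lemma commutation_like_boundaries:
  assumes G: "group G" and \<rho>: "\<rho> \<in> hom G Cstar"
    and d: "\<And>g. g \<in> carrier G \<Longrightarrow> d g \<noteq> 0 \<Longrightarrow> \<rho> g \<noteq> 1"
  shows "commutation_like G d (\<lambda>g h.
    Poly_Mapping.single [g] (\<rho> h - 1) - Poly_Mapping.single [h] (\<rho> g - 1) \<in> boundaries_1 G \<rho>)"
    (is "commutation_like G d (\<lambda>g h. ?r g h \<in> ?B)")
proof -
  interpret G: group G by fact
  have mult: "\<rho> (g \<otimes>\<^bsub>G\<^esub> h) = \<rho> g * \<rho> h" if "g \<in> carrier G" "h \<in> carrier G" for g h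
    using hom_mult[OF \<rho> that] by (simp add: Cstar_def)
  have nz: "\<rho> g \<noteq> 0" if "g \<in> carrier G" for g using \<rho> that by (auto simp: hom_def Cstar_def Pi_iff)
  have one: "\<rho> \<one>\<^bsub>G\<^esub> = 1" using mult[of "\<one>\<^bsub>G\<^esub>" "\<one>\<^bsub>G\<^esub>"] nz[of "\<one>\<^bsub>G\<^esub>"] by simp
  have inv: "\<rho> (inv\<^bsub>G\<^esub> g) * \<rho> g = 1" if "g \<in> carrier G" for g
    using mult[of "inv\<^bsub>G\<^esub> g" g] that one by simp
  note closed = boundaries_1_closed boundaries_1_diff
  define D where "D g h = Poly_Mapping.single [h] (\<rho> g) - Poly_Mapping.single [g \<otimes>\<^bsub>G\<^esub> h] 1 + Poly_Mapping.single [g] 1"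
    for g h
  have D: "D g h \<in> ?B" if "g \<in> carrier G" "h \<in> carrier G" for g h
    unfolding boundaries_1_def D_def
    by (rule image_eqI[of _ _ "Poly_Mapping.single [g, h] 1"])
      (use that in \<open>auto simp: bar_boundary_single_2 tuples_2\<close>)
  note lk = lookup_add lookup_minus lookup_single when_def
  have 1: "?r g h \<in> ?B" if gh: "g \<in> carrier G" "h \<in> carrier G" "g \<otimes>\<^bsub>G\<^esub> h = h \<otimes>\<^bsub>G\<^esub> g" for g h
  proof -
    have eq: "?r g h = D h g - D g h"
      by (rule poly_mapping_eqI) (simp add: D_def gh(3) lk)
    show ?thesis unfolding eq by (rule closed(4)[OF D[OF gh(2,1)] D[OF gh(1,2)]])
  qed
  have 2: "?r h g \<in> ?B" if r: "?r g h \<in> ?B" for g h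
  proof -
    have "?r h g = scale (- 1) (?r g h)" by (rule poly_mapping_eqI) (simp add: lk)
    then show ?thesis using closed(3)[OF r] by simp
  qed
  have 3: "?r g (h \<otimes>\<^bsub>G\<^esub> k) \<in> ?B"
    if gh: "g \<in> carrier G" "h \<in> carrier G" "k \<in> carrier G" and r: "?r g h \<in> ?B" "?r g k \<in> ?B" for g h k
  proof -
    have eq: "?r g (h \<otimes>\<^bsub>G\<^esub> k) = ?r g h + scale (\<rho> h) (?r g k) + scale (\<rho> g - 1) (D h k)"
      by (rule poly_mapping_eqI) (simp add: D_def lk mult[OF gh(2,3)] algebra_simps)
    show ?thesis unfolding eq by (rule closed(2)[OF closed(2)[OF r(1) closed(3)[OF r(2)]] closed(3)[OF D[OF gh(2,3)]]])
  qed
  have 4: "?r g (inv\<^bsub>G\<^esub> h) \<in> ?B"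
    if gh: "g \<in> carrier G" "h \<in> carrier G" and r: "?r g h \<in> ?B" for g h
  proof -
    have hi: "inv\<^bsub>G\<^esub> h \<in> carrier G" using gh by simp
    \<comment> \<open>\<open>D \<one> \<one>\<close> is the chain on the unit element, since
      \<open>\<rho> \<one> = 1\<close>; it removes the term for \<open>inv h \<otimes> h\<close>
      from \<open>D (inv h) h\<close>.\<close>
    have eq: "?r g (inv\<^bsub>G\<^esub> h) = scale (\<rho> (inv\<^bsub>G\<^esub> h)) (scale (- 1) (?r g h)) -
        scale (\<rho> g - 1) (D (inv\<^bsub>G\<^esub> h) h + D \<one>\<^bsub>G\<^esub> \<one>\<^bsub>G\<^esub>)"
    proof (rule poly_mapping_eqI)
      fix xs
      have e: "\<rho> (inv\<^bsub>G\<^esub> h) * (\<rho> h * z) = z" for z using inv[OF gh(2)] by (simp flip: mult.assoc)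
      show "Poly_Mapping.lookup (?r g (inv\<^bsub>G\<^esub> h)) xs =
        Poly_Mapping.lookup (scale (\<rho> (inv\<^bsub>G\<^esub> h)) (scale (- 1) (?r g h)) -
        scale (\<rho> g - 1) (D (inv\<^bsub>G\<^esub> h) h + D \<one>\<^bsub>G\<^esub> \<one>\<^bsub>G\<^esub>)) xs"
        using inv[OF gh(2)] gh by (simp add: D_def lk one algebra_simps e)
    qed
    show ?thesis unfolding eq
      by (rule closed(4)[OF closed(3)[OF closed(3)[OF r]] closed(3)[OF closed(2)[OF D[OF hi gh(2)] D]]]) simp_all
  qed
  have 5: "?r g k \<in> ?B"
    if gh: "h \<in> carrier G" and r: "?r g h \<in> ?B" "?r h k \<in> ?B" and dh: "d h \<noteq> 0" for g h k
  proof -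
    have eq: "scale (\<rho> h - 1) (?r g k) = scale (\<rho> k - 1) (?r g h) + scale (\<rho> g - 1) (?r h k)"
      by (rule poly_mapping_eqI) (simp add: lk algebra_simps)
    have "scale (1 / (\<rho> h - 1)) (scale (\<rho> h - 1) (?r g k)) \<in> ?B"
      unfolding eq by (rule closed(3)[OF closed(2)[OF closed(3)[OF r(1)] closed(3)[OF r(2)]]])
    then show ?thesis using d[OF gh dh] by (simp add: scale_scale scale_1)
  qed
  show ?thesis unfolding commutation_like_def
    by (intro conjI ballI impI) (erule (2) 1, erule 2, erule (2) 4, erule (4) 3, erule (3) 5)
qed


text \<open>Crossed homomorphisms are the homomorphisms to the affine group of the complex line, with
  \<open>(a, b)\<close> standing for \<open>z \<mapsto> a z + b\<close>.\<close>

definition affine_group :: "(complex \<times> complex) monoid" where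
  "affine_group = \<lparr>carrier = {(a, b). a \<noteq> 0}, mult = (\<lambda>(a, b) (a', b'). (a * a', b + a * b')), one = (1, 0)\<rparr>"

lemma group_affine_group: "group affine_group"
proof (rule groupI)
  fix x assume "x \<in> carrier affine_group"
  then obtain a b where x: "x = (a, b)" "a \<noteq> 0" by (auto simp: affine_group_def)
  then show "\<exists>y\<in>carrier affine_group. y \<otimes>\<^bsub>affine_group\<^esub> x = \<one>\<^bsub>affine_group\<^esub>"
    by (intro bexI[of _ "(1 / a, - b / a)"]) (auto simp: affine_group_def)
qed (auto simp: affine_group_def algebra_simps)

text \<open>Crossed homomorphisms are the twisted 1-cocycles; pairing with them detects homology
  classes.\<close>

lemma crossed_hom_vanishes_on_boundaries:
  assumes f: "\<And>g h. g \<in> carrier G \<Longrightarrow> h \<in> carrier G \<Longrightarrow> f (g \<otimes>\<^bsub>G\<^esub> h) = f g + \<rho> g * f h"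
    and b: "b \<in> boundaries_1 G \<rho>"
  shows "lin_extend (\<lambda>xs a. a * f (hd xs)) b = (0::complex)"
proof -
  let ?E = "lin_extend (\<lambda>xs a. a * f (hd xs))"
  have E_add: "?E (c + c') = ?E c + ?E c'" for c c' by (rule lin_extend_add) (auto simp: distrib_right)
  have single: "?E (Poly_Mapping.single xs a) = a * f (hd xs)" for xs a by (subst lin_extend_single) auto
  obtain c where c: "Poly_Mapping.keys c \<subseteq> tuples G 2" "b = bar_boundary G \<rho> c"
    using b by (auto simp: boundaries_1_def)
  have "?E (bar_boundary G \<rho> c) = 0" using c(1)
  proof (induction rule: chain_induct)
    case (add xs a c)
    then obtain g h where k: "xs = [g, h]" "g \<in> carrier G" "h \<in> carrier G" by (auto simp: tuples_2)
    have eq: "bar_boundary G \<rho> (Poly_Mapping.single xs a) =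
        Poly_Mapping.single [h] (\<rho> g * a) + (Poly_Mapping.single [g \<otimes>\<^bsub>G\<^esub> h] (- a) + Poly_Mapping.single [g] a)"
      unfolding k by (simp add: bar_boundary_single_2 single_uminus)
    show ?case
      unfolding bar_boundary_add eq by (simp add: E_add single f k add.IH algebra_simps)
  qed simp
  then show ?thesis by (simp add: c)
qed

text \<open>On a free basis the values of a crossed homomorphism are arbitrary: a homomorphism to
  the affine group is prescribed, and its first component is \<rho> because it is so on the
  basis.\<close>

lemma free_basis_characteristic:
  assumes G: "group G" "free_basis G X" and \<rho>: "\<rho> \<in> hom G Cstar"
    and xy: "x \<in> X" "y \<in> X" "x \<noteq> y"
  shows "dim_at_least 1 (twisted_homology G \<rho> 1)"
proof -
  interpret G: group G by fact
  have X: "X \<subseteq> carrier G" using G(2) by (simp add: free_basis_def)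
  have nz: "\<rho> g \<noteq> 0" if "g \<in> carrier G" for g using \<rho> that by (auto simp: hom_def Cstar_def Pi_iff)
  have Cs: "group Cstar"
    by (rule groupI) (auto simp: Cstar_def intro: bexI[of _ "1 / x" for x])
  have crossed: "\<exists>f. (\<forall>g\<in>carrier G. \<forall>h\<in>carrier G. f (g \<otimes>\<^bsub>G\<^esub> h) = f g + \<rho> g * f h) \<and> (\<forall>z\<in>X. f z = w z)"
    for w :: "'a \<Rightarrow> complex"
  proof -
    have "(\<lambda>z. (\<rho> z, w z)) ` X \<subseteq> carrier affine_group" using nz X by (auto simp: affine_group_def)
    then obtain \<theta> where th: "\<theta> \<in> hom G affine_group" "\<forall>z\<in>X. \<theta> z = (\<rho> z, w z)"
      using free_basis_universal[OF G group_affine_group] by blast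
    have "fst \<circ> \<theta> \<in> hom G Cstar"
      using th(1) by (auto simp: hom_def affine_group_def Cstar_def Pi_iff case_prod_beta)
    then have fst: "(fst \<circ> \<theta>) g = \<rho> g" if "g \<in> carrier G" for g
      using hom_eq_on_basis[OF G Cs _ \<rho>, of "fst \<circ> \<theta>"] th(2) that by simp
    have "snd (\<theta> (g \<otimes>\<^bsub>G\<^esub> h)) = snd (\<theta> g) + \<rho> g * snd (\<theta> h)"
      if "g \<in> carrier G" "h \<in> carrier G" for g h
      using hom_mult[OF th(1) that] fst[OF that(1)] by (simp add: affine_group_def case_prod_beta)
    then show ?thesis using th(2) by (intro exI[of _ "snd \<circ> \<theta>"]) simp
  qed
  \<comment> \<open>The boundary of [g] is \<open>\<rho> g - 1\<close>, so this is the obvious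
    relation between the boundaries of [x] and [y]. It degenerates to 0 if both are trivial, and
    then [x] is a cycle by itself.\<close>
  define c where "c = (if \<rho> x = 1 \<and> \<rho> y = 1 then Poly_Mapping.single [x] 1
    else Poly_Mapping.single [x] (\<rho> y - 1) + Poly_Mapping.single [y] (1 - \<rho> x))"
  have "Poly_Mapping.keys c \<subseteq> {[x], [y]}"
    by (auto simp: c_def in_keys_iff lookup_add lookup_single when_def split: if_splits)
  also have "\<dots> \<subseteq> tuples G 1" using xy X by (auto simp: tuples_def)
  finally have keys: "Poly_Mapping.keys c \<subseteq> tuples G 1" .
  have bd: "bar_boundary G \<rho> c = 0"
    by (simp add: c_def bar_boundary_add bar_boundary_single_1 algebra_simps flip: single_add)
  have "c \<notin> boundaries_1 G \<rho>"
  proof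
    assume c: "c \<in> boundaries_1 G \<rho>"
    \<comment> \<open>\<open>w\<close> is supported on one of \<open>x\<close> and \<open>y\<close>,
      chosen so that its coefficient in \<open>c\<close> is nonzero.\<close>
    obtain w where w: "w x * (if \<rho> x = 1 \<and> \<rho> y = 1 then 1 else \<rho> y - 1) +
        w y * (if \<rho> x = 1 \<and> \<rho> y = 1 then 0 else 1 - \<rho> x) \<noteq> 0"
    proof (cases "\<rho> y = 1 \<and> \<rho> x \<noteq> 1")
      case True
      then show thesis using xy by (intro that[of "\<lambda>z. if z = y then 1 else 0"]) auto
    next
      case False
      then show thesis using xy by (intro that[of "\<lambda>z. if z = x then 1 else 0"]) auto
    qed
    obtain f where f: "\<And>g h. g \<in> carrier G \<Longrightarrow> h \<in> carrier G \<Longrightarrow> f (g \<otimes>\<^bsub>G\<^esub> h) = f g + \<rho> g * f h"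
        "\<And>z. z \<in> X \<Longrightarrow> f z = w z"
      using crossed[of w] by blast
    let ?E = "lin_extend (\<lambda>xs a. a * f (hd xs))"
    have add: "?E (c + c') = ?E c + ?E c'" for c c' by (rule lin_extend_add) (auto simp: distrib_right)
    have single: "?E (Poly_Mapping.single xs a) = a * f (hd xs)" for xs a by (subst lin_extend_single) auto
    have "?E c = 0" by (rule crossed_hom_vanishes_on_boundaries[OF f(1) c])
    then show False using w f(2) xy by (auto simp: c_def add single mult.commute split: if_splits)
  qed
  then show ?thesis using dim_twisted_homology_1[OF G(1) \<rho>] keys bd by blast
qed

section \<open>Cohomology and cup products\<close>

lemma coboundary_0: "coboundary G 0 f = (\<lambda>_. 0)"
  by (auto simp: coboundary_def tuples_def bar_face_def length_Suc_conv fun_eq_iff)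

lemma coboundary_1:
  "coboundary G 1 f = (\<lambda>xs. if xs \<in> tuples G 2 then
     f [xs ! 1] - f [xs ! 0 \<otimes>\<^bsub>G\<^esub> xs ! 1] + f [xs ! 0] else 0)"
proof
  fix xs
  show "coboundary G 1 f xs = (if xs \<in> tuples G 2 then
     f [xs ! 1] - f [xs ! 0 \<otimes>\<^bsub>G\<^esub> xs ! 1] + f [xs ! 0] else 0)"
  proof (cases "xs \<in> tuples G 2")
    case True
    then obtain g h where "xs = [g, h]" by (auto simp: tuples_2)
    then show ?thesis using True by (simp add: coboundary_def bar_face_def numeral_2_eq_2)
  qed (simp add: coboundary_def numeral_2_eq_2)
qed

text \<open>With trivial coefficients the coboundary in degree 0 vanishes, so the classes of degree
  1 are the singletons of cocycles.\<close>

lemma coboundaries_1: "coboundaries G 1 = {\<lambda>_. 0}"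
  by (auto simp: coboundaries_def coboundary_0 cochains_def)

lemma cocycles_1:
  "f \<in> cocycles G 1 \<longleftrightarrow> (\<forall>xs. xs \<notin> tuples G 1 \<longrightarrow> f xs = 0) \<and>
    (\<forall>g\<in>carrier G. \<forall>h\<in>carrier G. f [g \<otimes>\<^bsub>G\<^esub> h] = f [g] + f [h])"
proof -
  have "coboundary G 1 f = (\<lambda>_. 0) \<longleftrightarrow> (\<forall>g\<in>carrier G. \<forall>h\<in>carrier G. f [g \<otimes>\<^bsub>G\<^esub> h] = f [g] + f [h])"
  proof (intro iffI ballI ext)
    fix g h assume "coboundary G 1 f = (\<lambda>_. 0)" "g \<in> carrier G" "h \<in> carrier G"
    then have "coboundary G 1 f [g, h] = 0" "[g, h] \<in> tuples G 2" by (auto simp: tuples_def)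
    then show "f [g \<otimes>\<^bsub>G\<^esub> h] = f [g] + f [h]" by (simp only: coboundary_1) (simp add: algebra_simps)
  qed (auto simp only: coboundary_1 tuples_2 split: if_split, simp)
  then show ?thesis by (simp add: cocycles_def cochains_def)
qed

lemma coboundaries_2:
  assumes "group G"
  shows "F \<in> coboundaries G 2 \<longleftrightarrow> (\<forall>xs. xs \<notin> tuples G 2 \<longrightarrow> F xs = 0) \<and>
    (\<exists>u. \<forall>g\<in>carrier G. \<forall>h\<in>carrier G. F [g, h] = u g + u h - u (g \<otimes>\<^bsub>G\<^esub> h))"
proof
  assume "F \<in> coboundaries G 2"
  then obtain f where "F = coboundary G 1 f" by (auto simp: coboundaries_def)
  then show "(\<forall>xs. xs \<notin> tuples G 2 \<longrightarrow> F xs = 0) \<and>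
    (\<exists>u. \<forall>g\<in>carrier G. \<forall>h\<in>carrier G. F [g, h] = u g + u h - u (g \<otimes>\<^bsub>G\<^esub> h))"
    unfolding coboundary_1 by (auto simp: tuples_2 intro!: exI[of _ "\<lambda>g. f [g]"])
next
  assume F: "(\<forall>xs. xs \<notin> tuples G 2 \<longrightarrow> F xs = 0) \<and>
    (\<exists>u. \<forall>g\<in>carrier G. \<forall>h\<in>carrier G. F [g, h] = u g + u h - u (g \<otimes>\<^bsub>G\<^esub> h))"
  then obtain u where u: "\<And>g h. g \<in> carrier G \<Longrightarrow> h \<in> carrier G \<Longrightarrow> F [g, h] = u g + u h - u (g \<otimes>\<^bsub>G\<^esub> h)"
    by blast
  define f where "f = (\<lambda>xs. if xs \<in> tuples G 1 then u (hd xs) else 0)"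
  have f: "f [g] = u g" if "g \<in> carrier G" for g using that by (simp add: f_def tuples_def)
  have "F xs = coboundary G 1 f xs" for xs
  proof (cases "xs \<in> tuples G 2")
    case True
    then obtain g h where xs: "xs = [g, h]" "g \<in> carrier G" "h \<in> carrier G" by (auto simp: tuples_2)
    then show ?thesis unfolding coboundary_1
      using True monoid.m_closed[OF group.is_monoid[OF assms]] by (simp add: f u)
  qed (use F in \<open>simp add: coboundary_1 del: One_nat_def\<close>)
  then have "F = coboundary G 1 f" by blast
  then show "F \<in> coboundaries G 2"
    by (auto simp: coboundaries_def cochains_def f_def)
qed

lemma vectorspace_cochains: "vectorspace class_ring (cochains G k)"
proof (rule complex_vectorspaceI)
  fix v assume "v \<in> carrier (cochains G k)"
  then show "\<exists>u\<in>carrier (cochains G k). u \<oplus>\<^bsub>cochains G k\<^esub> v = \<zero>\<^bsub>cochains G k\<^esub>"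
    by (intro bexI[of _ "\<lambda>xs. - v xs"]) (auto simp: cochains_def)
qed (auto simp: cochains_def algebra_simps)

abbreviation H1 :: "('g, 'm) monoid_scheme \<Rightarrow> (complex, ('g list \<Rightarrow> complex) set) module" where
  "H1 G \<equiv> cohomology G 1"

lemma vectorspace_cocycles_1: "vectorspace class_ring (cochains G 1\<lparr>carrier := cocycles G 1\<rparr>)"
proof (rule vectorspace_restrict[OF vectorspace_cochains])
  show "cocycles G 1 \<subseteq> carrier (cochains G 1)" by (auto simp: cocycles_def)
qed (unfold cocycles_1, auto simp: cochains_def algebra_simps)

lemma vectorspace_H1: "vectorspace class_ring (H1 G)"
  unfolding cohomology_def coboundaries_1
  by (rule quotient_space(1)[OF vectorspace_cocycles_1])
    (auto simp: cochains_def cocycles_1 simp del: One_nat_def)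

lemma H1_simps:
  "carrier (H1 G) = (\<lambda>f. {f}) ` cocycles G 1"
  "{f} \<oplus>\<^bsub>H1 G\<^esub> {g} = {\<lambda>xs. f xs + g xs}"
  "a \<odot>\<^bsub>H1 G\<^esub> {f} = {\<lambda>xs. a * f xs}"
  "\<zero>\<^bsub>H1 G\<^esub> = {\<lambda>_. 0}"
  unfolding cohomology_def coboundaries_1
  by (auto simp: quotient_space_def A_RCOSETS_def' a_r_coset_def' set_add_def' cochains_def)

lemma carrier_cohomology_0:
  "carrier (cohomology G 0) = (\<lambda>f. {f}) ` {f. \<forall>xs. xs \<noteq> [] \<longrightarrow> f xs = 0}"
proof -
  have "xs \<in> tuples G 0 \<longleftrightarrow> xs = []" for xs by (auto simp: tuples_def)
  then have "cocycles G 0 = {f. \<forall>xs. xs \<noteq> [] \<longrightarrow> f xs = 0}"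
    by (auto simp: cocycles_def cochains_def coboundary_0)
  then show ?thesis
    by (auto simp: cohomology_def coboundaries_def quotient_space_def A_RCOSETS_def' a_r_coset_def' cochains_def)
qed

lemma cup_0_1: "cup G 0 1 {f} {b} = {\<lambda>xs. f [] * b xs}"
  using coboundaries_1[of G] by (auto simp: cup_def a_r_coset_def' cochains_def cup_cochain_def)

text \<open>A coset of the coboundaries is zero exactly if its representative is a coboundary, and
  \<open>u\<close> is the 1-cochain that bounds it.\<close>

lemma cup_1_1_zero:
  assumes m: "group G"
    and f: "f \<in> cocycles G 1" and b: "b \<in> cocycles G 1"
  shows "cup G 1 1 {f} {b} = \<zero>\<^bsub>cohomology G (1 + 1)\<^esub> \<longleftrightarrow>
    (\<exists>u. \<forall>g\<in>carrier G. \<forall>h\<in>carrier G. f [g] * b [h] = u g + u h - u (g \<otimes>\<^bsub>G\<^esub> h))"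
proof -
  let ?F = "cup_cochain 1 f b" and ?B = "coboundaries G 2"
  have F: "?F xs = 0" if xs: "xs \<notin> tuples G 2" for xs
  proof (cases "take 1 xs \<in> tuples G 1 \<and> drop 1 xs \<in> tuples G 1")
    case True
    then have "xs \<in> tuples G 2" by (cases xs) (auto simp: tuples_def)
    with xs show ?thesis by blast
  next
    case False
    then show ?thesis using f b unfolding cup_cochain_def cocycles_1 by auto
  qed
  have F2: "?F [g, h] = f [g] * b [h]" for g h by (simp add: cup_cochain_def)
  have sub: "(\<lambda>xs. w xs - v xs) \<in> ?B" if wv: "w \<in> ?B" "v \<in> ?B" for w v
  proof -
    obtain p where p: "\<forall>g\<in>carrier G. \<forall>h\<in>carrier G. w [g, h] = p g + p h - p (g \<otimes>\<^bsub>G\<^esub> h)"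
      using wv(1) unfolding coboundaries_2[OF m] by blast
    obtain q where q: "\<forall>g\<in>carrier G. \<forall>h\<in>carrier G. v [g, h] = q g + q h - q (g \<otimes>\<^bsub>G\<^esub> h)"
      using wv(2) unfolding coboundaries_2[OF m] by blast
    show ?thesis using wv p q unfolding coboundaries_2[OF m]
      by (intro conjI exI[of _ "\<lambda>g. p g - q g"]) auto
  qed
  have zero: "(\<lambda>_. 0) \<in> ?B" unfolding coboundaries_2[OF m] by (auto intro!: exI[of _ "\<lambda>_. 0"])
  have "?B +>\<^bsub>cochains G 2\<^esub> ?F = ?B \<longleftrightarrow> ?F \<in> ?B"
  proof
    assume eq: "?B +>\<^bsub>cochains G 2\<^esub> ?F = ?B"
    have "(\<lambda>xs. 0 + ?F xs) \<in> ?B +>\<^bsub>cochains G 2\<^esub> ?F"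
      using zero by (force simp: a_r_coset_def' cochains_def)
    then show "?F \<in> ?B" unfolding eq by simp
  next
    assume FB: "?F \<in> ?B"
    have neg: "(\<lambda>xs. - w xs) \<in> ?B" if "w \<in> ?B" for w using sub[OF zero that] by simp
    have "(\<lambda>xs. w xs + ?F xs) \<in> ?B" if "w \<in> ?B" for w
      using sub[OF that neg[OF FB]] by simp
    moreover have "\<exists>v\<in>?B. w = (\<lambda>xs. v xs + ?F xs)" if "w \<in> ?B" for w
      by (rule bexI[OF _ sub[OF that FB]]) simp
    ultimately show "?B +>\<^bsub>cochains G 2\<^esub> ?F = ?B"
      by (auto simp: a_r_coset_def' cochains_def)
  qed
  then have "cup G 1 1 {f} {b} = \<zero>\<^bsub>cohomology G (1 + 1)\<^esub> \<longleftrightarrow> ?F \<in> ?B"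
    by (simp add: cup_def cohomology_def quotient_space_def numeral_2_eq_2)
  then show ?thesis unfolding coboundaries_2[OF m] F2 using F by simp
qed

text \<open>Classes of degree 0 are scalars, so the image of multiplication by \<open>b\<close> is
  the line of \<open>b\<close>; the cohomology is nonzero if some class outside this line
  annihilates \<open>b\<close>.\<close>

lemma dim_cup_complex:
  assumes m: "group G"
    and b: "b \<in> cocycles G 1"
  shows "dim_at_least 1 (cup_complex_cohomology G {b} 1) \<longleftrightarrow>
    (\<exists>f\<in>cocycles G 1. (\<exists>u. \<forall>g\<in>carrier G. \<forall>h\<in>carrier G. f [g] * b [h] = u g + u h - u (g \<otimes>\<^bsub>G\<^esub> h)) \<and>
      (\<forall>s. f \<noteq> (\<lambda>xs. s * b xs)))"
proof -
  define P where "P f \<longleftrightarrow> (\<exists>u. \<forall>g\<in>carrier G. \<forall>h\<in>carrier G. f [g] * b [h] = u g + u h - u (g \<otimes>\<^bsub>G\<^esub> h))"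
    for f :: "'a list \<Rightarrow> complex"
  let ?Z = "{X \<in> carrier (H1 G). cup G 1 1 X {b} = \<zero>\<^bsub>cohomology G (1 + 1)\<^esub>}"
  let ?W = "(\<lambda>Y. cup G (1 - 1) 1 Y {b}) ` carrier (cohomology G (1 - 1))"
  have Z: "?Z = (\<lambda>f. {f}) ` {f \<in> cocycles G 1. P f}"
    unfolding H1_simps P_def using cup_1_1_zero[OF m _ b] by auto
  have W: "?W = (\<lambda>s. {\<lambda>xs. s * b xs}) ` UNIV"
  proof -
    have "?W = (\<lambda>f::'a list \<Rightarrow> complex. {\<lambda>xs. f [] * b xs}) ` {f. \<forall>xs. xs \<noteq> [] \<longrightarrow> f xs = 0}"
      using cup_0_1[of G _ b] by (simp add: carrier_cohomology_0 image_image)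
    also have "\<dots> = (\<lambda>s. {\<lambda>xs. s * b xs}) ` UNIV"
    proof (intro equalityI subsetI)
      fix X assume "X \<in> (\<lambda>s. {\<lambda>xs. s * b xs}) ` UNIV"
      then obtain s where "X = {\<lambda>xs. s * b xs}" by blast
      then show "X \<in> (\<lambda>f::'a list \<Rightarrow> complex. {\<lambda>xs. f [] * b xs}) ` {f. \<forall>xs. xs \<noteq> [] \<longrightarrow> f xs = 0}"
        by (intro image_eqI[of _ _ "\<lambda>xs. if xs = [] then s else 0"]) auto
    qed blast
    finally show ?thesis .
  qed
  have Padd: "P (\<lambda>xs. f xs + g xs)" if "P f" "P g" for f g
  proof -
    obtain u v where "\<forall>a\<in>carrier G. \<forall>h\<in>carrier G. f [a] * b [h] = u a + u h - u (a \<otimes>\<^bsub>G\<^esub> h)"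
      "\<forall>a\<in>carrier G. \<forall>h\<in>carrier G. g [a] * b [h] = v a + v h - v (a \<otimes>\<^bsub>G\<^esub> h)"
      using \<open>P f\<close> \<open>P g\<close> unfolding P_def by blast
    then show ?thesis unfolding P_def by (intro exI[of _ "\<lambda>a. u a + v a"]) (auto simp: distrib_right)
  qed
  have Pscale: "P (\<lambda>xs. s * f xs)" if "P f" for f s
  proof -
    obtain u where "\<forall>a\<in>carrier G. \<forall>h\<in>carrier G. f [a] * b [h] = u a + u h - u (a \<otimes>\<^bsub>G\<^esub> h)"
      using \<open>P f\<close> unfolding P_def by blast
    then show ?thesis unfolding P_def by (intro exI[of _ "\<lambda>a. s * u a"]) (simp add: mult.assoc flip: distrib_left right_diff_distrib)
  qed
  have P0: "P (\<lambda>_. 0)" unfolding P_def by (rule exI[of _ "\<lambda>_. 0"]) simp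
  have "b [g \<otimes>\<^bsub>G\<^esub> h] = b [g] + b [h]" if "g \<in> carrier G" "h \<in> carrier G" for g h
    using b that unfolding cocycles_1 by blast
  \<comment> \<open>The square of \<open>b\<close> is the coboundary of minus half of the pointwise
    square, by (s + t)^2 = s^2 + 2 s t + t^2.\<close>
  then have Pb: "P b" unfolding P_def
    by (intro exI[of _ "\<lambda>g. - (b [g] * b [g]) / 2"]) (simp add: field_simps)
  have cadd: "(\<lambda>xs. f xs + g xs) \<in> cocycles G 1" if "f \<in> cocycles G 1" "g \<in> cocycles G 1" for f g
    using that unfolding cocycles_1 by (auto simp: algebra_simps)
  have cscale: "(\<lambda>xs. s * f xs) \<in> cocycles G 1" if "f \<in> cocycles G 1" for f s
    using that unfolding cocycles_1 by (auto simp: algebra_simps)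
  have vs: "vectorspace class_ring (H1 G\<lparr>carrier := ?Z\<rparr>)"
  proof (rule vectorspace_restrict[OF vectorspace_H1])
    show "\<zero>\<^bsub>H1 G\<^esub> \<in> ?Z" unfolding H1_simps(4) Z using P0 cscale[OF b, of 0] by auto
    show "u \<oplus>\<^bsub>H1 G\<^esub> v \<in> ?Z" if uv: "u \<in> ?Z" "v \<in> ?Z" for u v
    proof -
      obtain f g where fg: "u = {f}" "v = {g}" "f \<in> cocycles G 1" "P f" "g \<in> cocycles G 1" "P g"
        using uv unfolding Z by blast
      show ?thesis unfolding fg(1,2) H1_simps(2) Z using cadd[OF fg(3,5)] Padd[OF fg(4,6)] by blast
    qed
    show "a \<odot>\<^bsub>H1 G\<^esub> v \<in> ?Z" if v: "v \<in> ?Z" for a v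
    proof -
      obtain f where f: "v = {f}" "f \<in> cocycles G 1" "P f" using v unfolding Z by blast
      show ?thesis unfolding f(1) H1_simps(3) Z using cscale[OF f(2)] Pscale[OF f(3)] by blast
    qed
  qed blast
  have "dim_at_least 1 (quotient_space (H1 G\<lparr>carrier := ?Z\<rparr>) ?W) \<longleftrightarrow> \<not> carrier (H1 G\<lparr>carrier := ?Z\<rparr>) \<subseteq> ?W"
  proof (rule quotient_space(2)[OF vs])
    show "?W \<subseteq> carrier (H1 G\<lparr>carrier := ?Z\<rparr>)"
      unfolding W Z using cscale[OF b] Pscale[OF Pb] by auto
    show "\<zero>\<^bsub>H1 G\<lparr>carrier := ?Z\<rparr>\<^esub> \<in> ?W"
      unfolding W using H1_simps(4)[of G] by (intro image_eqI[of _ _ 0]) auto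
    show "u \<oplus>\<^bsub>H1 G\<lparr>carrier := ?Z\<rparr>\<^esub> v \<in> ?W" if uv: "u \<in> ?W" "v \<in> ?W" for u v
    proof -
      obtain s t where st: "u = {\<lambda>xs. s * b xs}" "v = {\<lambda>xs. t * b xs}" using uv unfolding W by blast
      show ?thesis unfolding W st using H1_simps(2)[of G "\<lambda>xs. s * b xs" "\<lambda>xs. t * b xs"]
        by (intro image_eqI[of _ _ "s + t"]) (auto simp: distrib_right)
    qed
    show "a \<odot>\<^bsub>H1 G\<lparr>carrier := ?Z\<rparr>\<^esub> v \<in> ?W" if v: "v \<in> ?W" for a v
    proof -
      obtain t where t: "v = {\<lambda>xs. t * b xs}" using v unfolding W by blast
      show ?thesis unfolding W t using H1_simps(3)[of G a "\<lambda>xs. t * b xs"]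
        by (intro image_eqI[of _ _ "a * t"]) (auto simp: mult.assoc)
    qed
  qed
  moreover have "cup_complex_cohomology G {b} 1 = quotient_space (H1 G\<lparr>carrier := ?Z\<rparr>) ?W"
    by (simp add: cup_complex_cohomology_def)
  ultimately have "dim_at_least 1 (cup_complex_cohomology G {b} 1) \<longleftrightarrow> \<not> ?Z \<subseteq> ?W"
    by simp
  also have "\<dots> \<longleftrightarrow> (\<exists>f\<in>cocycles G 1. P f \<and> (\<forall>s. f \<noteq> (\<lambda>xs. s * b xs)))"
    unfolding Z W by auto
  finally show ?thesis unfolding P_def .
qed


text \<open>The class of \<open>d\<close> is the one that escapes the resonance variety: every
  \<open>f\<close> with trivial product is forced to be a multiple of it.\<close>

lemma resonance_of_boundaries:
  assumes G: "group G" and d: "d \<in> hom G add_group" and k: "k \<in> carrier G" "d k \<noteq> 0"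
    and total: "\<And>R. commutation_like G d R \<Longrightarrow> (\<forall>g\<in>carrier G. \<forall>h\<in>carrier G. R g h)"
  shows "resonance_variety_1 G \<noteq> carrier (cohomology G 1)"
proof -
  interpret G: group G by fact
  have add: "d (g \<otimes>\<^bsub>G\<^esub> h) = d g + d h" if "g \<in> carrier G" "h \<in> carrier G" for g h
    using hom_mult[OF d that] by simp
  define b where "b = (\<lambda>xs. if xs \<in> tuples G 1 then d (hd xs) else 0)"
  have b: "b [g] = d g" if "g \<in> carrier G" for g using that by (simp add: b_def tuples_def)
  have bc: "b \<in> cocycles G 1" unfolding cocycles_1 using b add by (auto simp: b_def)
  have "f = (\<lambda>xs. (f [k] / d k) * b xs)"
    if f: "f \<in> cocycles G 1" and u: "\<forall>g\<in>carrier G. \<forall>h\<in>carrier G. f [g] * b [h] = u g + u h - u (g \<otimes>\<^bsub>G\<^esub> h)"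
    for f u
  proof -
    have fadd: "f [g \<otimes>\<^bsub>G\<^esub> h] = f [g] + f [h]" if "g \<in> carrier G" "h \<in> carrier G" for g h
      using f that unfolding cocycles_1 by blast
    have f1: "f [\<one>\<^bsub>G\<^esub>] = 0" using fadd[of "\<one>\<^bsub>G\<^esub>" "\<one>\<^bsub>G\<^esub>"] by simp
    have d1: "d \<one>\<^bsub>G\<^esub> = 0" using add[of "\<one>\<^bsub>G\<^esub>" "\<one>\<^bsub>G\<^esub>"] by simp
    have finv: "f [inv\<^bsub>G\<^esub> g] = - f [g]" "d (inv\<^bsub>G\<^esub> g) = - d g" if "g \<in> carrier G" for g
      using fadd[of g "inv\<^bsub>G\<^esub> g"] add[of g "inv\<^bsub>G\<^esub> g"] that f1 d1 by (simp_all add: eq_neg_iff_add_eq_0 add.commute)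
    have "commutation_like G d (\<lambda>g h. f [g] * d h = f [h] * d g)"
      unfolding commutation_like_def
    proof (intro conjI ballI impI)
      \<comment> \<open>The bounding cochain takes the same value on both products, so f(g) d(h) is
        symmetric for commuting elements.\<close>
      fix g h assume gh: "g \<in> carrier G" "h \<in> carrier G" "g \<otimes>\<^bsub>G\<^esub> h = h \<otimes>\<^bsub>G\<^esub> g"
      have "f [g] * b [h] = f [h] * b [g]"
        using bspec[OF bspec[OF u gh(1)] gh(2)] bspec[OF bspec[OF u gh(2)] gh(1)] gh(3)
        by (simp add: add.commute)
      then show "f [g] * d h = f [h] * d g" using b gh by simp
    next
      fix g h k assume g: "g \<in> carrier G" "h \<in> carrier G" "k \<in> carrier G"
        and 1: "f [g] * d h = f [h] * d g" and 2: "f [h] * d k = f [k] * d h" and 3: "d h \<noteq> 0"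
      have "d h * (f [g] * d k) = (f [g] * d h) * d k" by simp
      also have "\<dots> = (f [h] * d k) * d g" unfolding 1 by simp
      also have "\<dots> = d h * (f [k] * d g)" unfolding 2 by simp
      finally show "f [g] * d k = f [k] * d g" using 3 by simp
    qed (simp_all add: fadd add finv algebra_simps)
    then have all: "f [g] * d k = f [k] * d g" if "g \<in> carrier G" for g using total that k(1) by blast
    show ?thesis
    proof
      fix xs
      show "f xs = (f [k] / d k) * b xs"
      proof (cases "xs \<in> tuples G 1")
        case True
        then obtain g where "g \<in> carrier G" "xs = [g]" unfolding tuples_1 by blast
        then show ?thesis using all[of g] k(2) b by (simp add: field_simps)
      next
        case False
        then show ?thesis using f bc unfolding cocycles_1 by simp
      qed
    qed
  qed
  then have "\<not> dim_at_least 1 (cup_complex_cohomology G {b} 1)"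
    unfolding dim_cup_complex[OF G bc] by blast
  moreover have "{b} \<in> carrier (cohomology G 1)" unfolding H1_simps using bc by blast
  ultimately show ?thesis unfolding resonance_variety_1_def by blast
qed

text \<open>The character \<open>exp \<circ> d\<close> escapes the characteristic variety.
  Integrality of \<open>d\<close> excludes nonzero multiples of 2 \<pi> i, so it is nontrivial
  wherever \<open>d\<close> is nonzero.\<close>

lemma characteristic_of_boundaries:
  assumes G: "group G" and d: "d \<in> hom G add_group" "\<And>g. g \<in> carrier G \<Longrightarrow> d g \<in> \<int>"
    and k: "k \<in> carrier G" "d k \<noteq> 0"
    and total: "\<And>R. commutation_like G d R \<Longrightarrow> (\<forall>g\<in>carrier G. \<forall>h\<in>carrier G. R g h)"
  shows "characteristic_variety_1 G \<noteq> hom G Cstar"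
proof -
  let ?r = "\<lambda>g. exp (d g)"
  have r: "?r \<in> hom G Cstar"
    using hom_mult[OF d(1)] by (auto simp: hom_def Cstar_def exp_add)
  have nontriv: "?r g \<noteq> 1" if g: "g \<in> carrier G" "d g \<noteq> 0" for g
  proof -
    obtain n where n: "d g = of_int n" using d(2)[OF g(1)] by (auto elim: Ints_cases)
    have "exp (d g) = of_real (exp (of_int n))" by (simp add: n exp_of_real[symmetric])
    moreover have "n \<noteq> 0" using g n by auto
    ultimately show ?thesis by (metis exp_eq_one_iff of_int_eq_0_iff of_real_eq_1_iff)
  qed
  have "\<not> dim_at_least 1 (twisted_homology G ?r 1)"
    unfolding dim_twisted_homology_1[OF G r]
    using in_boundaries_1_if_total[OF k(1), of ?r] nontriv[OF k]
      total[OF commutation_like_boundaries[OF G r nontriv]] k(1) by blast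
  then show ?thesis using r unfolding characteristic_variety_1_def by blast
qed

text \<open>Homomorphisms to the following Heisenberg group are pairs of additive homomorphisms \<open>f\<close>,
  \<open>a\<close> together with a function whose coboundary is \<open>f \<union> a\<close>.\<close>

definition heisenberg :: "(complex \<times> complex \<times> complex) monoid" where
  "heisenberg = \<lparr>carrier = UNIV,
     mult = (\<lambda>(p, q, r) (p', q', r'). (p + p', q + q', r + r' - p * q')), one = (0, 0, 0)\<rparr>"

lemma group_heisenberg: "group heisenberg"
proof (rule groupI)
  fix x :: "complex \<times> complex \<times> complex"
  obtain p q r where "x = (p, q, r)" by (cases x)
  then show "\<exists>y\<in>carrier heisenberg. y \<otimes>\<^bsub>heisenberg\<^esub> x = \<one>\<^bsub>heisenberg\<^esub>"
    by (intro bexI[of _ "(- p, - q, - r - p * q)"]) (auto simp: heisenberg_def)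
qed (auto simp: heisenberg_def algebra_simps)

text \<open>A homomorphism to the Heisenberg group prescribed on the basis yields an additive
  \<open>f\<close>, the given \<open>b\<close>, and a bounding cochain for their product, all at
  once.\<close>

lemma free_basis_resonance:
  assumes G: "group G" "free_basis G X" and b: "b \<in> cocycles G 1"
    and xy: "x \<in> X" "y \<in> X" "x \<noteq> y"
  shows "dim_at_least 1 (cup_complex_cohomology G {b} 1)"
proof -
  interpret G: group G by fact
  have X: "X \<subseteq> carrier G" using G(2) by (simp add: free_basis_def)
  have badd: "b [g \<otimes>\<^bsub>G\<^esub> h] = b [g] + b [h]" if "g \<in> carrier G" "h \<in> carrier G" for g h
    using b that unfolding cocycles_1 by blast
  \<comment> \<open>Values that are not proportional to those of \<open>b\<close> on
    \<open>x\<close> and \<open>y\<close>, so that \<open>f\<close> lies outside the line of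
    \<open>b\<close>.\<close>
  obtain w :: "'a \<Rightarrow> complex" where w: "\<And>s. w x \<noteq> s * b [x] \<or> w y \<noteq> s * b [y]"
  proof (cases "b [x] = 0")
    case True
    then show thesis by (intro that[of "\<lambda>_. 1"]) auto
  next
    case False
    then show thesis using xy by (intro that[of "\<lambda>z. if z = x then 0 else 1"]) auto
  qed
  obtain \<theta> where th: "\<theta> \<in> hom G heisenberg" "\<forall>z\<in>X. \<theta> z = (w z, b [z], 0)"
    using free_basis_universal[OF G group_heisenberg, of "\<lambda>z. (w z, b [z], 0)"]
    by (auto simp: heisenberg_def)
  define u where "u g = snd (snd (\<theta> g))" for g
  define f where "f = (\<lambda>xs. if xs \<in> tuples G 1 then fst (\<theta> (hd xs)) else 0)"
  have f: "f [g] = fst (\<theta> g)" if "g \<in> carrier G" for g using that by (simp add: f_def tuples_def)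
  have mult: "\<theta> (g \<otimes>\<^bsub>G\<^esub> h) = (fst (\<theta> g) + fst (\<theta> h), fst (snd (\<theta> g)) + fst (snd (\<theta> h)),
      u g + u h - fst (\<theta> g) * fst (snd (\<theta> h)))" if "g \<in> carrier G" "h \<in> carrier G" for g h
    using hom_mult[OF th(1) that] by (simp add: heisenberg_def u_def case_prod_beta)
  \<comment> \<open>The middle component and \<open>b\<close> are homomorphisms that agree on the
    basis, hence everywhere.\<close>
  have "(\<lambda>g. fst (snd (\<theta> g))) \<in> hom G add_group" "(\<lambda>g. b [g]) \<in> hom G add_group"
    using mult badd by (auto simp: hom_def)
  from hom_eq_on_basis[OF G group_add_group this] have beq: "fst (snd (\<theta> g)) = b [g]" if "g \<in> carrier G" for g
    using th(2) that by simp
  have "f \<in> cocycles G 1" unfolding cocycles_1 using f mult by (auto simp: f_def)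
  moreover have "\<forall>g\<in>carrier G. \<forall>h\<in>carrier G. f [g] * b [h] = u g + u h - u (g \<otimes>\<^bsub>G\<^esub> h)"
  proof (intro ballI)
    fix g h assume gh: "g \<in> carrier G" "h \<in> carrier G"
    have "u (g \<otimes>\<^bsub>G\<^esub> h) = u g + u h - fst (\<theta> g) * fst (snd (\<theta> h))"
      using mult[OF gh] by (simp add: u_def)
    then show "f [g] * b [h] = u g + u h - u (g \<otimes>\<^bsub>G\<^esub> h)" using f gh beq by simp
  qed
  moreover have "f \<noteq> (\<lambda>xs. s * b xs)" for s
  proof
    assume "f = (\<lambda>xs. s * b xs)"
    then have "f [x] = s * b [x]" "f [y] = s * b [y]" by simp_all
    moreover have "f [x] = w x" "f [y] = w y" using f th(2) xy X by auto
    ultimately show False using w[of s] by simp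
  qed
  ultimately show ?thesis unfolding dim_cup_complex[OF G(1) b] by blast
qed

section \<open>Meridians and parallel lines\<close>

text \<open>Any point can be moved along \<open>(cnj a, cnj b)\<close> onto the line of
  \<open>f\<close>, where the form of \<open>g\<close> vanishes too; this makes one form a multiple
  of the other.\<close>

lemma line_subset_eq:
  assumes f: "(fst f, fst (snd f)) \<noteq> (0, 0)" and g: "(fst g, fst (snd g)) \<noteq> (0, 0)"
    and sub: "{v. lin f v = 0} \<subseteq> {v. lin g v = 0}"
  shows "{v. lin f v = 0} = {v. lin g v = 0}"
proof -
  obtain a b c where fe: "f = (a, b, c)" by (cases f)
  obtain a' b' c' where ge: "g = (a', b', c')" by (cases g)
  define N where "N = a * cnj a + b * cnj b"
  have "N = of_real ((cmod a)\<^sup>2 + (cmod b)\<^sup>2)" by (simp only: N_def of_real_add complex_norm_square)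
  then have N: "N \<noteq> 0" using f by (simp only: of_real_eq_0_iff sum_power2_eq_zero_iff) (auto simp: fe)
  define k where "k = (a' * cnj a + b' * cnj b) / N"
  have mult: "lin g v = k * lin f v" for v
  proof -
    define s where "s = lin f v / N"
    have s: "s * N = lin f v" using N by (simp add: s_def)
    let ?w = "(fst v - s * cnj a, snd v - s * cnj b)"
    have "lin f ?w = lin f v - s * N" by (simp add: lin_def fe N_def algebra_simps)
    then have "lin g ?w = 0" using sub s by auto
    moreover have "lin g ?w = lin g v - s * (a' * cnj a + b' * cnj b)"
      by (simp add: lin_def ge algebra_simps)
    moreover have "s * (a' * cnj a + b' * cnj b) = k * lin f v" by (simp add: s_def k_def)
    ultimately show ?thesis by simp
  qed
  have "k \<noteq> 0"
  proof
    assume "k = 0"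
    then have "lin g v = 0" for v by (simp add: mult)
    from this[of "(0, 0)"] this[of "(1, 0)"] this[of "(0, 1)"] show False using g by (auto simp: lin_def ge)
  qed
  then show ?thesis by (auto simp: mult)
qed

text \<open>\<open>u\<close> lies on the segment from \<open>p\<close> to \<open>x\<close>, close to
  \<open>p\<close>. Lines through \<open>p\<close> miss it because they miss \<open>x\<close>; the
  other lines are far compared with its distance to \<open>p\<close>.\<close>

lemma rotatable_near:
  assumes F: "finite F" and x: "x \<in> line_complement F"
  obtains u where "rotatable F p u"
    "\<And>f. f \<in> F \<Longrightarrow> lin f p \<noteq> 0 \<Longrightarrow> cmod (lin f u - lin f p) < cmod (lin f p)"
proof -
  let ?u = "\<lambda>t::real. (fst p + of_real t * (fst x - fst p), snd p + of_real t * (snd x - snd p))"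
  have lu: "lin f (?u t) - lin f p = of_real t * (lin f x - lin f p)" for f t
    by (simp add: lin_def algebra_simps)
  have "\<forall>f\<in>F. \<forall>\<^sub>F t in at_right 0. lin f p \<noteq> 0 \<longrightarrow> t * cmod (lin f x - lin f p) < cmod (lin f p)"
  proof
    fix f
    show "\<forall>\<^sub>F t in at_right 0. lin f p \<noteq> 0 \<longrightarrow> t * cmod (lin f x - lin f p) < cmod (lin f p)"
    proof (cases "lin f p = 0")
      case False
      have "((\<lambda>t. t * cmod (lin f x - lin f p)) \<longlongrightarrow> 0 * cmod (lin f x - lin f p)) (at_right 0)"
        by (intro tendsto_intros)
      then have "\<forall>\<^sub>F t in at_right 0. t * cmod (lin f x - lin f p) < cmod (lin f p)"
        by (rule order_tendstoD) (use False in simp)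
      then show ?thesis by (rule eventually_mono) simp
    qed simp
  qed
  then have "\<forall>\<^sub>F t in at_right 0. \<forall>f\<in>F. lin f p \<noteq> 0 \<longrightarrow> t * cmod (lin f x - lin f p) < cmod (lin f p)"
    using F by (intro eventually_ball_finite)
  then have "\<forall>\<^sub>F t in at_right 0. 0 < t \<and> (\<forall>f\<in>F. lin f p \<noteq> 0 \<longrightarrow> t * cmod (lin f x - lin f p) < cmod (lin f p))"
    by (intro eventually_conj eventually_at_right_less)
  then obtain t :: real where t: "0 < t"
      "\<And>f. f \<in> F \<Longrightarrow> lin f p \<noteq> 0 \<Longrightarrow> t * cmod (lin f x - lin f p) < cmod (lin f p)"
    using eventually_happens'[of "at_right (0::real)"] by force
  have near: "cmod (lin f (?u t) - lin f p) < cmod (lin f p)" if "f \<in> F" "lin f p \<noteq> 0" for f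
    using t(2)[OF that] t(1) unfolding lu by (simp add: norm_mult)
  have "cmod (lin f p) \<noteq> cmod (lin f (?u t) - lin f p)" if f: "f \<in> F" for f
  proof (cases "lin f p = 0")
    case True
    then show ?thesis using t(1) x f unfolding lu line_complement_lin by (simp add: norm_mult)
  next
    case False
    then show ?thesis using near[OF f] by simp
  qed
  then show thesis using near by (intro that[of "?u t"]) (simp_all add: rotatable_def)
qed

text \<open>A small rotation about \<open>p\<close> winds once around the lines through
  \<open>p\<close> and not around the others. A point of \<open>l\<close> outside \<open>m\<close>
  separates the two winding numbers.\<close>

lemma meridian_exists:
  assumes A: "line_arrangement A" and x: "x \<notin> \<Union>A"
    and co: "\<And>l. l \<in> A \<Longrightarrow> (fst (co l), fst (snd (co l))) \<noteq> (0, 0) \<and> l = {v. lin (co l) v = 0}"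
    and lm: "l \<in> A" "m \<in> A" and p: "p \<in> l" "p \<notin> m"
  shows "\<exists>g\<in>carrier (arrangement_group A x).
    class_value (\<lambda>q. winding_number (lin (co l) \<circ> q) 0) g = 1 \<and>
    class_value (\<lambda>q. winding_number (lin (co m) \<circ> q) 0) g = 0"
proof -
  define W where "W = - \<Union>A"
  have W: "proper_lines (co ` A)" "W = line_complement (co ` A)"
    unfolding W_def by (rule complement_lines[OF A co]; assumption)+
  have xW: "x \<in> W" using x by (simp add: W_def)
  have fin: "finite (co ` A)" using A by (simp add: line_arrangement_def)
  obtain u where u: "rotatable (co ` A) p u"
      "\<And>f. f \<in> co ` A \<Longrightarrow> lin f p \<noteq> 0 \<Longrightarrow> cmod (lin f u - lin f p) < cmod (lin f p)"
    using rotatable_near[OF fin xW[unfolded W(2)], of p] by blast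
  have r: "path_in W (rot p u)" using path_in_rot[OF u(1)] by (simp add: W)
  have "path_connected W"
    using path_connected_diff_lines[OF W(1) open_UNIV convex_UNIV] W(2) by simp
  moreover have "u \<in> W" using r rot_ends[of p u] by (metis pathstart_in_path_image subsetD)
  ultimately obtain b where b: "path_in W b" "pathstart b = x" "pathfinish b = u"
    using xW unfolding path_connected_def by blast
  define q where "q = b +++ (rot p u +++ reversepath b)"
  have q: "path_in W q" "q \<in> loops W x"
    unfolding q_def using b r by (auto simp: loops_iff path_image_join rot_ends)
  have val: "class_value (\<lambda>q. winding_number (lin (co k) \<circ> q) 0) (path_class W q) =
      (if p \<in> k then 1 else 0)" if k: "k \<in> A" for k
  proof -
    interpret path_functor add_group W "\<lambda>q. winding_number (lin (co k) \<circ> q) 0"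
      unfolding W(2) using k by (intro path_functor_winding_lin) auto
    have "class_value (\<lambda>q. winding_number (lin (co k) \<circ> q) 0) (path_class W q) =
        winding_number (lin (co k) \<circ> rot p u) 0"
      unfolding class_value[OF q(1)] using conjugate[OF b(1) r] b by (simp add: rot_ends q_def)
    also have "lin (co k) \<circ> rot p u = (\<lambda>t. lin (co k) p + cis_turn t * (lin (co k) u - lin (co k) p))"
      by (auto simp: lin_rot)
    also have "winding_number \<dots> 0 = (if cmod (lin (co k) p) < cmod (lin (co k) u - lin (co k) p) then 1 else 0)"
      by (rule winding_number_rotation) (use u(1) k in \<open>auto simp: rotatable_def\<close>)
    finally have eq: "class_value (\<lambda>q. winding_number (lin (co k) \<circ> q) 0) (path_class W q) =
      (if cmod (lin (co k) p) < cmod (lin (co k) u - lin (co k) p) then 1 else 0)" .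
    have pk: "p \<in> k \<longleftrightarrow> lin (co k) p = 0" using co[OF k] by blast
    show ?thesis
    proof (cases "p \<in> k")
      case True
      then have "cmod (lin (co k) p) < cmod (lin (co k) u - lin (co k) p)"
        using pk u(1) k by (auto simp: rotatable_def)
      then show ?thesis unfolding eq using True by simp
    next
      case False
      then have "\<not> cmod (lin (co k) p) < cmod (lin (co k) u - lin (co k) p)"
        using pk u(2)[of "co k"] k by auto
      then show ?thesis unfolding eq using False by simp
    qed
  qed
  have "path_class W q \<in> carrier (arrangement_group A x)"
    using q(2) by (simp add: arrangement_group_def carrier_fundamental_group W_def)
  then show ?thesis using val[OF lm(1)] val[OF lm(2)] p by (intro bexI[of _ "path_class W q"]) simp_all
qed

text \<open>The winding numbers around two lines are linearly independent homomorphisms, whereas on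
  a basis with at most one element some nontrivial combination vanishes.\<close>

lemma free_basis_two_elements:
  assumes A: "line_arrangement A" "card A \<ge> 2" and x: "x \<notin> \<Union>A"
    and X: "free_basis (arrangement_group A x) X"
  obtains y z where "y \<in> X" "z \<in> X" "y \<noteq> z"
proof -
  obtain co where co: "\<And>l. l \<in> A \<Longrightarrow> (fst (co l), fst (snd (co l))) \<noteq> (0, 0) \<and> l = {v. lin (co l) v = 0}"
    using line_coordinates[OF A(1)] by blast
  let ?G = "arrangement_group A x"
  have G: "group ?G" unfolding arrangement_group_def using x by (intro group_fundamental_group) simp
  obtain B where "B \<subseteq> A" "card B = 2" using obtain_subset_with_card_n[OF A(2)] by blast
  then obtain l m where lm: "l \<in> A" "m \<in> A" "l \<noteq> m" by (auto simp: card_2_iff)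
  have not_sub: "\<exists>p. p \<in> k \<and> p \<notin> k'" if k: "k \<in> A" "k' \<in> A" "k \<noteq> k'" for k k'
  proof (rule ccontr)
    assume "\<not> ?thesis"
    then have sub: "k \<subseteq> k'" by blast
    note e = co[OF k(1), THEN conjunct2, symmetric] co[OF k(2), THEN conjunct2, symmetric]
    have "{v. lin (co k) v = 0} = {v. lin (co k') v = 0}"
      by (rule line_subset_eq[OF co[OF k(1), THEN conjunct1] co[OF k(2), THEN conjunct1]])
        (unfold e, rule sub)
    then show False using k(3) unfolding e by simp
  qed
  define d where "d k = class_value (\<lambda>q. winding_number (lin (co k) \<circ> q) 0)" for k
  have dhom: "d k \<in> hom ?G add_group" if k: "k \<in> A" for k
  proof -
    have W: "- \<Union>A = line_complement (co ` A)" by (rule complement_lines[OF A(1) co])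
    interpret path_functor add_group "- \<Union>A" "\<lambda>q. winding_number (lin (co k) \<circ> q) 0"
      unfolding W using k by (intro path_functor_winding_lin) auto
    show ?thesis unfolding d_def arrangement_group_def by (rule class_value_hom)
  qed
  obtain g where g: "g \<in> carrier ?G" "d l g = 1" "d m g = 0"
    using not_sub[OF lm] meridian_exists[OF A(1) x co lm(1,2)] unfolding d_def by blast
  obtain h where h: "h \<in> carrier ?G" "d m h = 1" "d l h = 0"
    using not_sub[OF lm(2,1) lm(3)[symmetric]] meridian_exists[OF A(1) x co lm(2,1)] unfolding d_def by blast
  have False if one: "\<And>y z. y \<in> X \<Longrightarrow> z \<in> X \<Longrightarrow> y = z"
  proof -
    \<comment> \<open>A vanishing combination on the basis; if \<open>d l\<close> vanishes there,
      which includes an empty basis, \<open>d l\<close> itself serves.\<close>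
    obtain s t where st: "s \<noteq> 0 \<or> t \<noteq> 0" "\<And>y. y \<in> X \<Longrightarrow> s * d l y + t * d m y = 0"
    proof (cases "\<forall>y\<in>X. d l y = 0")
      case True
      then show thesis by (intro that[of 1 0]) auto
    next
      case False
      then obtain y where y: "y \<in> X" "d l y \<noteq> 0" by blast
      then show thesis using one by (intro that[of "d m y" "- d l y"]) (auto simp: mult.commute)
    qed
    have "(\<lambda>g. s * d l g + t * d m g) \<in> hom ?G add_group" "(\<lambda>_. 0) \<in> hom ?G add_group"
      using hom_mult[OF dhom[OF lm(1)]] hom_mult[OF dhom[OF lm(2)]]
      by (auto simp: hom_def algebra_simps)
    from hom_eq_on_basis[OF G X group_add_group this] st(2)
    have "s * d l k + t * d m k = 0" if "k \<in> carrier ?G" for k using that by blast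
    from this[OF g(1)] this[OF h(1)] st(1) g h show False by simp
  qed
  then show thesis using that by blast
qed

lemma parallel_common_form:
  assumes A: "line_arrangement A" and l: "l \<in> A" and par: "\<forall>l\<in>A. \<forall>m\<in>A. parallel l m"
  obtains a b ce where "(a, b) \<noteq> (0, 0)" "\<And>m. m \<in> A \<Longrightarrow> m = {v. a * fst v + b * snd v = ce m}"
proof -
  have "affine_line l" using A l by (simp add: line_arrangement_def)
  then obtain a b c where abc: "(a, b) \<noteq> (0, 0)" "l = {(x, y). a * x + b * y = c}"
    unfolding affine_line_def by (elim exE conjE)
  have "\<exists>e. m = {v. a * fst v + b * snd v = e}" if m: "m \<in> A" for m
  proof -
    obtain w where w: "m = (+) w ` l" using par l m unfolding parallel_def by blast
    have "v \<in> m \<longleftrightarrow> a * fst v + b * snd v = c + (a * fst w + b * snd w)" for v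
    proof
      assume "v \<in> m"
      then show "a * fst v + b * snd v = c + (a * fst w + b * snd w)"
        unfolding w abc(2) by (auto simp: algebra_simps)
    next
      assume *: "a * fst v + b * snd v = c + (a * fst w + b * snd w)"
      then have "v - w \<in> l" unfolding abc(2) by (auto simp: algebra_simps)
      then show "v \<in> m" unfolding w by (intro image_eqI[of _ _ "v - w"]) simp_all
    qed
    then show ?thesis by blast
  qed
  then obtain ce where "\<And>m. m \<in> A \<Longrightarrow> m = {v. a * fst v + b * snd v = ce m}" by metis
  then show thesis using that abc(1) by blast
qed

text \<open>The lassos of the punctured plane are used twice: in \<open>G\<close> itself they
  generate, and in the permutations of words over the candidate basis they allow the action that
  proves freeness.\<close>

theorem free_group_if_parallel:
  assumes A: "line_arrangement A" and l: "l \<in> A" and par: "\<forall>l\<in>A. \<forall>m\<in>A. parallel l m"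
    and x: "x \<notin> \<Union>A"
  shows "free_group (arrangement_group A x)"
proof -
  obtain a b ce where ab: "(a, b) \<noteq> (0, 0)"
      and ce: "\<And>m. m \<in> A \<Longrightarrow> m = {v. a * fst v + b * snd v = ce m}"
    using parallel_common_form[OF A l par] by metis
  define P where "P = ce ` A"
  have finP: "finite P" using A by (simp add: P_def line_arrangement_def)
  define L where "L v = a * fst v + b * snd v" for v
  define U where "U = - \<Union>A"
  have U: "v \<in> U \<longleftrightarrow> L v \<notin> P" for v
  proof -
    have "v \<in> m \<longleftrightarrow> L v = ce m" if "m \<in> A" for m using ce[OF that] by (auto simp: L_def)
    then show ?thesis by (auto simp: U_def P_def)
  qed
  define N where "N = a * cnj a + b * cnj b"
  have "N = of_real ((cmod a)\<^sup>2 + (cmod b)\<^sup>2)" by (simp only: N_def of_real_add complex_norm_square)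
  then have N: "N \<noteq> 0" using ab by (simp only: of_real_eq_0_iff sum_power2_eq_zero_iff) auto
  \<comment> \<open>A complex line through \<open>x\<close> transversal to the arrangement,
    parametrised so that \<open>L\<close> inverts it.\<close>
  define \<sigma> where "\<sigma> z = (fst x + (z - L x) / N * cnj a, snd x + (z - L x) / N * cnj b)" for z
  have L\<sigma>: "L (\<sigma> z) = z" for z
  proof -
    have "L (fst x + r * cnj a, snd x + r * cnj b) = L x + r * N" for r
      by (simp add: L_def N_def algebra_simps)
    from this[of "(z - L x) / N"] show ?thesis using N by (simp add: \<sigma>_def)
  qed
  have \<sigma>x: "\<sigma> (L x) = x" by (simp add: \<sigma>_def)
  have Lc: "continuous_on S L" and \<sigma>c: "continuous_on S' \<sigma>" for S S'
    unfolding L_def \<sigma>_def by (intro continuous_intros; use N in simp)+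
  have LU: "L ` U \<subseteq> UNIV - P" using U by blast
  have \<sigma>U: "\<sigma> ` (UNIV - P) \<subseteq> U" by (intro image_subsetI) (simp add: U L\<sigma>)
  have xU: "x \<in> U" using x by (simp add: U_def)
  then have Lx: "L x \<in> UNIV - P" using U by simp
  let ?G = "arrangement_group A x"
  have GU: "?G = fundamental_group U x" by (simp add: arrangement_group_def U_def)
  have G: "group ?G" unfolding GU by (rule group_fundamental_group[OF xU])
  have pcU: "path_connected U"
  proof -
    obtain co where co: "\<And>l. l \<in> A \<Longrightarrow> (fst (co l), fst (snd (co l))) \<noteq> (0, 0) \<and> l = {v. lin (co l) v = 0}"
      using line_coordinates[OF A] by blast
    have "proper_lines (co ` A)" "U = line_complement (co ` A)"
      unfolding U_def by (rule complement_lines[OF A co]; assumption)+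
    then show ?thesis using path_connected_diff_lines[OF _ open_UNIV convex_UNIV] by force
  qed
  obtain tr where tr: "\<And>u. u \<in> U \<Longrightarrow> path_in U (tr u) \<and> pathstart (tr u) = x \<and> pathfinish (tr u) = u"
    "tr x = (\<lambda>_. x)" using tethers_exist[OF pcU xU] by blast
  interpret val: path_functor ?G U "path_value U tr" unfolding GU by (rule path_functor_path_value[OF xU tr(1)])
  define \<Phi> where "\<Phi> q = path_value U tr (\<sigma> \<circ> q)" for q
  interpret \<Phi>: path_functor ?G "UNIV - P" \<Phi> unfolding \<Phi>_def by (rule val.compose[OF \<sigma>c \<sigma>U])
  \<comment> \<open>The two types are those of the elements of \<open>G\<close> and of the
    permutations of words in these elements.\<close>
  obtain \<gamma> where \<gamma>: "freely_generated TYPE((real \<Rightarrow> complex \<times> complex) set)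
      TYPE(((real \<Rightarrow> complex \<times> complex) set \<times> bool) list \<Rightarrow> ((real \<Rightarrow> complex \<times> complex) set \<times> bool) list)
      (UNIV - P) (L x) P 1 \<gamma>"
    using freely_generated_punctured[OF finP open_UNIV convex_UNIV _ Lx, of 1] by auto
  have \<gamma>l: "\<gamma> p \<in> loops (UNIV - P) (L x)" if "p \<in> P" for p
    using \<gamma> that tethered_loop unfolding freely_generated_def by blast
  have loop: "\<Phi> q = path_class U (\<sigma> \<circ> q)" "\<sigma> \<circ> q \<in> loops U x" if q: "q \<in> loops (UNIV - P) (L x)" for q
  proof -
    show lp: "\<sigma> \<circ> q \<in> loops U x"
      using q path_in_compose[OF _ \<sigma>c \<sigma>U] by (auto simp: loops_iff pathstart_compose pathfinish_compose \<sigma>x)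
    show "\<Phi> q = path_class U (\<sigma> \<circ> q)"
      unfolding \<Phi>_def by (rule path_value_loop[where tr = tr, OF lp tr(2)])
  qed
  have Lloop: "L \<circ> q \<in> loops (UNIV - P) (L x)" if q: "q \<in> loops U x" for q
    using q path_in_compose[OF _ Lc LU] by (auto simp: loops_iff pathstart_compose pathfinish_compose)
  \<comment> \<open>A loop is homotopic to its projection to the transversal, along the level lines.\<close>
  have retract: "\<Phi> (L \<circ> q) = path_class U q" if q: "q \<in> loops U x" for q
  proof -
    have q': "path_in U q" "pathstart q = x" "pathfinish q = x" using q by (auto simp: loops_iff)
    have "homotopic_paths U (\<sigma> \<circ> (L \<circ> q)) q"
    proof (rule homotopic_paths_linear)
      show "path (\<sigma> \<circ> (L \<circ> q))" using loop(2)[OF Lloop[OF q]] by (simp add: loops_iff)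
      show "path q" using q' by simp
      show "pathstart q = pathstart (\<sigma> \<circ> (L \<circ> q))" "pathfinish q = pathfinish (\<sigma> \<circ> (L \<circ> q))"
        using q' by (simp_all add: pathstart_compose pathfinish_compose \<sigma>x)
      fix t :: real assume "t \<in> {0..1}"
      then have "q t \<in> U" using path_in_point[OF q'(1)] by blast
      then have nP: "L (q t) \<notin> P" using U by simp
      show "closed_segment ((\<sigma> \<circ> (L \<circ> q)) t) (q t) \<subseteq> U"
      proof
        fix v assume "v \<in> closed_segment ((\<sigma> \<circ> (L \<circ> q)) t) (q t)"
        then obtain s where s: "v = (1 - s) *\<^sub>R \<sigma> (L (q t)) + s *\<^sub>R q t" by (auto simp: closed_segment_def)
        have "L v = (1 - s) *\<^sub>R L (\<sigma> (L (q t))) + s *\<^sub>R L (q t)"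
          unfolding s by (simp add: L_def scaleR_conv_of_real algebra_simps)
        then have "L v = L (q t)" unfolding L\<sigma> by (simp add: scaleR_conv_of_real algebra_simps)
        then show "v \<in> U" using nP U by simp
      qed
    qed
    then show ?thesis unfolding loop(1)[OF Lloop[OF q]] by (rule path_class_eqI)
  qed
  define X where "X = (\<lambda>p. \<Phi> (\<gamma> p)) ` P"
  have XG: "X \<subseteq> carrier ?G" unfolding X_def using \<Phi>.closed \<gamma>l by (auto simp: loops_iff)
  have gen: "carrier ?G \<subseteq> J" if J: "subgroup J ?G" "X \<subseteq> J" for J
  proof
    fix g assume "g \<in> carrier ?G"
    then obtain q where q: "q \<in> loops U x" "g = path_class U q" by (auto simp: GU carrier_fundamental_group)
    have "\<Phi> (L \<circ> q) \<in> J"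
    proof (rule generatesD[OF _ \<Phi>.path_functor_axioms' J(1) _ Lloop[OF q(1)]])
      show "generates TYPE((real \<Rightarrow> complex \<times> complex) set) (UNIV - P) (L x) (\<gamma> ` P)"
        using \<gamma> unfolding freely_generated_def by blast
      show "\<Phi> c \<in> J" if "c \<in> \<gamma> ` P" for c using that J(2) unfolding X_def by blast
    qed
    then show "g \<in> J" using retract[OF q(1)] q(2) by simp
  qed
  \<comment> \<open>The letter is the class of the lasso itself, so the resulting homomorphism sends
    each basis element to its own permutation.\<close>
  have "(\<lambda>p. letter_perm X (\<Phi> (\<gamma> p), True)) ` P \<subseteq> carrier perm_group"
    by (intro image_subsetI letter_perm_group(1)) (simp add: X_def)
  from conjunct2[OF conjunct2[OF \<gamma>[unfolded freely_generated_def]], unfolded prescribable_def,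
      rule_format, OF group_perm_group this]
  obtain \<Psi> where \<Psi>: "path_functor perm_group (UNIV - P) \<Psi>"
      "\<And>p. p \<in> P \<Longrightarrow> \<Psi> (\<gamma> p) = letter_perm X (\<Phi> (\<gamma> p), True)"
    by blast
  interpret \<Psi>L: path_functor perm_group U "\<lambda>q. \<Psi> (L \<circ> q)"
    by (rule path_functor.compose[OF \<Psi>(1) Lc LU])
  have "free_basis ?G X"
  proof (rule free_basisI[OF G XG gen])
    show "class_value (\<lambda>q. \<Psi> (L \<circ> q)) \<in> hom ?G perm_group" unfolding GU by (rule \<Psi>L.class_value_hom)
    fix y assume "y \<in> X"
    then obtain p where p: "p \<in> P" "y = \<Phi> (\<gamma> p)" by (auto simp: X_def)
    have e: "L \<circ> (\<sigma> \<circ> \<gamma> p) = \<gamma> p" by (simp add: fun_eq_iff L\<sigma>)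
    have "path_in U (\<sigma> \<circ> \<gamma> p)" using loop(2)[OF \<gamma>l[OF p(1)]] unfolding loops_iff by (rule conjunct1)
    from \<Psi>L.class_value[OF this] show "class_value (\<lambda>q. \<Psi> (L \<circ> q)) y = letter_perm X (y, True)"
      unfolding p(2) e \<Psi>(2)[OF p(1)] loop(1)[OF \<gamma>l[OF p(1)]] .
  qed
  then show ?thesis using G unfolding free_group_def by (intro conjI exI)
qed

theorem theorem9p10:
  fixes \<A> :: "(complex \<times> complex) set set" and x :: "complex \<times> complex"
    and G :: "(real \<Rightarrow> complex \<times> complex) set monoid"
  assumes "line_arrangement \<A>" and "card \<A> \<ge> 2"
    and "x \<notin> \<Union>\<A>"
    and "G = arrangement_group \<A> x"
  shows "(free_group G \<longleftrightarrow> characteristic_variety_1 G = hom G Cstar)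
    \<and> (characteristic_variety_1 G = hom G Cstar \<longleftrightarrow>
        resonance_variety_1 G = carrier (cohomology G 1))
    \<and> (resonance_variety_1 G = carrier (cohomology G 1) \<longleftrightarrow>
        (\<forall>l\<in>\<A>. \<forall>m\<in>\<A>. parallel l m))"
proof -
  obtain l where l: "l \<in> \<A>" using assms(2) by fastforce
  have G: "group G" unfolding assms(4) arrangement_group_def
    by (rule group_fundamental_group) (use assms(3) in simp)
  have 1: "characteristic_variety_1 G = hom G Cstar \<and> resonance_variety_1 G = carrier (cohomology G 1)"
    if free: "free_group G"
  proof -
    obtain X where X: "free_basis G X" using free unfolding free_group_def by blast
    \<comment> \<open>Two lines are essential here: for a single line the group is infinite cyclic,
      and only the trivial character has nonzero first homology.\<close>
    obtain y z where yz: "y \<in> X" "z \<in> X" "y \<noteq> z"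
      using free_basis_two_elements[OF assms(1,2,3) X[unfolded assms(4)]] by blast
    have "dim_at_least 1 (cup_complex_cohomology G a 1)" if a: "a \<in> carrier (cohomology G 1)" for a
    proof -
      obtain b where "a = {b}" "b \<in> cocycles G 1" using a unfolding H1_simps by blast
      then show ?thesis using free_basis_resonance[OF G X _ yz] by blast
    qed
    then show ?thesis
      unfolding characteristic_variety_1_def resonance_variety_1_def
      using free_basis_characteristic[OF G X _ yz] by blast
  qed
  have 2: "free_group G" if "\<forall>l\<in>\<A>. \<forall>m\<in>\<A>. parallel l m"
    unfolding assms(4) by (rule free_group_if_parallel[OF assms(1) l that assms(3)])
  have 3: "characteristic_variety_1 G \<noteq> hom G Cstar \<and> resonance_variety_1 G \<noteq> carrier (cohomology G 1)"
    if np: "\<not> (\<forall>l\<in>\<A>. \<forall>m\<in>\<A>. parallel l m)"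
  proof -
    obtain k m where "k \<in> \<A>" "m \<in> \<A>" "\<not> parallel k m" using np by blast
    from nonparallel_commutation[OF assms(1) this assms(3,4)]
    obtain d where d: "d \<in> hom G add_group" "\<forall>g\<in>carrier G. d g \<in> \<int>" "\<exists>g\<in>carrier G. d g \<noteq> 0"
        "\<forall>R. commutation_like G d R \<longrightarrow> (\<forall>g\<in>carrier G. \<forall>h\<in>carrier G. R g h)"
      by (elim exE conjE)
    obtain g where g: "g \<in> carrier G" "d g \<noteq> 0" using d(3) by (rule bexE)
    show ?thesis
      using characteristic_of_boundaries[OF G d(1) d(2)[rule_format] g d(4)[THEN spec, THEN mp]]
        resonance_of_boundaries[OF G d(1) g d(4)[THEN spec, THEN mp]] by (rule conjI)
  qed
  \<comment> \<open>Fact \<open>3\<close> is the contrapositive of two implications: if either jump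
    locus is everything, the lines are parallel. With \<open>1\<close> and \<open>2\<close> this
    closes the circle.\<close>
  show ?thesis using 1 2 3 by blast
qed

end
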